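(* Assume SETH. Then for every constant $\varepsilon>0$ the following holds. Given two collections $A,B$, each consisting of $N$ subsets of a universe $[m]$, where $m=N^{o(1)}$ and every subset $b\in B$ has the same size $k$, no algorithm running in time $O(N^{2-\varepsilon})$ can distinguish between the following two cases: (Completeness) there exist $a\in A$, $b\in B$ such that $b\subseteq a$; and (Soundness) for every $a\in A$, $b\in B$ we have $|a\cap b|\le k/2^{(\log N)^{1-o(1)}}$.
   Context: SETH (Strong Exponential Time Hypothesis): for every $\varepsilon>0$ there exists $k\ge 3$ such that $k$-SAT (deciding satisfiability of a CNF formula in which every clause has at most $k$ literals) on $n$ variables cannot be solved in time $O(2^{(1-\varepsilon)n})$. $[m]=\{1,\dots,m\}$. *)

theory Defs
  imports Complex_Main "HOL-Library.Landau_Symbols" "HOL-Library.Log_Nat"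
begin

section \<open>Model of computation: deterministic random access machines with logarithmic cost\<close>

text \<open>
  A machine has registers and a random access memory, both holding natural numbers of arbitrary
  size. Every step is charged the total bit length of the numbers and addresses it touches, so that
  large words give no unfair advantage. For word RAMs with words of logarithmic size the running
  times agree with these up to polylogarithmic factors.
\<close>

datatype arith_op = Add | Sub | Mult | Div

fun apply_op :: "arith_op \<Rightarrow> nat \<Rightarrow> nat \<Rightarrow> nat" where
  "apply_op Add x y = x + y"
| "apply_op Sub x y = x - y"
| "apply_op Mult x y = x * y"
| "apply_op Div x y = x div y"

text \<open>
  In \<open>Load r s\<close> the address is the content of register \<open>s\<close>; in \<open>Store r s\<close> the address is the
  content of register \<open>r\<close> and the stored value is the content of register \<open>s\<close>. \<open>Sub\<close> is truncated
  subtraction, so that comparisons reduce to \<open>JumpZero\<close>.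
\<close>

datatype instr =
    Const nat nat
  | Arith arith_op nat nat nat
  | Load nat nat
  | Store nat nat
  | Jump nat
  | JumpZero nat nat

type_synonym ram_program = "instr list"

record config =
  pc :: nat
  reg :: "nat \<Rightarrow> nat"
  mem :: "nat \<Rightarrow> nat"

definition halted :: "ram_program \<Rightarrow> config \<Rightarrow> bool" where
  "halted P c \<longleftrightarrow> pc c \<ge> length P"

fun exec_instr :: "instr \<Rightarrow> config \<Rightarrow> config" where
  "exec_instr (Const r v) c = c\<lparr>pc := pc c + 1, reg := (reg c)(r := v)\<rparr>"
| "exec_instr (Arith f r s t) c =
     c\<lparr>pc := pc c + 1, reg := (reg c)(r := apply_op f (reg c s) (reg c t))\<rparr>"
| "exec_instr (Load r s) c = c\<lparr>pc := pc c + 1, reg := (reg c)(r := mem c (reg c s))\<rparr>"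
| "exec_instr (Store r s) c = c\<lparr>pc := pc c + 1, mem := (mem c)(reg c r := reg c s)\<rparr>"
| "exec_instr (Jump l) c = c\<lparr>pc := l\<rparr>"
| "exec_instr (JumpZero r l) c = c\<lparr>pc := (if reg c r = 0 then l else pc c + 1)\<rparr>"

text \<open>\<open>floorlog 2 x\<close> is the number of binary digits of \<open>x\<close>.\<close>

fun instr_cost :: "instr \<Rightarrow> config \<Rightarrow> nat" where
  "instr_cost (Const r v) c = 1 + floorlog 2 v"
| "instr_cost (Arith f r s t) c =
     1 + floorlog 2 (reg c s) + floorlog 2 (reg c t) + floorlog 2 (apply_op f (reg c s) (reg c t))"
| "instr_cost (Load r s) c = 1 + floorlog 2 (reg c s) + floorlog 2 (mem c (reg c s))"
| "instr_cost (Store r s) c = 1 + floorlog 2 (reg c r) + floorlog 2 (reg c s)"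
| "instr_cost (Jump l) c = 1"
| "instr_cost (JumpZero r l) c = 1 + floorlog 2 (reg c r)"

definition step :: "ram_program \<Rightarrow> config \<Rightarrow> config" where
  "step P c = (if halted P c then c else exec_instr (P ! pc c) c)"

definition step_cost :: "ram_program \<Rightarrow> config \<Rightarrow> nat" where
  "step_cost P c = (if halted P c then 0 else instr_cost (P ! pc c) c)"

definition initial :: "nat list \<Rightarrow> config" where
  "initial xs = \<lparr>pc = 0, reg = (\<lambda>_. 0), mem = (\<lambda>i. if i < length xs then xs ! i else 0)\<rparr>"

definition config_after :: "ram_program \<Rightarrow> nat list \<Rightarrow> nat \<Rightarrow> config" where
  "config_after P xs i = (step P ^^ i) (initial xs)"

definition halts_within :: "ram_program \<Rightarrow> nat list \<Rightarrow> real \<Rightarrow> bool" where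
  "halts_within P xs t \<longleftrightarrow>
     (\<exists>i. halted P (config_after P xs i) \<and> real (\<Sum>j<i. step_cost P (config_after P xs j)) \<le> t)"

definition accepts :: "ram_program \<Rightarrow> nat list \<Rightarrow> bool" where
  "accepts P xs \<longleftrightarrow> (\<exists>i. halted P (config_after P xs i) \<and> reg (config_after P xs i) 0 \<noteq> 0)"

definition rejects :: "ram_program \<Rightarrow> nat list \<Rightarrow> bool" where
  "rejects P xs \<longleftrightarrow> (\<exists>i. halted P (config_after P xs i) \<and> reg (config_after P xs i) 0 = 0)"

section \<open>The Strong Exponential Time Hypothesis\<close>

datatype literal = Pos nat | Neg nat

type_synonym cnf = "literal list list"

fun var :: "literal \<Rightarrow> nat" where
  "var (Pos x) = x"
| "var (Neg x) = x"

fun lit_true :: "(nat \<Rightarrow> bool) \<Rightarrow> literal \<Rightarrow> bool" where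
  "lit_true \<alpha> (Pos x) = \<alpha> x"
| "lit_true \<alpha> (Neg x) = (\<not> \<alpha> x)"

definition satisfiable :: "cnf \<Rightarrow> bool" where
  "satisfiable \<phi> \<longleftrightarrow> (\<exists>\<alpha>. \<forall>c \<in> set \<phi>. \<exists>l \<in> set c. lit_true \<alpha> l)"

text \<open>
  A formula lists a set of clauses, and a clause lists a set of literals, without repetition.
  This bounds the length of a formula polynomially in \<open>n\<close> for fixed \<open>k\<close>. If clauses could be
  repeated, the input length would be unbounded in terms of \<open>n\<close>, and no running time bound
  depending on \<open>n\<close> alone would be meaningful.
\<close>

definition is_kcnf :: "nat \<Rightarrow> nat \<Rightarrow> cnf \<Rightarrow> bool" where
  "is_kcnf k n \<phi> \<longleftrightarrow>
     distinct (map set \<phi>) \<and>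
     (\<forall>c \<in> set \<phi>. distinct c \<and> length c \<le> k \<and> (\<forall>l \<in> set c. var l \<in> {1..n}))"

fun enc_literal :: "literal \<Rightarrow> nat" where
  "enc_literal (Pos x) = 2 * x"
| "enc_literal (Neg x) = 2 * x + 1"

definition enc_cnf :: "nat \<Rightarrow> cnf \<Rightarrow> nat list" where
  "enc_cnf n \<phi> = n # length \<phi> # concat (map (\<lambda>c. length c # map enc_literal c) \<phi>)"

definition solves_kSAT :: "ram_program \<Rightarrow> nat \<Rightarrow> (nat \<Rightarrow> real) \<Rightarrow> bool" where
  "solves_kSAT P k T \<longleftrightarrow>
     (\<forall>n \<phi>. is_kcnf k n \<phi> \<longrightarrow>
        halts_within P (enc_cnf n \<phi>) (T n) \<and>
        (satisfiable \<phi> \<longrightarrow> accepts P (enc_cnf n \<phi>)) \<and>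
        (\<not> satisfiable \<phi> \<longrightarrow> rejects P (enc_cnf n \<phi>)))"

definition SETH :: bool where
  "SETH \<longleftrightarrow>
     (\<forall>\<epsilon>::real. \<epsilon> > 0 \<longrightarrow>
        (\<exists>k\<ge>3. \<not> (\<exists>P T. T \<in> O(\<lambda>n. 2 powr ((1 - \<epsilon>) * real n)) \<and> solves_kSAT P k T)))"

section \<open>The gap subset problem\<close>

text \<open>
  A collection of \<open>N\<close> subsets is an indexed family, given as a list of length \<open>N\<close>.
  The condition \<open>k \<ge> 1\<close> is needed for the two cases to be disjoint: for \<open>k = 0\<close> both would hold
  on the same input, and every algorithm would fail for a trivial reason.
\<close>

definition is_instance :: "nat \<Rightarrow> nat \<Rightarrow> nat \<Rightarrow> nat set list \<Rightarrow> nat set list \<Rightarrow> bool" where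
  "is_instance N m k A B \<longleftrightarrow>
     length A = N \<and> length B = N \<and>
     (\<forall>a \<in> set A. a \<subseteq> {1..m}) \<and>
     (\<forall>b \<in> set B. b \<subseteq> {1..m} \<and> card b = k) \<and>
     k \<ge> 1"

definition completeness_case :: "nat set list \<Rightarrow> nat set list \<Rightarrow> bool" where
  "completeness_case A B \<longleftrightarrow> (\<exists>a \<in> set A. \<exists>b \<in> set B. b \<subseteq> a)"

definition soundness_case :: "real \<Rightarrow> nat \<Rightarrow> nat set list \<Rightarrow> nat set list \<Rightarrow> bool" where
  "soundness_case g k A B \<longleftrightarrow> (\<forall>a \<in> set A. \<forall>b \<in> set B. real (card (a \<inter> b)) \<le> real k / g)"

definition enc_subset :: "nat \<Rightarrow> nat set \<Rightarrow> nat list" where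
  "enc_subset m s = map (\<lambda>x. if x \<in> s then 1 else 0) [1..<m + 1]"

definition enc_instance :: "nat \<Rightarrow> nat \<Rightarrow> nat set list \<Rightarrow> nat set list \<Rightarrow> nat list" where
  "enc_instance N m A B = N # m # concat (map (enc_subset m) A) @ concat (map (enc_subset m) B)"

text \<open>
  The universe size \<open>m\<close> and the gap \<open>g\<close> are functions of \<open>N\<close>. The case \<open>N = 1\<close> is excluded because
  there \<open>log N = 0\<close>, so that a gap \<open>2 powr (log 2 N powr x)\<close> degenerates to 1 and the two cases overlap.
\<close>

definition distinguishes ::
  "ram_program \<Rightarrow> (nat \<Rightarrow> nat) \<Rightarrow> (nat \<Rightarrow> real) \<Rightarrow> (nat \<Rightarrow> real) \<Rightarrow> bool" where
  "distinguishes P m g T \<longleftrightarrow>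
     (\<forall>N\<ge>2. \<forall>k A B. is_instance N (m N) k A B \<longrightarrow>
        halts_within P (enc_instance N (m N) A B) (T N) \<and>
        (completeness_case A B \<longrightarrow> accepts P (enc_instance N (m N) A B)) \<and>
        (soundness_case (g N) k A B \<longrightarrow> rejects P (enc_instance N (m N) A B)))"

end

theory Submission
  imports Defs "HOL-Computational_Algebra.Computational_Algebra" "HOL-Real_Asymp.Real_Asymp"
begin

text \<open>
  An assignment to \<open>n\<close> variables is split into halves \<open>x\<close> and \<open>y\<close> of \<open>h\<close> bits each, so that \<open>N = 2 ^ h\<close>.
  By sparsification a satisfiable formula may be replaced, after guessing \<open>o(h)\<close> bits, by one with
  \<open>M = T * L\<close> clauses, almost linear in \<open>h\<close>. The assignment satisfies it iff the 0/1 vectors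
  of clauses not satisfied by \<open>x\<close> and by \<open>y\<close> are orthogonal. Orthogonality has a Merlin-Arthur
  protocol: the vectors are cut into \<open>T\<close> blocks of length \<open>L\<close> and read as polynomials over a prime
  field of size polynomial in \<open>M\<close>, Merlin's advice is the sum of the \<open>T\<close> products of
  polynomials, and Arthur compares values at a random point \<open>r\<close>. The advice, again \<open>o(h)\<close> bits, is guessed.

  For a fixed guess, the universe consists of \<open>R\<close>-tuples of pairs of a random point with the \<open>T\<close> values
  of the polynomials of \<open>y\<close>. The set of \<open>y\<close> contains the \<open>q ^ R\<close> tuples with the true values, and the set
  of \<open>x\<close> those tuples on which Arthur accepts. With polylogarithmic \<open>T\<close> and \<open>R\<close> slightly sublinear
  in \<open>h\<close>, the universe has size \<open>2 powr o(h)\<close> while \<open>R\<close> independent repetitions give the gap \<open>2 ^ R\<close>.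
  Running an algorithm of time \<open>N powr (2 - \<epsilon>)\<close> on all \<open>2 powr o(h)\<close> guesses then decides
  satisfiability faster than SETH permits. In the machine model, the guesses and the instances are
  produced by a compiler for a small expression language, and the algorithm is run as a subroutine.
\<close>

section \<open>Composable machine code\<close>

text \<open>Sparsification is forced by the length of Merlin's advice: a \<open>k\<close>-CNF may
  have about \<open>h ^ k\<close> clauses, every bit of advice doubles the number of queries, and
  only \<open>o(h)\<close> bits can be afforded. Cutting \<open>M\<close> coordinates into
  \<open>T\<close> blocks shortens the advice to about \<open>M / T\<close> field elements but makes
  elements of the universe \<open>T\<close> times longer, so \<open>M\<close> has to be within
  polylogarithmic factors of \<open>h\<close> before a suitable \<open>T\<close> exists. Wrong
  advice is harmless. The guided family always contains the original clauses, and a false clause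
  contains an alive set that is false as well; a wrong offer is a polynomial identity that fails at
  most points. Hence soundness holds for every guess, and a single accepted query decides. All
  estimates are made for fixed \<open>k\<close>: SETH supplies \<open>k\<close> from
  \<open>\<epsilon>\<close>, and the universe size and both error exponents then depend on it. Fixed
  \<open>k\<close> also means polynomially many possible clauses, so a whole family of clauses is a
  number that the machine can hold in a register.\<close>

type_synonym state = "(nat \<Rightarrow> nat) \<times> (nat \<Rightarrow> nat)"

definition cfg :: "nat \<Rightarrow> state \<Rightarrow> config" where
  "cfg p s = \<lparr>pc = p, reg = fst s, mem = snd s\<rparr>"

lemma cfg_sel [simp]: "pc (cfg p s) = p" "reg (cfg p s) = fst s" "mem (cfg p s) = snd s"
  by (simp_all add: cfg_def)

definition reach :: "ram_program \<Rightarrow> config \<Rightarrow> nat \<Rightarrow> config \<Rightarrow> bool" where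
  "reach P c C c' \<longleftrightarrow> (\<exists>i. (step P ^^ i) c = c' \<and> (\<Sum>j<i. step_cost P ((step P ^^ j) c)) \<le> C)"

lemma reach_refl: "reach P c C c"
  unfolding reach_def by (rule exI[of _ 0]) simp

lemma reach_trans:
  assumes "reach P a C b" "reach P b D c"
  shows "reach P a (C + D) c"
proof -
  obtain i where i: "(step P ^^ i) a = b" "(\<Sum>j<i. step_cost P ((step P ^^ j) a)) \<le> C"
    using assms(1) by (auto simp: reach_def)
  obtain l where l: "(step P ^^ l) b = c" "(\<Sum>j<l. step_cost P ((step P ^^ j) b)) \<le> D"
    using assms(2) by (auto simp: reach_def)
  have shift: "(step P ^^ (j + i)) a = (step P ^^ j) b" for j
    using i(1) by (simp add: funpow_add)
  have "(\<Sum>j<l + i. step_cost P ((step P ^^ j) a)) =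
      (\<Sum>j<i. step_cost P ((step P ^^ j) a)) + (\<Sum>j<l. step_cost P ((step P ^^ (j + i)) a))"
    by (induction l) auto
  then have "(\<Sum>j<l + i. step_cost P ((step P ^^ j) a)) \<le> C + D"
    using i(2) l(2) shift by simp
  moreover have "(step P ^^ (l + i)) a = c"
    using shift l(1) by simp
  ultimately show ?thesis
    unfolding reach_def by blast
qed

lemma reach_mono: "reach P a C b \<Longrightarrow> C \<le> D \<Longrightarrow> reach P a D b"
  unfolding reach_def by fastforce

lemma reach_step:
  assumes "pc c < length P" "instr_cost (P ! pc c) c \<le> C" "exec_instr (P ! pc c) c = c'"
  shows "reach P c C c'"
  unfolding reach_def using assms
  by (intro exI[of _ 1]) (auto simp: step_def step_cost_def halted_def)

text \<open>
  A piece of code is a function of the address at which it is placed, because jump targets are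
  absolute.
\<close>

type_synonym code = "nat \<Rightarrow> instr list"

definition code_at :: "ram_program \<Rightarrow> nat \<Rightarrow> instr list \<Rightarrow> bool" where
  "code_at P p cs \<longleftrightarrow> (\<forall>i<length cs. p + i < length P \<and> P ! (p + i) = cs ! i)"

lemma code_at_append [simp]:
  "code_at P p (xs @ ys) \<longleftrightarrow> code_at P p xs \<and> code_at P (p + length xs) ys"
proof
  assume A: "code_at P p (xs @ ys)"
  have "p + i < length P \<and> P ! (p + i) = xs ! i" if "i < length xs" for i
    using A that unfolding code_at_def by (auto simp: nth_append dest!: spec[of _ i])
  moreover have "p + length xs + i < length P \<and> P ! (p + length xs + i) = ys ! i"
    if "i < length ys" for i
    using A that unfolding code_at_def
    by (auto simp: nth_append add.assoc dest!: spec[of _ "length xs + i"])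
  ultimately show "code_at P p xs \<and> code_at P (p + length xs) ys"
    by (simp add: code_at_def)
next
  assume A: "code_at P p xs \<and> code_at P (p + length xs) ys"
  show "code_at P p (xs @ ys)"
    unfolding code_at_def
  proof (intro allI impI)
    fix i assume i: "i < length (xs @ ys)"
    show "p + i < length P \<and> P ! (p + i) = (xs @ ys) ! i"
    proof (cases "i < length xs")
      case True
      then show ?thesis using A by (simp add: code_at_def nth_append)
    next
      case False
      then have "i - length xs < length ys" using i by simp
      with A have "p + length xs + (i - length xs) < length P \<and>
          P ! (p + length xs + (i - length xs)) = ys ! (i - length xs)"
        unfolding code_at_def by blast
      then show ?thesis using False by (simp add: nth_append)
    qed
  qed
qed

lemma code_at_Cons [simp]:
  "code_at P p (x # ys) \<longleftrightarrow> p < length P \<and> P ! p = x \<and> code_at P (Suc p) ys"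
  using code_at_append[of P p "[x]" ys] by (simp add: code_at_def del: code_at_append)

lemma code_at_Nil [simp]: "code_at P p []"
  by (simp add: code_at_def)

lemma code_at_self: "code_at P 0 P"
  by (simp add: code_at_def)

text \<open>Jump targets are computed from the lengths of blocks, so a block must occupy the same
  number of instructions at every address.\<close>

definition position_free :: "code \<Rightarrow> bool" where
  "position_free c \<longleftrightarrow> (\<forall>p. length (c p) = length (c 0))"

text \<open>The claim ranges over every program that contains the block, at any address, so one
  proof serves all uses of the block inside larger code.\<close>

definition runs :: "code \<Rightarrow> state \<Rightarrow> nat \<Rightarrow> state \<Rightarrow> bool" where
  "runs c s C s' \<longleftrightarrow> position_free c \<and>
     (\<forall>P p. code_at P p (c p) \<longrightarrow> reach P (cfg p s) C (cfg (p + length (c 0)) s'))"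

definition nop :: code where "nop = (\<lambda>_. [])"
definition atom :: "instr \<Rightarrow> code" where "atom i = (\<lambda>_. [i])"
definition seq :: "code \<Rightarrow> code \<Rightarrow> code" (infixr ";;" 60) where
  "seq c d = (\<lambda>p. c p @ d (p + length (c p)))"

lemma position_free_simps [simp]:
  "position_free nop" "position_free (atom i)"
  by (auto simp: position_free_def nop_def atom_def)

lemma length_position_free: "position_free c \<Longrightarrow> length (c p) = length (c 0)"
  by (simp add: position_free_def)

lemma position_free_seq [simp, intro]:
  "position_free c \<Longrightarrow> position_free d \<Longrightarrow> position_free (c ;; d)"
  unfolding position_free_def seq_def by (metis length_append)

lemma runs_seq:
  assumes "runs c s C t" "runs d t D u"
  shows "runs (c ;; d) s (C + D) u"
  unfolding runs_def
proof (intro conjI allI impI)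
  show "position_free (c ;; d)"
    using assms by (auto simp: runs_def)
  fix P p
  assume A: "code_at P p ((c ;; d) p)"
  have c: "length (c q) = length (c 0)" for q
    using assms(1) by (simp add: runs_def position_free_def)
  have d: "length (d q) = length (d 0)" for q
    using assms(2) by (simp add: runs_def position_free_def)
  from A have "reach P (cfg p s) C (cfg (p + length (c 0)) t)"
    using assms(1) by (auto simp: seq_def runs_def)
  moreover from A have "reach P (cfg (p + length (c 0)) t) D (cfg (p + length (c 0) + length (d 0)) u)"
    using assms(2) c[of p] by (auto simp: seq_def runs_def)
  moreover have "length ((c ;; d) 0) = length (c 0) + length (d 0)"
    by (simp add: seq_def d[of "length (c 0)"])
  ultimately show "reach P (cfg p s) (C + D) (cfg (p + length ((c ;; d) 0)) u)"
    by (metis reach_trans add.assoc)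
qed

lemma runs_mono: "runs c s C t \<Longrightarrow> C \<le> D \<Longrightarrow> runs c s D t"
  unfolding runs_def using reach_mono by blast

lemma runs_nop: "runs nop s 0 s"
  by (auto simp: runs_def nop_def reach_refl position_free_def)

text \<open>Operands below \<open>2 ^ w\<close> give results below \<open>2 ^ (2 * w + 1)\<close>,
  so an arithmetic instruction costs at most \<open>1 + w + w + (2 * w + 1)\<close>; the other
  instructions are cheaper.\<close>

abbreviation unit_cost :: "nat \<Rightarrow> nat" where
  "unit_cost w \<equiv> 4 * w + 2"

lemma floorlog_zero [simp]: "floorlog b 0 = 0"
  by (simp add: floorlog_def)

lemma floorlog_le_pow2: "x < 2 ^ w \<Longrightarrow> floorlog 2 x \<le> w"
  by (simp add: floorlog_leI)

lemma apply_op_less: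
  assumes "x < 2 ^ v" "y < 2 ^ w"
  shows "apply_op f x y < 2 ^ (v + w + 1)"
proof (cases f)
  case Add
  have "x < 2 ^ (v + w)" "y < 2 ^ (v + w)"
    using assms by (auto elim!: order.strict_trans2 intro!: power_increasing)
  then have "x + y < 2 ^ (v + w) + 2 ^ (v + w)"
    by (rule add_strict_mono)
  then show ?thesis using Add by simp
next
  case Sub
  have "x < 2 ^ (v + w + 1)"
    using assms(1) by (rule order.strict_trans2) (rule power_increasing, auto)
  then show ?thesis using Sub by simp
next
  case Mult
  have "x * y < 2 ^ v * 2 ^ w"
    using assms by (intro mult_strict_mono) auto
  also have "\<dots> \<le> 2 ^ (v + w + 1)"
    by (simp add: power_add)
  finally show ?thesis using Mult by simp
next
  case Div
  have "x < 2 ^ (v + w + 1)"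
    using assms(1) by (rule order.strict_trans2) (rule power_increasing, auto)
  then show ?thesis using Div le_less_trans[OF div_le_dividend] by simp
qed

lemma runs_atom:
  assumes "instr_cost i (cfg 0 s) \<le> C"
    and "\<And>p. instr_cost i (cfg p s) = instr_cost i (cfg 0 s)"
    and "\<And>p. exec_instr i (cfg p s) = cfg (p + 1) t"
  shows "runs (atom i) s C t"
  unfolding runs_def
proof (intro conjI allI impI)
  fix P p
  assume "code_at P p (atom i p)"
  then show "reach P (cfg p s) C (cfg (p + length (atom i 0)) t)"
    using assms(1) assms(2)[of p] assms(3)[of p]
    by (intro reach_step) (simp_all add: atom_def)
qed simp

lemma runs_Const:
  assumes "v < 2 ^ w"
  shows "runs (atom (Const r v)) (R, M) (unit_cost w) (R(r := v), M)"
  using floorlog_le_pow2[OF assms] by (intro runs_atom) (auto simp: cfg_def)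

lemma runs_Arith:
  assumes "R x < 2 ^ w" "R y < 2 ^ w"
  shows "runs (atom (Arith f r x y)) (R, M) (unit_cost w) (R(r := apply_op f (R x) (R y)), M)"
proof -
  have "floorlog 2 (apply_op f (R x) (R y)) \<le> w + w + 1"
    using apply_op_less[OF assms] by (rule floorlog_le_pow2)
  then show ?thesis
    using floorlog_le_pow2[OF assms(1)] floorlog_le_pow2[OF assms(2)]
    by (intro runs_atom) (auto simp: cfg_def)
qed

lemma runs_Load:
  assumes "R x < 2 ^ w" "M (R x) < 2 ^ w"
  shows "runs (atom (Load r x)) (R, M) (unit_cost w) (R(r := M (R x)), M)"
  using floorlog_le_pow2[OF assms(1)] floorlog_le_pow2[OF assms(2)]
  by (intro runs_atom) (auto simp: cfg_def)

lemma runs_Store: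
  assumes "R x < 2 ^ w" "R y < 2 ^ w"
  shows "runs (atom (Store x y)) (R, M) (unit_cost w) (R, M(R x := R y))"
  using floorlog_le_pow2[OF assms(1)] floorlog_le_pow2[OF assms(2)]
  by (intro runs_atom) (auto simp: cfg_def)

definition copy :: "nat \<Rightarrow> nat \<Rightarrow> code" where
  "copy t r = atom (Const t 0) ;; atom (Arith Add t r t)"

lemma runs_copy:
  assumes "R r < 2 ^ w" "r \<noteq> t"
  shows "runs (copy t r) (R, M) (2 * unit_cost w) (R(t := R r), M)"
proof -
  have "runs (copy t r) (R, M) (unit_cost w + unit_cost w) (R(t := 0, t := apply_op Add ((R(t := 0)) r) ((R(t := 0)) t)), M)"
    unfolding copy_def using assms by (intro runs_seq[OF runs_Const runs_Arith]) auto
  then show ?thesis using assms by (simp add: mult_2)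
qed

text \<open>\<open>x - (x - y)\<close> with truncated subtraction is \<open>min x y\<close>.\<close>

definition clamp :: "nat \<Rightarrow> nat \<Rightarrow> code" where
  "clamp t g = atom (Arith Sub (t + 1) t g) ;; atom (Arith Sub t t (t + 1))"

lemma runs_clamp:
  assumes "R t < 2 ^ w" "R g < 2 ^ w" "g < t"
  shows "runs (clamp t g) (R, M) (2 * unit_cost w) (R(t + 1 := R t - R g, t := min (R t) (R g)), M)"
proof -
  have "runs (clamp t g) (R, M) (unit_cost w + unit_cost w)
     (R(t + 1 := apply_op Sub (R t) (R g),
        t := apply_op Sub ((R(t + 1 := apply_op Sub (R t) (R g))) t)
               ((R(t + 1 := apply_op Sub (R t) (R g))) (t + 1))), M)"
    unfolding clamp_def using assms
    by (intro runs_seq[OF runs_Arith runs_Arith]) (auto intro: le_less_trans[OF diff_le_self])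
  moreover have "R t - (R t - R g) = min (R t) (R g)" by simp
  ultimately show ?thesis using assms by (simp add: mult_2)
qed

section \<open>Counted loops\<close>

abbreviation loop_code :: "nat \<Rightarrow> nat \<Rightarrow> nat \<Rightarrow> code \<Rightarrow> code" where
  "loop_code i n x body \<equiv> (\<lambda>p. [Arith Sub x n i, JumpZero x (p + 5 + length (body (p + 2)))] @
     body (p + 2) @ [Const x 1, Arith Add i i x, Jump p])"

lemma loop_code_at:
  assumes "position_free body" "code_at P p (loop_code i n x body p)"
  shows "p < length P" "P ! p = Arith Sub x n i"
    "p + 1 < length P" "P ! (p + 1) = JumpZero x (p + 5 + length (body 0))"
    "code_at P (p + 2) (body (p + 2))"
    "p + 2 + length (body 0) < length P" "P ! (p + 2 + length (body 0)) = Const x 1"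
    "p + 3 + length (body 0) < length P" "P ! (p + 3 + length (body 0)) = Arith Add i i x"
    "p + 4 + length (body 0) < length P" "P ! (p + 4 + length (body 0)) = Jump p"
proof -
  have l: "length (body (p + 2)) = length (body 0)"
    using assms(1) by (rule length_position_free)
  note c = assms(2)[unfolded code_at_append code_at_Cons l]
  show "p < length P" "P ! p = Arith Sub x n i"
    "p + 1 < length P" "P ! (p + 1) = JumpZero x (p + 5 + length (body 0))"
    "code_at P (p + 2) (body (p + 2))"
    "p + 2 + length (body 0) < length P" "P ! (p + 2 + length (body 0)) = Const x 1"
    "p + 3 + length (body 0) < length P" "P ! (p + 3 + length (body 0)) = Arith Add i i x"
    "p + 4 + length (body 0) < length P" "P ! (p + 4 + length (body 0)) = Jump p"
    using c by (simp_all add: eval_nat_numeral)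
qed

lemma reach_loop_code:
  fixes body :: code and n :: nat
  assumes pf: "position_free body"
    and distinct: "i \<noteq> rn" "i \<noteq> x" "rn \<noteq> x"
    and n: "n < 2 ^ w"
    and step: "\<And>j R M. j < n \<Longrightarrow> I j R M \<Longrightarrow> R i = j \<Longrightarrow> R rn = n \<Longrightarrow>
       \<exists>R' M'. runs body (R(x := n - j), M) C (R', M') \<and> R' i = j \<and> R' rn = n \<and>
         I (Suc j) (R'(x := 1, i := Suc j)) M'"
    and zero: "\<And>R M. I n R M \<Longrightarrow> I n (R(x := 0)) M"
    and start: "I j R M" "R i = j" "R rn = n" "j \<le> n"
  shows "\<exists>R' M'. I n R' M' \<and> (\<forall>P p. code_at P p (loop_code i rn x body p) \<longrightarrow>
           reach P (cfg p (R, M)) ((n - j) * (C + 5 * unit_cost w) + 2 * unit_cost w)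
           (cfg (p + 5 + length (body 0)) (R', M')))"
  using start
proof (induction "n - j" arbitrary: j R M)
  case 0
  have len: "length (body q) = length (body 0)" for q
    by (rule length_position_free[OF pf])
  have j: "j = n" using 0(1) 0(5) by linarith
  have "reach P (cfg p (R, M)) ((n - j) * (C + 5 * unit_cost w) + 2 * unit_cost w)
      (cfg (p + 5 + length (body 0)) (R(x := 0), M))"
    if code: "code_at P p (loop_code i rn x body p)" for P p
  proof -
    note c = loop_code_at[OF pf code]
    have "floorlog 2 (R rn) \<le> w" "floorlog 2 (R i) \<le> w" "R rn - R i = 0"
      unfolding 0(3,4) j using floorlog_le_pow2[OF n] by simp_all
    then have r1: "reach P (cfg p (R, M)) (unit_cost w) (cfg (p + 1) (R(x := 0), M))"
      by (intro reach_step) (simp_all add: c(1,2) cfg_def)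
    have r2: "reach P (cfg (p + 1) (R(x := 0), M)) (unit_cost w)
        (cfg (p + 5 + length (body 0)) (R(x := 0), M))"
      using c(3,4) by (intro reach_step) (simp_all add: cfg_def)
    show ?thesis
      by (rule reach_mono[OF reach_trans[OF r1 r2]]) simp
  qed
  moreover have "I n (R(x := 0)) M"
    using 0(2) j zero by blast
  ultimately show ?case by blast
next
  case (Suc d)
  have len: "length (body q) = length (body 0)" for q
    by (rule length_position_free[OF pf])
  have j: "j < n" using Suc.hyps(2) by linarith
  have small: "n - j < 2 ^ w" "j < 2 ^ w"
    using n j by linarith+
  have "w \<noteq> 0"
    using n j by (cases "w = 0") simp_all
  then have n1: "Suc 0 < 2 ^ w"
    using one_less_power[of "2::nat" w] by simp
  have bits: "floorlog 2 n \<le> w" "floorlog 2 (n - j) \<le> w" "floorlog 2 j \<le> w"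
      "floorlog 2 (Suc j) \<le> w" "floorlog 2 (Suc 0) \<le> w"
    using n small j n1 by (auto intro!: floorlog_le_pow2)
  obtain R1 M1 where b: "runs body (R(x := n - j), M) C (R1, M1)" "R1 i = j" "R1 rn = n"
      "I (Suc j) (R1(x := 1, i := Suc j)) M1"
    using step[OF j Suc.prems(1-3)] by blast
  have d: "d = n - Suc j" using Suc.hyps(2) by simp
  have "(R1(x := 1, i := Suc j)) i = Suc j" "(R1(x := 1, i := Suc j)) rn = n" "Suc j \<le> n"
    using b(3) distinct j by simp_all
  from Suc.hyps(1)[OF d b(4) this] obtain R' M' where fin: "I n R' M'" and
    rest: "\<And>P p. code_at P p (loop_code i rn x body p) \<Longrightarrow>
      reach P (cfg p (R1(x := 1, i := Suc j), M1))
      ((n - Suc j) * (C + 5 * unit_cost w) + 2 * unit_cost w)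
      (cfg (p + 5 + length (body 0)) (R', M'))"
    by blast
  have "reach P (cfg p (R, M)) ((n - j) * (C + 5 * unit_cost w) + 2 * unit_cost w)
      (cfg (p + 5 + length (body 0)) (R', M'))"
    if code: "code_at P p (loop_code i rn x body p)" for P p
  proof -
    note c = loop_code_at[OF pf code]
    have r1: "reach P (cfg p (R, M)) (unit_cost w) (cfg (p + 1) (R(x := n - j), M))"
      using bits Suc.prems(2,3) by (intro reach_step) (simp_all add: c(1,2) cfg_def)
    have r2: "reach P (cfg (p + 1) (R(x := n - j), M)) (unit_cost w) (cfg (p + 2) (R(x := n - j), M))"
      using bits j c(3,4) by (intro reach_step) (simp_all add: cfg_def)
    have r3: "reach P (cfg (p + 2) (R(x := n - j), M)) C (cfg (p + 2 + length (body 0)) (R1, M1))"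
      using b(1) c(5) unfolding runs_def by blast
    have r4: "reach P (cfg (p + 2 + length (body 0)) (R1, M1)) (unit_cost w)
        (cfg (p + 3 + length (body 0)) (R1(x := 1), M1))"
      using bits c(6,7) by (intro reach_step) (simp_all add: cfg_def eval_nat_numeral)
    have r5: "reach P (cfg (p + 3 + length (body 0)) (R1(x := 1), M1)) (unit_cost w)
        (cfg (p + 4 + length (body 0)) (R1(x := 1, i := Suc j), M1))"
      using bits b(2) distinct c(8,9)
      by (intro reach_step) (simp_all add: cfg_def eval_nat_numeral)
    have r6: "reach P (cfg (p + 4 + length (body 0)) (R1(x := 1, i := Suc j), M1)) (unit_cost w)
        (cfg p (R1(x := 1, i := Suc j), M1))"
      using c(10,11) by (intro reach_step) (simp_all add: cfg_def)
    \<comment> \<open>Five control instructions per turn: subtraction, test, constant, increment and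
      the jump back.\<close>
    have turn: "reach P (cfg p (R, M)) (C + 5 * unit_cost w) (cfg p (R1(x := 1, i := Suc j), M1))"
      by (rule reach_mono[OF reach_trans[OF r1 reach_trans[OF r2 reach_trans[OF r3
                reach_trans[OF r4 reach_trans[OF r5 r6]]]]]]) simp
    have "n - j = Suc (n - Suc j)" using j by simp
    then have "(C + 5 * unit_cost w) + ((n - Suc j) * (C + 5 * unit_cost w) + 2 * unit_cost w) =
        (n - j) * (C + 5 * unit_cost w) + 2 * unit_cost w" by (simp only: mult_Suc add.assoc)
    with reach_trans[OF turn rest[OF code]] show ?thesis by (simp only:)
  qed
  with fin show ?case by blast
qed

definition for_loop :: "nat \<Rightarrow> nat \<Rightarrow> nat \<Rightarrow> code \<Rightarrow> code" where
  "for_loop i n x body = atom (Const i 0) ;; loop_code i n x body"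

lemma position_free_loop_code [intro]:
  assumes "position_free body" shows "position_free (loop_code i n x body)"
proof -
  have "length (body q) = length (body 0)" for q
    using assms by (rule length_position_free)
  then have "length (body (q + 2)) = length (body 2)" for q
    by metis
  then show ?thesis
    unfolding position_free_def by simp
qed

lemma position_free_for_loop [intro]: "position_free body \<Longrightarrow> position_free (for_loop i n x body)"
  unfolding for_loop_def by (intro position_free_seq position_free_loop_code) auto

text \<open>Register \<open>x\<close> first holds the truncated difference \<open>n - j\<close>,
  which is zero exactly at the end, and then the constant 1 for the increment. The assumptions on
  body and invariant are therefore phrased across these overwrites of \<open>x\<close> and
  \<open>i\<close>.\<close>

lemma runs_for_loop:
  fixes I :: "nat \<Rightarrow> (nat \<Rightarrow> nat) \<Rightarrow> (nat \<Rightarrow> nat) \<Rightarrow> bool"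
  assumes pf: "position_free body"
    and distinct: "i \<noteq> rn" "i \<noteq> x" "rn \<noteq> x"
    and n: "n < 2 ^ w" "R rn = n"
    and start: "I 0 (R(i := 0)) M"
    and step: "\<And>j R M. j < n \<Longrightarrow> I j R M \<Longrightarrow> R i = j \<Longrightarrow> R rn = n \<Longrightarrow>
       \<exists>R' M'. runs body (R(x := n - j), M) C (R', M') \<and> R' i = j \<and> R' rn = n \<and>
         I (Suc j) (R'(x := 1, i := Suc j)) M'"
    and zero: "\<And>R M. I n R M \<Longrightarrow> I n (R(x := 0)) M"
  shows "\<exists>R' M'. runs (for_loop i rn x body) (R, M) (n * (C + 5 * unit_cost w) + 3 * unit_cost w)
    (R', M') \<and> I n R' M'"
proof -
  have c0: "runs (atom (Const i 0)) (R, M) (unit_cost w) (R(i := 0), M)"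
    by (rule runs_Const) simp
  have "\<exists>R' M'. I n R' M' \<and> (\<forall>P p. code_at P p (loop_code i rn x body p) \<longrightarrow>
      reach P (cfg p (R(i := 0), M)) ((n - 0) * (C + 5 * unit_cost w) + 2 * unit_cost w)
      (cfg (p + 5 + length (body 0)) (R', M')))"
    using distinct n start
    by (intro reach_loop_code[where I = I and j = 0, OF pf distinct n(1)] step zero) simp_all
  then obtain R' M' where fin: "I n R' M'" and
    loop: "\<And>P p. code_at P p (loop_code i rn x body p) \<Longrightarrow>
      reach P (cfg p (R(i := 0), M)) (n * (C + 5 * unit_cost w) + 2 * unit_cost w)
      (cfg (p + 5 + length (body 0)) (R', M'))"
    by (metis diff_zero)
  have l: "length (loop_code i rn x body 0) = 5 + length (body 0)"
    using length_position_free[OF pf, of "0 + 2"] by simp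
  have "runs (loop_code i rn x body) (R(i := 0), M)
      (n * (C + 5 * unit_cost w) + 2 * unit_cost w) (R', M')"
    unfolding runs_def l
  proof (intro conjI allI impI)
    show "position_free (loop_code i rn x body)"
      using pf by (rule position_free_loop_code)
    fix P p assume "code_at P p (loop_code i rn x body p)"
    from loop[OF this] show "reach P (cfg p (R(i := 0), M))
        (n * (C + 5 * unit_cost w) + 2 * unit_cost w) (cfg (p + (5 + length (body 0))) (R', M'))"
      by (simp only: add.assoc)
  qed
  from runs_seq[OF c0 this]
  have "runs (for_loop i rn x body) (R, M) (n * (C + 5 * unit_cost w) + 3 * unit_cost w) (R', M')"
    unfolding for_loop_def by (rule runs_mono) simp
  with fin show ?thesis by blast
qed

section \<open>An expression language with polynomial evaluation cost\<close>

text \<open>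
  Variables are de Bruijn levels: a binder appends its variable at the end of the environment, and
  \<open>Call f es\<close> evaluates \<open>f\<close> in the fresh environment of its arguments. Loop counts, input addresses
  and exponents are cut off at a parameter \<open>S\<close>, and accumulators at \<open>2 ^ S\<close>, so that the cost of an
  expression is polynomial in \<open>S\<close> whatever the expression is.
\<close>

datatype ex =
    Num nat
  | Var nat
  | Inp ex
  | Op arith_op ex ex
  | Sum ex ex
  | Rec ex ex ex
  | Pow2 ex
  | Call ex "ex list"

primrec eval :: "nat \<Rightarrow> (nat \<Rightarrow> nat) \<Rightarrow> ex \<Rightarrow> nat list \<Rightarrow> nat" where
  "eval S \<mu> (Num c) \<rho> = c"
| "eval S \<mu> (Var i) \<rho> = (if i < length \<rho> then \<rho> ! i else 0)"
| "eval S \<mu> (Inp e) \<rho> = \<mu> (min (eval S \<mu> e \<rho>) S)"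
| "eval S \<mu> (Op f d e) \<rho> = apply_op f (eval S \<mu> d \<rho>) (eval S \<mu> e \<rho>)"
| "eval S \<mu> (Sum d e) \<rho> = (\<Sum>i<min (eval S \<mu> d \<rho>) S. eval S \<mu> e (\<rho> @ [i]))"
| "eval S \<mu> (Rec n d e) \<rho> = rec_nat (min (eval S \<mu> d \<rho>) (2 ^ S))
     (\<lambda>i x. min (eval S \<mu> e (\<rho> @ [i, x])) (2 ^ S)) (min (eval S \<mu> n \<rho>) S)"
| "eval S \<mu> (Pow2 e) \<rho> = 2 ^ min (eval S \<mu> e \<rho>) S"
| "eval S \<mu> (Call f es) \<rho> = eval S \<mu> f (map (\<lambda>e. eval S \<mu> e \<rho>) es)"

fun seq_args :: "(nat list \<Rightarrow> nat \<Rightarrow> code) list \<Rightarrow> nat list \<Rightarrow> nat \<Rightarrow> code" where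
  "seq_args [] rs t = nop"
| "seq_args (c # cs) rs t = c rs t ;; seq_args cs rs (t + 1)"

text \<open>
  Registers 1 and 2 hold \<open>S\<close> and \<open>2 ^ S\<close>. The variables live in the registers \<open>rs\<close>, the result goes
  to register \<open>t\<close>, and only registers from \<open>t\<close> on are overwritten.
\<close>

primrec comp :: "ex \<Rightarrow> nat list \<Rightarrow> nat \<Rightarrow> code" where
  "comp (Num c) = (\<lambda>rs t. atom (Const t c))"
| "comp (Var i) = (\<lambda>rs t. if i < length rs then copy t (rs ! i) else atom (Const t 0))"
| "comp (Inp e) = (\<lambda>rs t. comp e rs t ;; clamp t 1 ;; atom (Load t t))"
| "comp (Op f d e) = (\<lambda>rs t. comp d rs t ;; comp e rs (t + 1) ;; atom (Arith f t t (t + 1)))"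
| "comp (Sum d e) = (\<lambda>rs t. comp d rs (t + 1) ;; clamp (t + 1) 1 ;; atom (Const t 0) ;;
     for_loop (t + 2) (t + 1) (t + 3)
       (comp e (rs @ [t + 2]) (t + 4) ;; atom (Arith Add t t (t + 4))))"
| "comp (Rec n d e) = (\<lambda>rs t. comp d rs t ;; clamp t 2 ;; comp n rs (t + 1) ;; clamp (t + 1) 1 ;;
     for_loop (t + 2) (t + 1) (t + 3)
       (comp e (rs @ [t + 2, t]) (t + 4) ;; clamp (t + 4) 2 ;; copy t (t + 4)))"
| "comp (Pow2 e) = (\<lambda>rs t. comp e rs (t + 1) ;; clamp (t + 1) 1 ;; atom (Const t 1) ;;
     for_loop (t + 2) (t + 1) (t + 3) (atom (Arith Add t t t)))"
| "comp (Call f es) = (\<lambda>rs t. seq_args (map comp es) rs (t + 1) ;;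
     comp f [t + 1..<t + 1 + length es] (t + 1 + length es) ;; copy t (t + 1 + length es))"

text \<open>\<open>vb\<close> and \<open>tb\<close> bound the values, as powers of \<open>2 ^ S\<close>, and the cost.\<close>

primrec vb :: "ex \<Rightarrow> nat \<Rightarrow> nat" where
  "vb (Num c) a = c"
| "vb (Var i) a = a"
| "vb (Inp e) a = 1"
| "vb (Op f d e) a = vb d a + vb e a + 1"
| "vb (Sum d e) a = vb e (a + 1) + 1"
| "vb (Rec n d e) a = 2"
| "vb (Pow2 e) a = 2"
| "vb (Call f es) a = vb f (sum_list (map (\<lambda>e. vb e a) es))"

primrec tb :: "ex \<Rightarrow> nat \<Rightarrow> nat \<Rightarrow> nat" where
  "tb (Num c) a S = unit_cost (c * S)"
| "tb (Var i) a S = 2 * unit_cost (a * S)"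
| "tb (Inp e) a S = tb e a S + 3 * unit_cost ((vb e a + 1) * S)"
| "tb (Op f d e) a S = tb d a S + tb e a S + unit_cost ((vb d a + vb e a) * S)"
| "tb (Sum d e) a S = tb d a S + 2 * unit_cost ((vb d a + 1) * S) + unit_cost 0 +
     S * (tb e (a + 1) S + unit_cost ((vb e (a + 1) + 1) * S) + 5 * unit_cost S) + 3 * unit_cost S"
| "tb (Rec n d e) a S = tb d a S + 2 * unit_cost ((vb d a + 2) * S) + tb n a S +
     2 * unit_cost ((vb n a + 1) * S) +
     S * (tb e (a + 2) S + 2 * unit_cost ((vb e (a + 2) + 2) * S) + 2 * unit_cost (2 * S) +
       5 * unit_cost S) + 3 * unit_cost S"
| "tb (Pow2 e) a S = tb e a S + 2 * unit_cost ((vb e a + 1) * S) + unit_cost S +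
     S * (unit_cost S + 5 * unit_cost S) + 3 * unit_cost S"
| "tb (Call f es) a S = sum_list (map (\<lambda>e. tb e a S) es) +
     tb f (sum_list (map (\<lambda>e. vb e a) es)) S +
     2 * unit_cost (vb f (sum_list (map (\<lambda>e. vb e a) es)) * S)"

lemma position_free_copy [simp]: "position_free (copy t r)"
  unfolding copy_def by (intro position_free_seq) auto

lemma position_free_clamp [simp]: "position_free (clamp t g)"
  unfolding clamp_def by (intro position_free_seq) auto

lemma position_free_seq_args:
  "(\<And>c t. c \<in> set cs \<Longrightarrow> position_free (c rs t)) \<Longrightarrow> position_free (seq_args cs rs t)"
  by (induction cs arbitrary: t) auto

lemma position_free_comp [simp]: "position_free (comp e rs t)"
proof (induction e arbitrary: rs t)
  case (Call f es)
  then have "position_free (seq_args (map comp es) rs (t + 1))"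
    by (intro position_free_seq_args) auto
  then show ?case using Call by (auto intro!: position_free_seq)
qed (auto intro!: position_free_seq position_free_for_loop)

lemma less_pow2_mono: "(x::nat) < 2 ^ a \<Longrightarrow> a \<le> b \<Longrightarrow> x < 2 ^ b"
  by (erule order.strict_trans2) (rule power_increasing, auto)

lemma le_pow2_less: "(x::nat) \<le> 2 ^ a \<Longrightarrow> a < b \<Longrightarrow> x < 2 ^ b"
  by (erule order.strict_trans1) (rule power_strict_increasing, auto)

lemma sum_less_pow2:
  fixes n :: nat
  assumes "\<And>i. i < n \<Longrightarrow> f i < 2 ^ a" "n < 2 ^ b"
  shows "(\<Sum>i<n. f i :: nat) < 2 ^ (a + b)"
proof -
  have "(\<Sum>i<n. f i) \<le> (\<Sum>i<n. 2 ^ a)"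
    using assms(1) by (intro sum_mono) (auto simp: less_imp_le)
  also have "\<dots> < 2 ^ (a + b)"
    using assms(2) by (simp add: power_add)
  finally show ?thesis .
qed

lemma rec_nat_min_le: "rec_nat (min x b) (\<lambda>i x. min (f i x) b) n \<le> (b::nat)"
  by (cases n) auto

text \<open>Bit lengths are measured in multiples of \<open>S\<close>. The multiplier depends on the
  expression and on the bound \<open>a\<close> for the environment, never on \<open>S\<close>; this
  is the reason why costs are polynomial in \<open>S\<close>.\<close>

lemma eval_less:
  assumes S: "1 \<le> S" and \<mu>: "\<And>x. x \<le> S \<Longrightarrow> \<mu> x < 2 ^ S"
  shows "(\<And>v. v \<in> set \<rho> \<Longrightarrow> v < 2 ^ (a * S)) \<Longrightarrow> eval S \<mu> e \<rho> < 2 ^ (vb e a * S)"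
proof (induction e arbitrary: a \<rho>)
  case (Num c)
  have "c < 2 ^ c" by simp
  also have "\<dots> \<le> 2 ^ (c * S)" using S by (intro power_increasing) auto
  finally show ?case by simp
next
  case (Var i)
  then show ?case by auto
next
  case (Inp e)
  show ?case using \<mu>[of "min (eval S \<mu> e \<rho>) S"] by simp
next
  case (Op f d e)
  have "apply_op f (eval S \<mu> d \<rho>) (eval S \<mu> e \<rho>) < 2 ^ (vb d a * S + vb e a * S + 1)"
    using Op by (intro apply_op_less) auto
  then show ?case using S unfolding eval.simps
    by (elim less_pow2_mono) (simp add: algebra_simps)
next
  case (Sum d e)
  have "eval S \<mu> e (\<rho> @ [i]) < 2 ^ (vb e (a + 1) * S)" if "i < S" for i
  proof (rule Sum.IH(2))
    fix v assume "v \<in> set (\<rho> @ [i])"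
    then consider "v \<in> set \<rho>" | "v = i" by auto
    then show "v < 2 ^ ((a + 1) * S)"
    proof cases
      case 1
      then show ?thesis using Sum.prems less_pow2_mono[of v "a * S" "(a + 1) * S"] by auto
    next
      case 2
      have "i < 2 ^ S" using that by (meson less_exp less_trans)
      then show ?thesis using 2 less_pow2_mono[of v S "(a + 1) * S"] by auto
    qed
  qed
  moreover have "min (eval S \<mu> d \<rho>) S < 2 ^ S"
    by (meson less_exp le_less_trans min.cobounded2)
  ultimately show ?case
    using sum_less_pow2[of "min (eval S \<mu> d \<rho>) S" "\<lambda>i. eval S \<mu> e (\<rho> @ [i])" "vb e (a + 1) * S" S]
    by (simp add: algebra_simps)
next
  case (Rec n d e)
  \<comment> \<open>The accumulator may equal \<open>2 ^ S\<close>, so a strict bound needs the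
    multiplier 2.\<close>
  have "eval S \<mu> (Rec n d e) \<rho> \<le> 2 ^ S"
    using rec_nat_min_le by simp
  then show ?case using S by (auto intro!: le_pow2_less)
next
  case (Pow2 e)
  have "(2::nat) ^ min (eval S \<mu> e \<rho>) S \<le> 2 ^ S" by (rule power_increasing) auto
  then show ?case using S by (auto intro!: le_pow2_less)
next
  case (Call f es)
  show ?case
    unfolding eval.simps vb.simps
  proof (rule Call.IH(1))
    fix v assume "v \<in> set (map (\<lambda>e. eval S \<mu> e \<rho>) es)"
    then obtain e where e: "e \<in> set es" "v = eval S \<mu> e \<rho>" by auto
    then have "v < 2 ^ (vb e a * S)" using Call by auto
    moreover have "vb e a \<le> sum_list (map (\<lambda>e. vb e a) es)"
      using e by (intro member_le_sum_list) auto
    ultimately show "v < 2 ^ (sum_list (map (\<lambda>e. vb e a) es) * S)"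
      by (elim less_pow2_mono) (rule mult_right_mono, auto)
  qed
qed

subsection \<open>Correctness of the compilation\<close>

text \<open>Memory and the registers below \<open>t\<close> come back unchanged. The registers from
  \<open>t\<close> on thus form a stack: intermediate results stay valid while later subexpressions
  are evaluated above them.\<close>

definition compiles :: "nat \<Rightarrow> (nat \<Rightarrow> nat) \<Rightarrow> ex \<Rightarrow> bool" where
  "compiles S \<mu> e \<longleftrightarrow> (\<forall>\<rho> rs t R M a. (\<forall>r\<in>set rs. r < t) \<longrightarrow> 2 < t \<longrightarrow> R 1 = S \<longrightarrow> R 2 = 2 ^ S \<longrightarrow>
     (\<forall>x\<le>S. M x = \<mu> x) \<longrightarrow> map R rs = \<rho> \<longrightarrow> (\<forall>v\<in>set \<rho>. v < 2 ^ (a * S)) \<longrightarrow>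
     (\<exists>R'. runs (comp e rs t) (R, M) (tb e a S) (R', M) \<and> R' t = eval S \<mu> e \<rho> \<and>
        (\<forall>r<t. R' r = R r)))"

lemma compilesD:
  assumes "compiles S \<mu> e" "\<And>r. r \<in> set rs \<Longrightarrow> r < t" "2 < t" "R 1 = S" "R 2 = 2 ^ S"
    "\<And>x. x \<le> S \<Longrightarrow> M x = \<mu> x" "map R rs = \<rho>" "\<And>v. v \<in> set \<rho> \<Longrightarrow> v < 2 ^ (a * S)"
  obtains R' where "runs (comp e rs t) (R, M) (tb e a S) (R', M)" "R' t = eval S \<mu> e \<rho>"
    "\<And>r. r < t \<Longrightarrow> R' r = R r"
  using assms unfolding compiles_def by metis

lemma runs_seq_args:
  assumes "\<And>e. e \<in> set es \<Longrightarrow> compiles S \<mu> e"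
    and "\<And>r. r \<in> set rs \<Longrightarrow> r < t" "2 < t" "R 1 = S" "R 2 = 2 ^ S"
    and "\<And>x. x \<le> S \<Longrightarrow> M x = \<mu> x" "map R rs = \<rho>" "\<And>v. v \<in> set \<rho> \<Longrightarrow> v < 2 ^ (a * S)"
  shows "\<exists>R'. runs (seq_args (map comp es) rs t) (R, M) (sum_list (map (\<lambda>e. tb e a S) es)) (R', M) \<and>
    map R' [t..<t + length es] = map (\<lambda>e. eval S \<mu> e \<rho>) es \<and> (\<forall>r<t. R' r = R r)"
  using assms
proof (induction es arbitrary: t R)
  case Nil
  then show ?case by (auto intro!: exI[of _ R] runs_nop)
next
  case (Cons e es)
  obtain R1 where R1: "runs (comp e rs t) (R, M) (tb e a S) (R1, M)" "R1 t = eval S \<mu> e \<rho>"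
    "\<And>r. r < t \<Longrightarrow> R1 r = R r"
    by (rule compilesD[of S \<mu> e rs t R M \<rho> a]) (use Cons.prems in auto)
  have "\<exists>R'. runs (seq_args (map comp es) rs (t + 1)) (R1, M) (sum_list (map (\<lambda>e. tb e a S) es)) (R', M) \<and>
    map R' [t + 1..<t + 1 + length es] = map (\<lambda>e. eval S \<mu> e \<rho>) es \<and> (\<forall>r<t + 1. R' r = R1 r)"
    using Cons.prems R1(3) by (intro Cons.IH) (auto simp: less_Suc_eq)
  then obtain R' where R': "runs (seq_args (map comp es) rs (t + 1)) (R1, M)
      (sum_list (map (\<lambda>e. tb e a S) es)) (R', M)"
    "map R' [t + 1..<t + 1 + length es] = map (\<lambda>e. eval S \<mu> e \<rho>) es" "\<forall>r<t + 1. R' r = R1 r"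
    by blast
  have "[t..<t + length (e # es)] = t # [t + 1..<t + 1 + length es]"
    by (simp add: upt_conv_Cons del: upt_Suc)
  then have "map R' [t..<t + length (e # es)] = map (\<lambda>e. eval S \<mu> e \<rho>) (e # es)"
    using R' R1 by simp
  moreover have "runs (seq_args (map comp (e # es)) rs t) (R, M)
      (sum_list (map (\<lambda>e. tb e a S) (e # es))) (R', M)"
    using runs_seq[OF R1(1) R'(1)] by simp
  ultimately show ?case using R'(3) R1(3) by (metis less_SucI Suc_eq_plus1)
qed

lemma compiles_all:
  assumes S: "1 \<le> S" and \<mu>: "\<And>x. x \<le> S \<Longrightarrow> \<mu> x < 2 ^ S"
  shows "compiles S \<mu> e"
proof (induction e)
  case (Num c)
  have "c < 2 ^ c" by simp
  also have "\<dots> \<le> 2 ^ (c * S)" using S by (intro power_increasing) auto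
  finally have "c < 2 ^ (c * S)" .
  from runs_Const[OF this] show ?case
    unfolding compiles_def by (auto intro!: exI)
next
  case (Var i)
  show ?case
    unfolding compiles_def
  proof (intro allI impI)
    fix \<rho> rs t R M a
    assume A: "\<forall>r\<in>set rs. r < t" "2 < (t::nat)" "map R rs = \<rho>" "\<forall>v\<in>set \<rho>. v < (2::nat) ^ (a * S)"
    show "\<exists>R'. runs (comp (Var i) rs t) (R, M) (tb (Var i) a S) (R', M) \<and>
        R' t = eval S \<mu> (Var i) \<rho> \<and> (\<forall>r<t. R' r = R r)"
    proof (cases "i < length rs")
      case True
      then have "R (rs ! i) < 2 ^ (a * S)" "rs ! i \<noteq> t" "\<rho> ! i = R (rs ! i)" "length \<rho> = length rs"
        using A by auto
      with runs_copy[of R "rs ! i" "a * S" t M] True show ?thesis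
        by (auto intro!: exI[of _ "R(t := R (rs ! i))"])
    next
      case False
      have "runs (atom (Const t 0)) (R, M) (2 * unit_cost (a * S)) (R(t := 0), M)"
        by (rule runs_mono[OF runs_Const[of 0 "a * S"]]) auto
      with False A show ?thesis
        by (auto intro!: exI[of _ "R(t := 0)"])
    qed
  qed
next
  case (Inp e)
  show ?case
    unfolding compiles_def
  proof (intro allI impI)
    fix \<rho> rs t R M a
    assume A: "\<forall>r\<in>set rs. r < t" "2 < (t::nat)" "R 1 = S" "R 2 = 2 ^ S" "\<forall>x\<le>S. M x = \<mu> x"
      "map R rs = \<rho>" "\<forall>v\<in>set \<rho>. v < (2::nat) ^ (a * S)"
    obtain R1 where R1: "runs (comp e rs t) (R, M) (tb e a S) (R1, M)" "R1 t = eval S \<mu> e \<rho>"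
      "\<And>r. r < t \<Longrightarrow> R1 r = R r"
      by (rule compilesD[OF Inp, of rs t R M \<rho> a]) (use A in auto)
    let ?w = "(vb e a + 1) * S"
    let ?x = "min (R1 t) (R1 1)"
    let ?R2 = "R1(t + 1 := R1 t - R1 1, t := ?x)"
    have x: "?x = min (eval S \<mu> e \<rho>) S" using R1 A by simp
    have "R1 t < 2 ^ (vb e a * S)"
      unfolding R1(2) by (rule eval_less[OF S \<mu>]) (use A in auto)
    moreover have "S < 2 ^ S" by simp
    ultimately have w: "R1 t < 2 ^ ?w" "S < 2 ^ ?w"
      by (auto intro: less_pow2_mono[of _ S] less_pow2_mono[of _ "vb e a * S"])
    have r2: "runs (clamp t 1) (R1, M) (2 * unit_cost ?w) (?R2, M)"
      using w R1(3)[of 1] A by (intro runs_clamp) auto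
    have "M ?x < 2 ^ S" unfolding x using A \<mu>[of "min (eval S \<mu> e \<rho>) S"] by simp
    then have "M ?x < 2 ^ ?w" by (rule less_pow2_mono) simp
    then have r3: "runs (atom (Load t t)) (?R2, M) (unit_cost ?w) (?R2(t := M (?R2 t)), M)"
      using w A R1(3)[of 1] by (intro runs_Load) auto
    have "M ?x = \<mu> (min (eval S \<mu> e \<rho>) S)" using x A by simp
    then have "(?R2(t := M (?R2 t))) t = eval S \<mu> (Inp e) \<rho>" by simp
    moreover have "\<forall>r<t. (?R2(t := M (?R2 t))) r = R r" using R1(3) by simp
    moreover have "runs (comp (Inp e) rs t) (R, M) (tb (Inp e) a S) (?R2(t := M (?R2 t)), M)"
      unfolding comp.simps tb.simps by (rule runs_mono[OF runs_seq[OF R1(1) runs_seq[OF r2 r3]]]) simp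
    ultimately show "\<exists>R'. runs (comp (Inp e) rs t) (R, M) (tb (Inp e) a S) (R', M) \<and>
        R' t = eval S \<mu> (Inp e) \<rho> \<and> (\<forall>r<t. R' r = R r)" by blast
  qed
next
  case (Op f d e)
  show ?case
    unfolding compiles_def
  proof (intro allI impI)
    fix \<rho> rs t R M a
    assume A: "\<forall>r\<in>set rs. r < t" "2 < (t::nat)" "R 1 = S" "R 2 = 2 ^ S" "\<forall>x\<le>S. M x = \<mu> x"
      "map R rs = \<rho>" "\<forall>v\<in>set \<rho>. v < (2::nat) ^ (a * S)"
    obtain R1 where R1: "runs (comp d rs t) (R, M) (tb d a S) (R1, M)" "R1 t = eval S \<mu> d \<rho>"
      "\<And>r. r < t \<Longrightarrow> R1 r = R r"
      by (rule compilesD[OF Op(1), of rs t R M \<rho> a]) (use A in auto)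
    obtain R2 where R2: "runs (comp e rs (t + 1)) (R1, M) (tb e a S) (R2, M)"
      "R2 (t + 1) = eval S \<mu> e \<rho>" "\<And>r. r < t + 1 \<Longrightarrow> R2 r = R1 r"
      by (rule compilesD[OF Op(2), of rs "t + 1" R1 M \<rho> a]) (use A R1 in \<open>auto simp: less_Suc_eq\<close>)
    let ?w = "(vb d a + vb e a) * S"
    have "R2 t < 2 ^ (vb d a * S)"
      unfolding R2(3)[of t, simplified] R1(2) by (rule eval_less[OF S \<mu>]) (use A in auto)
    moreover have "R2 (t + 1) < 2 ^ (vb e a * S)"
      unfolding R2(2) by (rule eval_less[OF S \<mu>]) (use A in auto)
    ultimately have "R2 t < 2 ^ ?w" "R2 (t + 1) < 2 ^ ?w"
      by (auto elim!: less_pow2_mono simp: algebra_simps)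
    note r3 = runs_Arith[where R = R2 and x = t and y = "t + 1" and f = f and r = t and M = M, OF this]
    have "runs (comp (Op f d e) rs t) (R, M) (tb (Op f d e) a S)
        (R2(t := apply_op f (R2 t) (R2 (t + 1))), M)"
      unfolding comp.simps tb.simps by (rule runs_mono[OF runs_seq[OF R1(1) runs_seq[OF R2(1) r3]]]) simp
    then show "\<exists>R'. runs (comp (Op f d e) rs t) (R, M) (tb (Op f d e) a S) (R', M) \<and>
        R' t = eval S \<mu> (Op f d e) \<rho> \<and> (\<forall>r<t. R' r = R r)"
      using R1 R2 by (intro exI[of _ "R2(t := apply_op f (R2 t) (R2 (t + 1)))"]) auto
  qed
next
  case (Sum d e)
  show ?case
    unfolding compiles_def
  proof (intro allI impI)
    fix \<rho> rs t R M a
    assume A: "\<forall>r\<in>set rs. r < t" "2 < (t::nat)" "R 1 = S" "R 2 = 2 ^ S" "\<forall>x\<le>S. M x = \<mu> x"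
      "map R rs = \<rho>" "\<forall>v\<in>set \<rho>. v < (2::nat) ^ (a * S)"
    obtain R1 where R1: "runs (comp d rs (t + 1)) (R, M) (tb d a S) (R1, M)"
      "R1 (t + 1) = eval S \<mu> d \<rho>" "\<And>r. r < t + 1 \<Longrightarrow> R1 r = R r"
      by (rule compilesD[OF Sum(1), of rs "t + 1" R M \<rho> a]) (use A in auto)
    define n where "n = min (eval S \<mu> d \<rho>) S"
    let ?R2 = "R1(t + 2 := R1 (t + 1) - S, t + 1 := n)"
    let ?R3 = "?R2(t := 0)"
    have nS: "n \<le> S" by (simp add: n_def)
    then have n: "n < 2 ^ S" by (meson le_less_trans less_exp)
    have S2: "S < 2 ^ S" by simp
    have "R1 (t + 1) < 2 ^ (vb d a * S)"
      unfolding R1(2) by (rule eval_less[OF S \<mu>]) (use A in auto)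
    then have w: "R1 (t + 1) < 2 ^ ((vb d a + 1) * S)" "R1 1 < 2 ^ ((vb d a + 1) * S)"
      using S2 R1(3)[of 1] A
      by (auto intro: less_pow2_mono[of _ S] less_pow2_mono[of _ "vb d a * S"])
    have r2: "runs (clamp (t + 1) 1) (R1, M) (2 * unit_cost ((vb d a + 1) * S)) (?R2, M)"
      using runs_clamp[where R = R1 and t = "t + 1" and g = 1 and M = M, OF w] A R1(3)[of 1] R1(2) by (simp add: n_def)
    have r3: "runs (atom (Const t 0)) (?R2, M) (unit_cost 0) (?R3, M)"
      by (rule runs_Const) simp
    let ?body = "comp e (rs @ [t + 2]) (t + 4) ;; atom (Arith Add t t (t + 4))"
    let ?w = "(vb e (a + 1) + 1) * S"
    let ?I = "\<lambda>j Q N. N = M \<and> (\<forall>r<t. Q r = R r) \<and> Q t = (\<Sum>i<j. eval S \<mu> e (\<rho> @ [i]))"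
    have summand: "eval S \<mu> e (\<rho> @ [i]) < 2 ^ (vb e (a + 1) * S)" if "i < n" for i
    proof (rule eval_less[OF S \<mu>])
      fix v assume "v \<in> set (\<rho> @ [i])"
      then consider "v \<in> set \<rho>" | "v = i" by auto
      then show "v < 2 ^ ((a + 1) * S)"
        using A that n less_pow2_mono[of v S "(a + 1) * S"] less_pow2_mono[of v "a * S" "(a + 1) * S"]
        by cases auto
    qed
    have "\<exists>R' M'. runs (for_loop (t + 2) (t + 1) (t + 3) ?body) (?R3, M)
        (n * (tb e (a + 1) S + unit_cost ?w + 5 * unit_cost S) + 3 * unit_cost S) (R', M') \<and> ?I n R' M'"
    proof (rule runs_for_loop)
      fix j Q N
      assume J: "j < n" "?I j Q N" "Q (t + 2) = j" "Q (t + 1) = n"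
      let ?Q = "Q(t + 3 := n - j)"
      have env: "v < 2 ^ ((a + 1) * S)" if "v \<in> set (\<rho> @ [j])" for v
      proof -
        from that consider "v \<in> set \<rho>" | "v = j" by auto
        then show ?thesis
          using A J(1) n less_pow2_mono[of v S "(a + 1) * S"] less_pow2_mono[of v "a * S" "(a + 1) * S"]
          by cases auto
      qed
      have "map Q rs = \<rho>" using A J by auto
      moreover have "t + 3 \<notin> set rs" using A by force
      ultimately have mapQ: "map ?Q (rs @ [t + 2]) = \<rho> @ [j]"
        using J by simp
      obtain Q1 where Q1: "runs (comp e (rs @ [t + 2]) (t + 4)) (?Q, M) (tb e (a + 1) S) (Q1, M)"
        "Q1 (t + 4) = eval S \<mu> e (\<rho> @ [j])" "\<And>r. r < t + 4 \<Longrightarrow> Q1 r = ?Q r"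
        by (rule compilesD[OF Sum(2), of "rs @ [t + 2]" "t + 4" ?Q M "\<rho> @ [j]" "a + 1"])
          (rule mapQ | use A J env in force)+
      have "Q1 t = (\<Sum>i<j. eval S \<mu> e (\<rho> @ [i]))" using Q1(3)[of t] J by simp
      moreover have "(\<Sum>i<j. eval S \<mu> e (\<rho> @ [i])) < 2 ^ (vb e (a + 1) * S + S)"
        using summand J n by (intro sum_less_pow2) auto
      ultimately have "Q1 t < 2 ^ ?w" "Q1 (t + 4) < 2 ^ ?w"
        using Q1(2) summand[OF J(1)] by (auto simp: algebra_simps intro: less_pow2_mono[of _ "vb e (a + 1) * S"])
      note r = runs_Arith[where R = Q1 and x = t and y = "t + 4" and f = Add and r = t and M = M, OF this]
      show "\<exists>R' M'. runs ?body (Q(t + 3 := n - j), N) (tb e (a + 1) S + unit_cost ?w) (R', M') \<and>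
          R' (t + 2) = j \<and> R' (t + 1) = n \<and> ?I (Suc j) (R'(t + 3 := 1, t + 2 := Suc j)) M'"
        using runs_seq[OF Q1(1) r] J Q1
        by (intro exI[of _ "Q1(t := apply_op Add (Q1 t) (Q1 (t + 4)))"] exI[of _ M]) auto
    qed (use n R1 A in \<open>auto intro!: position_free_seq\<close>)
    then obtain R' M' where F: "runs (for_loop (t + 2) (t + 1) (t + 3) ?body) (?R3, M)
        (n * (tb e (a + 1) S + unit_cost ?w + 5 * unit_cost S) + 3 * unit_cost S) (R', M')" "?I n R' M'"
      by blast
    have "n * (tb e (a + 1) S + unit_cost ?w + 5 * unit_cost S) \<le>
        S * (tb e (a + 1) S + unit_cost ?w + 5 * unit_cost S)"
      using nS by (rule mult_right_mono) simp
    then have "runs (comp (Sum d e) rs t) (R, M) (tb (Sum d e) a S) (R', M')"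
      unfolding comp.simps tb.simps
      by (intro runs_mono[OF runs_seq[OF R1(1) runs_seq[OF r2 runs_seq[OF r3 F(1)]]]]) linarith
    with F(2) show "\<exists>R'. runs (comp (Sum d e) rs t) (R, M) (tb (Sum d e) a S) (R', M) \<and>
        R' t = eval S \<mu> (Sum d e) \<rho> \<and> (\<forall>r<t. R' r = R r)"
      by (auto simp: n_def)
  qed
next
  case (Rec k d e)
  show ?case
    unfolding compiles_def
  proof (intro allI impI)
    fix \<rho> rs t R M a
    assume A: "\<forall>r\<in>set rs. r < t" "2 < (t::nat)" "R 1 = S" "R 2 = 2 ^ S" "\<forall>x\<le>S. M x = \<mu> x"
      "map R rs = \<rho>" "\<forall>v\<in>set \<rho>. v < (2::nat) ^ (a * S)"
    obtain R0 where R0: "runs (comp d rs t) (R, M) (tb d a S) (R0, M)"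
      "R0 t = eval S \<mu> d \<rho>" "\<And>r. r < t \<Longrightarrow> R0 r = R r"
      by (rule compilesD[OF Rec(2), of rs t R M \<rho> a]) (use A in auto)
    let ?R0 = "R0(t + 1 := R0 t - 2 ^ S, t := min (eval S \<mu> d \<rho>) (2 ^ S))"
    have S2: "S < 2 ^ S" by simp
    have B: "(2::nat) ^ S < 2 ^ (c + 2 * S)" for c
      using S by (intro power_strict_increasing) auto
    have "R0 t < 2 ^ (vb d a * S)"
      unfolding R0(2) by (rule eval_less[OF S \<mu>]) (use A in auto)
    then have w0: "R0 t < 2 ^ ((vb d a + 2) * S)" "R0 2 < 2 ^ ((vb d a + 2) * S)"
      using R0(3)[of 2] A B[of "vb d a * S"]
      by (auto intro: less_pow2_mono[of _ "vb d a * S"] simp: algebra_simps)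
    have r0: "runs (clamp t 2) (R0, M) (2 * unit_cost ((vb d a + 2) * S)) (?R0, M)"
      using runs_clamp[where R = R0 and t = t and g = 2 and M = M, OF w0] A R0(3)[of 2] R0(2) by simp
    have "t \<notin> set rs" "t + 1 \<notin> set rs" using A by force+
    then have mapR: "map ?R0 rs = \<rho>" using A R0(3) by auto
    obtain R1 where R1: "runs (comp k rs (t + 1)) (?R0, M) (tb k a S) (R1, M)"
      "R1 (t + 1) = eval S \<mu> k \<rho>" "\<And>r. r < t + 1 \<Longrightarrow> R1 r = ?R0 r"
      by (rule compilesD[OF Rec(1), of rs "t + 1" ?R0 M \<rho> a])
        (rule mapR | use A R0(3) in force)+
    define n where "n = min (eval S \<mu> k \<rho>) S"
    let ?R2 = "R1(t + 2 := R1 (t + 1) - S, t + 1 := n)"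
    have nS: "n \<le> S" by (simp add: n_def)
    then have n: "n < 2 ^ S" by (meson le_less_trans less_exp)
    have R11: "R1 1 = S" using R1(3)[of 1] R0(3)[of 1] A by simp
    have "R1 (t + 1) < 2 ^ (vb k a * S)"
      unfolding R1(2) by (rule eval_less[OF S \<mu>]) (use A in auto)
    then have w: "R1 (t + 1) < 2 ^ ((vb k a + 1) * S)" "R1 1 < 2 ^ ((vb k a + 1) * S)"
      using S2 R11 by (auto intro: less_pow2_mono[of _ S] less_pow2_mono[of _ "vb k a * S"])
    have r2: "runs (clamp (t + 1) 1) (R1, M) (2 * unit_cost ((vb k a + 1) * S)) (?R2, M)"
      using runs_clamp[where R = R1 and t = "t + 1" and g = 1 and M = M, OF w] A R11 R1(2) by (simp add: n_def)
    let ?body = "comp e (rs @ [t + 2, t]) (t + 4) ;; clamp (t + 4) 2 ;; copy t (t + 4)"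
    let ?w = "(vb e (a + 2) + 2) * S"
    let ?C = "tb e (a + 2) S + (2 * unit_cost ?w + 2 * unit_cost (2 * S))"
    define F where "F = rec_nat (min (eval S \<mu> d \<rho>) (2 ^ S)) (\<lambda>i x. min (eval S \<mu> e (\<rho> @ [i, x])) (2 ^ S))"
    let ?I = "\<lambda>j Q N. N = M \<and> (\<forall>r<t. Q r = R r) \<and> Q t = F j"
    have F_le: "F j \<le> 2 ^ S" for j
      unfolding F_def by (rule rec_nat_min_le)
    have "\<exists>R' M'. runs (for_loop (t + 2) (t + 1) (t + 3) ?body) (?R2, M)
        (n * (?C + 5 * unit_cost S) + 3 * unit_cost S) (R', M') \<and> ?I n R' M'"
    proof (rule runs_for_loop)
      fix j Q N
      assume J: "j < n" "?I j Q N" "Q (t + 2) = j" "Q (t + 1) = n"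
      let ?Q = "Q(t + 3 := n - j)"
      have env: "v < 2 ^ ((a + 2) * S)" if "v \<in> set (\<rho> @ [j, F j])" for v
      proof -
        from that consider "v \<in> set \<rho>" | "v = j" | "v = F j" by auto
        then show ?thesis
        proof cases
          case 1
          then show ?thesis using A less_pow2_mono[of v "a * S" "(a + 2) * S"] by auto
        next
          case 2
          then show ?thesis using J(1) n less_pow2_mono[of v S "(a + 2) * S"] by auto
        next
          case 3
          then show ?thesis
            using le_less_trans[OF F_le[of j] B[of "a * S"]] by (simp only: add_mult_distrib)
        qed
      qed
      have "map Q rs = \<rho>" using A J by auto
      moreover have "t + 3 \<notin> set rs" using A by force
      ultimately have mapQ: "map ?Q (rs @ [t + 2, t]) = \<rho> @ [j, F j]"
        using J by simp
      obtain Q1 where Q1: "runs (comp e (rs @ [t + 2, t]) (t + 4)) (?Q, M) (tb e (a + 2) S) (Q1, M)"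
        "Q1 (t + 4) = eval S \<mu> e (\<rho> @ [j, F j])" "\<And>r. r < t + 4 \<Longrightarrow> Q1 r = ?Q r"
        by (rule compilesD[OF Rec(3), of "rs @ [t + 2, t]" "t + 4" ?Q M "\<rho> @ [j, F j]" "a + 2"])
          (rule mapQ | use A J env in force)+
      let ?Q2 = "Q1(t + 5 := Q1 (t + 4) - 2 ^ S, t + 4 := min (Q1 (t + 4)) (2 ^ S))"
      have Q12: "Q1 2 = 2 ^ S" using Q1(3)[of 2] J A by simp
      have "Q1 (t + 4) < 2 ^ (vb e (a + 2) * S)"
        unfolding Q1(2) by (rule eval_less[OF S \<mu>]) (use env in blast)+
      then have w2: "Q1 (t + 4) < 2 ^ ?w" "Q1 2 < 2 ^ ?w"
        using Q12 B[of "vb e (a + 2) * S"]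
        by (auto intro: less_pow2_mono[of _ "vb e (a + 2) * S"] simp: algebra_simps)
      have c1: "runs (clamp (t + 4) 2) (Q1, M) (2 * unit_cost ?w) (?Q2, M)"
        using runs_clamp[where R = Q1 and t = "t + 4" and g = 2 and M = M, OF w2] Q12 by (simp add: eval_nat_numeral)
      have c2: "runs (copy t (t + 4)) (?Q2, M) (2 * unit_cost (2 * S)) (?Q2(t := ?Q2 (t + 4)), M)"
        using le_less_trans[OF min.cobounded2 B[of 0]] by (intro runs_copy) auto
      show "\<exists>R' M'. runs ?body (Q(t + 3 := n - j), N) ?C (R', M') \<and>
          R' (t + 2) = j \<and> R' (t + 1) = n \<and> ?I (Suc j) (R'(t + 3 := 1, t + 2 := Suc j)) M'"
        using runs_seq[OF Q1(1) runs_seq[OF c1 c2]] J Q1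
        by (intro exI[of _ "?Q2(t := ?Q2 (t + 4))"] exI[of _ M]) (auto simp: F_def)
    qed (use n R1 R0 A in \<open>auto intro!: position_free_seq simp: F_def\<close>)
    then obtain R' M' where Z: "runs (for_loop (t + 2) (t + 1) (t + 3) ?body) (?R2, M)
        (n * (?C + 5 * unit_cost S) + 3 * unit_cost S) (R', M')" "?I n R' M'"
      by blast
    have "n * (?C + 5 * unit_cost S) \<le> S * (?C + 5 * unit_cost S)"
      using nS by (rule mult_right_mono) simp
    then have "runs (comp (Rec k d e) rs t) (R, M) (tb (Rec k d e) a S) (R', M')"
      unfolding comp.simps tb.simps
      by (intro runs_mono[OF runs_seq[OF R0(1) runs_seq[OF r0 runs_seq[OF R1(1) runs_seq[OF r2 Z(1)]]]]])
        (simp add: algebra_simps)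
    with Z(2) show "\<exists>R'. runs (comp (Rec k d e) rs t) (R, M) (tb (Rec k d e) a S) (R', M) \<and>
        R' t = eval S \<mu> (Rec k d e) \<rho> \<and> (\<forall>r<t. R' r = R r)"
      by (auto simp: n_def F_def)
  qed
next
  case (Pow2 e)
  show ?case
    unfolding compiles_def
  proof (intro allI impI)
    fix \<rho> rs t R M a
    assume A: "\<forall>r\<in>set rs. r < t" "2 < (t::nat)" "R 1 = S" "R 2 = 2 ^ S" "\<forall>x\<le>S. M x = \<mu> x"
      "map R rs = \<rho>" "\<forall>v\<in>set \<rho>. v < (2::nat) ^ (a * S)"
    obtain R1 where R1: "runs (comp e rs (t + 1)) (R, M) (tb e a S) (R1, M)"
      "R1 (t + 1) = eval S \<mu> e \<rho>" "\<And>r. r < t + 1 \<Longrightarrow> R1 r = R r"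
      by (rule compilesD[OF Pow2, of rs "t + 1" R M \<rho> a]) (use A in auto)
    define n where "n = min (eval S \<mu> e \<rho>) S"
    let ?R2 = "R1(t + 2 := R1 (t + 1) - S, t + 1 := n)"
    let ?R3 = "?R2(t := 1)"
    have nS: "n \<le> S" by (simp add: n_def)
    then have n: "n < 2 ^ S" by (meson le_less_trans less_exp)
    have S2: "S < 2 ^ S" by simp
    have "R1 (t + 1) < 2 ^ (vb e a * S)"
      unfolding R1(2) by (rule eval_less[OF S \<mu>]) (use A in auto)
    then have w: "R1 (t + 1) < 2 ^ ((vb e a + 1) * S)" "R1 1 < 2 ^ ((vb e a + 1) * S)"
      using S2 R1(3)[of 1] A
      by (auto intro: less_pow2_mono[of _ S] less_pow2_mono[of _ "vb e a * S"])
    have r2: "runs (clamp (t + 1) 1) (R1, M) (2 * unit_cost ((vb e a + 1) * S)) (?R2, M)"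
      using runs_clamp[where R = R1 and t = "t + 1" and g = 1 and M = M, OF w] A R1(3)[of 1] R1(2) by (simp add: n_def)
    have r3: "runs (atom (Const t 1)) (?R2, M) (unit_cost S) (?R3, M)"
      using S one_less_power[of "2::nat" S] by (intro runs_Const) auto
    let ?I = "\<lambda>j Q N. N = M \<and> (\<forall>r<t. Q r = R r) \<and> Q t = 2 ^ j"
    have "\<exists>R' M'. runs (for_loop (t + 2) (t + 1) (t + 3) (atom (Arith Add t t t))) (?R3, M)
        (n * (unit_cost S + 5 * unit_cost S) + 3 * unit_cost S) (R', M') \<and> ?I n R' M'"
    proof (rule runs_for_loop)
      fix j Q N
      assume J: "j < n" "?I j Q N" "Q (t + 2) = j" "Q (t + 1) = n"
      have "Q t < 2 ^ S" using J nS by (auto intro!: power_strict_increasing)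
      then have "(Q(t + 3 := n - j)) t < 2 ^ S" by simp
      from runs_Arith[where R = "Q(t + 3 := n - j)" and x = t and y = t and f = Add and r = t and M = M, OF this this] J
      show "\<exists>R' M'. runs (atom (Arith Add t t t)) (Q(t + 3 := n - j), N) (unit_cost S) (R', M') \<and>
          R' (t + 2) = j \<and> R' (t + 1) = n \<and> ?I (Suc j) (R'(t + 3 := 1, t + 2 := Suc j)) M'"
        by (intro exI[of _ "Q(t + 3 := n - j, t := Q t + Q t)"] exI[of _ M]) auto
    qed (use n R1 A in auto)
    then obtain R' M' where F: "runs (for_loop (t + 2) (t + 1) (t + 3) (atom (Arith Add t t t))) (?R3, M)
        (n * (unit_cost S + 5 * unit_cost S) + 3 * unit_cost S) (R', M')" "?I n R' M'"
      by blast
    have "n * (unit_cost S + 5 * unit_cost S) \<le> S * (unit_cost S + 5 * unit_cost S)"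
      using nS by (rule mult_right_mono) simp
    then have "runs (comp (Pow2 e) rs t) (R, M) (tb (Pow2 e) a S) (R', M')"
      unfolding comp.simps tb.simps
      by (intro runs_mono[OF runs_seq[OF R1(1) runs_seq[OF r2 runs_seq[OF r3 F(1)]]]]) linarith
    with F(2) show "\<exists>R'. runs (comp (Pow2 e) rs t) (R, M) (tb (Pow2 e) a S) (R', M) \<and>
        R' t = eval S \<mu> (Pow2 e) \<rho> \<and> (\<forall>r<t. R' r = R r)"
      by (auto simp: n_def)
  qed
next
  case (Call f es)
  show ?case
    unfolding compiles_def
  proof (intro allI impI)
    fix \<rho> rs t R M a
    assume A: "\<forall>r\<in>set rs. r < t" "2 < (t::nat)" "R 1 = S" "R 2 = 2 ^ S" "\<forall>x\<le>S. M x = \<mu> x"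
      "map R rs = \<rho>" "\<forall>v\<in>set \<rho>. v < (2::nat) ^ (a * S)"
    let ?m = "length es" and ?b = "sum_list (map (\<lambda>e. vb e a) es)"
    let ?vs = "map (\<lambda>e. eval S \<mu> e \<rho>) es"
    have "\<exists>R'. runs (seq_args (map comp es) rs (t + 1)) (R, M) (sum_list (map (\<lambda>e. tb e a S) es)) (R', M) \<and>
        map R' [t + 1..<t + 1 + ?m] = ?vs \<and> (\<forall>r<t + 1. R' r = R r)"
      by (rule runs_seq_args) (use A Call in auto)
    then obtain R1 where R1: "runs (seq_args (map comp es) rs (t + 1)) (R, M)
          (sum_list (map (\<lambda>e. tb e a S) es)) (R1, M)"
        "map R1 [t + 1..<t + 1 + ?m] = ?vs" "\<And>r. r < t + 1 \<Longrightarrow> R1 r = R r"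
      by blast
    have env: "v < 2 ^ (?b * S)" if v: "v \<in> set ?vs" for v
    proof -
      obtain e where e: "e \<in> set es" "v = eval S \<mu> e \<rho>" using v by auto
      have "v < 2 ^ (vb e a * S)" unfolding e(2) by (rule eval_less[OF S \<mu>]) (use A in auto)
      moreover have "vb e a \<le> ?b"
        using e by (intro member_le_sum_list) auto
      ultimately show ?thesis by (elim less_pow2_mono) (rule mult_right_mono, auto)
    qed
    obtain R2 where R2: "runs (comp f [t + 1..<t + 1 + ?m] (t + 1 + ?m)) (R1, M) (tb f ?b S) (R2, M)"
      "R2 (t + 1 + ?m) = eval S \<mu> f ?vs" "\<And>r. r < t + 1 + ?m \<Longrightarrow> R2 r = R1 r"
      by (rule compilesD[OF Call(1), of "[t + 1..<t + 1 + ?m]" "t + 1 + ?m" R1 M ?vs ?b])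
        (use A R1 env in auto)
    have "R2 (t + 1 + ?m) < 2 ^ (vb f ?b * S)"
      unfolding R2(2) by (rule eval_less[OF S \<mu>]) (use env in blast)+
    then have r3: "runs (copy t (t + 1 + ?m)) (R2, M) (2 * unit_cost (vb f ?b * S))
        (R2(t := R2 (t + 1 + ?m)), M)"
      by (intro runs_copy) auto
    have "runs (comp (Call f es) rs t) (R, M) (tb (Call f es) a S) (R2(t := R2 (t + 1 + ?m)), M)"
      unfolding comp.simps tb.simps by (rule runs_mono[OF runs_seq[OF R1(1) runs_seq[OF R2(1) r3]]]) simp
    then show "\<exists>R'. runs (comp (Call f es) rs t) (R, M) (tb (Call f es) a S) (R', M) \<and>
        R' t = eval S \<mu> (Call f es) \<rho> \<and> (\<forall>r<t. R' r = R r)"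
      using R1(3) R2(2,3) by (intro exI[of _ "R2(t := R2 (t + 1 + ?m))"]) auto
  qed
qed

subsection \<open>Polynomial bounds\<close>

definition poly_bdd :: "(nat \<Rightarrow> nat) \<Rightarrow> bool" where
  "poly_bdd f \<longleftrightarrow> (\<exists>C. \<forall>S\<ge>1. f S \<le> C * S ^ C)"

lemma poly_bddI: "(\<And>S. 1 \<le> S \<Longrightarrow> f S \<le> C * S ^ D) \<Longrightarrow> poly_bdd f"
  unfolding poly_bdd_def
proof (intro exI[of _ "C + D"] allI impI)
  fix S :: nat assume a: "\<And>S. 1 \<le> S \<Longrightarrow> f S \<le> C * S ^ D" "1 \<le> S"
  have "f S \<le> C * S ^ D" using a by simp
  also have "\<dots> \<le> (C + D) * S ^ (C + D)" using a(2) by (intro mult_mono power_increasing) auto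
  finally show "f S \<le> (C + D) * S ^ (C + D)" .
qed

lemma poly_bdd_const [intro, simp]: "poly_bdd (\<lambda>_. c)"
  by (rule poly_bddI[of _ c 0]) simp

lemma poly_bdd_id [intro, simp]: "poly_bdd (\<lambda>S. S)"
  by (rule poly_bddI[of _ 1 1]) simp

lemma poly_bdd_add [intro]:
  assumes "poly_bdd f" "poly_bdd g" shows "poly_bdd (\<lambda>S. f S + g S)"
proof -
  obtain C D where CD: "\<And>S. 1 \<le> S \<Longrightarrow> f S \<le> C * S ^ C" "\<And>S. 1 \<le> S \<Longrightarrow> g S \<le> D * S ^ D"
    using assms by (auto simp: poly_bdd_def)
  show ?thesis
  proof (rule poly_bddI)
    fix S :: nat assume S: "1 \<le> S"
    have "f S + g S \<le> C * S ^ (C + D) + D * S ^ (C + D)"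
      using S by (intro add_mono order.trans[OF CD(1)] order.trans[OF CD(2)] mult_left_mono power_increasing) auto
    then show "f S + g S \<le> (C + D) * S ^ (C + D)" by (simp add: algebra_simps)
  qed
qed

lemma poly_bdd_mult [intro]:
  assumes "poly_bdd f" "poly_bdd g" shows "poly_bdd (\<lambda>S. f S * g S)"
proof -
  obtain C D where CD: "\<And>S. 1 \<le> S \<Longrightarrow> f S \<le> C * S ^ C" "\<And>S. 1 \<le> S \<Longrightarrow> g S \<le> D * S ^ D"
    using assms by (auto simp: poly_bdd_def)
  show ?thesis
  proof (rule poly_bddI)
    fix S :: nat assume S: "1 \<le> S"
    have "f S * g S \<le> (C * S ^ C) * (D * S ^ D)"
      using S by (intro mult_mono CD) auto
    then show "f S * g S \<le> (C * D) * S ^ (C + D)" by (simp add: algebra_simps power_add)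
  qed
qed

lemma poly_bdd_power [intro]: "poly_bdd f \<Longrightarrow> poly_bdd (\<lambda>S. f S ^ c)"
  by (induction c) auto

lemma poly_bdd_mono: "poly_bdd g \<Longrightarrow> (\<And>S. f S \<le> g S) \<Longrightarrow> poly_bdd f"
  unfolding poly_bdd_def by (meson le_trans)

text \<open>The expression and \<open>a\<close> stay fixed while \<open>S\<close> grows:
  \<open>vb\<close> does not mention \<open>S\<close>, and \<open>S\<close> enters \<open>tb\<close>
  only through sums and products.\<close>

lemma poly_bdd_tb: "poly_bdd (tb e a)"
proof (induction e arbitrary: a)
  case (Call f es)
  have "poly_bdd (\<lambda>S. sum_list (map (\<lambda>e. tb e a S) es))"
    using Call(2) by (induction es) auto
  with Call(1) have "poly_bdd (\<lambda>S. tb (Call f es) a S)"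
    unfolding tb.simps by (intro poly_bdd_add poly_bdd_mult) auto
  then show ?case .
next
  case (Num c)
  have "poly_bdd (\<lambda>S. tb (Num c) a S)"
    unfolding tb.simps by (intro poly_bdd_add poly_bdd_mult poly_bdd_const poly_bdd_id)
  then show ?case .
next
  case (Var i)
  have "poly_bdd (\<lambda>S. tb (Var i) a S)"
    unfolding tb.simps by (intro poly_bdd_add poly_bdd_mult poly_bdd_const poly_bdd_id)
  then show ?case .
next
  case (Inp e)
  then have "poly_bdd (\<lambda>S. tb (Inp e) a S)"
    unfolding tb.simps by (intro poly_bdd_add poly_bdd_mult poly_bdd_const poly_bdd_id)
  then show ?case .
next
  case (Op f d e)
  then have "poly_bdd (\<lambda>S. tb (Op f d e) a S)"
    unfolding tb.simps by (intro poly_bdd_add poly_bdd_mult poly_bdd_const poly_bdd_id)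
  then show ?case .
next
  case (Sum d e)
  then have "poly_bdd (\<lambda>S. tb (Sum d e) a S)"
    unfolding tb.simps by (intro poly_bdd_add poly_bdd_mult poly_bdd_const poly_bdd_id)
  then show ?case .
next
  case (Rec n d e)
  then have "poly_bdd (\<lambda>S. tb (Rec n d e) a S)"
    unfolding tb.simps by (intro poly_bdd_add poly_bdd_mult poly_bdd_const poly_bdd_id)
  then show ?case .
next
  case (Pow2 e)
  then have "poly_bdd (\<lambda>S. tb (Pow2 e) a S)"
    unfolding tb.simps by (intro poly_bdd_add poly_bdd_mult poly_bdd_const poly_bdd_id)
  then show ?case .
qed

section \<open>Running a machine as a subroutine\<close>

lemma nth_concat_uniform:
  assumes "\<And>x. x \<in> set xs \<Longrightarrow> length (f x) = m" "i < length xs" "j < m"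
  shows "concat (map f xs) ! (i * m + j) = f (xs ! i) ! j"
  using assms
proof (induction xs arbitrary: i)
  case (Cons x xs)
  then show ?case
    by (cases i) (auto simp: nth_append add.assoc)
qed simp

lemma length_concat_uniform:
  "(\<And>x. x \<in> set xs \<Longrightarrow> length (f x) = m) \<Longrightarrow> length (concat (map f xs)) = length xs * m"
  by (induction xs) auto

text \<open>
  The registers of the subroutine are moved up by 12 and its memory cell \<open>a\<close> is kept at address
  \<open>b + a * Z\<close>, where registers 9 and 5 hold \<open>b\<close> and \<open>Z\<close>. Different values of \<open>b\<close> below \<open>Z\<close> (up to a
  common offset) give disjoint memories, so that no run has to clean up after itself.
\<close>

fun relocate :: "nat \<Rightarrow> nat \<Rightarrow> instr \<Rightarrow> instr list" where
  "relocate p n (Const r v) = [Const (12 + r) v, Const 8 0, Const 8 0]"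
| "relocate p n (Arith f r x y) = [Arith f (12 + r) (12 + x) (12 + y), Const 8 0, Const 8 0]"
| "relocate p n (Load r x) = [Arith Mult 8 (12 + x) 5, Arith Add 8 8 9, Load (12 + r) 8]"
| "relocate p n (Store r x) = [Arith Mult 8 (12 + r) 5, Arith Add 8 8 9, Store 8 (12 + x)]"
| "relocate p n (Jump l) = [Jump (p + 3 * min l n), Const 8 0, Const 8 0]"
| "relocate p n (JumpZero r l) = [JumpZero (12 + r) (p + 3 * min l n), Const 8 0, Const 8 0]"

text \<open>Every instruction is padded to three, so block \<open>j\<close> starts at
  \<open>p + 3 * j\<close>. Clipping the targets at the length of the program sends each halting
  jump to the first instruction after the embedded code.\<close>

definition embed :: "ram_program \<Rightarrow> code" where
  "embed P = (\<lambda>p. concat (map (relocate p (length P)) P))"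

fun uses_below :: "nat \<Rightarrow> instr \<Rightarrow> bool" where
  "uses_below m (Const r v) \<longleftrightarrow> r < m"
| "uses_below m (Arith f r x y) \<longleftrightarrow> r < m \<and> x < m \<and> y < m"
| "uses_below m (Load r x) \<longleftrightarrow> r < m \<and> x < m"
| "uses_below m (Store r x) \<longleftrightarrow> r < m \<and> x < m"
| "uses_below m (Jump l) \<longleftrightarrow> True"
| "uses_below m (JumpZero r l) \<longleftrightarrow> r < m"

lemma uses_below_mono: "uses_below m i \<Longrightarrow> m \<le> n \<Longrightarrow> uses_below n i"
  by (cases i) auto

text \<open>A program names finitely many registers, so straight-line code can clear them before
  each run; \<open>m > 0\<close> keeps the answer register among them.\<close>

lemma uses_below_exists: "\<exists>m>0. \<forall>i\<in>set P. uses_below m i"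
proof (induction P)
  case (Cons i P)
  then obtain m where m: "\<forall>i\<in>set P. uses_below m i" by auto
  obtain n where n: "uses_below n i"
  proof (cases i)
    case (Const r v) then show ?thesis using that[of "r + 1"] by simp
  next
    case (Arith f r x y) then show ?thesis using that[of "r + x + y + 1"] by simp
  next
    case (Load r x) then show ?thesis using that[of "r + x + 1"] by simp
  next
    case (Store r x) then show ?thesis using that[of "r + x + 1"] by simp
  next
    case (Jump l) then show ?thesis using that[of 1] by simp
  next
    case (JumpZero r l) then show ?thesis using that[of "r + 1"] by simp
  qed
  have "uses_below (m + n + 1) i" using n by (rule uses_below_mono) simp
  moreover have "\<forall>i\<in>set P. uses_below (m + n + 1) i" using m uses_below_mono[of m _ "m + n + 1"] by simp
  ultimately show ?case by (intro exI[of _ "m + n + 1"]) simp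
qed auto

lemma length_relocate [simp]: "length (relocate p n i) = 3"
  by (cases i) auto

lemma length_embed [simp]: "length (embed P p) = 3 * length P"
  unfolding embed_def by (subst length_concat_uniform[where m = 3]) auto

lemma position_free_embed [simp]: "position_free (embed P)"
  by (simp add: position_free_def)

lemma embed_at:
  assumes "code_at Q p (embed P p)" "j < length P"
  shows "code_at Q (p + 3 * j) (relocate p (length P) (P ! j))"
  unfolding code_at_def
proof (intro allI impI)
  fix i assume "i < length (relocate p (length P) (P ! j))"
  then have i: "i < 3" by simp
  have e: "embed P p ! (j * 3 + i) = relocate p (length P) (P ! j) ! i"
    unfolding embed_def using assms(2) i by (intro nth_concat_uniform) auto
  have "j * 3 + i < 3 * length P" using assms(2) i by simp
  then show "p + 3 * j + i < length Q \<and> Q ! (p + 3 * j + i) = relocate p (length P) (P ! j) ! i"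
    using assms(1) e unfolding code_at_def
    by (auto simp: algebra_simps dest!: spec[of _ "j * 3 + i"])
qed

definition simulates :: "nat \<Rightarrow> nat \<Rightarrow> nat \<Rightarrow> config \<Rightarrow> (nat \<Rightarrow> nat) \<Rightarrow> (nat \<Rightarrow> nat) \<Rightarrow> bool" where
  "simulates m b Z c R M \<longleftrightarrow> R 9 = b \<and> R 5 = Z \<and> (\<forall>r<m. R (12 + r) = reg c r) \<and>
     (\<forall>a. M (b + a * Z) = mem c a)"

text \<open>What a run leaves alone: the control registers except the scratch register 8, and all
  cells off its own progression. The input and the memories of the other queries are off that
  progression.\<close>

definition framed :: "nat \<Rightarrow> nat \<Rightarrow> state \<Rightarrow> state \<Rightarrow> bool" where
  "framed b Z s s' \<longleftrightarrow> (\<forall>r<12. r \<noteq> 8 \<longrightarrow> fst s' r = fst s r) \<and>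
     (\<forall>x. (\<forall>a. x \<noteq> b + a * Z) \<longrightarrow> snd s' x = snd s x)"

lemma floorlog_apply_op: "floorlog 2 (apply_op f x y) \<le> floorlog 2 x + floorlog 2 y + 1"
proof -
  have "z < 2 ^ floorlog 2 z" for z
    using floorlog_leD[of 2 z "floorlog 2 z"] by simp
  then show ?thesis
    by (intro floorlog_le_pow2 apply_op_less)
qed

text \<open>\<open>Load\<close> and \<open>Store\<close> pay in addition for computing
  \<open>b + a * Z\<close>, which is \<open>O(w)\<close> plus a multiple of the bits of the address.
  A step costs at least 1, so the additive \<open>8 * w\<close> can be absorbed into a
  factor.\<close>

lemma simulate_step:
  assumes sim: "simulates m b Z c R M" and Z: "0 < Z" and bits: "floorlog 2 Z \<le> w" "floorlog 2 b \<le> w"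
    and below: "\<forall>i\<in>set P. uses_below m i" and run: "\<not> halted P c"
  shows "\<exists>R' M'. simulates m b Z (step P c) R' M' \<and> framed b Z (R, M) (R', M') \<and>
    (\<forall>Q p. code_at Q p (embed P p) \<longrightarrow>
       reach Q (cfg (p + 3 * min (pc c) (length P)) (R, M)) ((8 * w + 14) * step_cost P c)
         (cfg (p + 3 * min (pc (step P c)) (length P)) (R', M')))"
proof -
  let ?n = "length P"
  define j where "j = pc c"
  have j: "j < ?n" using run by (simp add: halted_def j_def)
  have ub: "uses_below m (P ! j)" using below j by simp
  have R9: "R 9 = b" and R5: "R 5 = Z" and regs: "\<And>r. r < m \<Longrightarrow> R (12 + r) = reg c r"
    and mem: "\<And>a. M (b + a * Z) = mem c a"
    using sim by (auto simp: simulates_def)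
  have st: "step P c = exec_instr (P ! j) c" and sc: "step_cost P c = instr_cost (P ! j) c"
    using run by (auto simp: step_def step_cost_def j_def)
  have start: "p + 3 * min (pc c) ?n = p + 3 * j" for p :: nat
    using j by (simp add: j_def)
  have nxt: "p + 3 * min (Suc j) ?n = p + 3 * j + 3" for p :: nat
    using j by (simp add: min_def)
  have K: "(8 * w + 14) * x = 8 * w * x + 14 * x" for x :: nat
    by (simp add: algebra_simps)
  have le14: "14 * x \<le> (8 * w + 14) * x" for x :: nat by simp
  have wx: "8 * w \<le> 8 * w * (1 + x)" for x :: nat by simp
  have mult_fl: "floorlog 2 (x * Z) \<le> floorlog 2 x + w + 1" for x
    using floorlog_apply_op[of Mult x Z] bits by simp
  have add_fl: "floorlog 2 (x * Z + b) \<le> floorlog 2 x + 2 * w + 2" for x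
    using floorlog_apply_op[of Add "x * Z" b] mult_fl[of x] bits by simp
  show ?thesis
  proof (cases "P ! j")
    case (Const r v)
    let ?R = "R(12 + r := v, 8 := 0)"
    have "reach Q (cfg (p + 3 * j) (R, M)) ((8 * w + 14) * step_cost P c) (cfg (p + 3 * j + 3) (?R, M))"
      if "code_at Q p (embed P p)" for Q p
    proof -
      note code = embed_at[OF that j, unfolded Const, simplified]
      have r1: "reach Q (cfg (p + 3 * j) (R, M)) (1 + floorlog 2 v) (cfg (p + 3 * j + 1) (R(12 + r := v), M))"
        using code by (intro reach_step) (simp_all add: cfg_def)
      have r2: "reach Q (cfg (p + 3 * j + 1) (R(12 + r := v), M)) 1 (cfg (p + 3 * j + 2) (?R, M))"
        using code by (intro reach_step) (simp_all add: cfg_def)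
      have r3: "reach Q (cfg (p + 3 * j + 2) (?R, M)) 1 (cfg (p + 3 * j + 3) (?R, M))"
        using code by (intro reach_step) (simp_all add: cfg_def eval_nat_numeral)
      show ?thesis
        using le14[of "1 + floorlog 2 v"]
        by (intro reach_mono[OF reach_trans[OF r1 reach_trans[OF r2 r3]]])
          (simp add: sc Const algebra_simps)
    qed
    moreover have "simulates m b Z (step P c) ?R M" "framed b Z (R, M) (?R, M)"
      using R9 R5 regs mem by (auto simp: simulates_def framed_def st Const)
    moreover have "pc (step P c) = Suc j" by (simp add: st Const j_def[symmetric])
    ultimately show ?thesis unfolding start by (metis nxt)
  next
    case (Arith f r x y)
    let ?v = "apply_op f (R (12 + x)) (R (12 + y))"
    let ?R = "R(12 + r := ?v, 8 := 0)"
    have xy: "R (12 + x) = reg c x" "R (12 + y) = reg c y" using regs ub Arith by auto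
    have "reach Q (cfg (p + 3 * j) (R, M)) ((8 * w + 14) * step_cost P c) (cfg (p + 3 * j + 3) (?R, M))"
      if "code_at Q p (embed P p)" for Q p
    proof -
      note code = embed_at[OF that j, unfolded Arith, simplified]
      have r1: "reach Q (cfg (p + 3 * j) (R, M)) (step_cost P c) (cfg (p + 3 * j + 1) (R(12 + r := ?v), M))"
        using code by (intro reach_step) (simp_all add: cfg_def sc Arith xy)
      have r2: "reach Q (cfg (p + 3 * j + 1) (R(12 + r := ?v), M)) 1 (cfg (p + 3 * j + 2) (?R, M))"
        using code by (intro reach_step) (simp_all add: cfg_def)
      have r3: "reach Q (cfg (p + 3 * j + 2) (?R, M)) 1 (cfg (p + 3 * j + 3) (?R, M))"
        using code by (intro reach_step) (simp_all add: cfg_def eval_nat_numeral)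
      have "1 \<le> step_cost P c" by (simp add: sc Arith)
      then show ?thesis
        by (intro reach_mono[OF reach_trans[OF r1 reach_trans[OF r2 r3]]]) (simp add: K)
    qed
    moreover have "simulates m b Z (step P c) ?R M" "framed b Z (R, M) (?R, M)"
      using R9 R5 regs mem xy by (auto simp: simulates_def framed_def st Arith)
    moreover have "pc (step P c) = Suc j" by (simp add: st Arith j_def[symmetric])
    ultimately show ?thesis unfolding start by (metis nxt)
  next
    case (Load r x)
    let ?a = "R (12 + x)"
    let ?R1 = "R(8 := ?a * Z)" and ?R2 = "R(8 := ?a * Z + b)"
    let ?R = "R(8 := ?a * Z + b, 12 + r := M (?a * Z + b))"
    have x: "?a = reg c x" using regs ub Load by auto
    have Mx: "M (?a * Z + b) = mem c (reg c x)" using mem[of ?a] x by (simp add: add.commute)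
    have "reach Q (cfg (p + 3 * j) (R, M)) ((8 * w + 14) * step_cost P c) (cfg (p + 3 * j + 3) (?R, M))"
      if "code_at Q p (embed P p)" for Q p
    proof -
      note code = embed_at[OF that j, unfolded Load, simplified]
      have r1: "reach Q (cfg (p + 3 * j) (R, M)) (2 * floorlog 2 ?a + 2 * w + 2) (cfg (p + 3 * j + 1) (?R1, M))"
        using code bits mult_fl[of ?a] by (intro reach_step) (simp_all add: cfg_def R5)
      have r2: "reach Q (cfg (p + 3 * j + 1) (?R1, M)) (2 * floorlog 2 ?a + 4 * w + 4)
          (cfg (p + 3 * j + 2) (?R2, M))"
        using code bits mult_fl[of ?a] add_fl[of ?a] by (intro reach_step) (simp_all add: cfg_def R9)
      have r3: "reach Q (cfg (p + 3 * j + 2) (?R2, M))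
          (floorlog 2 ?a + 2 * w + 3 + floorlog 2 (M (?a * Z + b))) (cfg (p + 3 * j + 3) (?R, M))"
        using code add_fl[of ?a] by (intro reach_step) (simp_all add: cfg_def eval_nat_numeral)
      have cost: "step_cost P c = 1 + (floorlog 2 ?a + floorlog 2 (M (?a * Z + b)))"
        unfolding Mx unfolding x by (simp add: sc Load)
      define F where "F = floorlog 2 ?a + floorlog 2 (M (?a * Z + b))"
      have "(8 * w + 14) * step_cost P c = 8 * w * (1 + F) + 14 * (1 + F)"
        unfolding cost F_def[symmetric] by (simp only: K)
      moreover have "2 * floorlog 2 ?a + 2 * w + 2 + (2 * floorlog 2 ?a + 4 * w + 4 +
          (floorlog 2 ?a + 2 * w + 3 + floorlog 2 (M (?a * Z + b)))) \<le> 8 * w + 14 * (1 + F)"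
        unfolding F_def by simp
      moreover have "8 * w + 14 * (1 + F) \<le> 8 * w * (1 + F) + 14 * (1 + F)"
        using wx by (rule add_right_mono)
      ultimately have "2 * floorlog 2 ?a + 2 * w + 2 + (2 * floorlog 2 ?a + 4 * w + 4 +
          (floorlog 2 ?a + 2 * w + 3 + floorlog 2 (M (?a * Z + b)))) \<le> (8 * w + 14) * step_cost P c"
        by (simp only: le_trans)
      then show ?thesis
        by (rule reach_mono[OF reach_trans[OF r1 reach_trans[OF r2 r3]]])
    qed
    moreover have "simulates m b Z (step P c) ?R M" "framed b Z (R, M) (?R, M)"
      using R9 R5 regs mem x Mx by (auto simp: simulates_def framed_def st Load)
    moreover have "pc (step P c) = Suc j" by (simp add: st Load j_def[symmetric])
    ultimately show ?thesis unfolding start by (metis nxt)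
  next
    case (Store r x)
    let ?a = "R (12 + r)" and ?v = "R (12 + x)"
    let ?R1 = "R(8 := ?a * Z)" and ?R2 = "R(8 := ?a * Z + b)"
    let ?M = "M(?a * Z + b := ?v)"
    have x: "?a = reg c r" "?v = reg c x" using regs ub Store by auto
    have "reach Q (cfg (p + 3 * j) (R, M)) ((8 * w + 14) * step_cost P c) (cfg (p + 3 * j + 3) (?R2, ?M))"
      if "code_at Q p (embed P p)" for Q p
    proof -
      note code = embed_at[OF that j, unfolded Store, simplified]
      have r1: "reach Q (cfg (p + 3 * j) (R, M)) (2 * floorlog 2 ?a + 2 * w + 2) (cfg (p + 3 * j + 1) (?R1, M))"
        using code bits mult_fl[of ?a] by (intro reach_step) (simp_all add: cfg_def R5)
      have r2: "reach Q (cfg (p + 3 * j + 1) (?R1, M)) (2 * floorlog 2 ?a + 4 * w + 4)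
          (cfg (p + 3 * j + 2) (?R2, M))"
        using code bits mult_fl[of ?a] add_fl[of ?a] by (intro reach_step) (simp_all add: cfg_def R9)
      have r3: "reach Q (cfg (p + 3 * j + 2) (?R2, M))
          (floorlog 2 ?a + 2 * w + 3 + floorlog 2 ?v) (cfg (p + 3 * j + 3) (?R2, ?M))"
        using code add_fl[of ?a] by (intro reach_step) (simp_all add: cfg_def eval_nat_numeral)
      have cost: "step_cost P c = 1 + (floorlog 2 ?a + floorlog 2 ?v)"
        unfolding x by (simp add: sc Store)
      define F where "F = floorlog 2 ?a + floorlog 2 ?v"
      have "(8 * w + 14) * step_cost P c = 8 * w * (1 + F) + 14 * (1 + F)"
        unfolding cost F_def[symmetric] by (simp only: K)
      moreover have "2 * floorlog 2 ?a + 2 * w + 2 + (2 * floorlog 2 ?a + 4 * w + 4 +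
          (floorlog 2 ?a + 2 * w + 3 + floorlog 2 ?v)) \<le> 8 * w + 14 * (1 + F)"
        unfolding F_def by simp
      moreover have "8 * w + 14 * (1 + F) \<le> 8 * w * (1 + F) + 14 * (1 + F)"
        using wx by (rule add_right_mono)
      ultimately have "2 * floorlog 2 ?a + 2 * w + 2 + (2 * floorlog 2 ?a + 4 * w + 4 +
          (floorlog 2 ?a + 2 * w + 3 + floorlog 2 ?v)) \<le> (8 * w + 14) * step_cost P c"
        by (simp only: le_trans)
      then show ?thesis
        by (rule reach_mono[OF reach_trans[OF r1 reach_trans[OF r2 r3]]])
    qed
    moreover have "simulates m b Z (step P c) ?R2 ?M"
      using R9 R5 regs mem x Z by (auto simp: simulates_def st Store add.commute)
    moreover have "framed b Z (R, M) (?R2, ?M)"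
      by (auto simp: framed_def add.commute)
    moreover have "pc (step P c) = Suc j" by (simp add: st Store j_def[symmetric])
    ultimately show ?thesis unfolding start by (metis nxt)
  next
    case (Jump l)
    have "reach Q (cfg (p + 3 * j) (R, M)) ((8 * w + 14) * step_cost P c)
        (cfg (p + 3 * min (pc (step P c)) ?n) (R, M))"
      if "code_at Q p (embed P p)" for Q p
    proof -
      note code = embed_at[OF that j, unfolded Jump, simplified]
      show ?thesis
        using code by (intro reach_step) (simp_all add: cfg_def st sc Jump)
    qed
    moreover have "simulates m b Z (step P c) R M" "framed b Z (R, M) (R, M)"
      using R9 R5 regs mem by (auto simp: simulates_def framed_def st Jump)
    ultimately show ?thesis unfolding start by blast
  next
    case (JumpZero r l)
    have x: "R (12 + r) = reg c r" using regs ub JumpZero by auto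
    let ?R = "if reg c r = 0 then R else R(8 := 0)"
    have "reach Q (cfg (p + 3 * j) (R, M)) ((8 * w + 14) * step_cost P c)
        (cfg (p + 3 * min (pc (step P c)) ?n) (?R, M))"
      if "code_at Q p (embed P p)" for Q p
    proof -
      note code = embed_at[OF that j, unfolded JumpZero, simplified]
      show ?thesis
      proof (cases "reg c r = 0")
        case True
        then show ?thesis
          using code x by (intro reach_step) (simp_all add: cfg_def st sc JumpZero)
      next
        case False
        have r1: "reach Q (cfg (p + 3 * j) (R, M)) (step_cost P c) (cfg (p + 3 * j + 1) (R, M))"
          using code x False by (intro reach_step) (simp_all add: cfg_def sc JumpZero)
        have r2: "reach Q (cfg (p + 3 * j + 1) (R, M)) 1 (cfg (p + 3 * j + 2) (R(8 := 0), M))"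
          using code by (intro reach_step) (simp_all add: cfg_def)
        have r3: "reach Q (cfg (p + 3 * j + 2) (R(8 := 0), M)) 1 (cfg (p + 3 * j + 3) (R(8 := 0), M))"
          using code by (intro reach_step) (simp_all add: cfg_def eval_nat_numeral)
        have "pc (step P c) = Suc j" using False by (simp add: st JumpZero j_def[symmetric])
        then have e: "p + 3 * min (pc (step P c)) ?n = p + 3 * j + 3"
          by (simp only: nxt)
        have "1 \<le> step_cost P c" by (simp add: sc JumpZero)
        then have "reach Q (cfg (p + 3 * j) (R, M)) ((8 * w + 14) * step_cost P c)
            (cfg (p + 3 * j + 3) (R(8 := 0), M))"
          by (intro reach_mono[OF reach_trans[OF r1 reach_trans[OF r2 r3]]]) (simp add: K)
        then show ?thesis unfolding e using False by simp
      qed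
    qed
    moreover have "simulates m b Z (step P c) ?R M" "framed b Z (R, M) (?R, M)"
      using R9 R5 regs mem by (auto simp: simulates_def framed_def st JumpZero)
    ultimately show ?thesis unfolding start by blast
  qed
qed

lemma framed_refl: "framed b Z s s"
  by (simp add: framed_def)

lemma framed_trans: "framed b Z s t \<Longrightarrow> framed b Z t u \<Longrightarrow> framed b Z s u"
  by (simp add: framed_def)

lemma simulate_run:
  assumes Z: "0 < Z" and bits: "floorlog 2 Z \<le> w" "floorlog 2 b \<le> w"
    and below: "\<forall>i\<in>set P. uses_below m i" and sim: "simulates m b Z (initial ys) R M"
  shows "\<exists>R' M'. simulates m b Z (config_after P ys i) R' M' \<and> framed b Z (R, M) (R', M') \<and>
    (\<forall>Q p. code_at Q p (embed P p) \<longrightarrow>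
       reach Q (cfg p (R, M)) ((8 * w + 14) * (\<Sum>l<i. step_cost P (config_after P ys l)))
         (cfg (p + 3 * min (pc (config_after P ys i)) (length P)) (R', M')))"
proof (induction i)
  case 0
  show ?case
    using sim reach_refl
    by (intro exI[of _ R] exI[of _ M]) (simp add: config_after_def framed_refl initial_def)
next
  case (Suc i)
  let ?c = "config_after P ys i"
  obtain R1 M1 where 1: "simulates m b Z ?c R1 M1" "framed b Z (R, M) (R1, M1)"
    "\<And>Q p. code_at Q p (embed P p) \<Longrightarrow>
       reach Q (cfg p (R, M)) ((8 * w + 14) * (\<Sum>l<i. step_cost P (config_after P ys l)))
         (cfg (p + 3 * min (pc ?c) (length P)) (R1, M1))"
    using Suc by blast
  have next_c: "config_after P ys (Suc i) = step P ?c"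
    by (simp add: config_after_def)
  show ?case
  proof (cases "halted P ?c")
    case True
    then have "step P ?c = ?c" "step_cost P ?c = 0" by (simp_all add: step_def step_cost_def)
    then show ?thesis using 1 unfolding next_c by auto
  next
    case False
    from simulate_step[OF 1(1) Z bits below False]
    obtain R2 M2 where 2: "simulates m b Z (step P ?c) R2 M2" "framed b Z (R1, M1) (R2, M2)"
      "\<And>Q p. code_at Q p (embed P p) \<Longrightarrow>
       reach Q (cfg (p + 3 * min (pc ?c) (length P)) (R1, M1)) ((8 * w + 14) * step_cost P ?c)
         (cfg (p + 3 * min (pc (step P ?c)) (length P)) (R2, M2))"
      by blast
    have "reach Q (cfg p (R, M)) ((8 * w + 14) * (\<Sum>l<Suc i. step_cost P (config_after P ys l)))
         (cfg (p + 3 * min (pc (step P ?c)) (length P)) (R2, M2))"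
      if "code_at Q p (embed P p)" for Q p
      using reach_trans[OF 1(3)[OF that] 2(3)[OF that]] by (simp add: distrib_left)
    then show ?thesis
      unfolding next_c using 2(1) framed_trans[OF 1(2) 2(2)] by blast
  qed
qed

lemma runs_embed:
  assumes Z: "0 < Z" and bits: "floorlog 2 Z \<le> w" "floorlog 2 b \<le> w"
    and below: "\<forall>i\<in>set P. uses_below m i" and sim: "simulates m b Z (initial ys) R M"
    and halt: "halted P (config_after P ys i)"
    and cost: "(\<Sum>l<i. step_cost P (config_after P ys l)) \<le> t"
  shows "\<exists>R' M'. runs (embed P) (R, M) ((8 * w + 14) * t) (R', M') \<and>
    simulates m b Z (config_after P ys i) R' M' \<and> framed b Z (R, M) (R', M')"
proof -
  obtain R' M' where 1: "simulates m b Z (config_after P ys i) R' M'" "framed b Z (R, M) (R', M')"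
    "\<And>Q p. code_at Q p (embed P p) \<Longrightarrow>
       reach Q (cfg p (R, M)) ((8 * w + 14) * (\<Sum>l<i. step_cost P (config_after P ys l)))
         (cfg (p + 3 * min (pc (config_after P ys i)) (length P)) (R', M'))"
    using simulate_run[OF Z bits below sim, of i] by blast
  have "min (pc (config_after P ys i)) (length P) = length P"
    using halt by (simp add: halted_def)
  moreover have "(8 * w + 14) * (\<Sum>l<i. step_cost P (config_after P ys l)) \<le> (8 * w + 14) * t"
    using cost by (rule mult_left_mono) simp
  ultimately have "runs (embed P) (R, M) ((8 * w + 14) * t) (R', M')"
    unfolding runs_def using 1(3) reach_mono by fastforce
  with 1 show ?thesis by blast
qed

text \<open>Registers start at zero and every bit written has been paid for. The price of inspecting
  an answer is thereby bounded by the time of the run that produced it.\<close>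

lemma reg_bits: "floorlog 2 (reg (config_after P ys i) r) \<le> (\<Sum>l<i. step_cost P (config_after P ys l))"
proof (induction i)
  case 0
  then show ?case by (simp add: config_after_def initial_def)
next
  case (Suc i)
  let ?c = "config_after P ys i"
  have "floorlog 2 (reg (step P ?c) r) \<le> floorlog 2 (reg ?c r) + step_cost P ?c"
    by (cases "P ! pc ?c") (auto simp: step_def step_cost_def)
  then show ?case using Suc by (simp add: config_after_def)
qed

lemma config_after_halted:
  assumes "halted P (config_after P ys i)" "i \<le> l"
  shows "config_after P ys l = config_after P ys i"
  using assms(2)
proof (induction l rule: dec_induct)
  case (step l)
  then show ?case using assms(1) by (simp add: config_after_def step_def)
qed simp

lemma accepts_iff_halted:
  assumes "halted P (config_after P ys i)"
  shows "accepts P ys \<longleftrightarrow> reg (config_after P ys i) 0 \<noteq> 0"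
    and "rejects P ys \<longleftrightarrow> reg (config_after P ys i) 0 = 0"
proof -
  have "config_after P ys l = config_after P ys i" if "halted P (config_after P ys l)" for l
    using config_after_halted[OF assms, of l] config_after_halted[OF that, of i]
    by (metis nat_le_linear)
  with assms show "accepts P ys \<longleftrightarrow> reg (config_after P ys i) 0 \<noteq> 0"
    and "rejects P ys \<longleftrightarrow> reg (config_after P ys i) 0 = 0"
    unfolding accepts_def rejects_def by metis+
qed

fun reset :: "nat \<Rightarrow> code" where
  "reset 0 = nop"
| "reset (Suc m) = reset m ;; atom (Const (12 + m) 0)"

lemma runs_reset:
  "\<exists>R'. runs (reset m) (R, M) (2 * m) (R', M) \<and> (\<forall>r<m. R' (12 + r) = 0) \<and> (\<forall>r<12. R' r = R r)"
proof (induction m)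
  case 0
  then show ?case by (auto intro!: exI[of _ R] runs_nop)
next
  case (Suc m)
  then obtain R' where R': "runs (reset m) (R, M) (2 * m) (R', M)" "\<forall>r<m. R' (12 + r) = 0"
    "\<forall>r<12. R' r = R r" by blast
  have "runs (atom (Const (12 + m) 0)) (R', M) (unit_cost 0) (R'(12 + m := 0), M)"
    by (rule runs_Const) simp
  from runs_seq[OF R'(1) this] have "runs (reset (Suc m)) (R, M) (2 * Suc m) (R'(12 + m := 0), M)"
    by simp
  then show ?case
    using R'(2,3) by (intro exI[of _ "R'(12 + m := 0)"]) (auto simp: less_Suc_eq fun_upd_def)
qed

text \<open>Register 12 is register 0 of the subroutine. The outer register 0 is set but never
  cleared, so it accumulates the disjunction of all answers.\<close>

definition record_answer :: code where
  "record_answer = (\<lambda>p. [JumpZero 12 (p + 2), Const 0 1])"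

lemma position_free_record_answer [simp]: "position_free record_answer"
  by (simp add: position_free_def record_answer_def)

lemma runs_record_answer:
  "runs record_answer (R, M) (floorlog 2 (R 12) + 3) (if R 12 = 0 then R else R(0 := 1), M)"
  unfolding runs_def
proof (intro conjI allI impI)
  fix P p assume "code_at P p (record_answer p)"
  then have code: "p < length P" "P ! p = JumpZero 12 (p + 2)" "p + 1 < length P" "P ! (p + 1) = Const 0 1"
    by (simp_all add: record_answer_def)
  show "reach P (cfg p (R, M)) (floorlog 2 (R 12) + 3)
      (cfg (p + length (record_answer 0)) (if R 12 = 0 then R else R(0 := 1), M))"
  proof (cases "R 12 = 0")
    case True
    then show ?thesis
      using code by (intro reach_step) (simp_all add: cfg_def record_answer_def)
  next
    case False
    have r1: "reach P (cfg p (R, M)) (1 + floorlog 2 (R 12)) (cfg (p + 1) (R, M))"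
      using code False by (intro reach_step) (simp_all add: cfg_def)
    have "floorlog 2 (1::nat) \<le> 1" by (rule floorlog_le_pow2) simp
    then have r2: "reach P (cfg (p + 1) (R, M)) 2 (cfg (p + 2) (R(0 := 1), M))"
      using code by (intro reach_step) (simp_all add: cfg_def)
    show ?thesis
      using reach_mono[OF reach_trans[OF r1 r2], of "floorlog 2 (R 12) + 3"] False
      by (simp add: record_answer_def)
  qed
qed simp

section \<open>Reductions that query a machine on many computed instances\<close>

fun mul_times :: "nat \<Rightarrow> code" where
  "mul_times 0 = nop"
| "mul_times (Suc c) = mul_times c ;; atom (Arith Mult 1 1 7)"

lemma runs_mul_times:
  assumes "R 1 = 1" "R 7 = q" "1 \<le> q" "q ^ c < 2 ^ w"
  shows "runs (mul_times c) (R, M) (c * unit_cost w) (R(1 := q ^ c), M)"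
  using assms(4)
proof (induction c)
  case 0
  have "R(1 := q ^ 0) = R" using assms(1) by (auto simp: fun_eq_iff)
  then show ?case using runs_nop by simp
next
  case (Suc c)
  have "q ^ c \<le> q ^ Suc c" using assms(3) by (intro power_increasing) auto
  moreover have "q \<le> q ^ Suc c" using assms(3) by (intro self_le_power) auto
  ultimately have b: "q ^ c < 2 ^ w" "q < 2 ^ w" using Suc.prems by (metis le_less_trans)+
  have "runs (atom (Arith Mult 1 1 7)) (R(1 := q ^ c), M) (unit_cost w)
      ((R(1 := q ^ c))(1 := apply_op Mult ((R(1 := q ^ c)) 1) ((R(1 := q ^ c)) 7)), M)"
    using b assms(2) by (intro runs_Arith) auto
  moreover have "(R(1 := q ^ c))(1 := apply_op Mult ((R(1 := q ^ c)) 1) ((R(1 := q ^ c)) 7)) =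
      R(1 := q ^ Suc c)"
    using assms(2) by (auto simp: fun_eq_iff)
  ultimately have "runs (atom (Arith Mult 1 1 7)) (R(1 := q ^ c), M) (unit_cost w) (R(1 := q ^ Suc c), M)"
    by (simp only:)
  from runs_seq[OF Suc.IH[OF b(1)] this]
  have "runs (mul_times (Suc c)) (R, M) (c * unit_cost w + unit_cost w) (R(1 := q ^ Suc c), M)"
    by (simp only: mul_times.simps)
  then show ?case by (rule runs_mono) simp
qed

text \<open>The first input word is the number \<open>n\<close> of variables. The base
  \<open>n + 2\<close> is at least 2, so that its powers dominate every polynomial in
  \<open>n\<close>, constant factor included. Registers 1 and 2 receive the values that compiled
  expressions expect there; \<open>2 ^ S\<close> is obtained by doubling.\<close>

definition setup_code :: "nat \<Rightarrow> code" where
  "setup_code c = atom (Load 7 7) ;; atom (Const 8 2) ;; atom (Arith Add 7 7 8) ;; atom (Const 1 1) ;;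
     mul_times c ;; atom (Const 2 1) ;; for_loop 4 1 10 (atom (Arith Add 2 2 2))"

definition setup_cost :: "nat \<Rightarrow> nat \<Rightarrow> nat" where
  "setup_cost c S = (c + 5) * unit_cost S + (S * (unit_cost S + 5 * unit_cost S) + 3 * unit_cost S)"

lemma runs_setup:
  assumes S: "S = (M 0 + 2) ^ c" and c: "1 \<le> c"
  shows "\<exists>R. runs (setup_code c) (\<lambda>_. 0, M) (setup_cost c S) (R, M) \<and> R 0 = 0 \<and> R 1 = S \<and> R 2 = 2 ^ S"
proof -
  let ?n = "M 0"
  have "(?n + 2) ^ 1 \<le> S" unfolding S using c by (intro power_increasing) auto
  then have nS: "?n + 2 \<le> S" by simp
  have S2: "S < 2 ^ S" by simp
  with nS have small: "?n < 2 ^ S" "2 < (2::nat) ^ S" "?n + 2 < 2 ^ S" "1 < (2::nat) ^ S" "(0::nat) < 2 ^ S"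
    by linarith+
  let ?R0 = "\<lambda>_::nat. 0::nat"
  let ?R1 = "?R0(7 := M (?R0 7))"
  let ?R2 = "?R1(8 := 2)"
  let ?R3 = "?R2(7 := apply_op Add (?R2 7) (?R2 8))"
  let ?R4 = "?R3(1 := 1)"
  let ?R5 = "?R4(1 := (?n + 2) ^ c)"
  let ?R6 = "?R5(2 := 1)"
  have r1: "runs (atom (Load 7 7)) (?R0, M) (unit_cost S) (?R1, M)"
    using small by (intro runs_Load) auto
  have r2: "runs (atom (Const 8 2)) (?R1, M) (unit_cost S) (?R2, M)"
    using small by (intro runs_Const) auto
  have r3: "runs (atom (Arith Add 7 7 8)) (?R2, M) (unit_cost S) (?R3, M)"
    using small by (intro runs_Arith) auto
  have r4: "runs (atom (Const 1 1)) (?R3, M) (unit_cost S) (?R4, M)"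
    using small by (intro runs_Const) auto
  have r5: "runs (mul_times c) (?R4, M) (c * unit_cost S) (?R5, M)"
    using S S2 by (intro runs_mul_times) auto
  have r6: "runs (atom (Const 2 1)) (?R5, M) (unit_cost S) (?R6, M)"
    using small by (intro runs_Const) auto
  have "\<exists>R' M'. runs (for_loop 4 1 10 (atom (Arith Add 2 2 2))) (?R6, M)
      (S * (unit_cost S + 5 * unit_cost S) + 3 * unit_cost S) (R', M') \<and>
      (M' = M \<and> R' 0 = 0 \<and> R' 2 = 2 ^ S \<and> R' 1 = S)"
  proof (rule runs_for_loop[where I = "\<lambda>j Q N. N = M \<and> Q 0 = 0 \<and> Q 2 = 2 ^ j \<and> Q 1 = S"])
    fix j and Q N :: "nat \<Rightarrow> nat"
    assume J: "j < S" "N = M \<and> Q 0 = 0 \<and> Q 2 = 2 ^ j \<and> Q 1 = S" "Q 4 = j" "Q 1 = S"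
    have "(Q(10 := S - j)) 2 < 2 ^ S" using J by (auto intro!: power_strict_increasing)
    from runs_Arith[where R = "Q(10 := S - j)" and x = 2 and y = 2 and f = Add and r = 2 and M = M, OF this this] J
    show "\<exists>R' M'. runs (atom (Arith Add 2 2 2)) (Q(10 := S - j), N) (unit_cost S) (R', M') \<and>
        R' 4 = j \<and> R' 1 = S \<and> (M' = M \<and> (R'(10 := 1, 4 := Suc j)) 0 = 0 \<and>
          (R'(10 := 1, 4 := Suc j)) 2 = 2 ^ Suc j \<and> (R'(10 := 1, 4 := Suc j)) 1 = S)"
      by (intro exI[of _ "Q(10 := S - j, 2 := Q 2 + Q 2)"] exI[of _ M]) auto
  qed (use S in auto)
  then obtain R' M' where F: "runs (for_loop 4 1 10 (atom (Arith Add 2 2 2))) (?R6, M)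
      (S * (unit_cost S + 5 * unit_cost S) + 3 * unit_cost S) (R', M')"
    "M' = M" "R' 0 = 0" "R' 2 = 2 ^ S" "R' 1 = S" by blast
  have "runs (setup_code c) (\<lambda>_. 0, M) (setup_cost c S) (R', M)"
    unfolding setup_code_def setup_cost_def
    using runs_mono[OF runs_seq[OF r1 runs_seq[OF r2 runs_seq[OF r3 runs_seq[OF r4
      runs_seq[OF r5 runs_seq[OF r6 F(1)[unfolded F(2)]]]]]]], of "setup_cost c S"]
    by (simp add: setup_cost_def algebra_simps)
  with F show ?thesis by blast
qed

text \<open>Word \<open>i\<close> of query \<open>z\<close> goes to
  \<open>S + 1 + z + i * Z\<close>, that is, to cell \<open>i\<close> of the embedded machine with
  offset \<open>S + 1 + z\<close>. The input stays intact at the addresses up to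
  \<open>S\<close>.\<close>

definition write_body :: "ex \<Rightarrow> code" where
  "write_body e = comp e [3, 4] 12 ;; atom (Arith Mult 8 4 5) ;; atom (Arith Add 8 8 3) ;;
     atom (Arith Add 8 8 1) ;; atom (Const 9 1) ;; atom (Arith Add 8 8 9) ;; atom (Store 8 12)"

lemma position_free_write_body [simp]: "position_free (write_body e)"
  unfolding write_body_def by (auto intro!: position_free_seq)

lemma residue_unique:
  fixes z z' Z :: nat
  assumes "s + z + j * Z = s + z' + j' * Z" "z < Z" "z' < Z"
  shows "z = z' \<and> j = j'"
proof -
  have e: "z + j * Z = z' + j' * Z" using assms(1) by simp
  have "z = (z + j * Z) mod Z" using assms(2) by simp
  also have "\<dots> = (z' + j' * Z) mod Z" by (simp only: e)
  also have "\<dots> = z'" using assms(3) by simp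
  finally have zz: "z = z'" .
  with e have "j * Z = j' * Z" by (simp only: add_left_cancel)
  moreover have "Z \<noteq> 0" using assms(2) by linarith
  ultimately show ?thesis using zz mult_cancel2[of j Z j'] by blast
qed

lemma runs_write:
  fixes S z Z I a :: nat and R M :: "nat \<Rightarrow> nat"
  assumes S: "1 \<le> S" and \<mu>: "\<And>x. x \<le> S \<Longrightarrow> \<mu> x < 2 ^ S"
    and regs: "R 1 = S" "R 2 = 2 ^ S" "R 3 = z" "R 5 = Z" "R 6 = I"
    and bounds: "z < Z" "Z < 2 ^ (a * S)" "I < 2 ^ (a * S)"
    and low: "\<And>x. x \<le> S \<Longrightarrow> M x = \<mu> x"
    and fresh: "\<And>j. M (S + 1 + z + j * Z) = 0"
  shows "\<exists>R' M'. runs (for_loop 4 6 11 (write_body e)) (R, M)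
      (I * (tb e a S + 6 * unit_cost ((2 * a + 4 + vb e a) * S) + 5 * unit_cost (a * S)) + 3 * unit_cost (a * S))
      (R', M') \<and>
    (\<forall>j. M' (S + 1 + z + j * Z) = (if j < I then eval S \<mu> e [z, j] else 0)) \<and>
    (\<forall>x. (\<forall>j. x \<noteq> S + 1 + z + j * Z) \<longrightarrow> M' x = M x) \<and> (\<forall>r<7. r \<noteq> 4 \<longrightarrow> R' r = R r)"
proof -
  let ?w = "(2 * a + 4 + vb e a) * S"
  let ?Inv = "\<lambda>i Q N. (\<forall>j. N (S + 1 + z + j * Z) = (if j < i then eval S \<mu> e [z, j] else 0)) \<and>
    (\<forall>x. (\<forall>j. x \<noteq> S + 1 + z + j * Z) \<longrightarrow> N x = M x) \<and> (\<forall>r<7. r \<noteq> 4 \<longrightarrow> Q r = R r)"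
  have "\<exists>R' M'. runs (for_loop 4 6 11 (write_body e)) (R, M)
      (I * (tb e a S + 6 * unit_cost ?w + 5 * unit_cost (a * S)) + 3 * unit_cost (a * S))
      (R', M') \<and> ?Inv I R' M'"
  proof (rule runs_for_loop[where I = ?Inv])
    fix i Q N
    assume J: "i < I" "?Inv i Q N" "Q 4 = i" "Q 6 = I"
    let ?Q = "Q(11 := I - i)"
    have q: "Q 1 = S" "Q 2 = 2 ^ S" "Q 3 = z" "Q 5 = Z" using J regs by auto
    have Nlow: "N x = \<mu> x" if "x \<le> S" for x
    proof -
      have "N x = M x" using J(2) that by auto
      then show ?thesis using low that by simp
    qed
    have env: "v < 2 ^ (a * S)" if "v \<in> set [z, i]" for v
      using that bounds J(1) by auto
    obtain Q1 where Q1: "runs (comp e [3, 4] 12) (?Q, N) (tb e a S) (Q1, N)"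
      "Q1 12 = eval S \<mu> e [z, i]" "\<And>r. r < 12 \<Longrightarrow> Q1 r = ?Q r"
      by (rule compilesD[OF compiles_all[where S = S and \<mu> = \<mu> and e = e, OF S \<mu>], of "[3, 4]" 12 ?Q N "[z, i]" a])
        (use q J Nlow env in auto)
    have q1: "Q1 1 = S" "Q1 3 = z" "Q1 4 = i" "Q1 5 = Z" "Q1 6 = I"
      using Q1(3) q J by auto
    let ?v = "eval S \<mu> e [z, i]"
    have B: "(2::nat) ^ (a * S) \<le> 2 ^ ((2 * a + 1) * S)" "(2::nat) ^ (a * S + a * S) \<le> 2 ^ ((2 * a + 1) * S)"
      "(2::nat) ^ S \<le> 2 ^ ((2 * a + 1) * S)"
      by (intro power_increasing; simp add: algebra_simps)+
    have "i * Z \<le> 2 ^ (a * S) * 2 ^ (a * S)"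
      using J(1) bounds by (intro mult_mono) auto
    then have "i * Z \<le> 2 ^ ((2 * a + 1) * S)" using B(2) by (simp add: power_add)
    moreover have "z < 2 ^ ((2 * a + 1) * S)" using bounds B(1) by linarith
    moreover have "S + 1 \<le> 2 ^ ((2 * a + 1) * S)"
      using B(3) less_exp[of S] by linarith
    \<comment> \<open>Three summands of at most \<open>2 ^ ((2 * a + 1) * S)\<close> cost two extra
      bits, which \<open>1 \<le> S\<close> rounds up to multiples of \<open>S\<close>.\<close>
    ultimately have "i * Z + z + S + 1 < 4 * 2 ^ ((2 * a + 1) * S)" by simp
    also have "\<dots> = 2 ^ ((2 * a + 1) * S + 2)" by (simp add: power_add)
    also have "\<dots> \<le> 2 ^ ?w" using S by (intro power_increasing) (auto simp: algebra_simps)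
    finally have big: "i * Z + z + S + 1 < 2 ^ ?w" .
    have az: "(2::nat) ^ (a * S) \<le> 2 ^ ?w" by (intro power_increasing) (auto simp: algebra_simps)
    have sm: "i < 2 ^ ?w" "Z < 2 ^ ?w" "z < 2 ^ ?w" "S < 2 ^ ?w" "1 < (2::nat) ^ ?w" "i * Z < 2 ^ ?w"
        "i * Z + z < 2 ^ ?w" "i * Z + z + S < 2 ^ ?w"
      using big az bounds J(1) S by linarith+
    have "?v < 2 ^ (vb e a * S)" by (rule eval_less[OF S \<mu>]) (use env in auto)
    then have v: "?v < 2 ^ ?w" by (rule less_pow2_mono) (simp add: algebra_simps)
    let ?R1 = "Q1(8 := i * Z)"
    let ?R2 = "?R1(8 := i * Z + z)"
    let ?R3 = "?R2(8 := i * Z + z + S)"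
    let ?R4 = "?R3(9 := 1)"
    let ?R5 = "?R4(8 := i * Z + z + S + 1)"
    have r1: "runs (atom (Arith Mult 8 4 5)) (Q1, N) (unit_cost ?w) (?R1, N)"
      using runs_Arith[of Q1 4 ?w 5 Mult 8 N] q1 sm by simp
    have r2: "runs (atom (Arith Add 8 8 3)) (?R1, N) (unit_cost ?w) (?R2, N)"
      using runs_Arith[of ?R1 8 ?w 3 Add 8 N] q1 sm by simp
    have r3: "runs (atom (Arith Add 8 8 1)) (?R2, N) (unit_cost ?w) (?R3, N)"
      using runs_Arith[of ?R2 8 ?w 1 Add 8 N] q1 sm by simp
    have r4: "runs (atom (Const 9 1)) (?R3, N) (unit_cost ?w) (?R4, N)"
      using sm by (intro runs_Const) auto
    have r5: "runs (atom (Arith Add 8 8 9)) (?R4, N) (unit_cost ?w) (?R5, N)"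
      using runs_Arith[of ?R4 8 ?w 9 Add 8 N] q1 sm by simp
    let ?N = "N(i * Z + z + S + 1 := ?v)"
    have r6: "runs (atom (Store 8 12)) (?R5, N) (unit_cost ?w) (?R5, ?N)"
      using runs_Store[of ?R5 8 ?w 12 N] Q1(2) big v by simp
    have run: "runs (write_body e) (?Q, N) (tb e a S + 6 * unit_cost ?w) (?R5, ?N)"
      unfolding write_body_def
      by (rule runs_mono[OF runs_seq[OF Q1(1) runs_seq[OF r1 runs_seq[OF r2 runs_seq[OF r3
          runs_seq[OF r4 runs_seq[OF r5 r6]]]]]]]) simp
    have addr: "S + 1 + z + j * Z = i * Z + z + S + 1 \<longleftrightarrow> j = i" for j
      using residue_unique[of "S + 1" z j Z z i] bounds(1) by auto
    have "?N (S + 1 + z + j * Z) = (if j < Suc i then eval S \<mu> e [z, j] else 0)" for j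
      unfolding fun_upd_apply addr using J(2) by (auto simp: less_Suc_eq)
    moreover have "?N x = M x" if "\<forall>j. x \<noteq> S + 1 + z + j * Z" for x
    proof -
      have "x \<noteq> S + 1 + z + i * Z" using that by blast
      then have "x \<noteq> i * Z + z + S + 1" by simp
      then show ?thesis using J(2) that by simp
    qed
    moreover have "\<forall>r<7. r \<noteq> 4 \<longrightarrow> (?R5(11 := 1, 4 := Suc i)) r = R r"
      using Q1(3) J(2) by simp
    ultimately have "?Inv (Suc i) (?R5(11 := 1, 4 := Suc i)) ?N" by blast
    moreover have "?R5 4 = i" "?R5 6 = I" using q1 by simp_all
    ultimately show "\<exists>R' M'. runs (write_body e) (Q(11 := I - i), N) (tb e a S + 6 * unit_cost ?w) (R', M') \<and>
        R' 4 = i \<and> R' 6 = I \<and> ?Inv (Suc i) (R'(11 := 1, 4 := Suc i)) M'"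
      using run by blast
  next
    show "?Inv 0 (R(4 := 0)) M" using fresh by auto
  next
    fix Q N assume "?Inv I Q N" then show "?Inv I (Q(11 := 0)) N" by auto
  qed (use bounds regs in auto)
  then show ?thesis by blast
qed

definition query_body :: "ram_program \<Rightarrow> nat \<Rightarrow> ex \<Rightarrow> code" where
  "query_body P m e = for_loop 4 6 11 (write_body e) ;; atom (Arith Add 9 3 1) ;; atom (Const 8 1) ;;
     atom (Arith Add 9 9 8) ;; reset m ;; embed P ;; record_answer"

lemma position_free_reset [simp]: "position_free (reset m)"
  by (induction m) auto

lemma position_free_query_body [simp]: "position_free (query_body P m e)"
  unfolding query_body_def by (auto intro!: position_free_seq)

definition query_cost :: "ex \<Rightarrow> nat \<Rightarrow> nat \<Rightarrow> nat \<Rightarrow> nat \<Rightarrow> nat \<Rightarrow> nat" where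
  "query_cost e a m S I t =
     (I * (tb e a S + 6 * unit_cost ((2 * a + 4 + vb e a) * S) + 5 * unit_cost (a * S)) + 3 * unit_cost (a * S)) +
     3 * unit_cost ((a + 2) * S) + 2 * m + (8 * ((a + 2) * S) + 14) * t + (t + 3)"

lemma runs_queries:
  fixes S Z I a :: nat and R M :: "nat \<Rightarrow> nat"
  assumes S: "1 \<le> S" and \<mu>: "\<And>x. x \<le> S \<Longrightarrow> \<mu> x < 2 ^ S"
    and below: "\<forall>i\<in>set P. uses_below m i" and m: "0 < m"
    and regs: "R 0 = 0" "R 1 = S" "R 2 = 2 ^ S" "R 5 = Z" "R 6 = I"
    and bounds: "Z < 2 ^ (a * S)" "I < 2 ^ (a * S)"
    and mem: "M = (\<lambda>x. if x \<le> S then \<mu> x else 0)"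
    and ys: "\<And>z. z < Z \<Longrightarrow> ys z = map (\<lambda>i. eval S \<mu> e [z, i]) [0..<I]"
    and halts: "\<And>z. z < Z \<Longrightarrow> \<exists>i. halted P (config_after P (ys z) i) \<and>
        (\<Sum>l<i. step_cost P (config_after P (ys z) l)) \<le> t"
  shows "\<exists>R' M'. runs (for_loop 3 5 10 (query_body P m e)) (R, M)
      (Z * (query_cost e a m S I t + 5 * unit_cost (a * S)) + 3 * unit_cost (a * S)) (R', M') \<and>
      (R' 0 \<noteq> 0 \<longleftrightarrow> (\<exists>z<Z. accepts P (ys z)))"
proof -
  \<comment> \<open>The progressions of the queries still to come are blank, so every run starts
    from the memory of \<open>initial\<close>; register 0 is the disjunction of the answers so
    far.\<close>
  let ?Inv = "\<lambda>z (Q :: nat \<Rightarrow> nat) (N :: nat \<Rightarrow> nat). (\<forall>x\<le>S. N x = \<mu> x) \<and> (\<forall>z' j. z \<le> z' \<longrightarrow> z' < Z \<longrightarrow> N (S + 1 + z' + j * Z) = 0) \<and>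
    Q 1 = S \<and> Q 2 = 2 ^ S \<and> Q 6 = I \<and> (Q 0 \<noteq> 0 \<longleftrightarrow> (\<exists>z'<z. accepts P (ys z')))"
  have "\<exists>R' M'. runs (for_loop 3 5 10 (query_body P m e)) (R, M)
      (Z * (query_cost e a m S I t + 5 * unit_cost (a * S)) + 3 * unit_cost (a * S)) (R', M') \<and> ?Inv Z R' M'"
  proof (rule runs_for_loop[where I = ?Inv])
    fix z and Q N :: "nat \<Rightarrow> nat"
    assume J: "z < Z" "?Inv z Q N" "Q 3 = z" "Q 5 = Z"
    let ?Q = "Q(10 := Z - z)"
    let ?b = "S + 1 + z"
    let ?w = "(a + 2) * S"
    have pre: "?Q 1 = S" "?Q 2 = 2 ^ S" "?Q 3 = z" "?Q 5 = Z" "?Q 6 = I"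
      using J by auto
    have low: "\<And>x. x \<le> S \<Longrightarrow> N x = \<mu> x" and fresh: "\<And>j. N (S + 1 + z + j * Z) = 0"
      using J by auto
    obtain R1 M1 where W: "runs (for_loop 4 6 11 (write_body e)) (?Q, N)
      (I * (tb e a S + 6 * unit_cost ((2 * a + 4 + vb e a) * S) + 5 * unit_cost (a * S)) + 3 * unit_cost (a * S))
      (R1, M1)"
      "\<And>j. M1 (?b + j * Z) = (if j < I then eval S \<mu> e [z, j] else 0)"
      "\<And>x. (\<forall>j. x \<noteq> ?b + j * Z) \<Longrightarrow> M1 x = N x" "\<And>r. r < 7 \<Longrightarrow> r \<noteq> 4 \<Longrightarrow> R1 r = ?Q r"
      using runs_write[where R = ?Q and z = z and Z = Z and I = I and a = a and M = N and e = e and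
        S = S and \<mu> = \<mu>, OF S \<mu> pre J(1) bounds low fresh] by blast
    have r1: "R1 0 = Q 0" "R1 1 = S" "R1 2 = 2 ^ S" "R1 3 = z" "R1 5 = Z" "R1 6 = I"
      using W(4) J by auto
    have B: "(2::nat) ^ (a * S) \<le> 2 ^ ((a + 1) * S)" "(2::nat) ^ S \<le> 2 ^ ((a + 1) * S)"
      by (intro power_increasing; simp)+
    have "z + S + 1 < 2 * 2 ^ ((a + 1) * S)"
      using B J(1) bounds(1) less_exp[of S] by linarith
    also have "\<dots> = 2 ^ ((a + 1) * S + 1)" by simp
    also have "\<dots> \<le> 2 ^ ?w" using S by (intro power_increasing) (auto simp: algebra_simps)
    finally have big: "z + S + 1 < 2 ^ ?w" .
    have "Z < 2 ^ ?w"
      using bounds(1) by (rule less_pow2_mono) simp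
    then have bits: "floorlog 2 Z \<le> ?w" "floorlog 2 ?b \<le> ?w"
      using big by (auto intro!: floorlog_le_pow2 simp: add.commute)
    let ?R2 = "R1(9 := z + S)"
    let ?R3 = "?R2(8 := 1)"
    let ?R4 = "?R3(9 := z + S + 1)"
    have c1: "runs (atom (Arith Add 9 3 1)) (R1, M1) (unit_cost ?w) (?R2, M1)"
      using runs_Arith[of R1 3 ?w 1 Add 9 M1] r1 big by simp
    have c2: "runs (atom (Const 8 1)) (?R2, M1) (unit_cost ?w) (?R3, M1)"
      using big S by (intro runs_Const) linarith
    have c3: "runs (atom (Arith Add 9 9 8)) (?R3, M1) (unit_cost ?w) (?R4, M1)"
      using runs_Arith[of ?R3 9 ?w 8 Add 9 M1] r1 big S by simp
    obtain R5 where c4: "runs (reset m) (?R4, M1) (2 * m) (R5, M1)" "\<forall>r<m. R5 (12 + r) = 0"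
      "\<forall>r<12. R5 r = ?R4 r" using runs_reset by blast
    have sim: "simulates m ?b Z (initial (ys z)) R5 M1"
      using c4 r1 W(2) J(1) ys by (simp add: simulates_def initial_def)
    obtain i where halt: "halted P (config_after P (ys z) i)"
      "(\<Sum>l<i. step_cost P (config_after P (ys z) l)) \<le> t" using halts[OF J(1)] by blast
    have "0 < Z" using J(1) by simp
    from runs_embed[OF this bits below sim halt]
    obtain R6 M6 where c5: "runs (embed P) (R5, M1) ((8 * ?w + 14) * t) (R6, M6)"
      "simulates m ?b Z (config_after P (ys z) i) R6 M6" "framed ?b Z (R5, M1) (R6, M6)" by blast
    have R12: "R6 12 = reg (config_after P (ys z) i) 0"
      using c5(2) m by (auto simp: simulates_def)
    then have "floorlog 2 (R6 12) \<le> t" using reg_bits[of P "ys z" i 0] halt(2) by simp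
    then have c6: "runs record_answer (R6, M6) (t + 3) (if R6 12 = 0 then R6 else R6(0 := 1), M6)"
      by (intro runs_mono[OF runs_record_answer]) simp
    let ?R7 = "if R6 12 = 0 then R6 else R6(0 := 1)"
    have run: "runs (query_body P m e) (?Q, N) (query_cost e a m S I t) (?R7, M6)"
      unfolding query_body_def query_cost_def
      by (rule runs_mono[OF runs_seq[OF W(1) runs_seq[OF c1 runs_seq[OF c2 runs_seq[OF c3
          runs_seq[OF c4(1) runs_seq[OF c5(1) c6]]]]]]]) simp
    have acc: "R6 12 \<noteq> 0 \<longleftrightarrow> accepts P (ys z)"
      using accepts_iff_halted(1)[OF halt(1)] R12 by simp
    have keep: "R6 r = Q r" if "r < 7" "r \<noteq> 4" for r
      using c5(3) c4(3) W(4) that by (auto simp: framed_def)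
    have M6: "M6 x = N x" if "\<forall>j. x \<noteq> ?b + j * Z" for x
      using c5(3) W(3) that by (auto simp: framed_def)
    have "\<forall>x\<le>S. M6 x = \<mu> x" using M6 J(2) by auto
    moreover have "M6 (S + 1 + z' + j * Z) = 0" if "Suc z \<le> z'" "z' < Z" for z' j
    proof -
      have "\<forall>j'. S + 1 + z' + j * Z \<noteq> ?b + j' * Z"
        using residue_unique[of "S + 1" z' j Z z] that J(1) by auto
      then show ?thesis using M6 J(2) that by simp
    qed
    moreover have "?R7 0 \<noteq> 0 \<longleftrightarrow> (\<exists>z'<Suc z. accepts P (ys z'))"
      using acc keep[of 0] J(2) by (auto simp: less_Suc_eq)
    moreover have "?R7 1 = S" "?R7 2 = 2 ^ S" "?R7 3 = z" "?R7 5 = Z" "?R7 6 = I"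
      using keep[of 1] keep[of 2] keep[of 3] keep[of 5] keep[of 6] J by auto
    ultimately show "\<exists>R' M'. runs (query_body P m e) (Q(10 := Z - z), N) (query_cost e a m S I t) (R', M') \<and>
        R' 3 = z \<and> R' 5 = Z \<and> ?Inv (Suc z) (R'(10 := 1, 3 := Suc z)) M'"
      using run by (intro exI[of _ ?R7] exI[of _ M6]) simp
  next
    show "?Inv 0 (R(3 := 0)) M" using regs mem by auto
  next
    fix Q N assume "?Inv Z Q N" then show "?Inv Z (Q(10 := 0)) N" by auto
  qed (use bounds regs in auto)
  then show ?thesis by blast
qed

abbreviation input_word :: "nat list \<Rightarrow> nat \<Rightarrow> nat" where
  "input_word xs \<equiv> (\<lambda>i. if i < length xs then xs ! i else 0)"

text \<open>A Turing reduction described by three expressions: the number \<open>Z\<close> of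
  queries, their length \<open>I\<close>, and word \<open>i\<close> of query \<open>z\<close>.
  \<open>Z\<close> and \<open>I\<close> may be exponential in \<open>S\<close>; hence they bound
  loops of the machine code, whereas loops inside expressions stop at \<open>S\<close>. Computing a
  word and simulating a step each cost a factor polynomial in \<open>S\<close>, so the total is such
  a factor times the number of queries times length plus running time.\<close>

theorem query_reduction:
  assumes c: "1 \<le> c"
  shows "\<exists>Q F. poly_bdd F \<and> (\<forall>xs S Z I t ys. S = (input_word xs 0 + 2) ^ c \<longrightarrow> length xs \<le> S + 1 \<longrightarrow>
     (\<forall>x\<in>set xs. x < 2 ^ S) \<longrightarrow>
     Z = eval S (input_word xs) eZ [] \<longrightarrow> I = eval S (input_word xs) eI [] \<longrightarrow>
     (\<forall>z<Z. ys z = map (\<lambda>i. eval S (input_word xs) e [z, i]) [0..<I] \<and>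
        (\<exists>i. halted P (config_after P (ys z) i) \<and>
           (\<Sum>l<i. step_cost P (config_after P (ys z) l)) \<le> t)) \<longrightarrow>
     (\<exists>i. halted Q (config_after Q xs i) \<and>
        (\<Sum>l<i. step_cost Q (config_after Q xs l)) \<le> F S * ((Z + 1) * (I + t + 1)) \<and>
        (reg (config_after Q xs i) 0 \<noteq> 0 \<longleftrightarrow> (\<exists>z<Z. accepts P (ys z)))))"
proof -
  obtain m where m: "0 < m" "\<forall>i\<in>set P. uses_below m i"
    using uses_below_exists by blast
  define a where "a = vb eZ 0 + vb eI 0"
  define main where "main = setup_code c ;; comp eZ [] 12 ;; copy 5 12 ;; comp eI [] 12 ;; copy 6 12 ;;
    for_loop 3 5 10 (query_body P m e)"
  define F0 where "F0 S = setup_cost c S + tb eZ 0 S + 2 * unit_cost (a * S) + tb eI 0 S +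
    2 * unit_cost (a * S) + 3 * unit_cost (a * S)" for S
  define F1 where "F1 S = tb e a S + 6 * unit_cost ((2 * a + 4 + vb e a) * S) + 5 * unit_cost (a * S)" for S
  define F2 where "F2 S = 3 * unit_cost (a * S) + 3 * unit_cost ((a + 2) * S) + 2 * m + 3 +
    5 * unit_cost (a * S)" for S
  define F3 where "F3 S = 8 * ((a + 2) * S) + 15" for S
  define F where "F S = F0 S + F1 S + F2 S + F3 S" for S
  have "poly_bdd (\<lambda>S. F S)"
    unfolding F_def F0_def F1_def F2_def F3_def setup_cost_def
    by (intro poly_bdd_add poly_bdd_mult poly_bdd_const poly_bdd_id poly_bdd_tb)
  moreover have "\<exists>i. halted (main 0) (config_after (main 0) xs i) \<and>
        (\<Sum>l<i. step_cost (main 0) (config_after (main 0) xs l)) \<le> F S * ((Z + 1) * (I + t + 1)) \<and>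
        (reg (config_after (main 0) xs i) 0 \<noteq> 0 \<longleftrightarrow> (\<exists>z<Z. accepts P (ys z)))"
    if S: "S = (input_word xs 0 + 2) ^ c" and len: "length xs \<le> S + 1" and words: "\<forall>x\<in>set xs. x < 2 ^ S"
      and Z: "Z = eval S (input_word xs) eZ []" and I: "I = eval S (input_word xs) eI []"
      and ys: "\<forall>z<Z. ys z = map (\<lambda>i. eval S (input_word xs) e [z, i]) [0..<I] \<and>
        (\<exists>i. halted P (config_after P (ys z) i) \<and> (\<Sum>l<i. step_cost P (config_after P (ys z) l)) \<le> t)"
    for xs S Z I t ys
  proof -
    let ?\<mu> = "input_word xs"
    have S1: "1 \<le> S" unfolding S by simp
    have \<mu>: "?\<mu> x < 2 ^ S" if "x \<le> S" for x using words by auto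
    have Zb: "Z < 2 ^ (vb eZ 0 * S)" "I < 2 ^ (vb eI 0 * S)"
      unfolding Z I by (rule eval_less[OF S1 \<mu>], simp_all)+
    have ZI: "Z < 2 ^ (a * S)" "I < 2 ^ (a * S)"
      by (rule less_pow2_mono[OF Zb(1)], simp add: a_def algebra_simps)
        (rule less_pow2_mono[OF Zb(2)], simp add: a_def algebra_simps)
    obtain R0 where R0: "runs (setup_code c) (\<lambda>_. 0, ?\<mu>) (setup_cost c S) (R0, ?\<mu>)"
      "R0 0 = 0" "R0 1 = S" "R0 2 = 2 ^ S" using runs_setup[where M = ?\<mu>, OF S c] by blast
    obtain R1 where R1: "runs (comp eZ [] 12) (R0, ?\<mu>) (tb eZ 0 S) (R1, ?\<mu>)" "R1 12 = Z"
      "\<And>r. r < 12 \<Longrightarrow> R1 r = R0 r"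
      by (rule compilesD[OF compiles_all[where S = S and \<mu> = ?\<mu> and e = eZ, OF S1 \<mu>], of "[]" 12 R0 ?\<mu> "[]" 0])
        (use R0 Z in auto)
    let ?R2 = "R1(5 := R1 12)"
    have r2: "runs (copy 5 12) (R1, ?\<mu>) (2 * unit_cost (a * S)) (?R2, ?\<mu>)"
      using ZI R1(2) by (intro runs_copy) auto
    obtain R3 where R3: "runs (comp eI [] 12) (?R2, ?\<mu>) (tb eI 0 S) (R3, ?\<mu>)" "R3 12 = I"
      "\<And>r. r < 12 \<Longrightarrow> R3 r = ?R2 r"
      by (rule compilesD[OF compiles_all[where S = S and \<mu> = ?\<mu> and e = eI, OF S1 \<mu>], of "[]" 12 ?R2 ?\<mu> "[]" 0])
        (use R0 R1 I in auto)
    let ?R4 = "R3(6 := R3 12)"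
    have r4: "runs (copy 6 12) (R3, ?\<mu>) (2 * unit_cost (a * S)) (?R4, ?\<mu>)"
      using ZI R3(2) by (intro runs_copy) auto
    have mem: "?\<mu> = (\<lambda>x. if x \<le> S then ?\<mu> x else 0)" using len by (auto simp: fun_eq_iff)
    have "\<exists>R' M'. runs (for_loop 3 5 10 (query_body P m e)) (?R4, ?\<mu>)
      (Z * (query_cost e a m S I t + 5 * unit_cost (a * S)) + 3 * unit_cost (a * S)) (R', M') \<and>
      (R' 0 \<noteq> 0 \<longleftrightarrow> (\<exists>z<Z. accepts P (ys z)))"
    proof (rule runs_queries[OF S1 \<mu> m(2,1) _ _ _ _ _ ZI mem])
      show "ys z = map (\<lambda>i. eval S ?\<mu> e [z, i]) [0..<I]" if "z < Z" for z
        using ys that by blast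
      show "\<exists>i. halted P (config_after P (ys z) i) \<and> (\<Sum>l<i. step_cost P (config_after P (ys z) l)) \<le> t"
        if "z < Z" for z using ys that by blast
    qed (use R0(2-4) R1(2,3) R3(2,3) in simp_all)
    then obtain R5 M5 where R5: "runs (for_loop 3 5 10 (query_body P m e)) (?R4, ?\<mu>)
      (Z * (query_cost e a m S I t + 5 * unit_cost (a * S)) + 3 * unit_cost (a * S)) (R5, M5)"
      "R5 0 \<noteq> 0 \<longleftrightarrow> (\<exists>z<Z. accepts P (ys z))" by blast
    let ?X = "I + t + 1"
    have "query_cost e a m S I t + 5 * unit_cost (a * S) = I * F1 S + F2 S + F3 S * t"
      unfolding query_cost_def F1_def F2_def F3_def by (simp add: algebra_simps)
    also have "\<dots> \<le> ?X * F1 S + ?X * F2 S + F3 S * ?X"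
      by (intro add_mono mult_right_mono mult_left_mono) (simp_all)
    finally have q: "query_cost e a m S I t + 5 * unit_cost (a * S) \<le> (F1 S + F2 S + F3 S) * ?X"
      by (simp add: algebra_simps)
    have "F0 S + Z * (query_cost e a m S I t + 5 * unit_cost (a * S)) \<le>
        F0 S * ((Z + 1) * ?X) + Z * ((F1 S + F2 S + F3 S) * ?X)"
      by (intro add_mono mult_left_mono q) simp_all
    also have "\<dots> \<le> F0 S * ((Z + 1) * ?X) + (Z + 1) * ((F1 S + F2 S + F3 S) * ?X)"
      by (intro add_left_mono mult_right_mono) simp_all
    also have "\<dots> = F S * ((Z + 1) * ?X)" unfolding F_def by (simp only: algebra_simps)
    finally have total: "F0 S + Z * (query_cost e a m S I t + 5 * unit_cost (a * S)) \<le> F S * ((Z + 1) * ?X)" .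
    have "runs main (\<lambda>_. 0, ?\<mu>) (F S * ((Z + 1) * ?X)) (R5, M5)"
      unfolding main_def
      by (rule runs_mono[OF runs_seq[OF R0(1) runs_seq[OF R1(1) runs_seq[OF r2 runs_seq[OF R3(1)
          runs_seq[OF r4 R5(1)]]]]]]) (use total in \<open>simp add: F0_def\<close>)
    then have "reach (main 0) (cfg 0 (\<lambda>_. 0, ?\<mu>)) (F S * ((Z + 1) * ?X)) (cfg (0 + length (main 0)) (R5, M5))"
      unfolding runs_def using code_at_self by blast
    moreover have "initial xs = cfg 0 (\<lambda>_. 0, ?\<mu>)" by (simp add: initial_def cfg_def)
    ultimately obtain i where i: "config_after (main 0) xs i = cfg (length (main 0)) (R5, M5)"
      "(\<Sum>l<i. step_cost (main 0) (config_after (main 0) xs l)) \<le> F S * ((Z + 1) * ?X)"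
      by (auto simp: reach_def config_after_def)
    show ?thesis
      by (intro exI[of _ i] conjI) (use i R5(2) in \<open>auto simp: halted_def\<close>)
  qed
  ultimately show ?thesis by (intro exI[of _ "main 0"] exI[of _ F]) blast
qed

section \<open>Sparsification\<close>

text \<open>
  The sparsification lemma of Impagliazzo, Paturi and Zane, for families of sets and hitting sets.
  The families only grow; a set is alive if no other member of the family is below it. The number
  of petal steps is bounded on every path, which bounds the number of paths.
\<close>

definition alive :: "nat set set \<Rightarrow> nat set \<Rightarrow> bool" where
  "alive K C \<longleftrightarrow> C \<in> K \<and> \<not> (\<exists>D\<in>K. D \<subset> C)"

definition petals :: "nat set set \<Rightarrow> nat \<Rightarrow> nat set \<Rightarrow> nat set set" where
  "petals K c H = {C - H | C. alive K C \<and> card C = c \<and> H \<subseteq> C}"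

locale sparsify =
  fixes V :: "nat set" and k W X :: nat
  assumes finite_V: "finite V" and W: "1 \<le> W" and X: "2 * W \<le> X" "2 * k + 1 \<le> X"
begin

text \<open>With the exponent \<open>2 * j - 1\<close> the product
  \<open>\<theta> l * \<theta> (i - l)\<close> is \<open>X ^ (2 * i - 2)\<close> for every
  \<open>l\<close>, one factor \<open>X\<close> below \<open>\<theta> i\<close>. That factor absorbs
  the sum over \<open>l\<close> in \<open>card_added\<close>.\<close>

definition \<theta> :: "nat \<Rightarrow> nat" where
  "\<theta> j = X ^ (2 * j - 1)"

lemma X_pos: "1 \<le> X" using X W by linarith

lemma \<theta>_pos: "1 \<le> \<theta> j"
  using X_pos by (simp add: \<theta>_def)

text \<open>A weak form of a sunflower with heart \<open>H\<close> and petals of size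
  \<open>j\<close>: the petals may overlap, and the threshold depends on the petal size
  only.\<close>

definition flower :: "nat set set \<Rightarrow> nat \<Rightarrow> nat \<Rightarrow> nat set \<Rightarrow> bool" where
  "flower K c j H \<longleftrightarrow> 1 \<le> j \<and> 1 \<le> card H \<and> card H + j = c \<and> c \<le> k \<and>
     \<theta> j \<le> card {C. alive K C \<and> card C = c \<and> H \<subseteq> C}"

text \<open>Least \<open>c\<close> first: no smaller set size has a flower, so the sizes below
  \<open>c\<close> are sparse. Least \<open>j\<close> next: few petals share a nonempty part
  \<open>S\<close>, since otherwise \<open>H \<union> S\<close> would be the heart of a flower with
  the same \<open>c\<close> and smaller petals.\<close>

definition min_flower :: "nat set set \<Rightarrow> nat \<Rightarrow> nat \<Rightarrow> nat set \<Rightarrow> bool" where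
  "min_flower K c j H \<longleftrightarrow> flower K c j H \<and>
     (\<forall>c' j' H'. flower K c' j' H' \<longrightarrow> c < c' \<or> c = c' \<and> j \<le> j')"

inductive path :: "nat set set \<Rightarrow> nat set set \<Rightarrow> nat set set \<Rightarrow> (nat \<Rightarrow> nat) \<Rightarrow> bool" for F where
  start: "path F F {} (\<lambda>_. 0)"
| heart: "path F K Ad p \<Longrightarrow> min_flower K c j H \<Longrightarrow> path F (insert H K) (insert H Ad) p"
| petal: "path F K Ad p \<Longrightarrow> min_flower K c j H \<Longrightarrow>
    path F (K \<union> petals K c H) (Ad \<union> petals K c H) (p(j := p j + 1))"

text \<open>Here \<open>Ad\<close> collects the sets added on the way and \<open>p j\<close> counts the petal steps adding
  sets of size \<open>j\<close>.\<close>

definition inv :: "nat set set \<Rightarrow> nat set set \<Rightarrow> bool" where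
  "inv K Ad \<longleftrightarrow> K \<subseteq> Pow V \<and> Ad \<subseteq> K \<and> {} \<notin> Ad \<and>
     (\<forall>i S. 1 \<le> card S \<longrightarrow> card S < i \<longrightarrow>
        card {C\<in>Ad. alive K C \<and> card C = i \<and> S \<subseteq> C} \<le> 2 * \<theta> (i - card S)) \<and>
     (\<forall>i. card {C\<in>Ad. card C = i \<and> \<not> alive K C} \<le>
        (\<Sum>l=1..<i. card {C\<in>Ad. card C = l} * (2 * \<theta> (i - l))))"

lemma invD:
  assumes "inv K Ad"
  shows "K \<subseteq> Pow V" "Ad \<subseteq> K" "{} \<notin> Ad"
    "1 \<le> card S \<Longrightarrow> card S < i \<Longrightarrow>
      card {C\<in>Ad. alive K C \<and> card C = i \<and> S \<subseteq> C} \<le> 2 * \<theta> (i - card S)"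
    "card {C\<in>Ad. card C = i \<and> \<not> alive K C} \<le>
      (\<Sum>l=1..<i. card {C\<in>Ad. card C = l} * (2 * \<theta> (i - l)))"
  using assms unfolding inv_def by blast+

lemma finite_family: "K \<subseteq> Pow V \<Longrightarrow> finite K"
  using finite_subset[of K "Pow V"] finite_V by simp

text \<open>Serves both kinds of step, with \<open>N\<close> the singleton of the heart or the set
  of petals. The new sets have equal size and no member of \<open>K\<close> below them, so they are
  alive on arrival. Only size \<open>m\<close> gains alive sets, and only sizes above
  \<open>m\<close> lose some.\<close>

lemma inv_extend:
  assumes inv: "inv K Ad" and N: "N \<subseteq> Pow V" "{} \<notin> N" "N \<inter> K = {}" "\<And>Y. Y \<in> N \<Longrightarrow> card Y = m"
    and min: "\<And>Y D. Y \<in> N \<Longrightarrow> D \<in> K \<Longrightarrow> \<not> D \<subset> Y"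
    and few: "\<And>S. 1 \<le> card S \<Longrightarrow> card S < m \<Longrightarrow> card {Y\<in>N. S \<subseteq> Y} \<le> \<theta> (m - card S)"
    and sparse: "\<And>S. 1 \<le> card S \<Longrightarrow> card S < m \<Longrightarrow>
      card {C. alive K C \<and> card C = m \<and> S \<subseteq> C} \<le> \<theta> (m - card S)"
  shows "inv (K \<union> N) (Ad \<union> N)"
proof -
  note K = invD(1-3)[OF inv] and I1 = invD(4)[OF inv] and I2 = invD(5)[OF inv]
  have finK: "finite K" and finN: "finite N" and finAd: "finite Ad"
    using finite_family[OF K(1)] finite_family[OF N(1)] K(2) finite_subset by auto
  have fin_mem: "finite C" if "C \<in> K \<union> N" for C
    using that K(1) N(1) by (intro finite_subset[OF _ finite_V]) auto
  have m: "1 \<le> m" if "Y \<in> N" for Y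
  proof -
    have "Y \<noteq> {}" using that N(2) by blast
    then have "0 < card Y" using fin_mem[of Y] that card_gt_0_iff[of Y] by simp
    then show ?thesis using N(4)[OF that] by simp
  qed
  have old_alive: "alive K C" if "alive (K \<union> N) C" "C \<in> K" for C
    using that by (auto simp: alive_def)
  have new_alive: "alive (K \<union> N) Y" if "Y \<in> N" for Y
  proof -
    have "\<not> D \<subset> Y" if "D \<in> N" for D
      using N(4)[OF that] N(4)[OF \<open>Y \<in> N\<close>] fin_mem[of Y] \<open>Y \<in> N\<close> psubset_card_mono[of Y D] by auto
    then show ?thesis using that min by (auto simp: alive_def)
  qed
  have 1: "card {C \<in> Ad \<union> N. alive (K \<union> N) C \<and> card C = i \<and> S \<subseteq> C} \<le> 2 * \<theta> (i - card S)"
    if S: "1 \<le> card S" "card S < i" for i S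
  proof (cases "i = m")
    case True
    have "{C \<in> Ad \<union> N. alive (K \<union> N) C \<and> card C = i \<and> S \<subseteq> C} \<subseteq>
        {C. alive K C \<and> card C = m \<and> S \<subseteq> C} \<union> {Y\<in>N. S \<subseteq> Y}"
      using old_alive K(2) True by auto
    moreover have "finite {C. alive K C \<and> card C = m \<and> S \<subseteq> C}"
      using finK by (rule finite_subset[rotated]) (auto simp: alive_def)
    ultimately have "card {C \<in> Ad \<union> N. alive (K \<union> N) C \<and> card C = i \<and> S \<subseteq> C} \<le>
        card ({C. alive K C \<and> card C = m \<and> S \<subseteq> C} \<union> {Y\<in>N. S \<subseteq> Y})"
      using finN by (intro card_mono) auto
    also have "\<dots> \<le> card {C. alive K C \<and> card C = m \<and> S \<subseteq> C} + card {Y\<in>N. S \<subseteq> Y}"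
      by (rule card_Un_le)
    also have "\<dots> \<le> 2 * \<theta> (i - card S)"
      using few[of S] sparse[of S] S True by simp
    finally show ?thesis .
  next
    case False
    have "card {C \<in> Ad \<union> N. alive (K \<union> N) C \<and> card C = i \<and> S \<subseteq> C} \<le>
        card {C \<in> Ad. alive K C \<and> card C = i \<and> S \<subseteq> C}"
      using finAd old_alive K(2) N(4) False by (intro card_mono) auto
    then show ?thesis using I1[OF S] by simp
  qed
  have 2: "card {C \<in> Ad \<union> N. card C = i \<and> \<not> alive (K \<union> N) C} \<le>
      (\<Sum>l=1..<i. card {C \<in> Ad \<union> N. card C = l} * (2 * \<theta> (i - l)))" for i
  proof -
    let ?old = "{C \<in> Ad. card C = i \<and> \<not> alive K C}"
    let ?killed = "\<lambda>D. {C \<in> Ad. alive K C \<and> card C = i \<and> D \<subseteq> C}"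
    have mono: "card {C \<in> Ad. card C = l} \<le> card {C \<in> Ad \<union> N. card C = l}" for l
      using finAd finN by (intro card_mono) auto
    show ?thesis
    proof (cases "m < i \<and> N \<noteq> {}")
      case True
      \<comment> \<open>A set that dies now was alive before and lies above some new
        \<open>D\<close>, so the bound on alive sets through \<open>D\<close> counts the victims of
        \<open>D\<close>.\<close>
      have "{C \<in> Ad \<union> N. card C = i \<and> \<not> alive (K \<union> N) C} \<subseteq> ?old \<union> (\<Union>D\<in>N. ?killed D)"
        using new_alive K(2) by (auto simp: alive_def)
      then have "card {C \<in> Ad \<union> N. card C = i \<and> \<not> alive (K \<union> N) C} \<le> card (?old \<union> (\<Union>D\<in>N. ?killed D))"
        using finAd finN by (intro card_mono) auto
      also have "\<dots> \<le> card ?old + card (\<Union>D\<in>N. ?killed D)"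
        by (rule card_Un_le)
      also have "card (\<Union>D\<in>N. ?killed D) \<le> (\<Sum>D\<in>N. card (?killed D))"
        using finN by (rule card_UN_le)
      also have "\<dots> \<le> (\<Sum>D\<in>N. 2 * \<theta> (i - m))"
      proof (rule sum_mono)
        fix D assume "D \<in> N"
        then have "card D = m" "1 \<le> m" using N(4) m by auto
        then show "card (?killed D) \<le> 2 * \<theta> (i - m)" using I1[of D i] True by simp
      qed
      also have "\<dots> = card N * (2 * \<theta> (i - m))" by simp
      finally have A: "card {C \<in> Ad \<union> N. card C = i \<and> \<not> alive (K \<union> N) C} \<le>
          (\<Sum>l=1..<i. card {C\<in>Ad. card C = l} * (2 * \<theta> (i - l))) + card N * (2 * \<theta> (i - m))"
        using I2[of i] by simp
      have "m \<in> {1..<i}" using True m by auto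
      have split: "card {C \<in> Ad \<union> N. card C = l} =
          card {C \<in> Ad. card C = l} + (if l = m then card N else 0)" for l
      proof -
        have "{C \<in> Ad \<union> N. card C = l} = {C \<in> Ad. card C = l} \<union> {C\<in>N. card C = l}" by blast
        moreover have "{C\<in>N. card C = l} = (if l = m then N else {})" using N(4) by auto
        moreover have "Ad \<inter> N = {}" using K(2) N(3) by blast
        ultimately show ?thesis using finAd finN
          by (auto simp: card_Un_disjoint intro!: card_Un_disjoint)
      qed
      have "(\<Sum>l=1..<i. card {C \<in> Ad \<union> N. card C = l} * (2 * \<theta> (i - l))) =
        (\<Sum>l=1..<i. card {C \<in> Ad. card C = l} * (2 * \<theta> (i - l)) +
          (if l = m then card N * (2 * \<theta> (i - l)) else 0))"
        unfolding split by (intro sum.cong) (auto simp: algebra_simps)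
      also have "\<dots> = (\<Sum>l=1..<i. card {C\<in>Ad. card C = l} * (2 * \<theta> (i - l))) + card N * (2 * \<theta> (i - m))"
        using \<open>m \<in> {1..<i}\<close> by (simp add: sum.distrib)
      finally show ?thesis using A by simp
    next
      case False
      have none: "\<not> D \<subset> C" if "D \<in> N" "card C = i" "C \<in> Ad" for D C
      proof
        assume "D \<subset> C"
        moreover have "finite C" using fin_mem that(3) K(2) by blast
        ultimately have "card D < card C" by (rule psubset_card_mono[rotated])
        then show False using N(4)[OF that(1)] that(1,2) False by auto
      qed
      have "{C \<in> Ad \<union> N. card C = i \<and> \<not> alive (K \<union> N) C} \<subseteq> ?old"
      proof
        fix C assume C: "C \<in> {C \<in> Ad \<union> N. card C = i \<and> \<not> alive (K \<union> N) C}"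
        then have CA: "C \<in> Ad" "card C = i" using new_alive by blast+
        have "\<not> alive K C"
        proof
          assume "alive K C"
          then have "alive (K \<union> N) C"
            using none[OF _ CA(2,1)] unfolding alive_def by blast
          then show False using C by blast
        qed
        then show "C \<in> ?old" using CA by blast
      qed
      then have "card {C \<in> Ad \<union> N. card C = i \<and> \<not> alive (K \<union> N) C} \<le> card ?old"
        using finAd by (intro card_mono) auto
      also have "\<dots> \<le> (\<Sum>l=1..<i. card {C\<in>Ad. card C = l} * (2 * \<theta> (i - l)))" by (rule I2)
      also have "\<dots> \<le> (\<Sum>l=1..<i. card {C\<in>Ad \<union> N. card C = l} * (2 * \<theta> (i - l)))"
        by (rule sum_mono, rule mult_right_mono[OF mono]) simp
      finally show ?thesis .
    qed
  qed
  have "K \<union> N \<subseteq> Pow V" "Ad \<union> N \<subseteq> K \<union> N" "{} \<notin> Ad \<union> N" using K N by auto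
  then show ?thesis unfolding inv_def using 1 2 by blast
qed

lemma flowerD:
  assumes "flower K c j H"
  shows "\<exists>C. alive K C \<and> card C = c \<and> H \<subset> C"
proof -
  have "0 < card {C. alive K C \<and> card C = c \<and> H \<subseteq> C}"
    using assms \<theta>_pos[of j] by (auto simp: flower_def)
  then obtain C where C: "alive K C" "card C = c" "H \<subseteq> C"
    by (auto simp: card_gt_0_iff)
  moreover have "H \<noteq> C" using assms C by (auto simp: flower_def)
  ultimately show ?thesis by blast
qed

text \<open>Hearts and petals lie properly inside an alive set; a member of \<open>K\<close> equal
  to or below one of them would contradict that this set is alive.\<close>

lemma flower_new:
  assumes "flower K c j H" "K \<subseteq> Pow V"
  shows "H \<notin> K" "D \<in> K \<Longrightarrow> \<not> D \<subset> H" "H \<subseteq> V" "H \<noteq> {}"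
    "petals K c H \<inter> K = {}" "Y \<in> petals K c H \<Longrightarrow> D \<in> K \<Longrightarrow> \<not> D \<subset> Y"
    "petals K c H \<subseteq> Pow V" "Y \<in> petals K c H \<Longrightarrow> card Y = j"
    "card (petals K c H) = card {C. alive K C \<and> card C = c \<and> H \<subseteq> C}"
proof -
  obtain C where C: "alive K C" "card C = c" "H \<subset> C" using flowerD[OF assms(1)] by blast
  show "H \<notin> K" using C by (auto simp: alive_def)
  show "\<not> D \<subset> H" if "D \<in> K" using C that by (auto simp: alive_def)
  show HV: "H \<subseteq> V" using C assms(2) by (auto simp: alive_def)
  show Hne: "H \<noteq> {}" using assms(1) by (auto simp: flower_def)
  have "Y \<notin> K" if Y: "Y \<in> petals K c H" for Y
  proof
    assume "Y \<in> K"
    obtain D where D: "alive K D" "Y = D - H" "H \<subseteq> D" using Y by (auto simp: petals_def)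
    then have "Y \<subset> D" using Hne by blast
    then show False using D(1) \<open>Y \<in> K\<close> unfolding alive_def by blast
  qed
  then show "petals K c H \<inter> K = {}" by blast
  show "\<not> D \<subset> Y" if Y: "Y \<in> petals K c H" and D: "D \<in> K"
  proof
    assume "D \<subset> Y"
    obtain C where "alive K C" "Y = C - H" using Y by (auto simp: petals_def)
    then show False using \<open>D \<subset> Y\<close> D unfolding alive_def by blast
  qed
  show "petals K c H \<subseteq> Pow V" using assms(2) by (auto simp: petals_def alive_def)
  have finH: "finite H" by (rule finite_subset[OF HV finite_V])
  show "card Y = j" if "Y \<in> petals K c H"
    using that assms(1) card_Diff_subset[OF finH] by (auto simp: petals_def flower_def)
  have "petals K c H = (\<lambda>C. C - H) ` {C. alive K C \<and> card C = c \<and> H \<subseteq> C}"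
    by (auto simp: petals_def)
  moreover have "inj_on (\<lambda>C. C - H) {C. alive K C \<and> card C = c \<and> H \<subseteq> C}"
    by (auto simp: inj_on_def)
  ultimately show "card (petals K c H) = card {C. alive K C \<and> card C = c \<and> H \<subseteq> C}"
    by (simp add: card_image)
qed

lemma min_flower_sparse:
  assumes "min_flower K c j H" "i < c" "1 \<le> card S" "card S < i"
  shows "card {C. alive K C \<and> card C = i \<and> S \<subseteq> C} \<le> \<theta> (i - card S)"
proof (rule ccontr)
  assume "\<not> ?thesis"
  then have "flower K i (i - card S) S"
    using assms by (auto simp: flower_def min_flower_def)
  then have "c < i \<or> c = i \<and> j \<le> i - card S"
    using assms(1) unfolding min_flower_def by blast
  then show False using assms(2) by simp
qed

text \<open>A petal step adds at least \<open>\<theta> j\<close> sets of size \<open>j\<close>, all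
  of them new. Counting petal steps is thereby reduced to counting added sets.\<close>

lemma path_inv:
  assumes "path F K Ad p" "F \<subseteq> Pow V"
  shows "inv K Ad \<and> (\<forall>j. p j * \<theta> j \<le> card {C\<in>Ad. card C = j}) \<and> (\<forall>j. j = 0 \<or> k \<le> j \<longrightarrow> p j = 0)"
  using assms
proof (induction rule: path.induct)
  case start
  then show ?case by (auto simp: inv_def)
next
  case (heart K Ad p c j H)
  then have I: "inv K Ad" and P: "\<forall>j. p j * \<theta> j \<le> card {C\<in>Ad. card C = j}" by auto
  have K: "K \<subseteq> Pow V" "finite Ad"
    using invD(1,2)[OF I] finite_family[of K] by (auto intro: finite_subset)
  have fl: "flower K c j H" using heart by (simp add: min_flower_def)
  note new = flower_new[OF fl K(1)]
  have c: "card H < c" "1 \<le> card H" using fl by (auto simp: flower_def)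
  have "inv (K \<union> {H}) (Ad \<union> {H})"
  proof (rule inv_extend[OF I, where m = "card H"])
    show "card {Y \<in> {H}. S \<subseteq> Y} \<le> \<theta> (card H - card S)" for S
    proof -
      have "card {Y \<in> {H}. S \<subseteq> Y} \<le> card {H}" by (intro card_mono) auto
      then show ?thesis using \<theta>_pos[of "card H - card S"] by simp
    qed
  qed (use new c min_flower_sparse[OF heart(2)] in auto)
  moreover have "card {C\<in>Ad. card C = l} \<le> card {C\<in>insert H Ad. card C = l}" for l
    using K(2) by (intro card_mono) auto
  ultimately show ?case using heart P by (auto intro: order.trans)
next
  case (petal K Ad p c j H)
  then have I: "inv K Ad" and P: "\<forall>j. p j * \<theta> j \<le> card {C\<in>Ad. card C = j}"
    and Z: "\<forall>j. j = 0 \<or> k \<le> j \<longrightarrow> p j = 0" by auto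
  note K = invD(1,2)[OF I]
  have fin: "finite K" "finite Ad" using finite_family[OF K(1)] K(2) finite_subset by auto
  have fl: "flower K c j H" using petal by (simp add: min_flower_def)
  note new = flower_new[OF fl K(1)]
  let ?N = "petals K c H"
  have c: "j < c" "1 \<le> j" "c \<le> k" "1 \<le> card H" "card H + j = c" using fl by (auto simp: flower_def)
  have finN: "finite ?N" using new(7) finite_family by blast
  have finH: "finite H" by (rule finite_subset[OF new(3) finite_V])
  have ne: "{} \<notin> ?N" using new(8)[of "{}"] c by auto
  have "inv (K \<union> ?N) (Ad \<union> ?N)"
  proof (rule inv_extend[OF I, where m = j])
    fix S :: "nat set" assume S: "1 \<le> card S" "card S < j"
    have finS: "finite S" using S(1) card.infinite by fastforce
    show "card {Y \<in> ?N. S \<subseteq> Y} \<le> \<theta> (j - card S)"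
    proof (cases "S \<inter> H = {}")
      case False
      then have "{Y \<in> ?N. S \<subseteq> Y} = {}" by (auto simp: petals_def)
      then show ?thesis by (simp only: card.empty)
    next
      case True
      have cu: "card (H \<union> S) = card H + card S" using True finH finS by (intro card_Un_disjoint) auto
      have "\<not> flower K c (j - card S) (H \<union> S)"
      proof
        assume "flower K c (j - card S) (H \<union> S)"
        then have "c < c \<or> c = c \<and> j \<le> j - card S"
          using petal(2) unfolding min_flower_def by blast
        then show False using S by simp
      qed
      then have less: "card {C. alive K C \<and> card C = c \<and> H \<union> S \<subseteq> C} < \<theta> (j - card S)"
        using cu S c by (auto simp: flower_def)
      have "{Y \<in> ?N. S \<subseteq> Y} \<subseteq> (\<lambda>C. C - H) ` {C. alive K C \<and> card C = c \<and> H \<union> S \<subseteq> C}"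
        by (auto simp: petals_def)
      moreover have "finite {C. alive K C \<and> card C = c \<and> H \<union> S \<subseteq> C}"
        using fin(1) by (rule finite_subset[rotated]) (auto simp: alive_def)
      ultimately have "card {Y \<in> ?N. S \<subseteq> Y} \<le> card {C. alive K C \<and> card C = c \<and> H \<union> S \<subseteq> C}"
        by (meson card_image_le card_mono finite_imageI le_trans)
      then show ?thesis using less by simp
    qed
  qed (use new c ne min_flower_sparse[OF petal(2)] in auto)
  moreover have "(p(j := p j + 1)) l * \<theta> l \<le> card {C\<in>Ad \<union> ?N. card C = l}" for l
  proof (cases "l = j")
    case True
    have "{C\<in>Ad \<union> ?N. card C = j} = {C\<in>Ad. card C = j} \<union> ?N" using new(8) by auto
    moreover have "{C\<in>Ad. card C = j} \<inter> ?N = {}" using K(2) new(5) by blast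
    ultimately have "card {C\<in>Ad \<union> ?N. card C = j} = card {C\<in>Ad. card C = j} + card ?N"
      using fin finN by (simp add: card_Un_disjoint)
    moreover have "\<theta> j \<le> card ?N" using new(9) fl by (simp add: flower_def)
    moreover have "p j * \<theta> j \<le> card {C\<in>Ad. card C = j}" using P by blast
    ultimately show ?thesis using True by simp
  next
    case False
    have "card {C\<in>Ad. card C = l} \<le> card {C\<in>Ad \<union> ?N. card C = l}"
      using fin finN by (intro card_mono) auto
    then show ?thesis using P False by (auto intro: order.trans)
  qed
  ultimately show ?case using Z c by auto
qed

lemma \<theta>_mult: "1 \<le> l \<Longrightarrow> l < i \<Longrightarrow> \<theta> l * \<theta> (i - l) = X ^ (2 * i - 2)"
  unfolding \<theta>_def power_add[symmetric] by (rule arg_cong[of _ _ "power X"]) linarith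

text \<open>The alive added sets are counted through their elements, the dead ones through their
  killers. After multiplication by \<open>W\<close>, the alive part is at most
  \<open>card V * X ^ (2 * i - 2)\<close> because \<open>2 * W \<le> X\<close>, and by induction
  each of the \<open>i - 1\<close> sizes of killers contributes
  \<open>2 * card V * X ^ (2 * i - 2)\<close>. Since \<open>2 * k + 1 \<le> X\<close>, the total
  stays below \<open>card V * \<theta> i\<close>.\<close>

lemma card_added:
  assumes inv: "inv K Ad" and i: "1 \<le> i" "i < k"
  shows "W * card {C\<in>Ad. card C = i} \<le> card V * \<theta> i"
  using i
proof (induction i rule: less_induct)
  case (less i)
  let ?B = "\<lambda>i. card {C\<in>Ad. card C = i}"
  note K = invD(1,2)[OF inv]
  have fin: "finite Ad" using finite_family[OF K(1)] K(2) finite_subset by auto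
  show ?case
  proof (cases "i = 1")
    case True
    have "{C\<in>Ad. card C = i} \<subseteq> (\<lambda>x. {x}) ` V"
    proof
      fix C assume "C \<in> {C\<in>Ad. card C = i}"
      then have "C \<in> Ad" "card C = 1" using True by auto
      then obtain x where "C = {x}" by (auto simp: card_1_singleton_iff)
      then show "C \<in> (\<lambda>x. {x}) ` V" using \<open>C \<in> Ad\<close> K by auto
    qed
    then have "?B i \<le> card V" using finite_V by (meson card_image_le card_mono finite_imageI le_trans)
    moreover have "W \<le> \<theta> i" using X True by (simp add: \<theta>_def)
    ultimately show ?thesis by (subst mult.commute) (rule mult_mono, auto)
  next
    case False
    with less.prems have i2: "2 \<le> i" by simp
    let ?al = "{C\<in>Ad. alive K C \<and> card C = i}"
    have "?al \<subseteq> (\<Union>x\<in>V. {C\<in>Ad. alive K C \<and> card C = i \<and> {x} \<subseteq> C})"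
    proof
      fix C assume C: "C \<in> ?al"
      then have "C \<noteq> {}" using i2 by auto
      then obtain x where "x \<in> C" by blast
      moreover have "C \<subseteq> V" using C K by auto
      ultimately show "C \<in> (\<Union>x\<in>V. {C\<in>Ad. alive K C \<and> card C = i \<and> {x} \<subseteq> C})" using C by blast
    qed
    then have "card ?al \<le> card (\<Union>x\<in>V. {C\<in>Ad. alive K C \<and> card C = i \<and> {x} \<subseteq> C})"
      using fin finite_V by (intro card_mono) auto
    also have "\<dots> \<le> (\<Sum>x\<in>V. card {C\<in>Ad. alive K C \<and> card C = i \<and> {x} \<subseteq> C})"
      using finite_V by (rule card_UN_le)
    also have "\<dots> \<le> (\<Sum>x\<in>V. 2 * \<theta> (i - 1))"
    proof (rule sum_mono)
      fix x
      show "card {C\<in>Ad. alive K C \<and> card C = i \<and> {x} \<subseteq> C} \<le> 2 * \<theta> (i - 1)"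
        using invD(4)[OF inv, of "{x}" i] i2 by simp
    qed
    finally have al: "card ?al \<le> card V * (2 * \<theta> (i - 1))" by simp
    have dead: "card {C\<in>Ad. card C = i \<and> \<not> alive K C} \<le> (\<Sum>l=1..<i. ?B l * (2 * \<theta> (i - l)))"
      by (rule invD(5)[OF inv])
    have "{C\<in>Ad. card C = i} = ?al \<union> {C\<in>Ad. card C = i \<and> \<not> alive K C}" by blast
    then have "?B i \<le> card ?al + card {C\<in>Ad. card C = i \<and> \<not> alive K C}"
      by (simp add: card_Un_le)
    then have "?B i \<le> card V * (2 * \<theta> (i - 1)) + (\<Sum>l=1..<i. ?B l * (2 * \<theta> (i - l)))"
      using al dead by linarith
    then have "W * ?B i \<le> W * (card V * (2 * \<theta> (i - 1)) + (\<Sum>l=1..<i. ?B l * (2 * \<theta> (i - l))))"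
      by (rule mult_left_mono) simp
    also have "\<dots> = card V * (2 * W * \<theta> (i - 1)) + (\<Sum>l=1..<i. (W * ?B l) * (2 * \<theta> (i - l)))"
      by (simp add: algebra_simps sum_distrib_left)
    also have "\<dots> \<le> card V * (2 * W * \<theta> (i - 1)) + (\<Sum>l=1..<i. (card V * \<theta> l) * (2 * \<theta> (i - l)))"
      using less by (intro add_left_mono sum_mono mult_right_mono) auto
    also have "(\<Sum>l=1..<i. (card V * \<theta> l) * (2 * \<theta> (i - l))) = (\<Sum>l=1..<i. card V * (2 * X ^ (2 * i - 2)))"
      using \<theta>_mult[of _ i] by (intro sum.cong) (auto simp: mult.assoc mult.left_commute)
    also have "\<dots> = card V * ((i - 1) * (2 * X ^ (2 * i - 2)))" by simp
    also have "card V * (2 * W * \<theta> (i - 1)) + card V * ((i - 1) * (2 * X ^ (2 * i - 2))) \<le> card V * \<theta> i"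
    proof -
      have e1: "\<theta> i = X * X ^ (2 * i - 2)"
        unfolding \<theta>_def power_Suc[symmetric] using i2 by (intro arg_cong[of _ _ "power X"]) linarith
      have e2: "X ^ (2 * i - 2) = X * \<theta> (i - 1)"
        unfolding \<theta>_def power_Suc[symmetric] using i2 by (intro arg_cong[of _ _ "power X"]) linarith
      have "2 * W * \<theta> (i - 1) \<le> X * \<theta> (i - 1)" using X(1) by (rule mult_right_mono) simp
      then have "2 * W * \<theta> (i - 1) + (i - 1) * (2 * X ^ (2 * i - 2)) \<le> (1 + (i - 1) * 2) * X ^ (2 * i - 2)"
        unfolding e2 distrib_right by simp
      also have "\<dots> \<le> X * X ^ (2 * i - 2)" using X(2) less.prems(2) by (intro mult_right_mono) auto
      finally show ?thesis unfolding e1 distrib_left[symmetric] by (rule mult_left_mono) simp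
    qed
    finally show ?thesis .
  qed
qed

text \<open>Comparing the lower and the upper bound on added sets of size \<open>j\<close> cancels
  \<open>\<theta> j\<close> and leaves at most \<open>card V / W\<close> petal steps for each petal
  size.\<close>

lemma petal_steps:
  assumes "path F K Ad p" "F \<subseteq> Pow V"
  shows "W * (\<Sum>j<k. p j) \<le> k * card V"
proof -
  have I: "inv K Ad" "\<And>j. p j * \<theta> j \<le> card {C\<in>Ad. card C = j}" "\<And>j. j = 0 \<or> k \<le> j \<Longrightarrow> p j = 0"
    using path_inv[OF assms] by auto
  have "W * p j \<le> card V" if "j < k" for j
  proof (cases "j = 0")
    case False
    have "W * p j * \<theta> j \<le> W * card {C\<in>Ad. card C = j}"
      using I(2)[of j] by (simp add: mult.assoc)
    also have "\<dots> \<le> card V * \<theta> j" using card_added[OF I(1), of j] that False by simp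
    finally show ?thesis using \<theta>_pos[of j] by simp
  qed (use I in simp)
  then have "(\<Sum>j<k. W * p j) \<le> (\<Sum>j<k. card V)" by (intro sum_mono) simp
  then show ?thesis by (simp add: sum_distrib_left)
qed

text \<open>Every singleton is a potential heart, so without flowers fewer than
  \<open>\<theta> (c - 1)\<close> alive sets of size \<open>c \<ge> 2\<close> share a given point.
  Size 1 contributes one set per point and size 0 at most one set.\<close>

lemma card_alive:
  assumes K: "K \<subseteq> Pow V" "\<And>C. C \<in> K \<Longrightarrow> card C \<le> k" and none: "\<And>c j H. \<not> flower K c j H" and V: "V \<noteq> {}"
  shows "card {C. alive K C} \<le> 2 * (k + 1) * X ^ (2 * k) * card V"
proof -
  let ?c = "\<lambda>c. {C. alive K C \<and> card C = c}"
  have fin: "finite K" using finite_family[OF K(1)] .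
  have v1: "1 \<le> card V" using V finite_V by (simp add: Suc_le_eq card_gt_0_iff)
  have X1: "X ^ (2 * k) \<ge> 1" using X_pos by simp
  have finc: "finite (?c c)" for c
    using fin by (rule finite_subset[rotated]) (auto simp: alive_def)
  have each: "card (?c c) \<le> 2 * X ^ (2 * k) * card V" if c: "c \<le> k" for c
  proof (cases "c = 0")
    case True
    have "?c c \<subseteq> {{}}"
    proof
      fix C assume "C \<in> ?c c"
      then have "C \<subseteq> V" "card C = 0" using K(1) True by (auto simp: alive_def)
      then have "finite C" "card C = 0" by (auto intro: finite_subset[OF _ finite_V])
      then show "C \<in> {{}}" by simp
    qed
    then have "card (?c c) \<le> card {{} :: nat set}" by (intro card_mono) auto
    also have "\<dots> = 1" by simp
    also have "1 \<le> 2 * X ^ (2 * k) * card V" using v1 X1 by simp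
    finally show ?thesis .
  next
    case False
    have sub: "?c c \<subseteq> (\<Union>x\<in>V. {C. alive K C \<and> card C = c \<and> {x} \<subseteq> C})"
    proof
      fix C assume C: "C \<in> ?c c"
      then have "C \<noteq> {}" using False by auto
      then obtain x where "x \<in> C" by blast
      moreover have "C \<subseteq> V" using C K by (auto simp: alive_def)
      ultimately show "C \<in> (\<Union>x\<in>V. {C. alive K C \<and> card C = c \<and> {x} \<subseteq> C})" using C by blast
    qed
    have finx: "finite {C. alive K C \<and> card C = c \<and> {x} \<subseteq> C}" for x
      using fin by (rule finite_subset[rotated]) (auto simp: alive_def)
    have "card (?c c) \<le> card (\<Union>x\<in>V. {C. alive K C \<and> card C = c \<and> {x} \<subseteq> C})"
      using sub finx finite_V by (intro card_mono) auto
    also have "\<dots> \<le> (\<Sum>x\<in>V. card {C. alive K C \<and> card C = c \<and> {x} \<subseteq> C})"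
      using finite_V by (rule card_UN_le)
    also have "\<dots> \<le> (\<Sum>x\<in>V. X ^ (2 * k))"
    proof (rule sum_mono)
      fix x
      show "card {C. alive K C \<and> card C = c \<and> {x} \<subseteq> C} \<le> X ^ (2 * k)"
      proof (cases "c = 1")
        case True
        have "{C. alive K C \<and> card C = c \<and> {x} \<subseteq> C} \<subseteq> {{x}}"
          using True by (auto simp: card_1_singleton_iff)
        then have "card {C. alive K C \<and> card C = c \<and> {x} \<subseteq> C} \<le> card {{x}}" by (intro card_mono) auto
        then show ?thesis using X1 by simp
      next
        case c2: False
        have "\<not> flower K c (c - 1) {x}" by (rule none)
        then have "card {C. alive K C \<and> card C = c \<and> {x} \<subseteq> C} \<le> \<theta> (c - 1)"
          using c2 False c by (auto simp: flower_def)
        also have "\<dots> \<le> X ^ (2 * k)" unfolding \<theta>_def using X_pos c by (intro power_increasing) auto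
        finally show ?thesis .
      qed
    qed
    finally have "card (?c c) \<le> card V * X ^ (2 * k)" by simp
    then show ?thesis by (simp add: mult.commute)
  qed
  have "{C. alive K C} = (\<Union>c\<in>{..k}. ?c c)" using K(2) by (auto simp: alive_def)
  then have "card {C. alive K C} \<le> (\<Sum>c\<in>{..k}. card (?c c))"
    by (simp add: card_UN_le)
  also have "\<dots> \<le> (\<Sum>c\<in>{..k}. 2 * X ^ (2 * k) * card V)"
    using each by (intro sum_mono) auto
  also have "\<dots> = 2 * (k + 1) * X ^ (2 * k) * card V" by (simp add: algebra_simps)
  finally show ?thesis .
qed

end

section \<open>Codes of sets and the deterministic sparsification process\<close>

definition dig :: "nat \<Rightarrow> nat \<Rightarrow> nat \<Rightarrow> nat" where
  "dig w u i = u div 2 ^ (w * i) mod 2 ^ w"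

lemma dig_less: "dig w u i < 2 ^ w"
  by (simp add: dig_def)

lemma mult_split:
  fixes w :: nat
  assumes "i < n"
  shows "w * n = w * i + (w * (n - i - 1) + w)"
proof -
  obtain j where n: "n = Suc (i + j)" using less_imp_Suc_add[OF assms] by blast
  show ?thesis unfolding n by (simp add: algebra_simps)
qed

lemma digits_sum:
  assumes "\<And>i. i < n \<Longrightarrow> d i < 2 ^ w"
  shows "(\<Sum>i<n. d i * 2 ^ (w * i)) < 2 ^ (w * n) \<and> (\<forall>i<n. dig w (\<Sum>i<n. d i * 2 ^ (w * i)) i = d i)"
  using assms
proof (induction n)
  case 0
  then show ?case by auto
next
  case (Suc n)
  define u where "u = (\<Sum>i<n. d i * 2 ^ (w * i))"
  have u: "u < 2 ^ (w * n)" "\<forall>i<n. dig w u i = d i" using Suc by (auto simp: u_def)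
  let ?v = "u + d n * 2 ^ (w * n)"
  have "?v < 2 ^ (w * n) + d n * 2 ^ (w * n)" using u(1) by simp
  also have "\<dots> = (1 + d n) * 2 ^ (w * n)" by simp
  also have "\<dots> \<le> 2 ^ w * 2 ^ (w * n)" using Suc.prems[of n] by (intro mult_right_mono) auto
  finally have "?v < 2 ^ (w * Suc n)" by (simp add: power_add)
  moreover have "dig w ?v i = d i" if "i < Suc n" for i
  proof (cases "i = n")
    case True
    then show ?thesis using u(1) Suc.prems[of n] by (simp add: dig_def)
  next
    case False
    then have i: "i < n" using that by simp
    have "w * n = w * i + (w * (n - i - 1) + w)" using i by (rule mult_split)
    then have p: "(2::nat) ^ (w * n) = 2 ^ (w * i) * (2 ^ (w * (n - i - 1)) * 2 ^ w)"
      by (simp add: power_add)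
    have "?v div 2 ^ (w * i) = u div 2 ^ (w * i) + d n * 2 ^ (w * (n - i - 1)) * 2 ^ w"
      using div_mult_self1[of "2 ^ (w * i)" u "d n * 2 ^ (w * (n - i - 1)) * 2 ^ w"]
      unfolding p by (simp add: ac_simps)
    then have "dig w ?v i = dig w u i" by (simp add: dig_def)
    then show ?thesis using u(2) i by simp
  qed
  moreover have "(\<Sum>i<Suc n. d i * 2 ^ (w * i)) = ?v" by (simp add: u_def)
  ultimately show ?case by (simp only:) blast
qed

lemma digits_exist:
  assumes "\<And>i. i < n \<Longrightarrow> d i < 2 ^ w"
  shows "\<exists>u<2 ^ (w * n). \<forall>i<n. dig w u i = d i"
  using digits_sum[of n d w, OF assms] by blast

lemma digits_inj:
  assumes "u < 2 ^ (w * n)" "v < 2 ^ (w * n)" "\<And>i. i < n \<Longrightarrow> dig w u i = dig w v i"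
  shows "u = v"
  using assms
proof (induction n arbitrary: u v)
  case 0
  then show ?case by simp
next
  case (Suc n)
  let ?p = "2 ^ (w * n) :: nat"
  have dm: "dig w (x mod ?p) i = dig w x i" if "i < n" for x i
  proof -
    have "w * n = w * i + (w * (n - i - 1) + w)" using that by (rule mult_split)
    then have p: "?p = 2 ^ (w * i) * (2 ^ w * 2 ^ (w * (n - i - 1)))"
      by (simp add: power_add mult.commute)
    have "x mod ?p div 2 ^ (w * i) = x div 2 ^ (w * i) mod (2 ^ w * 2 ^ (w * (n - i - 1)))"
      unfolding p by (simp add: div_mult2_eq mod_mult2_eq)
    then show ?thesis by (simp add: dig_def mod_mult2_eq)
  qed
  have "u mod ?p = v mod ?p"
    by (rule Suc.IH) (use Suc.prems(3) dm in auto)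
  moreover have "x div ?p = dig w x n" if "x < 2 ^ (w * Suc n)" for x
  proof -
    have "x div ?p < 2 ^ w"
      using that by (intro less_mult_imp_div_less) (simp add: power_add)
    then show ?thesis by (simp add: dig_def)
  qed
  ultimately show ?case
    using Suc.prems by (metis div_mult_mod_eq lessI)
qed

section \<open>Sparsification driven by a set of decision times\<close>

locale process =
  fixes lb k W X :: nat
  assumes W: "1 \<le> W" and X: "2 * W \<le> X" "2 * k + 1 \<le> X" and lb: "1 \<le> lb"
begin

definition V :: "nat set" where "V = {1..<2 ^ lb}"

sublocale sparsify V k W X
  using W X by unfold_locales (auto simp: V_def)

definition U :: nat where "U = 2 ^ (lb * k)"

text \<open>The digit 0 is padding, which is why \<open>V\<close> starts at 1: sets with fewer than
  \<open>k\<close> elements get codes too. Codes are not unique, as digits can be permuted or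
  repeated.\<close>

definition lits :: "nat \<Rightarrow> nat set" where
  "lits u = {dig lb u i | i. i < k} - {0}"

lemma lits_V: "lits u \<subseteq> V"
  using dig_less by (auto simp: lits_def V_def Suc_le_eq)

lemma card_lits: "card (lits u) \<le> k"
proof -
  have "lits u \<subseteq> dig lb u ` {..<k}" by (auto simp: lits_def)
  then have "card (lits u) \<le> card (dig lb u ` {..<k})" by (intro card_mono) auto
  also have "\<dots> \<le> card {..<k}" by (rule card_image_le) simp
  finally show ?thesis by simp
qed

lemma lits_surj:
  assumes "S \<subseteq> V" "card S \<le> k"
  shows "\<exists>u<U. lits u = S"
proof -
  have fin: "finite S" using assms(1) finite_V finite_subset by auto
  then obtain xs where xs: "set xs = S" "distinct xs" using finite_distinct_list by blast
  have len: "length xs \<le> k" using xs assms(2) distinct_card by fastforce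
  let ?d = "\<lambda>i. if i < length xs then xs ! i else 0"
  have "?d i < 2 ^ lb" for i
    using assms(1) xs(1) by (auto simp: V_def dest!: nth_mem)
  then obtain u where u: "u < 2 ^ (lb * k)" "\<forall>i<k. dig lb u i = ?d i"
    using digits_exist[of k ?d lb] by auto
  have "lits u = S"
  proof
    show "lits u \<subseteq> S"
    proof
      fix x assume "x \<in> lits u"
      then obtain i where i: "i < k" "x = dig lb u i" "x \<noteq> 0" by (auto simp: lits_def)
      then have "x = ?d i" using u(2) by auto
      then have "i < length xs" "x = xs ! i" using i(3) by (auto split: if_splits)
      then show "x \<in> S" using xs(1) by auto
    qed
    show "S \<subseteq> lits u"
    proof
      fix x assume x: "x \<in> S"
      then obtain i where i: "i < length xs" "x = xs ! i" using xs(1) by (metis in_set_conv_nth)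
      then have "dig lb u i = x" "i < k" using u(2) len by auto
      moreover have "x \<noteq> 0" using x assms(1) by (auto simp: V_def)
      ultimately show "x \<in> lits u" by (auto simp: lits_def)
    qed
  qed
  then show ?thesis using u(1) by (auto simp: U_def)
qed

abbreviation codable :: "nat set set" where "codable \<equiv> lits ` {..<U}"

lemma codable_iff: "S \<in> codable \<longleftrightarrow> S \<subseteq> V \<and> card S \<le> k"
  using lits_V card_lits lits_surj by (auto simp: image_iff) (metis lessThan_iff)

text \<open>The number \<open>f\<close> packs \<open>c\<close>, \<open>j\<close> and a code of
  \<open>H\<close>, in this order of significance. The least \<open>f\<close> therefore belongs to a
  flower that is minimal in the sense of \<open>min_flower\<close>.\<close>

definition flw :: "nat set set \<Rightarrow> nat \<Rightarrow> bool" where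
  "flw K f \<longleftrightarrow> flower K (f div U div (k + 1)) (f div U mod (k + 1)) (lits (f mod U))"

definition Fm :: nat where "Fm = (k + 1) * (k + 1) * U"

definition least_flw :: "nat set set \<Rightarrow> nat" where
  "least_flw K = (LEAST f. flw K f)"

definition next_fam :: "nat set set \<Rightarrow> bool \<Rightarrow> nat set set" where
  "next_fam K d = (if \<exists>f<Fm. flw K f then
     let f = least_flw K in
       if d then K \<union> petals K (f div U div (k + 1)) (lits (f mod U)) else insert (lits (f mod U)) K
     else K)"

text \<open>A run is determined by the starting family and the set \<open>D\<close> of times at
  which petals are chosen; all other steps add the heart. Naming the petal times is the cheap
  description, because only petal steps are known to be few.\<close>

primrec fams :: "nat set set \<Rightarrow> nat set \<Rightarrow> nat \<Rightarrow> nat set set" where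
  "fams F D 0 = F"
| "fams F D (Suc t) = next_fam (fams F D t) (t \<in> D)"

lemma flower_code:
  assumes "K \<subseteq> codable" "flower K c j H"
  shows "\<exists>f<Fm. flw K f \<and> f div U = c * (k + 1) + j"
proof -
  have K: "K \<subseteq> Pow V" using assms(1) codable_iff by auto
  have HV: "H \<subseteq> V" using flower_new(3)[OF assms(2) K] .
  have h: "card H \<le> k" "1 \<le> j" "c \<le> k" "j < k + 1" using assms(2) by (auto simp: flower_def)
  obtain u where u: "u < U" "lits u = H" using lits_surj[OF HV h(1)] by blast
  let ?f = "(c * (k + 1) + j) * U + u"
  have d: "?f div U = c * (k + 1) + j" "?f mod U = u" using u(1) by simp_all
  have "(c * (k + 1) + j) div (k + 1) = c" "(c * (k + 1) + j) mod (k + 1) = j"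
    using h(4) by (simp_all only: div_mult_self3 mod_mult_self3 div_less mod_less)
  then have "flw K ?f" using assms(2) u(2) unfolding flw_def d by simp
  moreover have "?f < Fm"
  proof -
    have "c * (k + 1) + j + 1 \<le> (c + 1) * (k + 1)" using h(4) by simp
    also have "\<dots> \<le> (k + 1) * (k + 1)" using h(3) by (intro mult_right_mono) auto
    finally have "(c * (k + 1) + j + 1) * U \<le> (k + 1) * (k + 1) * U" by (rule mult_right_mono) simp
    moreover have "(x + 1) * U = x * U + U" for x by simp
    then have "?f < (c * (k + 1) + j + 1) * U" using u(1) by (simp only: add_less_cancel_left)
    ultimately show ?thesis unfolding Fm_def by (meson order.strict_trans2)
  qed
  ultimately show ?thesis using d by blast
qed

lemma least_flw_min_flower:
  assumes "K \<subseteq> codable" "\<exists>f<Fm. flw K f"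
  shows "min_flower K (least_flw K div U div (k + 1)) (least_flw K div U mod (k + 1)) (lits (least_flw K mod U))"
proof -
  let ?f = "least_flw K"
  have fl: "flw K ?f" unfolding least_flw_def using assms(2) by (auto intro: LeastI)
  have "?f div U div (k + 1) < c' \<or> ?f div U div (k + 1) = c' \<and> ?f div U mod (k + 1) \<le> j'"
    if that': "flower K c' j' H'" for c' j' H'
  proof -
    obtain f' where f': "flw K f'" "f' div U = c' * (k + 1) + j'"
      using flower_code[OF assms(1) that'] by blast
    have "?f \<le> f'" unfolding least_flw_def using f'(1) by (rule Least_le)
    then have le: "?f div U \<le> c' * (k + 1) + j'" using f'(2) div_le_mono by metis
    have j: "j' < k + 1" using that' by (auto simp: flower_def)
    let ?c = "?f div U div (k + 1)" and ?j = "?f div U mod (k + 1)"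
    have e: "?f div U = ?c * (k + 1) + ?j" by (rule div_mult_mod_eq[symmetric])
    show ?thesis
    proof (cases "?c < c'")
      case False
      have "?c \<le> (c' * (k + 1) + j') div (k + 1)" using le by (rule div_le_mono)
      also have "\<dots> = c'" using j by (subst div_mult_self3) auto
      finally have "?c = c'" using False by simp
      then show ?thesis using le e by (metis add_le_cancel_left)
    qed simp
  qed
  then show ?thesis using fl unfolding min_flower_def flw_def by blast
qed

lemma next_fam_path:
  assumes K: "K \<subseteq> codable" and path: "path F K Ad p" and F: "F \<subseteq> Pow V"
  shows "next_fam K d \<subseteq> codable \<and> (\<exists>Ad' p'. path F (next_fam K d) Ad' p' \<and>
    (\<Sum>j<k. p' j) = (\<Sum>j<k. p j) + (if d \<and> (\<exists>f<Fm. flw K f) then 1 else 0))"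
proof (cases "\<exists>f<Fm. flw K f")
  case False
  then show ?thesis using K path by (auto simp: next_fam_def)
next
  case True
  let ?f = "least_flw K"
  let ?c = "?f div U div (k + 1)" and ?j = "?f div U mod (k + 1)" and ?H = "lits (?f mod U)"
  have mf: "min_flower K ?c ?j ?H" by (rule least_flw_min_flower[OF K True])
  then have fl: "flower K ?c ?j ?H" by (simp add: min_flower_def)
  have KV: "K \<subseteq> Pow V" using K codable_iff by auto
  have j: "1 \<le> ?j" "?j < k" "?c \<le> k" using fl by (auto simp: flower_def)
  show ?thesis
  proof (cases d)
    case d: True
    then have n: "next_fam K d = K \<union> petals K ?c ?H"
      using True by (simp add: next_fam_def Let_def)
    have "petals K ?c ?H \<subseteq> codable"
    proof
      fix Y assume Y: "Y \<in> petals K ?c ?H"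
      have "Y \<subseteq> V" "card Y = ?j" using flower_new(7,8)[OF fl KV] Y by auto
      then show "Y \<in> codable" using j unfolding codable_iff by simp
    qed
    moreover have pa: "path F (next_fam K d) (Ad \<union> petals K ?c ?H) (p(?j := p ?j + 1))"
      unfolding n using path mf by (rule path.petal)
    moreover have "(\<Sum>l<k. (p(?j := p ?j + 1)) l) = (\<Sum>l<k. p l) + 1"
    proof -
      have "(\<Sum>l<k. (p(?j := p ?j + 1)) l) = (\<Sum>l<k. p l + (if l = ?j then 1 else 0))"
        by (intro sum.cong) auto
      also have "\<dots> = (\<Sum>l<k. p l) + 1" using j(2) by (simp add: sum.distrib)
      finally show ?thesis .
    qed
    ultimately show ?thesis
    proof (intro conjI exI)
      show "next_fam K d \<subseteq> codable" unfolding n using K \<open>petals K ?c ?H \<subseteq> codable\<close> by blast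
      show "path F (next_fam K d) (Ad \<union> petals K ?c ?H) (p(?j := p ?j + 1))" by (rule pa)
    qed (use d True in simp)
  next
    case d: False
    then have n: "next_fam K d = insert ?H K"
      using True by (simp add: next_fam_def Let_def)
    moreover have pa: "path F (next_fam K d) (insert ?H Ad) p"
      unfolding n using path mf by (rule path.heart)
    moreover have "?H \<in> codable" unfolding codable_iff using lits_V card_lits by blast
    ultimately show ?thesis
    proof (intro conjI exI)
      show "next_fam K d \<subseteq> codable" unfolding n using K \<open>?H \<in> codable\<close> by blast
      show "path F (next_fam K d) (insert ?H Ad) p" by (rule pa)
    qed (use d in simp)
  qed
qed

text \<open>Transfers the bounds on paths to runs. Only decisions at times with a flower count as
  petal steps, since a family without flowers no longer changes.\<close>

lemma fams_path:
  assumes F: "F \<subseteq> codable"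
  shows "fams F D t \<subseteq> codable \<and> (\<exists>Ad p. path F (fams F D t) Ad p \<and>
    (\<Sum>j<k. p j) = card {s. s < t \<and> s \<in> D \<and> (\<exists>f<Fm. flw (fams F D s) f)})"
proof (induction t)
  case 0
  have "path F F {} (\<lambda>_. 0)" by (rule path.start)
  then show ?case using F by (auto intro!: exI[of _ "{}"] exI[of _ "\<lambda>_. 0 :: nat"])
next
  case (Suc t)
  let ?B = "\<lambda>t. {s. s < t \<and> s \<in> D \<and> (\<exists>f<Fm. flw (fams F D s) f)}"
  let ?d = "t \<in> D \<and> (\<exists>f<Fm. flw (fams F D t) f)"
  obtain Ad p where p: "fams F D t \<subseteq> codable" "path F (fams F D t) Ad p" "(\<Sum>j<k. p j) = card (?B t)"
    using Suc by blast
  have "?B (Suc t) = (if ?d then insert t (?B t) else ?B t)" by (auto simp: less_Suc_eq)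
  then have "card (?B (Suc t)) = card (?B t) + (if ?d then 1 else 0)" by simp
  moreover have "F \<subseteq> Pow V" using F codable_iff by auto
  ultimately show ?case using next_fam_path[OF p(1,2), of "t \<in> D"] p(3) by auto
qed

lemma fams_mono: "F \<subseteq> fams F D t"
proof (induction t)
  case (Suc t)
  have "fams F D t \<subseteq> fams F D (Suc t)" by (auto simp: next_fam_def Let_def)
  with Suc show ?case by blast
qed simp

lemma no_flower_step: "\<not> (\<exists>f<Fm. flw K f) \<Longrightarrow> next_fam K d = K"
  unfolding next_fam_def by (rule if_not_P)

lemma fams_grow:
  assumes F: "F \<subseteq> codable" and fl: "\<exists>f<Fm. flw (fams F D t) f"
  shows "t \<le> card (fams F D t)"
  using fl
proof (induction t)
  case (Suc t)
  let ?K = "fams F D t"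
  have K: "?K \<subseteq> codable" using fams_path[OF F] by blast
  then have KV: "?K \<subseteq> Pow V" using codable_iff by auto
  have K': "fams F D (Suc t) \<subseteq> codable" using fams_path[OF F] by blast
  then have fin: "finite (fams F D (Suc t))" by (rule finite_subset) simp
  have fl: "\<exists>f<Fm. flw ?K f"
  proof (rule ccontr)
    assume none: "\<not> ?thesis"
    then have "fams F D (Suc t) = ?K" unfolding fams.simps by (rule no_flower_step)
    then show False using Suc.prems none by (simp only:)
  qed
  then have IH: "t \<le> card ?K" by (rule Suc.IH)
  let ?f = "least_flw ?K"
  let ?c = "?f div U div (k + 1)" and ?j = "?f div U mod (k + 1)" and ?H = "lits (?f mod U)"
  have f: "flower ?K ?c ?j ?H" using least_flw_min_flower[OF K fl] by (simp add: min_flower_def)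
  note new = flower_new[OF f KV]
  have "card (petals ?K ?c ?H) \<noteq> 0"
    using new(9) f \<theta>_pos[of ?j] by (auto simp: flower_def)
  then obtain Y where "Y \<in> petals ?K ?c ?H" by fastforce
  then have "?K \<subset> fams F D (Suc t)"
    using new(1,5) fl by (auto simp: next_fam_def Let_def)
  then have "card ?K < card (fams F D (Suc t))" by (rule psubset_card_mono[OF fin])
  then show ?case using IH by simp
qed simp

text \<open>A step that finds a flower adds a new set, so \<open>U\<close> such steps exhaust the
  codable sets, of which there are at most \<open>U\<close>. A further flower would have a heart
  that is codable and yet new.\<close>

lemma fams_final:
  assumes F: "F \<subseteq> codable"
  shows "\<not> flower (fams F D U) c j H"
proof
  assume f: "flower (fams F D U) c j H"
  have K: "fams F D U \<subseteq> codable" using fams_path[OF F] by blast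
  have fl: "\<exists>f<Fm. flw (fams F D U) f" using flower_code[OF K f] by blast
  have KV: "fams F D U \<subseteq> Pow V" using K codable_iff by auto
  let ?f = "least_flw (fams F D U)"
  have "U \<le> card (fams F D U)" using fams_grow[OF F fl] .
  moreover have "card codable \<le> U" using card_image_le[of "{..<U}" lits] by simp
  ultimately have "fams F D U = codable"
    using K by (metis card_seteq finite_imageI finite_lessThan le_trans)
  moreover have "lits (?f mod U) \<in> codable" unfolding codable_iff using lits_V card_lits by blast
  moreover have "flower (fams F D U) (?f div U div (k + 1)) (?f div U mod (k + 1)) (lits (?f mod U))"
    using least_flw_min_flower[OF K fl] by (simp add: min_flower_def)
  ultimately show False using flower_new(1)[OF _ KV] by metis
qed

theorem fams_sparse:
  assumes F: "F \<subseteq> codable" and lb2: "1 \<le> lb"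
  shows "card {C. alive (fams F D U) C} \<le> 2 * (k + 1) * X ^ (2 * k) * 2 ^ lb"
proof -
  have K: "fams F D U \<subseteq> codable" using fams_path[OF F] by blast
  have "(1::nat) < 2 ^ lb" using lb2 by (intro one_less_power) auto
  then have "1 \<in> V" by (simp add: V_def)
  then have "V \<noteq> {}" by blast
  have "card {C. alive (fams F D U) C} \<le> 2 * (k + 1) * X ^ (2 * k) * card V"
    by (rule card_alive) (use K codable_iff fams_final[OF F] \<open>V \<noteq> {}\<close> in auto)
  also have "\<dots> \<le> 2 * (k + 1) * X ^ (2 * k) * 2 ^ lb" by (rule mult_left_mono) (simp_all add: V_def)
  finally show ?thesis .
qed

lemma alive_below:
  assumes "K \<subseteq> Pow V" "C \<in> K"
  shows "\<exists>D\<subseteq>C. alive K D"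
proof -
  have "finite C" using assms by (intro finite_subset[OF _ finite_V]) auto
  then show ?thesis using assms(2)
  proof (induction C rule: finite_psubset_induct)
    case (psubset C)
    show ?case
    proof (cases "alive K C")
      case False
      then obtain D where "D \<in> K" "D \<subset> C" using psubset.prems by (auto simp: alive_def)
      then show ?thesis using psubset.IH[of D] by blast
    qed blast
  qed
qed

text \<open>The run whose decisions are dictated by a hitting set \<open>A\<close>: petals exactly
  if \<open>A\<close> misses the heart.\<close>

primrec guided :: "nat set \<Rightarrow> nat set set \<Rightarrow> nat \<Rightarrow> nat set set" where
  "guided A F 0 = F"
| "guided A F (Suc t) = next_fam (guided A F t) (A \<inter> lits (least_flw (guided A F t) mod U) = {})"

text \<open>If \<open>A\<close> meets the heart, the heart may be added; if it misses the heart, it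
  meets every set above the heart in a petal, so all petals may be added. Hence some run keeps
  \<open>A\<close> a hitting set, and the bound on petal steps makes its decision times few enough
  to be guessed.\<close>

theorem fams_hit:
  assumes F: "F \<subseteq> codable" and hit: "\<And>C. C \<in> F \<Longrightarrow> A \<inter> C \<noteq> {}"
  shows "\<exists>D\<subseteq>{..<U}. W * card D \<le> k * card V \<and> (\<forall>C\<in>fams F D U. A \<inter> C \<noteq> {})"
proof -
  \<comment> \<open>Times without a flower are left out, since \<open>petal_steps\<close> does not
    bound their number.\<close>
  define D where "D = {t. t < U \<and> (\<exists>f<Fm. flw (guided A F t) f) \<and>
    A \<inter> lits (least_flw (guided A F t) mod U) = {}}"
  have eq: "t \<le> U \<Longrightarrow> fams F D t = guided A F t" for t
  proof (induction t)
    case (Suc t)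
    then have IH: "fams F D t = guided A F t" and t: "t < U" by auto
    show ?case
    proof (cases "\<exists>f<Fm. flw (guided A F t) f")
      case True
      then have "t \<in> D \<longleftrightarrow> A \<inter> lits (least_flw (guided A F t) mod U) = {}" using t by (simp add: D_def)
      then show ?thesis by (simp add: IH)
    next
      case False
      then show ?thesis by (simp add: IH no_flower_step)
    qed
  qed simp
  have "\<forall>C\<in>guided A F t. A \<inter> C \<noteq> {}" for t
  proof (induction t)
    case (Suc t)
    let ?K = "guided A F t"
    let ?H = "lits (least_flw ?K mod U)"
    have "A \<inter> C \<noteq> {}" if C: "C \<in> petals ?K c ?H" and H: "A \<inter> ?H = {}" for C c
    proof -
      obtain B where "B \<in> ?K" "C = B - ?H" using C by (auto simp: petals_def alive_def)
      then show ?thesis using Suc H by blast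
    qed
    then show ?case using Suc by (auto simp: next_fam_def Let_def)
  qed (use hit in simp)
  then have "\<forall>C\<in>fams F D U. A \<inter> C \<noteq> {}" using eq[of U] by simp
  moreover have "W * card D \<le> k * card V"
  proof -
    obtain Ad p where p: "path F (fams F D U) Ad p"
      "(\<Sum>j<k. p j) = card {s. s < U \<and> s \<in> D \<and> (\<exists>f<Fm. flw (fams F D s) f)}"
      using fams_path[OF F] by blast
    have "{s. s < U \<and> s \<in> D \<and> (\<exists>f<Fm. flw (fams F D s) f)} = D"
      using eq by (auto simp: D_def)
    then have "(\<Sum>j<k. p j) = card D" using p(2) by simp
    moreover have "F \<subseteq> Pow V" using F codable_iff by auto
    ultimately show ?thesis using petal_steps[OF p(1)] by simp
  qed
  moreover have "D \<subseteq> {..<U}" by (auto simp: D_def)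
  ultimately show ?thesis by blast
qed

end

section \<open>Primes of polynomial size\<close>

text \<open>
  Nair's argument: with \<open>M\<close> a common multiple of \<open>1, \<dots>, N\<close>, the numbers \<open>M / (m * (n choose m))\<close> obey
  the recursion of Leibniz' harmonic triangle, hence are integers.
\<close>

lemma choose_dvd_common_multiple:
  fixes M N :: nat
  assumes M: "\<And>i. 1 \<le> i \<Longrightarrow> i \<le> N \<Longrightarrow> i dvd M"
  shows "1 \<le> m \<Longrightarrow> m \<le> n \<Longrightarrow> n \<le> N \<Longrightarrow> real M / (real m * real (n choose m)) \<in> \<int>"
proof (induction m arbitrary: n rule: nat_induct_at_least)
  case base
  then have "n dvd M" "n \<noteq> 0" using M[of n] by auto
  then obtain c where "M = n * c" by (auto elim: dvdE)
  then show ?case using \<open>n \<noteq> 0\<close> by simp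
next
  case (Suc m)
  from Suc.prems obtain n' where n: "n = Suc n'" by (cases n) auto
  with Suc.prems have mn: "m \<le> n'" by simp
  have "real M / (real m * real (n' choose m)) \<in> \<int>" "real M / (real m * real (n choose m)) \<in> \<int>"
    using Suc.IH[of n'] Suc.IH[of n] Suc.prems n by auto
  then have "real M / (real m * real (n' choose m)) - real M / (real m * real (n choose m)) \<in> \<int>"
    by (rule Ints_diff)
  also have "real M / (real m * real (n' choose m)) - real M / (real m * real (n choose m)) =
      real M / (real (Suc m) * real (n choose Suc m))"
  proof -
    obtain m' where m: "m = Suc m'" using Suc.hyps by (cases m) auto
    define A B C where "A = real (n' choose m')" and "B = real (n' choose m)" and "C = real (n choose m)"
    have "m \<le> n" using mn n by simp
    then have pos: "B > 0" "C > 0" "real m > 0" "real n > 0"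
      using mn n m by (simp_all only: B_def C_def of_nat_0_less_iff zero_less_binomial)
    have C: "C = A + B" unfolding A_def B_def C_def n m by simp
    have "Suc m' * (Suc n' choose Suc m') = Suc n' * (n' choose m')"
      by (metis Suc_times_binomial_eq mult.commute)
    then have mC: "real m * C = real n * A"
      unfolding A_def C_def n m of_nat_mult[symmetric] by (simp only:)
    have "Suc m * (Suc n' choose Suc m) = Suc n' * (n' choose m)"
      by (metis Suc_times_binomial_eq mult.commute)
    then have mS: "real (Suc m) * real (n choose Suc m) = real n * B"
      unfolding B_def n of_nat_mult[symmetric] by (simp only:)
    have "real M / (real m * B) - real M / (real m * C) = real M * (C - B) / (real m * B * C)"
      using pos by (simp add: field_simps)
    also have "\<dots> = real M * A / (B * (real m * C))" using C by (simp add: ac_simps)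
    also have "\<dots> = real M * A / (B * (real n * A))" unfolding mC ..
    also have "\<dots> = real M / (real n * B)"
    proof -
      have "A > 0" using mn m by (simp add: A_def)
      then show ?thesis using pos by (simp add: field_simps)
    qed
    finally show ?thesis unfolding mS B_def C_def .
  qed
  finally show ?case .
qed

lemma central_binomial_ge: "2 ^ m \<le> (2 * m choose m)"
proof (induction m)
  case (Suc m)
  have "Suc m * (2 * Suc m choose Suc m) = (2 * Suc m) * (Suc (2 * m) choose m)"
    using Suc_times_binomial_eq[of "Suc (2 * m)" m] by (simp add: mult.commute)
  then have "(2 * Suc m choose Suc m) = 2 * (Suc (2 * m) choose m)"
    by (metis mult.assoc mult.commute mult_cancel1 nat.distinct(1))
  also have "\<dots> \<ge> 2 * (2 * m choose m)"
    by (cases m) auto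
  finally show ?case using Suc by simp
qed simp

text \<open>Let \<open>n = 16 * Y ^ 2\<close>. Without primes between \<open>Y\<close> and
  \<open>n\<close> there are at most \<open>Y\<close> primes up to \<open>n\<close>, so the product
  \<open>M\<close> of their largest powers not exceeding \<open>n\<close>, a common multiple of 1 to
  \<open>n\<close>, is at most \<open>n ^ Y < 2 ^ ((4 + 2 * Y) * Y)\<close>. On the other hand
  \<open>M\<close> is at least the central binomial coefficient, which is at least
  \<open>2 ^ (8 * Y ^ 2)\<close>. The factor 16 makes the two incompatible for every
  \<open>Y \<ge> 1\<close>.\<close>

lemma prime_between:
  assumes "1 \<le> Y"
  shows "\<exists>p::nat. prime p \<and> Y \<le> p \<and> p \<le> 16 * Y ^ 2"
proof (rule ccontr)
  assume neg: "\<not> ?thesis"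
  define m where "m = 8 * Y ^ 2"
  define n where "n = 2 * m"
  have n16: "n = 16 * Y ^ 2" unfolding n_def m_def by simp
  have n1: "1 \<le> n" "1 \<le> m" using assms by (auto simp: n_def m_def)
  define Ps where "Ps = {p::nat. prime p \<and> p \<le> n}"
  have fin: "finite Ps" unfolding Ps_def by (rule finite_subset[of _ "{..n}"]) auto
  \<comment> \<open>The number of digits in base \<open>p\<close> minus one: the largest exponent
    with \<open>p ^ e p \<le> n\<close>.\<close>
  define e where "e p = floorlog p n - 1" for p
  have small: "p ^ e p \<le> n" if "p \<in> Ps" for p
    using floorlog_bounds[of n p] n1 that prime_gt_1_nat[of p] by (auto simp: e_def Ps_def)
  define M where "M = (\<Prod>p\<in>Ps. p ^ e p)"
  have dvd: "i dvd M" if i: "1 \<le> i" "i \<le> n" for i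
  proof -
    have sub: "prime_factors i \<subseteq> Ps"
    proof
      fix p assume p: "p \<in> prime_factors i"
      then have "prime p" "p dvd i" by auto
      moreover have "p \<le> i" using \<open>p dvd i\<close> i(1) by (intro dvd_imp_le) auto
      ultimately show "p \<in> Ps" using i(2) by (simp add: Ps_def)
    qed
    have "multiplicity p i \<le> e p" if p: "p \<in> prime_factors i" for p
    proof -
      have pp: "prime p" using p by auto
      have "p ^ multiplicity p i dvd i" by (rule multiplicity_dvd)
      then have "p ^ multiplicity p i \<le> i" using i(1) by (intro dvd_imp_le) auto
      then have "p ^ multiplicity p i \<le> n" using i(2) by (rule le_trans)
      also have "n < p ^ floorlog p n"
        using floorlog_bounds[of n p] n1 prime_gt_1_nat[OF pp] by auto
      finally have "multiplicity p i < floorlog p n"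
        using prime_gt_1_nat[OF pp] by (rule power_less_imp_less_exp[rotated])
      then show ?thesis by (simp add: e_def)
    qed
    then have "(\<Prod>p\<in>prime_factors i. p ^ multiplicity p i) dvd (\<Prod>p\<in>prime_factors i. p ^ e p)"
      by (intro prod_dvd_prod le_imp_power_dvd) auto
    also have "\<dots> dvd M" unfolding M_def using fin sub by (rule prod_dvd_prod_subset)
    finally show ?thesis using i prime_factorization_nat[of i] by simp
  qed
  have "real M / (real m * real (n choose m)) \<in> \<int>"
    by (rule choose_dvd_common_multiple[of n]) (use dvd n1 in \<open>auto simp: n_def\<close>)
  then obtain c where "real M / (real m * real (n choose m)) = of_int c" by (elim Ints_cases)
  then have "real M = of_int c * (real m * real (n choose m))"
    using n1 by (simp add: n_def field_simps)
  moreover have Mpos: "0 < M" unfolding M_def using fin by (intro prod_pos) (auto simp: Ps_def prime_gt_0_nat)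
  ultimately have "0 < of_int c * (real m * real (n choose m))" by (metis of_nat_0_less_iff)
  then have "0 < (of_int c :: real)" by (rule zero_less_mult_pos2) (use n1 in \<open>simp add: n_def\<close>)
  then have "1 \<le> c" by simp
  then have "1 * (1 * real (n choose m)) \<le> of_int c * (real m * real (n choose m))"
    using n1 by (intro mult_mono) auto
  then have "real (n choose m) \<le> real M" using \<open>real M = _\<close> by simp
  then have "2 ^ m \<le> M" using central_binomial_ge[of m] by (simp add: n_def)
  also have "M \<le> (\<Prod>p\<in>Ps. n)" unfolding M_def by (rule prod_mono) (use small in simp)
  also have "\<dots> = n ^ card Ps" by simp
  also have "\<dots> \<le> n ^ Y"
  proof (rule power_increasing[OF _ n1(1)])
    have "Ps \<subseteq> {..<Y}"
    proof
      fix p assume "p \<in> Ps"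
      then have "prime p" "p \<le> 16 * Y ^ 2" by (auto simp: Ps_def n_def m_def)
      then show "p \<in> {..<Y}" using neg by (meson lessThan_iff not_less)
    qed
    then have "card Ps \<le> card {..<Y}" by (intro card_mono) auto
    then show "card Ps \<le> Y" by simp
  qed
  also have "n ^ Y < (2 ^ (4 + 2 * Y)) ^ Y"
  proof (rule power_strict_mono)
    have "Y < 2 ^ Y" by (rule less_exp)
    then have "Y * Y < 2 ^ Y * 2 ^ Y" by (rule mult_strict_mono) simp_all
    moreover have "(2::nat) ^ (4 + 2 * Y) = 16 * (2 ^ Y * 2 ^ Y)"
      by (simp only: power_add mult_2) simp
    ultimately show "n < 2 ^ (4 + 2 * Y)" unfolding n16 power2_eq_square by linarith
    show "0 < Y" using assms by linarith
  qed simp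
  also have "\<dots> = 2 ^ ((4 + 2 * Y) * Y)" by (simp only: power_mult)
  also have "\<dots> \<le> 2 ^ m"
  proof (rule power_increasing)
    have "Y * 1 \<le> Y * Y" using assms by (rule mult_left_mono) simp
    then have "4 * Y + 2 * (Y * Y) \<le> 8 * (Y * Y)" by linarith
    then show "(4 + 2 * Y) * Y \<le> m" unfolding m_def power2_eq_square add_mult_distrib by (simp only: mult.assoc)
  qed simp
  finally show False by (simp only: less_irrefl)
qed

section \<open>The Merlin-Arthur protocol\<close>

text \<open>Integer polynomials stand in for polynomials over the field with \<open>p\<close>
  elements, where being nonzero means that some coefficient is not divisible by \<open>p\<close>.
  Splitting off a root by synthetic division lowers the degree, and the quotient stays nonzero
  because otherwise \<open>p\<close> would divide every coefficient of \<open>f\<close>.\<close>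

lemma roots_mod_prime:
  fixes f :: "int poly" and p :: nat
  assumes p: "prime p"
  shows "degree f \<le> D \<Longrightarrow> \<not> int p dvd coeff f i \<Longrightarrow> card {r. r < p \<and> int p dvd poly f (int r)} \<le> D"
proof (induction D arbitrary: f i)
  case 0
  then have f: "f = [:coeff f 0:]" by (metis degree_eq_zeroE le_zero_eq coeff_pCons_0)
  then have "i = 0" using 0(2) by (metis coeff_pCons_Suc coeff_0 dvd_0_right not0_implies_Suc)
  have "poly f (int r) = coeff f 0" for r by (subst f) simp
  then have "{r. r < p \<and> int p dvd poly f (int r)} = {}" using 0(2) \<open>i = 0\<close> by auto
  then show ?case by (simp only: card.empty)
next
  case (Suc D)
  let ?Z = "\<lambda>f. {r. r < p \<and> int p dvd poly f (int r)}"
  show ?case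
  proof (cases "?Z f = {}")
    case True
    then show ?thesis by (simp only: card.empty)
  next
    case False
    then obtain a where a: "a < p" "int p dvd poly f (int a)" by blast
    define g where "g = synthetic_div f (int a)"
    have f: "f = [:- int a, 1:] * g + [:poly f (int a):]"
      unfolding g_def by (rule synthetic_div_correct'[symmetric])
    have deg: "degree g \<le> D" using Suc.prems(1) by (simp add: g_def degree_synthetic_div)
    have "\<exists>j. \<not> int p dvd coeff g j"
    proof (rule ccontr)
      assume "\<nexists>j. \<not> int p dvd coeff g j"
      then have all: "int p dvd coeff g j" for j by blast
      have "int p dvd coeff ([:- int a, 1:] * g) i"
        by (cases i) (auto simp: all intro!: dvd_diff dvd_mult dvd_add)
      moreover have "int p dvd coeff [:poly f (int a):] i" using a(2) by (cases i) auto
      ultimately have "int p dvd coeff ([:- int a, 1:] * g + [:poly f (int a):]) i"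
        unfolding coeff_add by (rule dvd_add)
      then show False using f Suc.prems(2) by metis
    qed
    then obtain j where "\<not> int p dvd coeff g j" by blast
    from Suc.IH[OF deg this] have g: "card (?Z g) \<le> D" .
    have "?Z f \<subseteq> insert a (?Z g)"
    proof
      fix r assume r: "r \<in> ?Z f"
      have "poly f (int r) = (int r - int a) * poly g (int r) + poly f (int a)"
        by (subst f) (simp add: algebra_simps)
      then have "int p dvd (int r - int a) * poly g (int r)"
        using r a(2) by (simp add: dvd_add_left_iff)
      then have "int p dvd int r - int a \<or> int p dvd poly g (int r)"
        using p prime_dvd_mult_iff[of "int p"] by simp
      moreover have "r = a" if "int p dvd int r - int a"
      proof (rule ccontr)
        assume "r \<noteq> a"
        then have "\<bar>int p\<bar> \<le> \<bar>int r - int a\<bar>" using that by (intro dvd_imp_le_int) auto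
        then show False using r a(1) by auto
      qed
      ultimately show "r \<in> insert a (?Z g)" using r by blast
    qed
    then have "card (?Z f) \<le> card (insert a (?Z g))" by (intro card_mono) auto
    also have "\<dots> \<le> Suc (card (?Z g))" by (simp add: card_insert_if)
    finally show ?thesis using g by simp
  qed
qed

definition fwd :: "(nat \<Rightarrow> nat) \<Rightarrow> nat \<Rightarrow> nat \<Rightarrow> nat \<Rightarrow> nat" where
  "fwd a L j r = (\<Sum>i<L. a (j * L + i) * r ^ i)"

definition bwd :: "(nat \<Rightarrow> nat) \<Rightarrow> nat \<Rightarrow> nat \<Rightarrow> nat \<Rightarrow> nat" where
  "bwd b L j r = (\<Sum>i<L. b (j * L + i) * r ^ (L - 1 - i))"

text \<open>The coefficient of \<open>r ^ (L - 1)\<close> of the sum over \<open>j\<close> of the products \<open>fwd * bwd\<close> is the inner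
  product of \<open>a\<close> and \<open>b\<close>; the proof offers the other coefficients.\<close>

definition claim :: "(nat \<Rightarrow> nat) \<Rightarrow> nat \<Rightarrow> nat \<Rightarrow> nat" where
  "claim \<phi> L r = (\<Sum>d<2 * L. if d = L - 1 then 0 else \<phi> d * r ^ d)"

text \<open>The values of \<open>bwd\<close> are reduced because the elements of the universe store
  residues modulo \<open>q\<close>; by \<open>good_iff\<close> the outcome is the same as for the
  unreduced values.\<close>

definition good :: "(nat \<Rightarrow> nat) \<Rightarrow> (nat \<Rightarrow> nat) \<Rightarrow> (nat \<Rightarrow> nat) \<Rightarrow> nat \<Rightarrow> nat \<Rightarrow> nat \<Rightarrow> nat \<Rightarrow> bool" where
  "good a b \<phi> T L q r \<longleftrightarrow> (\<Sum>j<T. fwd a L j r * (bwd b L j r mod q)) mod q = claim \<phi> L r mod q"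

lemma good_iff:
  "good a b \<phi> T L q r \<longleftrightarrow> int q dvd int (\<Sum>j<T. fwd a L j r * bwd b L j r) - int (claim \<phi> L r)"
proof -
  have "(\<Sum>j<T. fwd a L j r * (bwd b L j r mod q)) mod q = (\<Sum>j<T. fwd a L j r * bwd b L j r) mod q"
    by (subst (1 2) mod_sum_eq[symmetric]) (simp add: mod_mult_right_eq)
  then show ?thesis
    unfolding good_def
    by (simp only: mod_eq_dvd_iff[symmetric] of_nat_mod[symmetric] of_nat_eq_iff)
qed

section \<open>The protocol as a polynomial identity modulo \<open>q\<close>\<close>

definition pa :: "(nat \<Rightarrow> nat) \<Rightarrow> nat \<Rightarrow> nat \<Rightarrow> int poly" where
  "pa a L j = (\<Sum>i<L. monom (int (a (j * L + i))) i)"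

definition pb :: "(nat \<Rightarrow> nat) \<Rightarrow> nat \<Rightarrow> nat \<Rightarrow> int poly" where
  "pb b L j = (\<Sum>i<L. monom (int (b (j * L + i))) (L - 1 - i))"

definition pg :: "(nat \<Rightarrow> nat) \<Rightarrow> (nat \<Rightarrow> nat) \<Rightarrow> nat \<Rightarrow> nat \<Rightarrow> int poly" where
  "pg a b T L = (\<Sum>j<T. pa a L j * pb b L j)"

lemma poly_pg: "poly (pg a b T L) (int r) = int (\<Sum>j<T. fwd a L j r * bwd b L j r)"
  by (simp add: pg_def pa_def pb_def fwd_def bwd_def poly_sum poly_monom)

lemma coeff_pa: "coeff (pa a L j) i = (if i < L then int (a (j * L + i)) else 0)"
proof -
  have "coeff (pa a L j) i = (\<Sum>i'<L. if i' = i then int (a (j * L + i')) else 0)"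
    unfolding pa_def coeff_sum by (intro sum.cong) auto
  then show ?thesis by simp
qed

lemma coeff_pb: "coeff (pb b L j) i = (if i < L then int (b (j * L + (L - 1 - i))) else 0)"
proof -
  have "coeff (pb b L j) i = (\<Sum>i'<L. if L - 1 - i' = i then int (b (j * L + i')) else 0)"
    unfolding pb_def coeff_sum by (intro sum.cong) auto
  also have "\<dots> = (\<Sum>i'<L. if i < L \<and> i' = L - 1 - i then int (b (j * L + i')) else 0)"
    by (intro sum.cong) auto
  finally show ?thesis by (cases "i < L") auto
qed

lemma sum_blocks:
  fixes f :: "nat \<Rightarrow> nat"
  shows "(\<Sum>j<T. \<Sum>i<L. f (j * L + i)) = (\<Sum>i<T * L. f i)"
proof -
  have "(\<Sum>i<k. f (m + i)) = sum f {m..<m + k}" for m k :: nat by (induction k) auto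
  then have "(\<Sum>j<T. \<Sum>i<L. f (j * L + i)) = (\<Sum>j<T. sum f {j * L..<j * L + L})" by simp
  also have "\<dots> = (\<Sum>i<T * L. f i)" by (rule sum.nat_group)
  finally show ?thesis .
qed

lemma coeff_pg: "1 \<le> L \<Longrightarrow> coeff (pg a b T L) (L - 1) = int (\<Sum>j<T. \<Sum>i<L. a (j * L + i) * b (j * L + i))"
proof -
  assume L: "1 \<le> L"
  have "coeff (pa a L j * pb b L j) (L - 1) = int (\<Sum>i<L. a (j * L + i) * b (j * L + i))" for j
  proof -
    have "coeff (pa a L j * pb b L j) (L - 1) = (\<Sum>i\<le>L - 1. coeff (pa a L j) i * coeff (pb b L j) (L - 1 - i))"
      by (rule coeff_mult)
    also have "\<dots> = (\<Sum>i\<le>L - 1. int (a (j * L + i) * b (j * L + i)))"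
      using L by (intro sum.cong) (auto simp: coeff_pa coeff_pb)
    also have "{..L - 1} = {..<L}" using L by auto
    finally show ?thesis by simp
  qed
  then show ?thesis by (simp add: pg_def coeff_sum)
qed

lemma coeff_pg_high: "2 * L \<le> d \<Longrightarrow> coeff (pg a b T L) d = 0"
  unfolding pg_def coeff_sum coeff_mult by (intro sum.neutral ballI) (auto simp: coeff_pa coeff_pb)

lemma poly_int_lessThan:
  assumes "\<And>d. n \<le> d \<Longrightarrow> coeff f d = 0"
  shows "poly f x = (\<Sum>d<n. coeff f d * x ^ d :: int)"
proof -
  have "f = (\<Sum>d<n. monom (coeff f d) d)"
    by (rule poly_eqI) (use assms in \<open>simp add: coeff_sum not_less\<close>)
  then have "poly f x = poly (\<Sum>d<n. monom (coeff f d) d) x" by simp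
  then show ?thesis by (simp add: poly_sum poly_monom)
qed

text \<open>The offered coefficients are the true ones modulo \<open>q\<close>, and the one left
  out, at \<open>L - 1\<close>, is the inner product, which vanishes. So the identity holds at every
  point.\<close>

lemma pcp_complete:
  assumes q: "0 < q" and L: "1 \<le> L" and orth: "\<And>i. i < T * L \<Longrightarrow> a i * b i = 0"
    and \<phi>: "\<And>d. d < 2 * L \<Longrightarrow> \<phi> d = nat (coeff (pg a b T L) d mod int q)"
  shows "good a b \<phi> T L q r"
proof -
  have "j * L + i < T * L" if "j < T" "i < L" for i j
  proof -
    have "j * L + i < Suc j * L" using that by simp
    also have "\<dots> \<le> T * L" using that by (intro mult_right_mono) auto
    finally show ?thesis .
  qed
  then have "(\<Sum>j<T. \<Sum>i<L. a (j * L + i) * b (j * L + i)) = 0"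
    using orth by (intro sum.neutral ballI) simp
  then have 0: "coeff (pg a b T L) (L - 1) = 0" unfolding coeff_pg[OF L] by (simp only: of_nat_0)
  have "int (\<Sum>j<T. fwd a L j r * bwd b L j r) = (\<Sum>d<2 * L. coeff (pg a b T L) d * int r ^ d)"
    unfolding poly_pg[symmetric] by (rule poly_int_lessThan) (rule coeff_pg_high)
  moreover have "int (claim \<phi> L r) = (\<Sum>d<2 * L. if d = L - 1 then 0 else int (\<phi> d) * int r ^ d)"
    unfolding claim_def of_nat_sum by (intro sum.cong) auto
  ultimately have eq: "int (\<Sum>j<T. fwd a L j r * bwd b L j r) - int (claim \<phi> L r) =
      (\<Sum>d<2 * L. coeff (pg a b T L) d * int r ^ d - (if d = L - 1 then 0 else int (\<phi> d) * int r ^ d))"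
    by (simp only: sum_subtractf)
  have dv: "int q dvd coeff (pg a b T L) d * int r ^ d - (if d = L - 1 then 0 else int (\<phi> d) * int r ^ d)"
    if "d < 2 * L" for d
  proof (cases "d = L - 1")
    case False
    have "int (\<phi> d) = coeff (pg a b T L) d mod int q" using \<phi>[OF that] q by simp
    then have "int q dvd coeff (pg a b T L) d - int (\<phi> d)" by simp
    then have "int q dvd (coeff (pg a b T L) d - int (\<phi> d)) * int r ^ d" by (rule dvd_mult2)
    then show ?thesis using False by (simp add: left_diff_distrib)
  next
    case True
    then show ?thesis unfolding True 0 by simp
  qed
  show ?thesis unfolding good_iff eq by (rule dvd_sum) (use dv in simp)
qed

text \<open>Whatever is offered, the difference polynomial has the inner product as its coefficient
  at \<open>L - 1\<close>. This number lies between 1 and \<open>T * L < q\<close>, so the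
  polynomial is nonzero modulo \<open>q\<close> and its degree bounds the number of accepted
  points.\<close>

lemma pcp_sound:
  assumes q: "prime q" "T * L < q" and L: "1 \<le> L"
    and bool: "\<And>i. a i \<le> 1" "\<And>i. b i \<le> 1" and i: "i < T * L" "a i = 1" "b i = 1"
  shows "card {r. r < q \<and> good a b \<phi> T L q r} \<le> 2 * L"
proof -
  define H where "H = pg a b T L - (\<Sum>d<2 * L. if d = L - 1 then 0 else monom (int (\<phi> d)) d)"
  have H: "poly H (int r) = int (\<Sum>j<T. fwd a L j r * bwd b L j r) - int (claim \<phi> L r)" for r
  proof -
    have "poly (\<Sum>d<2 * L. if d = L - 1 then 0 else monom (int (\<phi> d)) d) (int r) = int (claim \<phi> L r)"
      unfolding claim_def of_nat_sum poly_sum by (intro sum.cong) (auto simp: poly_monom)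
    then show ?thesis by (simp add: H_def poly_pg)
  qed
  have c: "coeff (\<Sum>d<2 * L. if d = L - 1 then 0 else monom (int (\<phi> d)) d) e =
      (if e < 2 * L \<and> e \<noteq> L - 1 then int (\<phi> e) else 0)" for e
  proof -
    have "coeff (\<Sum>d<2 * L. if d = L - 1 then 0 else monom (int (\<phi> d)) d) e =
        (\<Sum>d<2 * L. if d = e then (if d = L - 1 then 0 else int (\<phi> d)) else 0)"
      unfolding coeff_sum by (intro sum.cong) auto
    then show ?thesis by auto
  qed
  have "degree H \<le> 2 * L"
  proof (rule degree_le, intro allI impI)
    fix i assume "2 * L < i"
    then show "coeff H i = 0" unfolding H_def coeff_diff c by (simp add: coeff_pg_high)
  qed
  let ?s = "\<Sum>j<T. \<Sum>i<L. a (j * L + i) * b (j * L + i)"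
  have s: "?s = (\<Sum>i<T * L. a i * b i)" by (rule sum_blocks)
  have "?s \<le> (\<Sum>i<T * L. 1)"
    unfolding s by (rule sum_mono) (use mult_le_mono[OF bool] in simp)
  also have "\<dots> = T * L" by simp
  finally have lt: "?s < q" using q(2) by (rule le_less_trans)
  have "a i * b i \<le> (\<Sum>i<T * L. a i * b i)" by (rule member_le_sum) (use i(1) in auto)
  then have "0 < ?s" unfolding s using i(2,3) by (simp only: mult_1)
  then have "\<not> q dvd ?s" using lt by (rule nat_dvd_not_less)
  then have "\<not> int q dvd int ?s" by (simp only: int_dvd_int_iff not_False_eq_True)
  moreover have "coeff H (L - 1) = int ?s" unfolding H_def coeff_diff c coeff_pg[OF L] by simp
  ultimately have "\<not> int q dvd coeff H (L - 1)" by metis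
  from roots_mod_prime[OF q(1) \<open>degree H \<le> 2 * L\<close> this] show ?thesis
    unfolding good_iff H .
qed

text \<open>Each block of digits is a point followed by \<open>T\<close> values determined by it, so
  a tuple amounts to a free choice of \<open>R\<close> points from \<open>G\<close>. All points
  below \<open>q\<close> give the size of a set of \<open>y\<close>; the accepted points give the
  size of an intersection.\<close>

lemma card_tensor:
  fixes G :: "nat set" and B :: "nat \<Rightarrow> nat \<Rightarrow> nat"
  assumes G: "G \<subseteq> {..<2 ^ w}" and B: "\<And>j r. j < T \<Longrightarrow> B j r < 2 ^ w"
  shows "card {u. u < 2 ^ (w * ((T + 1) * R)) \<and> (\<forall>\<rho><R. dig w u (\<rho> * (T + 1)) \<in> G \<and>
      (\<forall>j<T. dig w u (\<rho> * (T + 1) + 1 + j) = B j (dig w u (\<rho> * (T + 1)))))} = card G ^ R"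
    (is "card ?A = _")
proof -
  let ?f = "\<lambda>u. \<lambda>\<rho>\<in>{..<R}. dig w u (\<rho> * (T + 1))"
  have "bij_betw ?f ?A (PiE {..<R} (\<lambda>_. G))"
    unfolding bij_betw_def
  proof (intro conjI subset_antisym)
    show "inj_on ?f ?A"
    proof (rule inj_onI)
      fix u v assume uv: "u \<in> ?A" "v \<in> ?A" "?f u = ?f v"
      have h: "dig w u (\<rho> * (T + 1)) = dig w v (\<rho> * (T + 1))" if "\<rho> < R" for \<rho>
        using fun_cong[OF uv(3), of \<rho>] that by simp
      show "u = v"
      proof (rule digits_inj)
        show "u < 2 ^ (w * ((T + 1) * R))" "v < 2 ^ (w * ((T + 1) * R))" using uv by auto
        fix i assume i: "i < (T + 1) * R"
        define \<rho> t where "\<rho> = i div (T + 1)" and "t = i mod (T + 1)"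
        have it: "i = \<rho> * (T + 1) + t" unfolding \<rho>_def t_def by (rule div_mult_mod_eq[symmetric])
        have \<rho>: "\<rho> < R" using i unfolding \<rho>_def by (intro less_mult_imp_div_less) (simp add: mult.commute)
        have t: "t < T + 1" unfolding t_def by simp
        show "dig w u i = dig w v i"
        proof (cases t)
          case 0
          then show ?thesis using h[OF \<rho>] it by simp
        next
          case (Suc j)
          then have "j < T" "i = \<rho> * (T + 1) + 1 + j" using t it by auto
          then show ?thesis using uv(1,2) h[OF \<rho>] \<rho> by auto
        qed
      qed
    qed
    show "?f ` ?A \<subseteq> PiE {..<R} (\<lambda>_. G)"
      by (intro image_subsetI) (auto simp: restrict_def PiE_iff extensional_def)
    show "PiE {..<R} (\<lambda>_. G) \<subseteq> ?f ` ?A"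
    proof
      fix g assume g: "g \<in> PiE {..<R} (\<lambda>_. G)"
      define d where "d i = (if i mod (T + 1) = 0 then g (i div (T + 1))
        else B (i mod (T + 1) - 1) (g (i div (T + 1))))" for i
      have "d i < 2 ^ w" if i: "i < (T + 1) * R" for i
      proof (cases "i mod (T + 1) = 0")
        case True
        have "i div (T + 1) < R" using i by (intro less_mult_imp_div_less) (simp add: mult.commute)
        then have "g (i div (T + 1)) \<in> G" using g by auto
        then show ?thesis using True G by (auto simp: d_def)
      next
        case False
        have "i mod (T + 1) < T + 1" by simp
        then have "i mod (T + 1) - 1 < T" using False by linarith
        then show ?thesis using B False by (simp add: d_def)
      qed
      then obtain u where u: "u < 2 ^ (w * ((T + 1) * R))" "\<forall>i<(T + 1) * R. dig w u i = d i"
        using digits_exist[of "(T + 1) * R" d w] by blast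
      have idx: "\<rho> * (T + 1) + t < (T + 1) * R" if "\<rho> < R" "t < T + 1" for \<rho> t
      proof -
        have "\<rho> * (T + 1) + t < Suc \<rho> * (T + 1)" using that by simp
        also have "\<dots> \<le> R * (T + 1)" using that by (intro mult_right_mono) auto
        finally show ?thesis by (simp add: mult.commute)
      qed
      have dm: "(\<rho> * (T + 1) + t) div (T + 1) = \<rho>" "(\<rho> * (T + 1) + t) mod (T + 1) = t"
        if "t < T + 1" for \<rho> t
      proof -
        have "(\<rho> * (T + 1) + t) div (T + 1) = \<rho> + t div (T + 1)" by (rule div_mult_self3) simp
        then show "(\<rho> * (T + 1) + t) div (T + 1) = \<rho>" using that by simp
        have "(\<rho> * (T + 1) + t) mod (T + 1) = t mod (T + 1)" by (rule mod_mult_self3)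
        then show "(\<rho> * (T + 1) + t) mod (T + 1) = t" using that by simp
      qed
      have h: "dig w u (\<rho> * (T + 1)) = g \<rho>" if "\<rho> < R" for \<rho>
        using u(2) idx[OF that, of 0] dm[of 0 \<rho>] by (simp add: d_def)
      have t: "dig w u (\<rho> * (T + 1) + 1 + j) = B j (g \<rho>)" if "\<rho> < R" "j < T" for \<rho> j
      proof -
        have "dig w u (\<rho> * (T + 1) + (1 + j)) = d (\<rho> * (T + 1) + (1 + j))"
          using u(2) idx[OF that(1), of "1 + j"] that(2) by simp
        also have "\<dots> = B j (g \<rho>)"
          unfolding d_def using dm[of "1 + j" \<rho>] that(2) by simp
        finally show ?thesis by (simp only: add.assoc)
      qed
      have "u \<in> ?A" using u(1) h t g by auto
      moreover have "?f u = g" using h g by (auto simp: fun_eq_iff PiE_def extensional_def)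
      ultimately show "g \<in> ?f ` ?A" by blast
    qed
  qed
  then have "card ?A = card (PiE {..<R} (\<lambda>_. G))" by (rule bij_betw_same_card)
  then show ?thesis by (simp add: card_PiE)
qed

section \<open>Expressions for the reduction\<close>

definition ele :: "ex \<Rightarrow> ex \<Rightarrow> ex" where "ele a b = Op Sub (Num 1) (Op Sub a b)"
definition enot :: "ex \<Rightarrow> ex" where "enot a = Op Sub (Num 1) a"
definition epos :: "ex \<Rightarrow> ex" where "epos a = enot (enot a)"
definition eand :: "ex \<Rightarrow> ex \<Rightarrow> ex" where "eand a b = epos (Op Mult a b)"
definition eor :: "ex \<Rightarrow> ex \<Rightarrow> ex" where "eor a b = epos (Op Add a b)"
definition eeq :: "ex \<Rightarrow> ex \<Rightarrow> ex" where "eeq a b = eand (ele a b) (ele b a)"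
definition eex :: "ex \<Rightarrow> ex \<Rightarrow> ex" where "eex m b = epos (Sum m b)"
definition eall :: "ex \<Rightarrow> ex \<Rightarrow> ex" where "eall m b = enot (Sum m (enot b))"
definition emod :: "ex \<Rightarrow> ex \<Rightarrow> ex" where "emod a b = Op Sub a (Op Mult (Op Div a b) b)"

abbreviation eadd :: "ex \<Rightarrow> ex \<Rightarrow> ex" where "eadd \<equiv> Op Add"
abbreviation esub :: "ex \<Rightarrow> ex \<Rightarrow> ex" where "esub \<equiv> Op Sub"
abbreviation emul :: "ex \<Rightarrow> ex \<Rightarrow> ex" where "emul \<equiv> Op Mult"
abbreviation ediv :: "ex \<Rightarrow> ex \<Rightarrow> ex" where "ediv \<equiv> Op Div"

lemma eval_ele [simp]: "eval S \<mu> (ele a b) \<rho> = of_bool (eval S \<mu> a \<rho> \<le> eval S \<mu> b \<rho>)"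
  by (auto simp: ele_def)

lemma eval_enot [simp]: "eval S \<mu> (enot a) \<rho> = of_bool (eval S \<mu> a \<rho> = 0)"
  by (auto simp: enot_def)

lemma eval_epos [simp]: "eval S \<mu> (epos a) \<rho> = of_bool (eval S \<mu> a \<rho> \<noteq> 0)"
  by (auto simp: epos_def)

lemma eval_eand [simp]: "eval S \<mu> (eand a b) \<rho> = of_bool (eval S \<mu> a \<rho> \<noteq> 0 \<and> eval S \<mu> b \<rho> \<noteq> 0)"
  by (auto simp: eand_def)

lemma eval_eor [simp]: "eval S \<mu> (eor a b) \<rho> = of_bool (eval S \<mu> a \<rho> \<noteq> 0 \<or> eval S \<mu> b \<rho> \<noteq> 0)"
  by (auto simp: eor_def)

lemma eval_eeq [simp]: "eval S \<mu> (eeq a b) \<rho> = of_bool (eval S \<mu> a \<rho> = eval S \<mu> b \<rho>)"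
  by (auto simp: eeq_def)

lemma eval_eex [simp]: "eval S \<mu> (eex m b) \<rho> =
    of_bool (\<exists>i\<in>{..<min (eval S \<mu> m \<rho>) S}. eval S \<mu> b (\<rho> @ [i]) \<noteq> 0)"
  by (auto simp: eex_def)

lemma eval_eall [simp]: "eval S \<mu> (eall m b) \<rho> =
    of_bool (\<forall>i\<in>{..<min (eval S \<mu> m \<rho>) S}. eval S \<mu> b (\<rho> @ [i]) \<noteq> 0)"
  by (auto simp: eall_def)

lemma eval_emod [simp]: "eval S \<mu> (emod a b) \<rho> = eval S \<mu> a \<rho> mod eval S \<mu> b \<rho>"
  by (simp add: emod_def minus_div_mult_eq_mod)

section \<open>Digits, powers, bit lengths, primes and least witnesses as expressions\<close>

definition f_dig :: ex where
  "f_dig = emod (ediv (Var 1) (Pow2 (emul (Var 0) (Var 2)))) (Pow2 (Var 0))"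

lemma eval_dig: "w * i \<le> S \<Longrightarrow> w \<le> S \<Longrightarrow> eval S \<mu> f_dig [w, u, i] = dig w u i"
  by (simp add: f_dig_def dig_def)

definition f_pow :: ex where "f_pow = Rec (Var 1) (Num 1) (emul (Var 0) (Var 3))"

lemma eval_pow:
  assumes "i \<le> S" "x ^ i \<le> 2 ^ S"
  shows "eval S \<mu> f_pow [x, i] = x ^ i"
proof -
  have "x ^ j \<le> 2 ^ S" if "j \<le> i" for j
  proof (cases "x = 0")
    case True
    have "x ^ j \<le> 1" using True by (cases j) auto
    also have "1 \<le> (2::nat) ^ S" by simp
    finally show ?thesis .
  next
    case False
    then have "x ^ j \<le> x ^ i" using that by (intro power_increasing) auto
    then show ?thesis using assms(2) by simp
  qed
  then have "j \<le> i \<Longrightarrow> rec_nat (min 1 (2 ^ S)) (\<lambda>i a. min (x * a) (2 ^ S)) j = x ^ j" for j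
  proof (induction j)
    case (Suc j)
    from Suc.prems(2)[OF Suc.prems(1)] have "x * x ^ j \<le> 2 ^ S" by simp
    then show ?case using Suc by simp
  qed simp
  then show ?thesis using assms(1) by (simp add: f_pow_def)
qed

definition f_bl :: ex where "f_bl = Sum (Var 0) (ele (Pow2 (Var 1)) (Var 0))"

lemma floorlog_gt_iff: "0 < x \<Longrightarrow> i < floorlog 2 x \<longleftrightarrow> 2 ^ i \<le> x"
  using floorlog_le_iff[of 2 x i] by linarith

lemma eval_bl:
  assumes "x \<le> S" "0 < x"
  shows "eval S \<mu> f_bl [x] = floorlog 2 x"
proof -
  have "{..<x} \<inter> {i. 2 ^ i \<le> x} = {..<floorlog 2 x}"
    using floorlog_gt_iff[OF assms(2)] less_exp order.strict_trans2 by (auto, blast)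
  moreover have "eval S \<mu> f_bl [x] = (\<Sum>i<x. of_bool (2 ^ i \<le> x))"
    using assms by (simp add: f_bl_def del: sum_of_bool_eq)
  ultimately show ?thesis by simp
qed

definition f_prime :: ex where
  "f_prime = eand (ele (Num 2) (Var 0))
     (eall (Var 0) (enot (eand (ele (Num 2) (Var 1)) (eeq (emod (Var 0) (Var 1)) (Num 0)))))"

lemma eval_prime:
  assumes "p \<le> S"
  shows "eval S \<mu> f_prime [p] = of_bool (prime p)"
proof -
  have "prime p \<longleftrightarrow> 2 \<le> p \<and> (\<forall>d\<in>{..<p}. \<not> (2 \<le> d \<and> p mod d = 0))"
  proof
    assume p: "prime p"
    then show "2 \<le> p \<and> (\<forall>d\<in>{..<p}. \<not> (2 \<le> d \<and> p mod d = 0))"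
      using prime_ge_2_nat[OF p] by (auto simp: prime_nat_iff mod_eq_0_iff_dvd)
  next
    assume p: "2 \<le> p \<and> (\<forall>d\<in>{..<p}. \<not> (2 \<le> d \<and> p mod d = 0))"
    show "prime p"
      unfolding prime_nat_iff
    proof (intro conjI allI impI)
      show "1 < p" using p by simp
      fix d assume d: "d dvd p"
      then have "d \<le> p" "d \<noteq> 0" using p by (auto intro: dvd_imp_le)
      moreover have "\<not> (2 \<le> d \<and> d < p)" using p d by (auto simp: mod_eq_0_iff_dvd)
      ultimately show "d = 1 \<or> d = p" by linarith
    qed
  qed
  then show ?thesis using assms by (simp add: f_prime_def)
qed

text \<open>Expressions can sum but not search: a least witness is computed as the number of indices
  up to which no witness has occurred, and the value \<open>m\<close> signals that there is none
  below \<open>m\<close>.\<close>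

lemma count_least:
  "card ({..<m} \<inter> {f. \<forall>g\<in>{..<Suc f}. \<not> P g}) = (if \<exists>f<m. P f then LEAST f. P f else m)"
proof (cases "\<exists>f<m. P f")
  case True
  then obtain f where f: "f < m" "P f" by blast
  let ?l = "LEAST f. P f"
  have l: "P ?l" "?l \<le> f" using f(2) by (auto intro: LeastI Least_le)
  have "{..<m} \<inter> {f. \<forall>g\<in>{..<Suc f}. \<not> P g} = {..<?l}"
  proof (intro set_eqI iffI)
    fix x assume "x \<in> {..<m} \<inter> {f. \<forall>g\<in>{..<Suc f}. \<not> P g}"
    then have "\<not> ?l < Suc x" using l(1) by blast
    then show "x \<in> {..<?l}" by simp
  next
    fix x assume "x \<in> {..<?l}"
    then have "x < ?l" by simp
    then have "\<not> P g" if "g < Suc x" for g using not_less_Least[of g P] that by linarith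
    then show "x \<in> {..<m} \<inter> {f. \<forall>g\<in>{..<Suc f}. \<not> P g}" using \<open>x < ?l\<close> l(2) f(1) by auto
  qed
  then show ?thesis using True by simp
next
  case False
  then have e: "{..<m} \<inter> {f. \<forall>g\<in>{..<Suc f}. \<not> P g} = {..<m}" by auto
  show ?thesis unfolding if_not_P[OF False] e by simp
qed

section \<open>Parameters\<close>

text \<open>
  \<open>h\<close> is half the number of variables and \<open>lb\<close> the number of bits coding a literal. Sparsification
  runs with thresholds \<open>W\<close> and \<open>X\<close>; \<open>K\<close> of its branching steps, each named by \<open>kap\<close> bits, add petals
  rather than a core, and it leaves at most \<open>T * L\<close> sets. The protocol works modulo the prime \<open>q\<close> of
  \<open>lam\<close> bits with \<open>2 * L\<close> offered coefficients and is repeated \<open>R\<close> times. There are \<open>z\<close> bits of advice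
  in total, and the universe has size \<open>2 ^ m\<close>.
\<close>

definition p_lb :: "nat \<Rightarrow> nat" where "p_lb h = floorlog 2 (4 * h + 4)"
text \<open>Two powers of the logarithm: about \<open>2 ^ lb / lb ^ 2\<close> advice entries of
  \<open>O(lb)\<close> bits each take \<open>O(h / lb)\<close> bits in total.\<close>

definition p_W :: "nat \<Rightarrow> nat" where "p_W h = p_lb h * p_lb h"
definition p_X :: "nat \<Rightarrow> nat \<Rightarrow> nat" where "p_X k h = 4 * (k + 1) * p_W h"
text \<open>\<open>T * L\<close> has to cover the bound of \<open>fams_sparse\<close>. The factor
  \<open>2 ^ lb\<close> of that bound is split into \<open>p_W\<close>, which goes to
  \<open>T\<close>, and about \<open>2 ^ lb / p_W\<close>, which becomes \<open>L\<close>, because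
  \<open>L\<close> determines the length of the advice.\<close>

definition p_T :: "nat \<Rightarrow> nat \<Rightarrow> nat" where "p_T k h = 2 * (k + 1) * p_X k h ^ (2 * k) * p_W h"
definition p_L :: "nat \<Rightarrow> nat" where "p_L h = 2 ^ p_lb h div p_W h + 1"
text \<open>A modulus of at least \<open>4 * T * L\<close> exceeds every possible inner product and
  makes \<open>2 * L\<close> accepted points at most half of all points.\<close>

definition p_Y :: "nat \<Rightarrow> nat \<Rightarrow> nat" where "p_Y k h = 4 * p_T k h * p_L h"
definition p_q :: "nat \<Rightarrow> nat \<Rightarrow> nat" where "p_q k h = p_Y k h + (LEAST f. prime (p_Y k h + f))"
definition p_lam :: "nat \<Rightarrow> nat \<Rightarrow> nat" where "p_lam k h = floorlog 2 (p_q k h)"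
text \<open>One repetition takes \<open>lam * (T + 1)\<close> bits, of order
  \<open>lb ^ (4 * k + 3)\<close>. The three further powers in the divisor keep the total
  \<open>o(h)\<close>, while \<open>R\<close> loses only polylogarithmic factors against
  \<open>h\<close>.\<close>

definition p_R :: "nat \<Rightarrow> nat \<Rightarrow> nat" where "p_R k h = h div p_lb h ^ (4 * k + 6) + 1"
definition p_m :: "nat \<Rightarrow> nat \<Rightarrow> nat" where "p_m k h = p_lam k h * ((p_T k h + 1) * p_R k h)"
definition p_K :: "nat \<Rightarrow> nat \<Rightarrow> nat" where "p_K k h = k * 2 ^ p_lb h div p_W h"
text \<open>One bit more than the times below \<open>U = 2 ^ (lb * k)\<close> need, so that
  \<open>U\<close> itself can serve as a blank entry when fewer than \<open>K\<close> times are to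
  be named.\<close>

definition p_kap :: "nat \<Rightarrow> nat \<Rightarrow> nat" where "p_kap k h = p_lb h * k + 1"
definition p_z1 :: "nat \<Rightarrow> nat \<Rightarrow> nat" where "p_z1 k h = p_kap k h * p_K k h"
definition p_z :: "nat \<Rightarrow> nat \<Rightarrow> nat" where "p_z k h = p_z1 k h + p_lam k h * (2 * p_L h)"

text \<open>The quantities that a cut-off in \<open>eval\<close> must leave unchanged are summands,
  so that \<open>p_S k h \<le> S\<close> disposes of these cut-offs together while remaining
  polynomial in \<open>h\<close>.\<close>

definition p_S :: "nat \<Rightarrow> nat \<Rightarrow> nat" where
  "p_S k h = 2 ^ (p_lb h * k) + (k + 1) * (k + 1) * 2 ^ (p_lb h * k) + k + p_lb h * k + 2 ^ p_lb h +
     (4 * h + 4) + p_T k h + 2 * p_L h + p_R k h + p_Y k h + 16 * p_Y k h ^ 2 + p_lam k h + p_m k h + p_z k h +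
     p_K k h + p_kap k h + p_X k h ^ (2 * k) + p_lb h ^ (4 * k + 6) + 4 * k + 6 + p_lb h"

definition c_h :: ex where "c_h = eadd (ediv (Inp (Num 0)) (Num 2)) (Num 1)"
definition c_lb :: ex where "c_lb = Call f_bl [eadd (emul (Num 4) c_h) (Num 4)]"
definition c_W :: ex where "c_W = emul c_lb c_lb"
definition c_X :: "nat \<Rightarrow> ex" where "c_X k = emul (Num (4 * (k + 1))) c_W"
definition c_T :: "nat \<Rightarrow> ex" where
  "c_T k = emul (emul (Num (2 * (k + 1))) (Call f_pow [c_X k, Num (2 * k)])) c_W"
definition c_L :: ex where "c_L = eadd (ediv (Pow2 c_lb) c_W) (Num 1)"
definition c_U :: "nat \<Rightarrow> ex" where "c_U k = Pow2 (emul c_lb (Num k))"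
definition c_F :: "nat \<Rightarrow> ex" where "c_F k = emul (Num ((k + 1) * (k + 1))) (c_U k)"
definition c_Y :: "nat \<Rightarrow> ex" where "c_Y k = emul (emul (Num 4) (c_T k)) c_L"
text \<open>The call without arguments starts from an empty environment, which fixes the de Bruijn
  levels inside wherever the expression is used.\<close>

definition c_q :: "nat \<Rightarrow> ex" where
  "c_q k = Call (eadd (c_Y k) (Sum (emul (Num 16) (emul (c_Y k) (c_Y k)))
     (eall (eadd (Var 0) (Num 1)) (enot (Call f_prime [eadd (c_Y k) (Var 1)]))))) []"
definition c_lam :: "nat \<Rightarrow> ex" where "c_lam k = Call f_bl [c_q k]"
definition c_R :: "nat \<Rightarrow> ex" where
  "c_R k = eadd (ediv c_h (Call f_pow [c_lb, Num (4 * k + 6)])) (Num 1)"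
definition c_m :: "nat \<Rightarrow> ex" where "c_m k = emul (c_lam k) (emul (eadd (c_T k) (Num 1)) (c_R k))"
definition c_K :: "nat \<Rightarrow> ex" where "c_K k = ediv (emul (Num k) (Pow2 c_lb)) c_W"
definition c_kap :: "nat \<Rightarrow> ex" where "c_kap k = eadd (emul c_lb (Num k)) (Num 1)"
definition c_z1 :: "nat \<Rightarrow> ex" where "c_z1 k = emul (c_kap k) (c_K k)"
definition c_z :: "nat \<Rightarrow> ex" where "c_z k = eadd (c_z1 k) (emul (c_lam k) (emul (Num 2) c_L))"

lemma p_lb_pos: "3 \<le> p_lb h"
  unfolding p_lb_def by (rule floorlog_geI) auto

lemma p_W_pos: "1 \<le> p_W h"
  using p_lb_pos[of h] by (simp add: p_W_def)

lemma p_X_pos: "1 \<le> p_X k h"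
  using p_W_pos[of h] by (simp add: p_X_def)

lemma p_T_pos: "1 \<le> p_T k h"
  using p_W_pos[of h] p_X_pos[of k h] by (simp add: p_T_def Suc_le_eq)

lemma p_Y_pos: "1 \<le> p_Y k h"
  using p_T_pos[of k h] by (simp add: p_Y_def p_L_def)

lemma p_q_least: "\<exists>f<16 * p_Y k h ^ 2. prime (p_Y k h + f)"
proof -
  obtain p where p: "prime p" "p_Y k h \<le> p" "p \<le> 16 * p_Y k h ^ 2"
    using prime_between[OF p_Y_pos] by blast
  then show ?thesis
    using p_Y_pos[of k h] by (intro exI[of _ "p - p_Y k h"]) auto
qed

lemma p_q: "prime (p_q k h)" "p_Y k h \<le> p_q k h" "p_q k h \<le> p_Y k h + 16 * p_Y k h ^ 2"
proof -
  obtain f where f: "f < 16 * p_Y k h ^ 2" "prime (p_Y k h + f)" using p_q_least by blast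
  show "prime (p_q k h)" unfolding p_q_def using f(2) by (rule LeastI)
  show "p_Y k h \<le> p_q k h" by (simp add: p_q_def)
  have "(LEAST f. prime (p_Y k h + f)) \<le> f" using f(2) by (rule Least_le)
  then show "p_q k h \<le> p_Y k h + 16 * p_Y k h ^ 2" using f(1) by (simp add: p_q_def)
qed

locale reduction =
  fixes k h S :: nat and \<mu> :: "nat \<Rightarrow> nat"
  assumes k: "1 \<le> k" and \<mu>0: "\<mu> 0 div 2 + 1 = h" and S: "p_S k h \<le> S"
begin

abbreviation ev :: "ex \<Rightarrow> nat list \<Rightarrow> nat" where "ev \<equiv> eval S \<mu>"

lemma S_ge:
  "2 ^ (p_lb h * k) \<le> S" "(k + 1) * (k + 1) * 2 ^ (p_lb h * k) \<le> S" "k \<le> S" "p_lb h * k \<le> S"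
  "2 ^ p_lb h \<le> S" "4 * h + 4 \<le> S" "p_T k h \<le> S" "2 * p_L h \<le> S" "p_R k h \<le> S" "p_Y k h + 16 * p_Y k h ^ 2 \<le> S"
  "p_lam k h \<le> S" "p_m k h \<le> S" "p_z k h \<le> S" "p_K k h \<le> S" "p_kap k h \<le> S" "p_X k h ^ (2 * k) \<le> S"
  "p_lb h ^ (4 * k + 6) \<le> S" "4 * k + 6 \<le> S" "p_lb h \<le> S"
  using S unfolding p_S_def by linarith+

lemma le_pow2_S: "x \<le> S \<Longrightarrow> x \<le> 2 ^ S"
  using less_exp[of S] by linarith

lemma ev_h [simp]: "ev c_h \<rho> = h"
  using \<mu>0 by (simp add: c_h_def)

lemma ev_lb [simp]: "ev c_lb \<rho> = p_lb h"
  using S_ge(6) by (simp add: c_lb_def p_lb_def eval_bl)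

lemma ev_W [simp]: "ev c_W \<rho> = p_W h"
  by (simp add: c_W_def p_W_def)

lemma ev_X [simp]: "ev (c_X k) \<rho> = p_X k h"
  by (simp add: c_X_def p_X_def)

lemma ev_powX: "i \<le> 2 * k \<Longrightarrow> ev f_pow [p_X k h, i] = p_X k h ^ i"
proof (rule eval_pow)
  assume i: "i \<le> 2 * k"
  then show "i \<le> S" using S_ge(18) by simp
  have "p_X k h ^ i \<le> p_X k h ^ (2 * k)" using i p_X_pos by (intro power_increasing) auto
  then show "p_X k h ^ i \<le> 2 ^ S" using S_ge(16) by (intro le_pow2_S) simp
qed

lemma ev_T [simp]: "ev (c_T k) \<rho> = p_T k h"
  by (simp add: c_T_def p_T_def ev_powX)

lemma ev_L [simp]: "ev c_L \<rho> = p_L h"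
  using S_ge(19) by (simp add: c_L_def p_L_def)

lemma ev_U [simp]: "ev (c_U k) \<rho> = 2 ^ (p_lb h * k)"
  using S_ge(4) by (simp add: c_U_def)

lemma ev_F [simp]: "ev (c_F k) \<rho> = (k + 1) * (k + 1) * 2 ^ (p_lb h * k)"
  by (simp add: c_F_def)

lemma ev_Y [simp]: "ev (c_Y k) \<rho> = p_Y k h"
  by (simp add: c_Y_def p_Y_def)

lemma ev_q [simp]: "ev (c_q k) \<rho> = p_q k h"
proof -
  let ?m = "16 * (p_Y k h * p_Y k h)"
  have m: "p_Y k h + ?m \<le> S" using S_ge(10) by (simp add: power2_eq_square)
  have "ev (c_q k) \<rho> = p_Y k h + (\<Sum>f<?m. of_bool (\<forall>g\<in>{..<Suc f}. \<not> prime (p_Y k h + g)))"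
    unfolding c_q_def using m by (simp add: eval_prime del: sum_of_bool_eq)
  also have "(\<Sum>f<?m. of_bool (\<forall>g\<in>{..<Suc f}. \<not> prime (p_Y k h + g))) =
      card ({..<?m} \<inter> {f. \<forall>g\<in>{..<Suc f}. \<not> prime (p_Y k h + g)})"
    by (subst sum_of_bool_eq) simp_all
  also have "\<dots> = (LEAST f. prime (p_Y k h + f))"
    unfolding count_least using p_q_least[of k h] by (simp add: power2_eq_square)
  finally show ?thesis by (simp add: p_q_def)
qed

lemma ev_lam [simp]: "ev (c_lam k) \<rho> = p_lam k h"
  using p_q(3)[of k h] S_ge(10) prime_gt_0_nat[OF p_q(1)[of k h]] by (simp add: c_lam_def p_lam_def eval_bl)

lemma ev_R [simp]: "ev (c_R k) \<rho> = p_R k h"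
  using S_ge(17,18) le_pow2_S by (simp add: c_R_def p_R_def eval_pow)

lemma ev_m [simp]: "ev (c_m k) \<rho> = p_m k h"
  by (simp add: c_m_def p_m_def)

lemma ev_K [simp]: "ev (c_K k) \<rho> = p_K k h"
  using S_ge(19) by (simp add: c_K_def p_K_def)

lemma ev_kap [simp]: "ev (c_kap k) \<rho> = p_kap k h"
  by (simp add: c_kap_def p_kap_def)

lemma ev_z1 [simp]: "ev (c_z1 k) \<rho> = p_z1 k h"
  by (simp add: c_z1_def p_z1_def)

lemma ev_z [simp]: "ev (c_z k) \<rho> = p_z k h"
  by (simp add: c_z_def p_z_def)

sublocale process "p_lb h" k "p_W h" "p_X k h"
proof
  show "1 \<le> p_W h" by (rule p_W_pos)
  show "2 * p_W h \<le> p_X k h" by (simp add: p_X_def)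
  have "2 * k + 1 \<le> 4 * (k + 1) * 1" by simp
  also have "\<dots> \<le> 4 * (k + 1) * p_W h" by (intro mult_left_mono p_W_pos) simp
  finally show "2 * k + 1 \<le> p_X k h" by (simp add: p_X_def)
  show "1 \<le> p_lb h" using p_lb_pos[of h] by linarith
qed

lemma U_S: "U \<le> S" "Fm \<le> S" using S_ge(1,2) by (simp_all add: U_def Fm_def)

lemma ev_U' [simp]: "ev (c_U k) \<rho> = U" by (simp add: U_def)
lemma ev_F' [simp]: "ev (c_F k) \<rho> = Fm" unfolding Fm_def U_def by simp

declare ev_U [simp del] ev_F [simp del]

end

section \<open>Evaluating the reduction\<close>

definition f_mem :: "nat \<Rightarrow> ex" where
  "f_mem k = eand (ele (Num 1) (Var 1)) (eex (Num k) (eeq (Call f_dig [c_lb, Var 0, Var 2]) (Var 1)))"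
definition f_sub :: "nat \<Rightarrow> ex" where
  "f_sub k = eall (Num k) (eor (eeq (Call f_dig [c_lb, Var 0, Var 2]) (Num 0))
     (Call (f_mem k) [Var 1, Call f_dig [c_lb, Var 0, Var 2]]))"
definition f_card :: "nat \<Rightarrow> ex" where
  "f_card k = Sum (Pow2 c_lb) (Call (f_mem k) [Var 0, Var 1])"
definition f_alive :: "nat \<Rightarrow> ex" where
  "f_alive k = eand (Call f_dig [Num 1, Var 0, Var 1]) (eall (c_U k) (enot (eand (Call f_dig [Num 1, Var 0, Var 2])
     (eand (Call (f_sub k) [Var 2, Var 1]) (enot (Call (f_sub k) [Var 1, Var 2]))))))"
definition f_can :: "nat \<Rightarrow> ex" where
  "f_can k = eall (Var 0) (enot (eand (Call (f_sub k) [Var 1, Var 0]) (Call (f_sub k) [Var 0, Var 1])))"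
definition f_deg :: "nat \<Rightarrow> ex" where
  "f_deg k = Sum (c_U k) (eand (Call (f_alive k) [Var 0, Var 3]) (eand (Call (f_can k) [Var 3])
     (eand (eeq (Call (f_card k) [Var 3]) (Var 1)) (Call (f_sub k) [Var 2, Var 3]))))"
definition f_flw2 :: "nat \<Rightarrow> ex" where
  "f_flw2 k = eand (ele (Num 1) (Var 2)) (eand (ele (Num 1) (Call (f_card k) [Var 3]))
     (eand (eeq (eadd (Call (f_card k) [Var 3]) (Var 2)) (Var 1)) (eand (ele (Var 1) (Num k))
       (ele (Call f_pow [c_X k, esub (emul (Num 2) (Var 2)) (Num 1)]) (Call (f_deg k) [Var 0, Var 1, Var 3])))))"
definition f_flw :: "nat \<Rightarrow> ex" where
  "f_flw k = Call (f_flw2 k) [Var 0, ediv (ediv (Var 1) (c_U k)) (Num (k + 1)),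
     emod (ediv (Var 1) (c_U k)) (Num (k + 1)), emod (Var 1) (c_U k)]"
definition f_least :: "nat \<Rightarrow> ex" where
  "f_least k = Sum (c_F k) (eall (eadd (Var 1) (Num 1)) (enot (Call (f_flw k) [Var 0, Var 2])))"
definition f_diff :: "nat \<Rightarrow> ex" where
  "f_diff k = eall (Pow2 c_lb) (eeq (Call (f_mem k) [Var 0, Var 3])
     (eand (Call (f_mem k) [Var 1, Var 3]) (enot (Call (f_mem k) [Var 2, Var 3]))))"
definition f_new2 :: "nat \<Rightarrow> ex" where
  "f_new2 k = eor (eand (Var 1) (eex (c_U k) (eand (Call (f_alive k) [Var 0, Var 5])
       (eand (eeq (Call (f_card k) [Var 5]) (Var 2)) (eand (Call (f_sub k) [Var 3, Var 5])
         (Call (f_diff k) [Var 4, Var 5, Var 3]))))))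
     (eand (enot (Var 1)) (eand (Call (f_sub k) [Var 4, Var 3]) (Call (f_sub k) [Var 3, Var 4])))"
definition f_new :: "nat \<Rightarrow> ex" where
  "f_new k = eor (Call f_dig [Num 1, Var 0, Var 3]) (eand (ele (eadd (Var 2) (Num 1)) (c_F k))
     (Call (f_new2 k) [Var 0, Var 1, ediv (ediv (Var 2) (c_U k)) (Num (k + 1)), emod (Var 2) (c_U k), Var 3]))"
definition f_next :: "nat \<Rightarrow> ex" where
  "f_next k = Sum (c_U k) (emul (Call (f_new k) [Var 0, Var 1, Var 2, Var 3]) (Pow2 (Var 3)))"
definition f_step :: "nat \<Rightarrow> ex" where
  "f_step k = Call (f_next k) [Var 0, Var 1, Call (f_least k) [Var 0]]"
definition f_dec :: "nat \<Rightarrow> ex" where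
  "f_dec k = eex (c_K k) (eeq (Call f_dig [c_kap k, Var 0, Var 2]) (Var 1))"
definition f_pos :: ex where
  "f_pos = Rec (Var 0) (Num 2) (eadd (eadd (Var 2) (Num 1)) (Inp (Var 2)))"
definition f_match :: "nat \<Rightarrow> ex" where
  "f_match k = eand (eall (Inp (Var 1)) (Call (f_mem k) [Var 0, Inp (eadd (eadd (Var 1) (Num 1)) (Var 2))]))
     (eall (Num k) (eor (eeq (Call f_dig [c_lb, Var 0, Var 2]) (Num 0))
       (eex (Inp (Var 1)) (eeq (Inp (eadd (eadd (Var 1) (Num 1)) (Var 3))) (Call f_dig [c_lb, Var 0, Var 2])))))"
definition f_init :: "nat \<Rightarrow> ex" where
  "f_init k = Sum (c_U k) (emul (eex (Inp (Num 1)) (Call (f_match k) [Var 0, Call f_pos [Var 1]])) (Pow2 (Var 0)))"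
definition f_fam :: "nat \<Rightarrow> ex" where
  "f_fam k = Rec (c_U k) (Call (f_init k) []) (Call (f_step k) [Var 2, Call (f_dec k) [Var 0, Var 1]])"
definition f_tru :: ex where
  "f_tru = eand (ele (eadd (emul (Var 0) c_h) (Num 1)) (ediv (Var 2) (Num 2)))
     (eand (ele (ediv (Var 2) (Num 2)) (eadd (emul (Var 0) c_h) c_h))
       (eeq (eadd (Call f_dig [Num 1, Var 1, esub (esub (ediv (Var 2) (Num 2)) (Num 1)) (emul (Var 0) c_h)])
          (emod (Var 2) (Num 2))) (Num 1)))"
definition f_sat :: "nat \<Rightarrow> ex" where
  "f_sat k = eex (Num k) (Call f_tru [Var 0, Var 1, Call f_dig [c_lb, Var 2, Var 3]])"
definition f_rk :: "nat \<Rightarrow> ex" where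
  "f_rk k = Sum (Var 1) (eand (Call (f_alive k) [Var 0, Var 2]) (Call (f_can k) [Var 2]))"
definition f_a :: "nat \<Rightarrow> ex" where
  "f_a k = eex (c_U k) (eand (Call (f_alive k) [Var 2, Var 4]) (eand (Call (f_can k) [Var 4])
     (eand (eeq (Call (f_rk k) [Var 2, Var 4]) (Var 3)) (enot (Call (f_sat k) [Var 0, Var 1, Var 4])))))"
definition f_fwd :: "nat \<Rightarrow> ex" where
  "f_fwd k = Sum c_L (emul (Call (f_a k) [Num 0, Var 0, Var 1, eadd (emul (Var 2) c_L) (Var 4)])
     (Call f_pow [Var 3, Var 4]))"
definition f_bwd :: "nat \<Rightarrow> ex" where
  "f_bwd k = Sum c_L (emul (Call (f_a k) [Num 1, Var 0, Var 1, eadd (emul (Var 2) c_L) (Var 4)])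
     (Call f_pow [Var 3, esub (esub c_L (Num 1)) (Var 4)]))"
definition f_claim :: "nat \<Rightarrow> ex" where
  "f_claim k = Sum (emul (Num 2) c_L) (emul (enot (eeq (Var 2) (esub c_L (Num 1))))
     (emul (Call f_dig [c_lam k, ediv (Var 0) (Pow2 (c_z1 k)), Var 2]) (Call f_pow [Var 1, Var 2])))"
definition f_chkA :: "nat \<Rightarrow> ex" where
  "f_chkA k = eand (ele (eadd (Var 4) (Num 1)) (c_q k))
     (eeq (emod (Sum (c_T k) (emul (Call (f_fwd k) [Var 0, Var 2, Var 6, Var 4])
         (Call f_dig [c_lam k, Var 3, eadd (eadd (emul (Var 5) (eadd (c_T k) (Num 1))) (Num 1)) (Var 6)]))) (c_q k))
       (emod (Call (f_claim k) [Var 1, Var 4]) (c_q k)))"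
definition f_chkB :: "nat \<Rightarrow> ex" where
  "f_chkB k = eand (ele (eadd (Var 4) (Num 1)) (c_q k))
     (eall (c_T k) (eeq
         (Call f_dig [c_lam k, Var 3, eadd (eadd (emul (Var 5) (eadd (c_T k) (Num 1))) (Num 1)) (Var 6)])
         (emod (Call (f_bwd k) [Var 0, Var 2, Var 6, Var 4]) (c_q k))))"
definition f_in :: "nat \<Rightarrow> ex \<Rightarrow> ex" where
  "f_in k chk = eall (c_R k) (Call chk [Var 0, Var 1, Var 2, Var 3,
     Call f_dig [c_lam k, Var 3, emul (Var 4) (eadd (c_T k) (Num 1))], Var 4])"
definition f_bit :: "nat \<Rightarrow> ex" where
  "f_bit k = eor
     (eand (ele (eadd (Var 1) (Num 1)) (Pow2 c_h))
       (Call (f_in k (f_chkA k)) [Var 1, Var 0, Call (f_fam k) [Var 0], Var 2]))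
     (eand (ele (Pow2 c_h) (Var 1))
       (Call (f_in k (f_chkB k)) [esub (Var 1) (Pow2 c_h), Var 0, Call (f_fam k) [Var 0], Var 2]))"
definition f_word :: "nat \<Rightarrow> ex" where
  "f_word k = eadd (emul (eeq (Var 1) (Num 0)) (Pow2 c_h)) (eadd (emul (eeq (Var 1) (Num 1)) (Pow2 (c_m k)))
     (emul (ele (Num 2) (Var 1)) (Call (f_bit k) [Var 0, ediv (esub (Var 1) (Num 2)) (Pow2 (c_m k)),
        emod (esub (Var 1) (Num 2)) (Pow2 (c_m k))])))"

context reduction
begin

text \<open>A family is a bit mask over all codes, and a member sets the bits of all its codes. The
  mask fits below the cut-off \<open>2 ^ S\<close> because \<open>U \<le> S\<close>.\<close>

definition enc :: "nat set set \<Rightarrow> nat" where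
  "enc K = (\<Sum>u<U. of_bool (lits u \<in> K) * 2 ^ u)"

lemma enc: "enc K < 2 ^ U" "u < U \<Longrightarrow> dig 1 (enc K) u = of_bool (lits u \<in> K)"
  using digits_sum[of U "\<lambda>u. of_bool (lits u \<in> K)" 1] by (auto simp: enc_def)

lemma ev_digl: "i < k \<Longrightarrow> ev f_dig [p_lb h, u, i] = dig (p_lb h) u i"
proof (rule eval_dig)
  assume "i < k"
  then have "p_lb h * i \<le> p_lb h * k" by (intro mult_left_mono) auto
  then show "p_lb h * i \<le> S" using S_ge(4) by linarith
qed (rule S_ge(19))

lemma ev_bit: "u \<le> S \<Longrightarrow> ev f_dig [Suc 0, x, u] = dig 1 x u"
  using eval_dig[of 1 u S \<mu> x] S_ge(19) p_lb_pos[of h] by simp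

lemma ev_mem: "ev (f_mem k) [u, x] = of_bool (x \<in> lits u)"
  using S_ge(3) by (auto simp: f_mem_def ev_digl lits_def)

lemma lits_subset_iff: "lits u \<subseteq> A \<longleftrightarrow> (\<forall>i<k. dig (p_lb h) u i = 0 \<or> dig (p_lb h) u i \<in> A)"
  unfolding lits_def by auto

lemma ev_sub: "ev (f_sub k) [u, v] = of_bool (lits u \<subseteq> lits v)"
  using S_ge(3) by (auto simp: f_sub_def ev_digl ev_mem lits_subset_iff)

lemma ev_card: "ev (f_card k) [u] = card (lits u)"
proof -
  have "ev (f_card k) [u] = card ({..<2 ^ p_lb h} \<inter> {x. x \<in> lits u})"
    using S_ge(5,19) by (simp add: f_card_def ev_mem)
  also have "{..<2 ^ p_lb h} \<inter> {x. x \<in> lits u} = lits u"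
    using lits_V[of u] by (auto simp: V_def)
  finally show ?thesis .
qed

lemma alive_lits:
  assumes "K \<subseteq> codable"
  shows "alive K (lits u) \<longleftrightarrow> lits u \<in> K \<and> (\<forall>v<U. \<not> (lits v \<in> K \<and> lits v \<subseteq> lits u \<and> \<not> lits u \<subseteq> lits v))"
proof -
  have "(\<exists>D\<in>K. D \<subset> lits u) \<longleftrightarrow> (\<exists>v<U. lits v \<in> K \<and> lits v \<subset> lits u)" using assms by blast
  then show ?thesis unfolding alive_def by blast
qed

lemma ev_alive:
  assumes "K \<subseteq> codable" "u < U"
  shows "ev (f_alive k) [enc K, u] = of_bool (alive K (lits u))"
proof -
  have b: "ev f_dig [Suc 0, enc K, v] = of_bool (lits v \<in> K)" if "v < U" for v
    using that U_S(1) enc(2)[OF that] by (simp add: ev_bit)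
  show ?thesis
    unfolding alive_lits[OF assms(1)] using assms(2) U_S(1)
    by (simp add: f_alive_def b ev_sub) (auto simp: b)
qed

text \<open>Sets have several codes; restricting to the least one turns counting codes into counting
  sets.\<close>

definition can :: "nat \<Rightarrow> bool" where "can u \<longleftrightarrow> (\<forall>v<u. lits v \<noteq> lits u)"

lemma ev_can: "u < U \<Longrightarrow> ev (f_can k) [u] = of_bool (can u)"
  using U_S(1) by (auto simp: f_can_def ev_sub can_def)

lemma bij_can: "bij_betw lits {u. u < U \<and> P (lits u) \<and> can u} {C\<in>codable. P C}"
  unfolding bij_betw_def
proof (intro conjI subset_antisym)
  show "inj_on lits {u. u < U \<and> P (lits u) \<and> can u}"
    by (rule inj_onI) (metis (mono_tags, lifting) can_def linorder_neqE_nat mem_Collect_eq)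
  show "lits ` {u. u < U \<and> P (lits u) \<and> can u} \<subseteq> {C\<in>codable. P C}" by auto
  show "{C\<in>codable. P C} \<subseteq> lits ` {u. u < U \<and> P (lits u) \<and> can u}"
  proof
    fix C assume C: "C \<in> {C\<in>codable. P C}"
    then obtain u where u: "u < U" "lits u = C" by auto
    define v where "v = (LEAST v. lits v = C)"
    have v: "lits v = C" unfolding v_def using u(2) by (rule LeastI)
    have "v \<le> u" unfolding v_def using u(2) by (rule Least_le)
    moreover have "can v"
      unfolding can_def
    proof (intro allI impI)
      fix w assume "w < v"
      then have "lits w \<noteq> C" unfolding v_def by (rule not_less_Least)
      then show "lits w \<noteq> lits v" using v by simp
    qed
    ultimately show "C \<in> lits ` {u. u < U \<and> P (lits u) \<and> can u}" using u v C by (intro image_eqI[of _ _ v]) auto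
  qed
qed

lemma ev_deg:
  assumes K: "K \<subseteq> codable"
  shows "ev (f_deg k) [enc K, c, H] = card {C. alive K C \<and> card C = c \<and> lits H \<subseteq> C}"
proof -
  let ?e = "eand (Call (f_alive k) [Var 0, Var 3]) (eand (Call (f_can k) [Var 3])
     (eand (eeq (Call (f_card k) [Var 3]) (Var 1)) (Call (f_sub k) [Var 2, Var 3])))"
  have "ev (f_deg k) [enc K, c, H] = (\<Sum>u<U. ev ?e [enc K, c, H, u])"
    using U_S(1) by (simp add: f_deg_def del: eval_eand sum_of_bool_eq)
  also have "\<dots> = (\<Sum>u<U. of_bool (alive K (lits u) \<and> can u \<and> card (lits u) = c \<and> lits H \<subseteq> lits u))"
    by (intro sum.cong) (simp_all add: ev_alive[OF K] ev_can ev_card ev_sub)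
  also have "\<dots> = card ({..<U} \<inter> {u. alive K (lits u) \<and> can u \<and> card (lits u) = c \<and> lits H \<subseteq> lits u})"
    by (subst sum_of_bool_eq) simp_all
  also have "{..<U} \<inter> {u. alive K (lits u) \<and> can u \<and> card (lits u) = c \<and> lits H \<subseteq> lits u} =
      {u. u < U \<and> (alive K (lits u) \<and> card (lits u) = c \<and> lits H \<subseteq> lits u) \<and> can u}" by auto
  also have "card \<dots> = card {C\<in>codable. alive K C \<and> card C = c \<and> lits H \<subseteq> C}"
    using bij_can[of "\<lambda>C. alive K C \<and> card C = c \<and> lits H \<subseteq> C"] by (rule bij_betw_same_card)
  also have "{C\<in>codable. alive K C \<and> card C = c \<and> lits H \<subseteq> C} = {C. alive K C \<and> card C = c \<and> lits H \<subseteq> C}"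
    using K by (auto simp: alive_def)
  finally show ?thesis .
qed

lemma ev_flw:
  assumes K: "K \<subseteq> codable"
  shows "ev (f_flw k) [enc K, f] = of_bool (flw K f)"
proof -
  have j: "f div U mod Suc k \<le> k" using mod_less_divisor[of "Suc k" "f div U"] by linarith
  have "ev f_pow [p_X k h, 2 * (f div U mod Suc k) - Suc 0] = \<theta> (f div U mod Suc k)"
  proof -
    have "2 * (f div U mod Suc k) - 1 \<le> 2 * k" using j by linarith
    from ev_powX[OF this] show ?thesis by (simp add: \<theta>_def)
  qed
  then show ?thesis
    unfolding flw_def flower_def
    by (simp add: f_flw_def f_flw2_def ev_card ev_deg[OF K])
qed

lemma ev_least:
  assumes K: "K \<subseteq> codable"
  shows "ev (f_least k) [enc K] = (if \<exists>f<Fm. flw K f then least_flw K else Fm)"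
proof -
  have "ev (f_least k) [enc K] = card ({..<Fm} \<inter> {f. \<forall>g\<in>{..<Suc f}. \<not> flw K g})"
    using U_S(2) by (simp add: f_least_def ev_flw[OF K])
  then show ?thesis unfolding count_least least_flw_def .
qed

lemma ev_diff: "ev (f_diff k) [u, v, H] = of_bool (lits u = lits v - lits H)"
proof -
  have "lits u = lits v - lits H \<longleftrightarrow> (\<forall>x<2 ^ p_lb h. x \<in> lits u \<longleftrightarrow> x \<in> lits v \<and> x \<notin> lits H)"
    using lits_V[of u] lits_V[of v] by (auto simp: V_def set_eq_iff subset_iff)
  then show ?thesis using S_ge(5,19) by (auto simp: f_diff_def ev_mem)
qed

lemma ev_new2:
  assumes K: "K \<subseteq> codable"
  shows "ev (f_new2 k) [enc K, d, c, H, u] = of_bool (if d \<noteq> 0 then lits u \<in> petals K c (lits H) else lits u = lits H)"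
proof -
  have "lits u \<in> petals K c (lits H) \<longleftrightarrow>
      (\<exists>v\<in>{..<U}. alive K (lits v) \<and> card (lits v) = c \<and> lits H \<subseteq> lits v \<and> lits u = lits v - lits H)"
    using K unfolding petals_def alive_def by blast
  then show ?thesis
    using U_S(1) by (auto simp: f_new2_def ev_alive[OF K] ev_card ev_sub ev_diff)
qed

lemma ev_new:
  assumes K: "K \<subseteq> codable" and u: "u < U"
  shows "ev (f_new k) [enc K, d, if \<exists>f<Fm. flw K f then least_flw K else Fm, u] =
    of_bool (lits u \<in> next_fam K (d \<noteq> 0))"
proof -
  have b: "ev f_dig [Suc 0, enc K, u] = of_bool (lits u \<in> K)"
    using u U_S(1) enc(2)[OF u] by (simp add: ev_bit)
  show ?thesis
  proof (cases "\<exists>f<Fm. flw K f")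
    case True
    then obtain f where f: "f < Fm" "flw K f" by blast
    have "least_flw K \<le> f" unfolding least_flw_def using f(2) by (rule Least_le)
    then have l: "Suc (least_flw K) \<le> Fm" using f(1) by simp
    have n: "next_fam K (d \<noteq> 0) = (if d \<noteq> 0 then K \<union> petals K (least_flw K div U div (k + 1)) (lits (least_flw K mod U))
        else insert (lits (least_flw K mod U)) K)"
      unfolding next_fam_def Let_def using True by (rule if_P)
    show ?thesis
      unfolding n if_P[OF True] using l by (simp add: f_new_def b ev_new2[OF K])
  next
    case False
    show ?thesis
      unfolding if_not_P[OF False] no_flower_step[OF False] by (simp add: f_new_def b)
  qed
qed

lemma ev_step:
  assumes K: "K \<subseteq> codable"
  shows "ev (f_step k) [enc K, d] = enc (next_fam K (d \<noteq> 0))"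
proof -
  have "ev (f_step k) [enc K, d] = (\<Sum>u<U. ev (f_new k) [enc K, d, if \<exists>f<Fm. flw K f then least_flw K else Fm, u] * 2 ^ min u S)"
    using U_S(1) by (simp add: f_step_def f_next_def ev_least[OF K] split del: if_split)
  also have "\<dots> = (\<Sum>u<U. of_bool (lits u \<in> next_fam K (d \<noteq> 0)) * 2 ^ u)"
  proof (rule sum.cong[OF refl])
    fix u assume "u \<in> {..<U}"
    then have u: "u < U" "min u S = u" using U_S(1) by auto
    show "ev (f_new k) [enc K, d, if \<exists>f<Fm. flw K f then least_flw K else Fm, u] * 2 ^ min u S =
        of_bool (lits u \<in> next_fam K (d \<noteq> 0)) * 2 ^ u"
      unfolding ev_new[OF K u(1)] u(2) ..
  qed
  finally show ?thesis by (simp only: enc_def)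
qed

definition D :: "nat \<Rightarrow> nat set" where
  "D z = {t. \<exists>i<p_K k h. dig (p_kap k h) z i = t}"

lemma ev_dec: "ev (f_dec k) [z, t] = of_bool (t \<in> D z)"
proof -
  have "ev f_dig [p_kap k h, z, i] = dig (p_kap k h) z i" if "i < p_K k h" for i
  proof (rule eval_dig)
    have "p_kap k h * i \<le> p_kap k h * p_K k h" using that by (intro mult_left_mono) auto
    then show "p_kap k h * i \<le> S" using S_ge(13) unfolding p_z_def p_z1_def by linarith
  qed (rule S_ge(15))
  then show ?thesis using S_ge(14) by (auto simp: f_dec_def D_def)
qed

lemma enc_le: "enc K \<le> 2 ^ S"
proof -
  have "enc K \<le> 2 ^ U" using enc(1) by (rule less_imp_le)
  also have "(2::nat) ^ U \<le> 2 ^ S" using U_S(1) by (intro power_increasing) auto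
  finally show ?thesis .
qed

lemma ev_fam:
  assumes F: "F \<subseteq> codable" and init: "ev (f_init k) [] = enc F"
  shows "ev (f_fam k) [z] = enc (fams F (D z) U)"
proof -
  have "rec_nat (min (enc F) (2 ^ S)) (\<lambda>i x. min (ev (f_step k) [x, ev (f_dec k) [z, i]]) (2 ^ S)) t =
      enc (fams F (D z) t)" for t
  proof (induction t)
    case 0
    then show ?case using enc_le by (simp add: min_def)
  next
    case (Suc t)
    have K: "fams F (D z) t \<subseteq> codable" using fams_path[OF F] by blast
    show ?case using Suc enc_le by (simp add: ev_step[OF K] ev_dec min_def)
  qed
  then show ?thesis using U_S(1) by (simp add: f_fam_def init)
qed

text \<open>Half \<open>s\<close> is responsible for the variables \<open>s * h + 1\<close> to
  \<open>s * h + h\<close>, and \<open>x\<close> holds their values as bits. Bit plus sign is 1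
  exactly if they fit: bit 1 with the even code of a positive literal, bit 0 with the odd code of a
  negative one. The padding code 0 is never true.\<close>

definition tru :: "nat \<Rightarrow> nat \<Rightarrow> nat \<Rightarrow> bool" where
  "tru s x c \<longleftrightarrow> s * h + 1 \<le> c div 2 \<and> c div 2 \<le> s * h + h \<and> dig 1 x (c div 2 - 1 - s * h) + c mod 2 = 1"

lemma ev_tru: "c < 2 ^ p_lb h \<Longrightarrow> ev f_tru [s, x, c] = of_bool (tru s x c)"
  using S_ge(5) by (simp add: f_tru_def tru_def ev_bit)

lemma ev_sat: "ev (f_sat k) [s, x, u] = of_bool (\<exists>c\<in>lits u. tru s x c)"
proof -
  have "(\<exists>c\<in>lits u. tru s x c) \<longleftrightarrow> (\<exists>i\<in>{..<k}. tru s x (dig (p_lb h) u i))"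
    by (auto simp: lits_def tru_def)
  then show ?thesis using S_ge(3) by (simp add: f_sat_def ev_digl ev_tru dig_less)
qed

text \<open>Ranks number the alive sets consecutively, so the vectors need only as many coordinates
  as there are alive sets, not \<open>U\<close> many.\<close>

definition rk :: "nat set set \<Rightarrow> nat \<Rightarrow> nat" where
  "rk K u = card {v. v < u \<and> alive K (lits v) \<and> can v}"

lemma ev_rk:
  assumes K: "K \<subseteq> codable" and u: "u < U"
  shows "ev (f_rk k) [enc K, u] = rk K u"
proof -
  have "ev (f_rk k) [enc K, u] = (\<Sum>v<u. ev (eand (Call (f_alive k) [Var 0, Var 2]) (Call (f_can k) [Var 2])) [enc K, u, v])"
    using u U_S(1) by (simp add: f_rk_def)
  also have "\<dots> = (\<Sum>v<u. of_bool (alive K (lits v) \<and> can v))"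
    using u by (intro sum.cong) (simp_all add: ev_alive[OF K] ev_can)
  also have "\<dots> = card {v. v < u \<and> alive K (lits v) \<and> can v}"
    by (simp add: Collect_conj_eq[symmetric] lessThan_def)
  finally show ?thesis by (simp only: rk_def)
qed

text \<open>A coordinate is 1 if its set is not satisfied by this half. Indices beyond the number of
  alive sets give 0, which pads the vectors to length \<open>T * L\<close>.\<close>

definition aa :: "nat \<Rightarrow> nat \<Rightarrow> nat set set \<Rightarrow> nat \<Rightarrow> nat" where
  "aa s x K i = of_bool (\<exists>u<U. alive K (lits u) \<and> can u \<and> rk K u = i \<and> \<not> (\<exists>c\<in>lits u. tru s x c))"

lemma ev_a:
  assumes K: "K \<subseteq> codable"
  shows "ev (f_a k) [s, x, enc K, i] = aa s x K i"
proof -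
  let ?e = "eand (Call (f_alive k) [Var 2, Var 4]) (eand (Call (f_can k) [Var 4])
     (eand (eeq (Call (f_rk k) [Var 2, Var 4]) (Var 3)) (enot (Call (f_sat k) [Var 0, Var 1, Var 4]))))"
  have "ev ?e [s, x, enc K, i, u] \<noteq> 0 \<longleftrightarrow>
      alive K (lits u) \<and> can u \<and> rk K u = i \<and> \<not> (\<exists>c\<in>lits u. tru s x c)" if "u < U" for u
    using that by (simp add: ev_alive[OF K] ev_can ev_rk[OF K] ev_sat) blast
  then have "(\<exists>u\<in>{..<U}. ev ?e [s, x, enc K, i, u] \<noteq> 0) \<longleftrightarrow>
      (\<exists>u<U. alive K (lits u) \<and> can u \<and> rk K u = i \<and> \<not> (\<exists>c\<in>lits u. tru s x c))"
    by blast
  moreover have "ev (f_a k) [s, x, enc K, i] = of_bool (\<exists>u\<in>{..<U}. ev ?e [s, x, enc K, i, u] \<noteq> 0)"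
    using U_S(1) by (simp add: f_a_def del: eval_eand)
  ultimately show ?thesis by (simp only: aa_def)
qed

lemma ev_powr:
  assumes "r < 2 ^ p_lam k h" "i < 2 * p_L h"
  shows "ev f_pow [r, i] = r ^ i"
proof (rule eval_pow)
  show "i \<le> S" using assms(2) S_ge(8) by linarith
  have "r ^ i \<le> (2 ^ p_lam k h) ^ i" using assms(1) by (intro power_mono) auto
  also have "\<dots> = 2 ^ (p_lam k h * i)" by (simp add: power_mult)
  also have "\<dots> \<le> 2 ^ (p_lam k h * (2 * p_L h))" using assms(2) by (intro power_increasing mult_left_mono) auto
  also have "\<dots> \<le> 2 ^ S" using S_ge(13) by (intro power_increasing) (auto simp: p_z_def)
  finally show "r ^ i \<le> 2 ^ S" .
qed

lemma ev_fwd: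
  assumes K: "K \<subseteq> codable" and r: "r < 2 ^ p_lam k h"
  shows "ev (f_fwd k) [x, enc K, j, r] = fwd (aa 0 x K) (p_L h) j r"
proof -
  have "ev f_pow [r, i] = r ^ i" if "i < p_L h" for i using ev_powr[OF r] that by simp
  then show ?thesis using S_ge(8) by (simp add: f_fwd_def fwd_def ev_a[OF K])
qed

lemma ev_bwd:
  assumes K: "K \<subseteq> codable" and r: "r < 2 ^ p_lam k h"
  shows "ev (f_bwd k) [x, enc K, j, r] = bwd (aa 1 x K) (p_L h) j r"
proof -
  have "ev f_pow [r, p_L h - Suc 0 - i] = r ^ (p_L h - Suc 0 - i)" if "i < p_L h" for i
    using ev_powr[OF r] that by simp
  then show ?thesis using S_ge(8) by (simp add: f_bwd_def bwd_def ev_a[OF K])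
qed

definition offer :: "nat \<Rightarrow> nat \<Rightarrow> nat" where
  "offer z d = dig (p_lam k h) (z div 2 ^ p_z1 k h) d"

lemma ev_claim:
  assumes r: "r < 2 ^ p_lam k h"
  shows "ev (f_claim k) [z, r] = claim (offer z) (p_L h) r"
proof -
  have z1: "p_z1 k h \<le> S" using S_ge(13) by (simp add: p_z_def)
  have d: "ev f_dig [p_lam k h, u, d] = dig (p_lam k h) u d" if "d < 2 * p_L h" for d u
  proof (rule eval_dig)
    have "p_lam k h * d \<le> p_lam k h * (2 * p_L h)" using that by (intro mult_left_mono) auto
    then show "p_lam k h * d \<le> S" using S_ge(13) unfolding p_z_def by linarith
  qed (rule S_ge(11))
  have "ev (f_claim k) [z, r] = (\<Sum>d<2 * p_L h. of_bool (d \<noteq> p_L h - Suc 0) * (offer z d * r ^ d))"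
    using S_ge(8) z1 by (simp add: f_claim_def d ev_powr[OF r] offer_def)
  also have "\<dots> = claim (offer z) (p_L h) r"
    unfolding claim_def by (intro sum.cong) auto
  finally show ?thesis .
qed

lemma ev_digm: "i \<le> (p_T k h + 1) * p_R k h \<Longrightarrow> ev f_dig [p_lam k h, u, i] = dig (p_lam k h) u i"
proof (rule eval_dig)
  assume "i \<le> (p_T k h + 1) * p_R k h"
  then have "p_lam k h * i \<le> p_m k h" unfolding p_m_def by (intro mult_left_mono) auto
  then show "p_lam k h * i \<le> S" using S_ge(12) by linarith
qed (rule S_ge(11))

lemma block_le:
  assumes "\<rho> < p_R k h" "t \<le> p_T k h"
  shows "\<rho> * (p_T k h + 1) + t \<le> (p_T k h + 1) * p_R k h"
proof -
  have "\<rho> * (p_T k h + 1) + t \<le> (\<rho> + 1) * (p_T k h + 1)" using assms(2) by simp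
  also have "\<dots> \<le> p_R k h * (p_T k h + 1)" using assms(1) by (intro mult_right_mono) auto
  finally show ?thesis by (simp only: mult.commute)
qed

text \<open>The set of \<open>x\<close> must not refer to any \<open>y\<close>: the values of the
  polynomials of \<open>y\<close> are read off the element \<open>u\<close> itself, and
  \<open>inB\<close> is what forces them to be the true ones.\<close>

definition inA :: "nat set set \<Rightarrow> nat \<Rightarrow> nat \<Rightarrow> nat \<Rightarrow> bool" where
  "inA K x z u \<longleftrightarrow> (\<forall>\<rho><p_R k h. let r = dig (p_lam k h) u (\<rho> * (p_T k h + 1)) in r < p_q k h \<and>
     (\<Sum>j<p_T k h. fwd (aa 0 x K) (p_L h) j r * dig (p_lam k h) u (\<rho> * (p_T k h + 1) + 1 + j)) mod p_q k h =
     claim (offer z) (p_L h) r mod p_q k h)"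

definition inB :: "nat set set \<Rightarrow> nat \<Rightarrow> nat \<Rightarrow> bool" where
  "inB K y u \<longleftrightarrow> (\<forall>\<rho><p_R k h. let r = dig (p_lam k h) u (\<rho> * (p_T k h + 1)) in r < p_q k h \<and>
     (\<forall>j<p_T k h. dig (p_lam k h) u (\<rho> * (p_T k h + 1) + 1 + j) = bwd (aa 1 y K) (p_L h) j r mod p_q k h))"

lemma ev_inA:
  assumes K: "K \<subseteq> codable"
  shows "ev (f_in k (f_chkA k)) [x, z, enc K, u] = of_bool (inA K x z u)"
proof -
  have chk: "ev (f_chkA k) [x, z, enc K, u, r, \<rho>] = of_bool (r < p_q k h \<and>
     (\<Sum>j<p_T k h. fwd (aa 0 x K) (p_L h) j r * dig (p_lam k h) u (\<rho> * (p_T k h + 1) + 1 + j)) mod p_q k h =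
     claim (offer z) (p_L h) r mod p_q k h)" if "r < 2 ^ p_lam k h" "\<rho> < p_R k h" for r \<rho>
  proof -
    have "ev f_dig [p_lam k h, u, \<rho> + \<rho> * p_T k h + Suc 0 + j] = dig (p_lam k h) u (Suc (\<rho> + \<rho> * p_T k h + j))"
      if "j < p_T k h" for j
      using ev_digm[of "\<rho> * (p_T k h + 1) + (1 + j)" u] block_le[OF \<open>\<rho> < p_R k h\<close>, of "1 + j"] that by simp
    then have "(\<Sum>j<p_T k h. ev (f_fwd k) [x, enc K, j, r] * ev f_dig [p_lam k h, u, \<rho> * (p_T k h + 1) + 1 + j]) =
      (\<Sum>j<p_T k h. fwd (aa 0 x K) (p_L h) j r * dig (p_lam k h) u (\<rho> * (p_T k h + 1) + 1 + j))"
      by (intro sum.cong) (simp_all add: ev_fwd[OF K that(1)])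
    then show ?thesis
      using S_ge(7) unfolding f_chkA_def by (simp add: ev_claim[OF that(1)] Suc_le_eq)
  qed
  have r: "ev f_dig [p_lam k h, u, \<rho> * (p_T k h + 1)] = dig (p_lam k h) u (\<rho> * (p_T k h + 1))"
    if "\<rho> < p_R k h" for \<rho>
    using ev_digm block_le[OF that, of 0] by simp
  have "(\<forall>\<rho>\<in>{..<p_R k h}. ev (f_chkA k) [x, z, enc K, u, ev f_dig [p_lam k h, u, \<rho> * (p_T k h + 1)], \<rho>] \<noteq> 0) \<longleftrightarrow>
      inA K x z u"
    unfolding inA_def Let_def using chk[OF dig_less] r by (simp add: Ball_def)
  then show ?thesis using S_ge(9) by (simp add: f_in_def)
qed

lemma ev_inB:
  assumes K: "K \<subseteq> codable"
  shows "ev (f_in k (f_chkB k)) [y, z, enc K, u] = of_bool (inB K y u)"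
proof -
  have chk: "ev (f_chkB k) [y, z, enc K, u, r, \<rho>] = of_bool (r < p_q k h \<and>
     (\<forall>j<p_T k h. dig (p_lam k h) u (\<rho> * (p_T k h + 1) + 1 + j) = bwd (aa 1 y K) (p_L h) j r mod p_q k h))"
    if "r < 2 ^ p_lam k h" "\<rho> < p_R k h" for r \<rho>
  proof -
    have "ev f_dig [p_lam k h, u, \<rho> * (p_T k h + 1) + 1 + j] = dig (p_lam k h) u (\<rho> * (p_T k h + 1) + 1 + j)"
      if "j < p_T k h" for j
      using ev_digm[of "\<rho> * (p_T k h + 1) + (1 + j)" u] block_le[OF \<open>\<rho> < p_R k h\<close>, of "1 + j"] that
      by (simp only: add.assoc)
    then have "(\<forall>j\<in>{..<p_T k h}. ev f_dig [p_lam k h, u, \<rho> * (p_T k h + 1) + 1 + j] =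
        ev (f_bwd k) [y, enc K, j, r] mod p_q k h) \<longleftrightarrow>
      (\<forall>j<p_T k h. dig (p_lam k h) u (\<rho> * (p_T k h + 1) + 1 + j) = bwd (aa 1 y K) (p_L h) j r mod p_q k h)"
      by (simp add: ev_bwd[OF K that(1)] Ball_def)
    then show ?thesis
      using S_ge(7) unfolding f_chkB_def by (simp add: Suc_le_eq)
  qed
  have r: "ev f_dig [p_lam k h, u, \<rho> * (p_T k h + 1)] = dig (p_lam k h) u (\<rho> * (p_T k h + 1))"
    if "\<rho> < p_R k h" for \<rho>
    using ev_digm block_le[OF that, of 0] by simp
  have "(\<forall>\<rho>\<in>{..<p_R k h}. ev (f_chkB k) [y, z, enc K, u, ev f_dig [p_lam k h, u, \<rho> * (p_T k h + 1)], \<rho>] \<noteq> 0) \<longleftrightarrow>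
      inB K y u"
    unfolding inB_def Let_def using chk[OF dig_less] r by (simp add: Ball_def)
  then show ?thesis using S_ge(9) by (simp add: f_in_def)
qed

lemma ev_word:
  assumes F: "F \<subseteq> codable" and init: "ev (f_init k) [] = enc F"
  shows "ev (f_word k) [z, i] = (if i = 0 then 2 ^ h else if i = 1 then 2 ^ p_m k h else
    let s = (i - 2) div 2 ^ p_m k h; u = (i - 2) mod 2 ^ p_m k h; K = fams F (D z) U in
      of_bool (if s < 2 ^ h then inA K s z u else inB K (s - 2 ^ h) u))"
proof -
  have K: "fams F (D z) U \<subseteq> codable" using fams_path[OF F] by blast
  have "ev (f_bit k) [z, s, u] = of_bool (if s < 2 ^ h then inA (fams F (D z) U) s z u
      else inB (fams F (D z) U) (s - 2 ^ h) u)" for s u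
    using S_ge(6) by (auto simp: f_bit_def ev_fam[OF F init] ev_inA[OF K] ev_inB[OF K] Suc_le_eq not_le)
  then show ?thesis
    using S_ge(6,12) by (auto simp: f_word_def Let_def)
qed

end

section \<open>Correctness of the reduction\<close>

lemma dig_mod: "i < n \<Longrightarrow> dig w (x mod 2 ^ (w * n)) i = dig w x i"
proof -
  assume i: "i < n"
  have p: "(2::nat) ^ (w * n) = 2 ^ (w * i) * (2 ^ w * 2 ^ (w * (n - i - 1)))"
    unfolding mult_split[OF i, of w] by (simp add: power_add mult.commute)
  have "x mod 2 ^ (w * n) div 2 ^ (w * i) = x div 2 ^ (w * i) mod (2 ^ w * 2 ^ (w * (n - i - 1)))"
    unfolding p by (simp add: mod_mult2_eq)
  then show ?thesis by (simp add: dig_def mod_mult2_eq)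
qed

section \<open>Clauses as sets of literal codes and their place in the input\<close>

definition clause_codes :: "cnf \<Rightarrow> nat set set" where
  "clause_codes \<phi> = (\<lambda>c. enc_literal ` set c) ` set \<phi>"

definition cnf_body :: "cnf \<Rightarrow> nat list" where
  "cnf_body \<phi> = concat (map (\<lambda>c. length c # map enc_literal c) \<phi>)"

definition clause_pos :: "cnf \<Rightarrow> nat \<Rightarrow> nat" where
  "clause_pos \<phi> i = (\<Sum>l<i. length (\<phi> ! l) + 1)"

lemma cnf_body_nth:
  assumes "i < length \<phi>" "j \<le> length (\<phi> ! i)"
  shows "clause_pos \<phi> i + j < length (cnf_body \<phi>) \<and>
    cnf_body \<phi> ! (clause_pos \<phi> i + j) = (length (\<phi> ! i) # map enc_literal (\<phi> ! i)) ! j"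
  using assms
proof (induction \<phi> arbitrary: i)
  case (Cons c \<phi>)
  show ?case
  proof (cases i)
    case 0
    then show ?thesis using Cons.prems by (simp add: cnf_body_def clause_pos_def nth_append nth_Cons split: nat.split)
  next
    case (Suc i')
    have p: "clause_pos (c # \<phi>) i = length c + 1 + clause_pos \<phi> i'"
      unfolding clause_pos_def Suc by (subst sum.lessThan_Suc_shift) simp
    have b: "cnf_body (c # \<phi>) = (length c # map enc_literal c) @ cnf_body \<phi>" by (simp add: cnf_body_def)
    have "clause_pos \<phi> i' + j < length (cnf_body \<phi>) \<and>
        cnf_body \<phi> ! (clause_pos \<phi> i' + j) = (length (\<phi> ! i') # map enc_literal (\<phi> ! i')) ! j"
      using Cons.prems Suc by (intro Cons.IH) auto
    then show ?thesis unfolding Suc p[unfolded Suc] b by (simp add: nth_append)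
  qed
qed simp

lemma length_cnf_body: "length (cnf_body \<phi>) = clause_pos \<phi> (length \<phi>)"
proof (induction \<phi>)
  case (Cons c \<phi>)
  have "clause_pos (c # \<phi>) (length (c # \<phi>)) = length c + 1 + clause_pos \<phi> (length \<phi>)"
    unfolding clause_pos_def length_Cons by (subst sum.lessThan_Suc_shift) simp
  then show ?case using Cons by (simp add: cnf_body_def)
qed (simp add: cnf_body_def clause_pos_def)

lemma enc_cnf_eq: "enc_cnf n \<phi> = n # length \<phi> # cnf_body \<phi>"
  by (simp add: enc_cnf_def cnf_body_def)

lemma enc_literal_inj: "enc_literal l = enc_literal l' \<longleftrightarrow> l = l'"
  by (cases l; cases l') (auto, presburger+)

context reduction
begin

lemma two_lb: "4 * h + 4 < 2 ^ p_lb h"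
  using floorlog_bounds[of "4 * h + 4" 2] by (simp add: p_lb_def)

lemma card_V_le: "card V \<le> 2 ^ p_lb h"
  by (simp add: V_def)

end

locale formula = reduction +
  fixes n :: nat and \<phi> :: cnf
  assumes kcnf: "is_kcnf k n \<phi>" and h: "h = n div 2 + 1" and \<mu>: "\<mu> = input_word (enc_cnf n \<phi>)"
begin

definition F :: "nat set set" where "F = clause_codes \<phi>"

lemma clause:
  assumes "c \<in> set \<phi>"
  shows "distinct c" "length c \<le> k" "l \<in> set c \<Longrightarrow> 1 \<le> var l \<and> var l \<le> n"
  using kcnf assms by (auto simp: is_kcnf_def)

lemma code_bounds: "c \<in> set \<phi> \<Longrightarrow> l \<in> set c \<Longrightarrow> 1 \<le> enc_literal l \<and> enc_literal l \<le> 2 * n + 1"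
  using clause(3)[of c l] by (cases l) auto

lemma n_h: "2 * n + 1 \<le> 4 * h + 4" "n \<le> 2 * h"
proof -
  show "2 * n + 1 \<le> 4 * h + 4" unfolding h by presburger
  show "n \<le> 2 * h" unfolding h by presburger
qed

lemma F_codable: "F \<subseteq> codable"
proof
  fix C assume "C \<in> F"
  then obtain c where c: "c \<in> set \<phi>" "C = enc_literal ` set c" by (auto simp: F_def clause_codes_def)
  have "C \<subseteq> V"
    using code_bounds[OF c(1)] n_h two_lb unfolding c(2) V_def by force
  moreover have "card C \<le> k"
    using card_image_le[of "set c" enc_literal] card_length[of c] clause(2)[OF c(1)] c(2) by simp
  ultimately show "C \<in> codable" unfolding codable_iff by blast
qed

text \<open>Clauses are distinct as sets and \<open>enc_literal\<close> is injective, so different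
  clauses give different codable sets, of which there are at most \<open>U\<close>. This bounds the
  input length by a polynomial in \<open>n\<close>.\<close>

lemma length_\<phi>: "length \<phi> \<le> U"
proof -
  have "inj_on (\<lambda>C. enc_literal ` C) (set (map set \<phi>))"
    by (rule inj_onI) (metis inj_image_eq_iff injI enc_literal_inj)
  then have "card (set (map set \<phi>)) = card ((\<lambda>C. enc_literal ` C) ` set (map set \<phi>))"
    by (simp only: card_image)
  also have "(\<lambda>C. enc_literal ` C) ` set (map set \<phi>) = F" by (auto simp: F_def clause_codes_def)
  also have "card F \<le> card codable" using F_codable by (intro card_mono) auto
  also have "\<dots> \<le> U" using card_image_le[of "{..<U}" lits] by simp
  finally show ?thesis using kcnf distinct_card[of "map set \<phi>"] by (simp add: is_kcnf_def)
qed

lemma length_enc: "length (enc_cnf n \<phi>) \<le> S"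
proof -
  have "clause_pos \<phi> (length \<phi>) \<le> (\<Sum>l<length \<phi>. k + 1)"
    unfolding clause_pos_def using clause(2) by (intro sum_mono) auto
  also have "\<dots> = length \<phi> * (k + 1)" by simp
  also have "\<dots> \<le> U * (k + 1)" using length_\<phi> by (rule mult_right_mono) simp
  also have "\<dots> \<le> (k + 1) * (k + 1) * U" by simp
  finally show ?thesis
    using S unfolding p_S_def U_def[symmetric] by (simp add: enc_cnf_eq length_cnf_body)
qed

lemma words: "\<forall>x\<in>set (enc_cnf n \<phi>). x < 2 ^ S"
proof
  fix x assume "x \<in> set (enc_cnf n \<phi>)"
  then have "x = n \<or> x = length \<phi> \<or> (\<exists>c\<in>set \<phi>. x = length c) \<or> (\<exists>c\<in>set \<phi>. \<exists>l\<in>set c. x = enc_literal l)"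
    by (auto simp: enc_cnf_def)
  then have "x \<le> S"
  proof (elim disjE bexE)
    assume "x = n" then show ?thesis using n_h(1) S_ge(6) by linarith
  next
    assume "x = length \<phi>" then show ?thesis using length_\<phi> U_S(1) by linarith
  next
    fix c assume "c \<in> set \<phi>" "x = length c" then show ?thesis using clause(2)[of c] S_ge(3) by linarith
  next
    fix c l assume "c \<in> set \<phi>" "l \<in> set c" "x = enc_literal l"
    then show ?thesis using code_bounds[of c l] n_h(1) S_ge(6) by linarith
  qed
  then show "x < 2 ^ S" using less_exp[of S] by linarith
qed

lemma \<mu>_nth: "i < length (enc_cnf n \<phi>) \<Longrightarrow> \<mu> i = enc_cnf n \<phi> ! i"
  by (simp add: \<mu>)

lemma \<mu>_1: "\<mu> 1 = length \<phi>"
  by (simp add: \<mu> enc_cnf_eq)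

lemma \<mu>_clause:
  assumes "i < length \<phi>" "j \<le> length (\<phi> ! i)"
  shows "\<mu> (2 + clause_pos \<phi> i + j) = (length (\<phi> ! i) # map enc_literal (\<phi> ! i)) ! j"
    "2 + clause_pos \<phi> i + j \<le> S"
proof -
  note b = cnf_body_nth[OF assms]
  have l: "2 + clause_pos \<phi> i + j < length (enc_cnf n \<phi>)" using b by (simp add: enc_cnf_eq)
  then show "2 + clause_pos \<phi> i + j \<le> S" using length_enc by linarith
  show "\<mu> (2 + clause_pos \<phi> i + j) = (length (\<phi> ! i) # map enc_literal (\<phi> ! i)) ! j"
    unfolding \<mu>_nth[OF l] using b by (simp add: enc_cnf_eq)
qed

lemma ev_pos: "i < length \<phi> \<Longrightarrow> ev f_pos [i] = 2 + clause_pos \<phi> i"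
proof -
  assume i: "i < length \<phi>"
  have r: "t \<le> i \<Longrightarrow> rec_nat (min 2 (2 ^ S)) (\<lambda>i x. min (x + 1 + \<mu> (min x S)) (2 ^ S)) t = 2 + clause_pos \<phi> t" for t
  proof (induction t)
    case 0
    have "2 \<le> S" using S_ge(6) by linarith
    then show ?case using le_pow2_S[of 2] by (simp add: clause_pos_def)
  next
    case (Suc t)
    then have t: "t < length \<phi>" using i by simp
    have m: "\<mu> (2 + clause_pos \<phi> t) = length (\<phi> ! t)" "2 + clause_pos \<phi> t \<le> S"
      using \<mu>_clause[OF t, of 0] by simp_all
    have "2 + clause_pos \<phi> (Suc t) \<le> 2 ^ S"
    proof (rule le_pow2_S)
      have "Suc t < length \<phi>" using Suc.prems i by simp
      then show "2 + clause_pos \<phi> (Suc t) \<le> S" using \<mu>_clause(2)[of "Suc t" 0] by simp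
    qed
    moreover have "clause_pos \<phi> (Suc t) = clause_pos \<phi> t + (length (\<phi> ! t) + 1)" by (simp add: clause_pos_def)
    moreover have "min (2 + clause_pos \<phi> t) S = 2 + clause_pos \<phi> t" using m(2) by simp
    ultimately show ?case using Suc.IH Suc.prems m(1) by simp
  qed
  have "i \<le> S" using i length_\<phi> U_S(1) by linarith
  then show ?thesis using r[of i] by (simp add: f_pos_def)
qed

lemma ev_match:
  assumes "i < length \<phi>"
  shows "ev (f_match k) [u, 2 + clause_pos \<phi> i] = of_bool (lits u = enc_literal ` set (\<phi> ! i))"
proof -
  let ?c = "\<phi> ! i" and ?p = "2 + clause_pos \<phi> i"
  have len: "\<mu> (min ?p S) = length ?c" using \<mu>_clause[OF assms, of 0] by simp
  have lS: "length ?c \<le> S" using clause(2)[of ?c] assms S_ge(3) by simp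
  have lit: "\<mu> (min (?p + 1 + j) S) = enc_literal (?c ! j)" if "j < length ?c" for j
    using \<mu>_clause[OF assms, of "j + 1"] that by (simp add: add.assoc)
  have "ev (f_match k) [u, ?p] = of_bool ((\<forall>j\<in>{..<length ?c}. \<mu> (min (?p + 1 + j) S) \<in> lits u) \<and>
      (\<forall>a\<in>{..<k}. dig (p_lb h) u a = 0 \<or> (\<exists>j\<in>{..<length ?c}. \<mu> (min (?p + 1 + j) S) = dig (p_lb h) u a)))"
    using lS S_ge(3) len unfolding f_match_def by (simp add: ev_mem ev_digl)
  also have "(\<forall>j\<in>{..<length ?c}. \<mu> (min (?p + 1 + j) S) \<in> lits u) \<longleftrightarrow> enc_literal ` set ?c \<subseteq> lits u"
    using lit by (auto simp: set_conv_nth)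
  also have "(\<forall>a\<in>{..<k}. dig (p_lb h) u a = 0 \<or> (\<exists>j\<in>{..<length ?c}. \<mu> (min (?p + 1 + j) S) = dig (p_lb h) u a)) \<longleftrightarrow>
      lits u \<subseteq> enc_literal ` set ?c"
  proof -
    have "(\<exists>j\<in>{..<length ?c}. \<mu> (min (?p + 1 + j) S) = x) \<longleftrightarrow> x \<in> enc_literal ` set ?c" for x
    proof -
      have "(\<exists>j\<in>{..<length ?c}. \<mu> (min (?p + 1 + j) S) = x) \<longleftrightarrow> (\<exists>j\<in>{..<length ?c}. enc_literal (?c ! j) = x)"
        using lit by (intro bex_cong) auto
      also have "\<dots> \<longleftrightarrow> x \<in> enc_literal ` set ?c" by (auto simp: set_conv_nth)
      finally show ?thesis .
    qed
    then show ?thesis unfolding lits_subset_iff by auto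
  qed
  finally show ?thesis by (simp add: set_eq_subset conj_commute)
qed

lemma ev_init: "ev (f_init k) [] = enc F"
proof -
  have l: "length \<phi> \<le> S" using length_\<phi> U_S(1) by linarith
  have m1: "\<mu> (min (Suc 0) S) = length \<phi>" using \<mu>_1 S_ge(6) by (simp add: min_def)
  have "lits u \<in> F \<longleftrightarrow> (\<exists>i\<in>{..<length \<phi>}. lits u = enc_literal ` set (\<phi> ! i))" for u
    unfolding F_def clause_codes_def by (auto simp: set_conv_nth)
  moreover have "(\<exists>i\<in>{..<length \<phi>}. ev (f_match k) [u, ev f_pos [i]] \<noteq> 0) \<longleftrightarrow>
      (\<exists>i\<in>{..<length \<phi>}. lits u = enc_literal ` set (\<phi> ! i))" for u
    by (intro bex_cong) (simp_all add: ev_pos ev_match del: add_2_eq_Suc)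
  ultimately have e: "ev (eex (Inp (Num 1)) (Call (f_match k) [Var 0, Call f_pos [Var 1]])) [u] = of_bool (lits u \<in> F)" for u
    using l m1 by simp
  have "ev (f_init k) [] = (\<Sum>u<U. ev (eex (Inp (Num 1)) (Call (f_match k) [Var 0, Call f_pos [Var 1]])) [u] * 2 ^ min u S)"
    using U_S(1) by (simp add: f_init_def del: eval_eex)
  also have "\<dots> = (\<Sum>u<U. of_bool (lits u \<in> F) * 2 ^ u)"
    unfolding e using U_S(1) by (intro sum.cong) auto
  finally show ?thesis by (simp only: enc_def)
qed

definition KK :: "nat \<Rightarrow> nat set set" where "KK z = fams F (D z) U"

text \<open>Elements of the universe are numbered from 1 but tuples from 0, hence the shift to
  \<open>e - 1\<close>.\<close>

definition setA :: "nat \<Rightarrow> nat \<Rightarrow> nat set" where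
  "setA z x = {e. 1 \<le> e \<and> e \<le> 2 ^ p_m k h \<and> inA (KK z) x z (e - 1)}"

definition setB :: "nat \<Rightarrow> nat \<Rightarrow> nat set" where
  "setB z y = {e. 1 \<le> e \<and> e \<le> 2 ^ p_m k h \<and> inB (KK z) y (e - 1)}"

lemma instance_word:
  "map (\<lambda>i. ev (f_word k) [z, i]) [0..<2 + 2 * 2 ^ h * 2 ^ p_m k h] =
     enc_instance (2 ^ h) (2 ^ p_m k h) (map (setA z) [0..<2 ^ h]) (map (setB z) [0..<2 ^ h])"
proof (rule nth_equalityI)
  let ?N = "2 ^ h :: nat" and ?M = "2 ^ p_m k h :: nat"
  let ?ys = "map (setA z) [0..<?N] @ map (setB z) [0..<?N]"
  have enc: "enc_instance ?N ?M (map (setA z) [0..<?N]) (map (setB z) [0..<?N]) =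
      ?N # ?M # concat (map (enc_subset ?M) ?ys)" by (simp add: enc_instance_def)
  have len: "length (concat (map (enc_subset ?M) ?ys)) = 2 * ?N * ?M"
    by (subst length_concat_uniform[where m = ?M]) (auto simp: enc_subset_def)
  show "length (map (\<lambda>i. ev (f_word k) [z, i]) [0..<2 + 2 * ?N * ?M]) =
      length (enc_instance ?N ?M (map (setA z) [0..<?N]) (map (setB z) [0..<?N]))"
    unfolding enc using len by simp
  fix i assume "i < length (map (\<lambda>i. ev (f_word k) [z, i]) [0..<2 + 2 * ?N * ?M])"
  then have i: "i < 2 + 2 * ?N * ?M" by simp
  have map_upt: "map f [0..<n] ! i = f i" if "i < n" for f :: "nat \<Rightarrow> nat" and i n
    using that by simp
  have "ev (f_word k) [z, i] = (?N # ?M # concat (map (enc_subset ?M) ?ys)) ! i"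
  proof (cases "i = 0 \<or> i = 1")
    case True
    then show ?thesis by (auto simp: ev_word[OF F_codable ev_init])
  next
    case False
    define j s u where "j = i - 2" and "s = j div ?M" and "u = j mod ?M"
    have ij: "i = Suc (Suc j)" and j: "j < 2 * ?N * ?M" using False i by (auto simp: j_def)
    have s: "s < 2 * ?N" unfolding s_def using j by (intro less_mult_imp_div_less)
    have u: "u < ?M" unfolding u_def by simp
    have jsu: "j = s * ?M + u" unfolding s_def u_def by (rule div_mult_mod_eq[symmetric])
    have "concat (map (enc_subset ?M) ?ys) ! j = enc_subset ?M (?ys ! s) ! u"
      unfolding jsu by (rule nth_concat_uniform) (use s u in \<open>auto simp: enc_subset_def\<close>)
    also have "\<dots> = of_bool (u + 1 \<in> ?ys ! s)"
      using u by (simp add: enc_subset_def nth_append del: upt_Suc)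
    also have "\<dots> = of_bool (if s < ?N then inA (KK z) s z u else inB (KK z) (s - ?N) u)"
      using s u by (auto simp: nth_append setA_def setB_def)
    finally show ?thesis
      unfolding ij by (simp add: ev_word[OF F_codable ev_init] Let_def s_def u_def KK_def)
  qed
  then show "map (\<lambda>i. ev (f_word k) [z, i]) [0..<2 + 2 * ?N * ?M] ! i =
      enc_instance ?N ?M (map (setA z) [0..<?N]) (map (setB z) [0..<?N]) ! i"
    unfolding enc using map_upt[OF i, of "\<lambda>i. ev (f_word k) [z, i]"] by (simp only:)
qed

abbreviation goodr :: "nat \<Rightarrow> nat \<Rightarrow> nat \<Rightarrow> nat \<Rightarrow> bool" where
  "goodr z x y \<equiv> good (aa 0 x (KK z)) (aa 1 y (KK z)) (offer z) (p_T k h) (p_L h) (p_q k h)"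

lemma q_lam: "p_q k h < 2 ^ p_lam k h"
  using floorlog_bounds[of "p_q k h" 2] prime_gt_0_nat[OF p_q(1)[of k h]] by (simp add: p_lam_def)

lemma q_pos: "0 < p_q k h" using prime_gt_0_nat[OF p_q(1)] .

lemma card_shift: "card {e::nat. 1 \<le> e \<and> e \<le> M \<and> P (e - 1)} = card {u. u < M \<and> P u}"
proof (rule bij_betw_same_card)
  show "bij_betw (\<lambda>e. e - 1) {e. 1 \<le> e \<and> e \<le> M \<and> P (e - 1)} {u. u < M \<and> P u}"
    by (rule bij_betwI[where g = Suc]) auto
qed

lemma inB_tensor: "inB K y u \<longleftrightarrow> (\<forall>\<rho><p_R k h. dig (p_lam k h) u (\<rho> * (p_T k h + 1)) \<in> {..<p_q k h} \<and>
    (\<forall>j<p_T k h. dig (p_lam k h) u (\<rho> * (p_T k h + 1) + 1 + j) =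
       bwd (aa 1 y K) (p_L h) j (dig (p_lam k h) u (\<rho> * (p_T k h + 1))) mod p_q k h))"
  by (simp add: inB_def Let_def)

lemma card_setB: "card (setB z y) = p_q k h ^ p_R k h"
proof -
  have "card {u. u < 2 ^ p_m k h \<and> inB (KK z) y u} = card {..<p_q k h} ^ p_R k h"
    unfolding inB_tensor p_m_def
  proof (rule card_tensor)
    show "{..<p_q k h} \<subseteq> {..<2 ^ p_lam k h}" using q_lam by auto
    show "bwd (aa 1 y (KK z)) (p_L h) j r mod p_q k h < 2 ^ p_lam k h" for j r
      using q_lam mod_less_divisor[OF q_pos] less_trans by blast
  qed
  then show ?thesis unfolding setB_def card_shift by simp
qed

lemma inAB: "inA (KK z) x z u \<and> inB (KK z) y u \<longleftrightarrow>
    (\<forall>\<rho><p_R k h. dig (p_lam k h) u (\<rho> * (p_T k h + 1)) \<in> {r. r < p_q k h \<and> goodr z x y r} \<and>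
    (\<forall>j<p_T k h. dig (p_lam k h) u (\<rho> * (p_T k h + 1) + 1 + j) =
       bwd (aa 1 y (KK z)) (p_L h) j (dig (p_lam k h) u (\<rho> * (p_T k h + 1))) mod p_q k h))"
  (is "?l \<longleftrightarrow> (\<forall>\<rho><_. ?r \<rho>)")
proof -
  have "(let r = dig (p_lam k h) u (\<rho> * (p_T k h + 1)) in r < p_q k h \<and>
     (\<Sum>j<p_T k h. fwd (aa 0 x (KK z)) (p_L h) j r * dig (p_lam k h) u (\<rho> * (p_T k h + 1) + 1 + j)) mod p_q k h =
     claim (offer z) (p_L h) r mod p_q k h) \<and>
    (let r = dig (p_lam k h) u (\<rho> * (p_T k h + 1)) in r < p_q k h \<and>
     (\<forall>j<p_T k h. dig (p_lam k h) u (\<rho> * (p_T k h + 1) + 1 + j) = bwd (aa 1 y (KK z)) (p_L h) j r mod p_q k h))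
    \<longleftrightarrow> ?r \<rho>" for \<rho>
    unfolding Let_def good_def by auto
  then show ?thesis unfolding inA_def inB_def by (simp only: all_conj_distrib[symmetric] imp_conjR[symmetric])
qed

lemma card_setAB: "card (setA z x \<inter> setB z y) = card {r. r < p_q k h \<and> goodr z x y r} ^ p_R k h"
proof -
  have "setA z x \<inter> setB z y = {e. 1 \<le> e \<and> e \<le> 2 ^ p_m k h \<and> (inA (KK z) x z (e - 1) \<and> inB (KK z) y (e - 1))}"
    by (auto simp: setA_def setB_def)
  then have "card (setA z x \<inter> setB z y) = card {u. u < 2 ^ p_m k h \<and> (inA (KK z) x z u \<and> inB (KK z) y u)}"
    using card_shift[of "2 ^ p_m k h" "\<lambda>u. inA (KK z) x z u \<and> inB (KK z) y u"] by (simp only:)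
  also have "\<dots> = card {r. r < p_q k h \<and> goodr z x y r} ^ p_R k h"
    unfolding inAB p_m_def
  proof (rule card_tensor)
    show "{r. r < p_q k h \<and> goodr z x y r} \<subseteq> {..<2 ^ p_lam k h}" using q_lam by auto
    show "bwd (aa 1 y (KK z)) (p_L h) j r mod p_q k h < 2 ^ p_lam k h" for j r
      using q_lam mod_less_divisor[OF q_pos] less_trans by blast
  qed
  finally show ?thesis .
qed

lemma is_inst: "is_instance (2 ^ h) (2 ^ p_m k h) (p_q k h ^ p_R k h) (map (setA z) [0..<2 ^ h]) (map (setB z) [0..<2 ^ h])"
proof -
  have "setA z x \<subseteq> {1..2 ^ p_m k h}" "setB z x \<subseteq> {1..2 ^ p_m k h}" for x
    by (auto simp: setA_def setB_def)
  moreover have "1 \<le> p_q k h ^ p_R k h" using q_pos by (simp add: Suc_le_eq)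
  ultimately show ?thesis unfolding is_instance_def by (auto simp: card_setB)
qed

lemma KK: "KK z \<subseteq> codable" "KK z \<subseteq> Pow V" "F \<subseteq> KK z"
proof -
  show K: "KK z \<subseteq> codable" unfolding KK_def using fams_path[OF F_codable] by blast
  show "KK z \<subseteq> Pow V"
  proof
    fix C assume "C \<in> KK z"
    then have "C \<in> codable" using K by blast
    then show "C \<in> Pow V" unfolding codable_iff by blast
  qed
  show "F \<subseteq> KK z" unfolding KK_def by (rule fams_mono)
qed

lemma tru_lit:
  assumes "1 \<le> var l" "var l \<le> 2 * h" "x = (\<Sum>i<h. of_bool (\<alpha> (i + 1)) * 2 ^ i)"
    "y = (\<Sum>i<h. of_bool (\<alpha> (h + i + 1)) * 2 ^ i)"
  shows "tru 0 x (enc_literal l) \<or> tru 1 y (enc_literal l) \<longleftrightarrow> lit_true \<alpha> l"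
proof -
  have x: "dig 1 x i = of_bool (\<alpha> (i + 1))" if "i < h" for i
    using digits_sum[of h "\<lambda>i. of_bool (\<alpha> (i + 1))" 1] that assms(3) by auto
  have y: "dig 1 y i = of_bool (\<alpha> (h + i + 1))" if "i < h" for i
    using digits_sum[of h "\<lambda>i. of_bool (\<alpha> (h + i + 1))" 1] that assms(4) by auto
  show ?thesis
  proof (cases "var l \<le> h")
    case True
    then have "dig 1 x (var l - 1) = of_bool (\<alpha> (var l))" using x[of "var l - 1"] assms(1) by simp
    then show ?thesis using True assms(1) by (cases l) (auto simp: tru_def)
  next
    case False
    then have "dig 1 y (var l - 1 - h) = of_bool (\<alpha> (var l))" using y[of "var l - 1 - h"] assms(2) by simp
    then show ?thesis using False assms(2) by (cases l) (auto simp: tru_def)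
  qed
qed

text \<open>Makes a coordinate refer to one alive set, so that a common 1 of the two vectors speaks
  about the same set.\<close>

lemma rk_inj:
  assumes "alive K (lits u)" "can u" "alive K (lits v)" "can v" "rk K u = rk K v"
  shows "u = v"
proof -
  have less: "rk K a < rk K b" if "a < b" "alive K (lits a)" "can a" for a b
    unfolding rk_def using that by (intro psubset_card_mono) auto
  show ?thesis using less[of u v] less[of v u] assms by (metis less_irrefl linorder_neqE_nat)
qed

text \<open>Times from \<open>t\<close> on are never consulted, so the blank entry \<open>U\<close>
  among decoded decision times does no harm.\<close>

lemma fams_cong: "(\<And>s. s < t \<Longrightarrow> s \<in> E \<longleftrightarrow> s \<in> E') \<Longrightarrow> fams G E t = fams G E' t"
  by (induction t) auto

text \<open>The right advice comes from a satisfying assignment, split into \<open>x\<close> and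
  \<open>y\<close>: the codes of its true literals form a hitting set \<open>A\<close>,
  \<open>fams_hit\<close> yields the petal times, and the product polynomial of the resulting
  vectors yields the coefficients. All sets of the final family are hit, so no coordinate is 1 in
  both vectors.\<close>

lemma completeness:
  assumes "satisfiable \<phi>"
  shows "\<exists>z<2 ^ p_z k h. completeness_case (map (setA z) [0..<2 ^ h]) (map (setB z) [0..<2 ^ h])"
proof -
  obtain \<alpha> where \<alpha>: "\<And>c. c \<in> set \<phi> \<Longrightarrow> \<exists>l\<in>set c. lit_true \<alpha> l"
    using assms by (auto simp: satisfiable_def)
  define x y where "x = (\<Sum>i<h. of_bool (\<alpha> (i + 1)) * 2 ^ i :: nat)"
    and "y = (\<Sum>i<h. of_bool (\<alpha> (h + i + 1)) * 2 ^ i :: nat)"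
  have xy: "x < 2 ^ h" "y < 2 ^ h"
    using digits_sum[of h "\<lambda>i. of_bool (\<alpha> (i + 1))" 1] digits_sum[of h "\<lambda>i. of_bool (\<alpha> (h + i + 1))" 1]
    by (auto simp: x_def y_def)
  define A where "A = {c. tru 0 x c \<or> tru 1 y c}"
  have "A \<inter> C \<noteq> {}" if C: "C \<in> F" for C
  proof -
    obtain c where c: "c \<in> set \<phi>" "C = enc_literal ` set c" using C by (auto simp: F_def clause_codes_def)
    obtain l where l: "l \<in> set c" "lit_true \<alpha> l" using \<alpha>[OF c(1)] by blast
    have "1 \<le> var l" "var l \<le> 2 * h" using clause(3)[OF c(1) l(1)] n_h(2) by auto
    then have "enc_literal l \<in> A" using tru_lit[OF _ _ x_def y_def] l(2) by (auto simp: A_def)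
    then show ?thesis using l(1) c(2) by blast
  qed
  from fams_hit[OF F_codable this] obtain E where E: "E \<subseteq> {..<U}" "p_W h * card E \<le> k * card V"
    "\<forall>C\<in>fams F E U. A \<inter> C \<noteq> {}" by blast
  have finE: "finite E" by (rule finite_subset[OF E(1)]) simp
  obtain es where es: "set es = E" "distinct es" using finite_distinct_list[OF finE] by blast
  have "card E \<le> k * card V div p_W h"
    using div_le_mono[OF E(2), of "p_W h"] p_W_pos[of h] by simp
  also have "\<dots> \<le> p_K k h" unfolding p_K_def using card_V_le by (intro div_le_mono mult_left_mono) auto
  finally have lenes: "length es \<le> p_K k h" using es distinct_card[of es] by simp
  define d where "d i = (if i < length es then es ! i else U)" for i
  have dU: "d i \<le> U" for i
  proof (cases "i < length es")
    case True
    then have "es ! i \<in> {..<U}" using es(1) E(1) nth_mem[of i es] by blast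
    then show ?thesis using True by (simp add: d_def)
  qed (simp add: d_def)
  have "d i < 2 ^ p_kap k h" for i
  proof -
    have "U < 2 ^ p_kap k h" unfolding U_def p_kap_def by (rule power_strict_increasing) auto
    then show ?thesis using dU[of i] by linarith
  qed
  then obtain z1 where z1: "z1 < 2 ^ (p_kap k h * p_K k h)" "\<forall>i<p_K k h. dig (p_kap k h) z1 i = d i"
    using digits_exist[of "p_K k h" d "p_kap k h"] by blast
  define K where "K = fams F E U"
  define c where "c i = nat (coeff (pg (aa 0 x K) (aa 1 y K) (p_T k h) (p_L h)) i mod int (p_q k h))" for i
  have "c i < 2 ^ p_lam k h" for i
  proof -
    have "coeff (pg (aa 0 x K) (aa 1 y K) (p_T k h) (p_L h)) i mod int (p_q k h) < int (p_q k h)"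
      using q_pos by simp
    then have "c i < p_q k h" unfolding c_def using q_pos by (simp add: nat_less_iff)
    then show ?thesis using q_lam by linarith
  qed
  then obtain z2 where z2: "z2 < 2 ^ (p_lam k h * (2 * p_L h))" "\<forall>i<2 * p_L h. dig (p_lam k h) z2 i = c i"
    using digits_exist[of "2 * p_L h" c "p_lam k h"] by blast
  define z where "z = z1 + z2 * 2 ^ p_z1 k h"
  have z1': "z1 < 2 ^ p_z1 k h" using z1(1) by (simp add: p_z1_def)
  have zm: "z mod 2 ^ p_z1 k h = z1" "z div 2 ^ p_z1 k h = z2"
    unfolding z_def using z1' by simp_all
  have zlt: "z < 2 ^ p_z k h"
  proof -
    have "z < (1 + z2) * 2 ^ p_z1 k h" unfolding z_def using z1' by simp
    also have "\<dots> \<le> 2 ^ (p_lam k h * (2 * p_L h)) * 2 ^ p_z1 k h" using z2(1) by (intro mult_right_mono) auto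
    also have "\<dots> = 2 ^ p_z k h" by (simp add: p_z_def power_add)
    finally show ?thesis .
  qed
  have Dz: "D z = d ` {..<p_K k h}"
  proof -
    have "dig (p_kap k h) z i = d i" if "i < p_K k h" for i
      using dig_mod[OF that, of "p_kap k h" z] zm(1) z1(2) that by (simp add: p_z1_def)
    then show ?thesis unfolding D_def by force
  qed
  have "s \<in> D z \<longleftrightarrow> s \<in> E" if "s < U" for s
  proof
    assume "s \<in> D z"
    then obtain i where "s = d i" unfolding Dz by blast
    then have "i < length es" "s = es ! i" using that by (auto simp: d_def split: if_splits)
    then show "s \<in> E" using es(1) by auto
  next
    assume "s \<in> E"
    then obtain i where i: "i < length es" "s = es ! i" using es(1) by (metis in_set_conv_nth)
    then show "s \<in> D z" unfolding Dz using lenes by (intro image_eqI[of _ _ i]) (auto simp: d_def)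
  qed
  then have KKz: "KK z = K" unfolding KK_def K_def by (intro fams_cong) blast
  have orth: "aa 0 x K i * aa 1 y K i = 0" for i
  proof (rule ccontr)
    assume "aa 0 x K i * aa 1 y K i \<noteq> 0"
    then obtain u v where u: "alive K (lits u)" "can u" "rk K u = i" "\<not> (\<exists>c\<in>lits u. tru 0 x c)"
      and v: "alive K (lits v)" "can v" "rk K v = i" "\<not> (\<exists>c\<in>lits v. tru 1 y c)"
      by (auto simp: aa_def)
    have "u = v" by (rule rk_inj[OF u(1,2) v(1,2)]) (simp add: u v)
    moreover have "A \<inter> lits u \<noteq> {}" using E(3) u(1) by (auto simp: K_def alive_def)
    ultimately show False using u(4) v(4) by (auto simp: A_def)
  qed
  have gd: "goodr z x y r" for r
    unfolding KKz
  proof (rule pcp_complete)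
    show "0 < p_q k h" by (rule q_pos)
    show "1 \<le> p_L h" by (simp add: p_L_def)
    show "offer z d = nat (coeff (pg (aa 0 x K) (aa 1 y K) (p_T k h) (p_L h)) d mod int (p_q k h))"
      if "d < 2 * p_L h" for d
      unfolding offer_def zm(2) using z2(2) that by (simp add: c_def)
  qed (rule orth)
  have "setB z y \<subseteq> setA z x"
  proof -
    have e: "{r. r < p_q k h \<and> goodr z x y r} = {..<p_q k h}" using gd by auto
    \<comment> \<open>With every point accepted, the joint condition of \<open>inAB\<close> is the
      one of \<open>inB\<close>.\<close>
    have "inA (KK z) x z u \<and> inB (KK z) y u \<longleftrightarrow> inB (KK z) y u" for u
      unfolding inAB e unfolding inB_tensor ..
    then have "inA (KK z) x z u" if "inB (KK z) y u" for u using that by blast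
    then show ?thesis by (auto simp: setA_def setB_def)
  qed
  moreover have "setA z x \<in> set (map (setA z) [0..<2 ^ h])" "setB z y \<in> set (map (setB z) [0..<2 ^ h])"
    using xy by auto
  ultimately have "completeness_case (map (setA z) [0..<2 ^ h]) (map (setB z) [0..<2 ^ h])"
    unfolding completeness_case_def by (intro bexI)
  then show ?thesis using zlt by blast
qed

text \<open>Nothing is assumed about the advice. \<open>F\<close> is contained in the final family,
  so the clause falsified by \<open>x\<close> and \<open>y\<close> contains an alive set, and
  neither half satisfies it. Both vectors are 1 at its rank, at most half of the points are
  accepted, and \<open>R\<close> repetitions give the factor \<open>2 ^ R\<close>.\<close>

lemma soundness:
  assumes "\<not> satisfiable \<phi>"
  shows "soundness_case (2 ^ p_R k h) (p_q k h ^ p_R k h) (map (setA z) [0..<2 ^ h]) (map (setB z) [0..<2 ^ h])"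
proof -
  have "real (card (setA z x \<inter> setB z y)) \<le> real (p_q k h ^ p_R k h) / 2 ^ p_R k h" for x y
  proof -
    define \<alpha> where "\<alpha> v = (if v \<le> h then dig 1 x (v - 1) = 1 else dig 1 y (v - 1 - h) = 1)" for v
    have "\<not> (\<forall>c\<in>set \<phi>. \<exists>l\<in>set c. lit_true \<alpha> l)" using assms unfolding satisfiable_def by blast
    then obtain cl where cl: "cl \<in> set \<phi>" "\<And>l. l \<in> set cl \<Longrightarrow> \<not> lit_true \<alpha> l" by blast
    let ?C = "enc_literal ` set cl"
    have bin: "dig 1 w i = 0 \<or> dig 1 w i = 1" for w i
      using dig_less[of 1 w i] by (auto simp: less_2_cases_iff)
    have nohit: "\<not> tru 0 x c \<and> \<not> tru 1 y c" if c: "c \<in> ?C" for c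
    proof -
      obtain l where l: "l \<in> set cl" "c = enc_literal l" using c by blast
      have v: "1 \<le> var l" using clause(3)[OF cl(1) l(1)] by simp
      have "\<not> lit_true \<alpha> l" by (rule cl(2)[OF l(1)])
      then show ?thesis
        using v bin[of x "var l - 1"] bin[of y "var l - 1 - h"] unfolding l(2)
        by (cases l) (auto simp: tru_def \<alpha>_def split: if_splits)
    qed
    have "?C \<in> KK z" using KK(3) cl(1) by (auto simp: F_def clause_codes_def)
    from alive_below[OF KK(2) this] obtain B where B: "B \<subseteq> ?C" "alive (KK z) B" by blast
    have alive_codable: "C \<in> codable" if "alive (KK z) C" for C
      by (rule subsetD[OF KK(1)]) (rule conjunct1[OF that[unfolded alive_def]])
    have "B \<in> {C\<in>codable. alive (KK z) C}" by (rule CollectI, rule conjI, rule alive_codable, rule B, rule B)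
    also have "\<dots> = lits ` {u. u < U \<and> alive (KK z) (lits u) \<and> can u}"
      by (rule bij_betw_imp_surj_on[OF bij_can, symmetric])
    finally obtain u where u: "u < U" "alive (KK z) (lits u)" "can u" "lits u = B" by (elim imageE CollectE conjE) simp
    let ?i = "rk (KK z) u"
    have one: "aa 0 x (KK z) ?i = 1" "aa 1 y (KK z) ?i = 1"
    proof -
      have "\<not> (\<exists>c\<in>lits u. tru 0 x c)" "\<not> (\<exists>c\<in>lits u. tru 1 y c)" using u(4) B(1) nohit by blast+
      then have "\<exists>v<U. alive (KK z) (lits v) \<and> can v \<and> rk (KK z) v = ?i \<and> \<not> (\<exists>c\<in>lits v. tru 0 x c)"
        "\<exists>v<U. alive (KK z) (lits v) \<and> can v \<and> rk (KK z) v = ?i \<and> \<not> (\<exists>c\<in>lits v. tru 1 y c)"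
        using u(1-3) by blast+
      then show "aa 0 x (KK z) ?i = 1" "aa 1 y (KK z) ?i = 1" unfolding aa_def by (simp_all only: of_bool_eq)
    qed
    \<comment> \<open>The bound of \<open>fams_sparse\<close> holds for all decision times, right or
      wrong. It places the common 1 among the \<open>T * L\<close> coordinates that the protocol
      sees.\<close>
    have "?i < card {v. v < U \<and> alive (KK z) (lits v) \<and> can v}"
      unfolding rk_def
    proof (rule psubset_card_mono)
      show "{v. v < u \<and> alive (KK z) (lits v) \<and> can v} \<subset> {v. v < U \<and> alive (KK z) (lits v) \<and> can v}"
      proof (rule psubsetI)
        show "{v. v < u \<and> alive (KK z) (lits v) \<and> can v} \<subseteq> {v. v < U \<and> alive (KK z) (lits v) \<and> can v}"
        proof (rule Collect_mono, rule impI)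
          fix v assume v: "v < u \<and> alive (KK z) (lits v) \<and> can v"
          then show "v < U \<and> alive (KK z) (lits v) \<and> can v" using less_trans[OF _ u(1), of v] by simp
        qed
        have "u \<in> {v. v < U \<and> alive (KK z) (lits v) \<and> can v}" using u(1-3) by simp
        moreover have "u \<notin> {v. v < u \<and> alive (KK z) (lits v) \<and> can v}" by simp
        ultimately show "{v. v < u \<and> alive (KK z) (lits v) \<and> can v} \<noteq> {v. v < U \<and> alive (KK z) (lits v) \<and> can v}"
          by metis
      qed
    qed simp
    also have "\<dots> = card {C\<in>codable. alive (KK z) C}"
      using bij_can[of "alive (KK z)"] by (rule bij_betw_same_card)
    also have "{C\<in>codable. alive (KK z) C} = {C. alive (KK z) C}"
      by (rule Collect_cong) (rule iffI, erule conjunct2, rule conjI, erule alive_codable)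
    also have "card {C. alive (KK z) C} \<le> 2 * (k + 1) * p_X k h ^ (2 * k) * 2 ^ p_lb h"
      unfolding KK_def using F_codable p_lb_pos[of h] by (intro fams_sparse) auto
    also have "\<dots> \<le> 2 * (k + 1) * p_X k h ^ (2 * k) * (p_W h * p_L h)"
    proof (rule mult_left_mono)
      have "2 ^ p_lb h = p_W h * (2 ^ p_lb h div p_W h) + 2 ^ p_lb h mod p_W h" by simp
      also have "\<dots> \<le> p_W h * (2 ^ p_lb h div p_W h) + p_W h"
        using p_W_pos[of h] mod_less_divisor[of "p_W h" "2 ^ p_lb h"] by linarith
      finally show "2 ^ p_lb h \<le> p_W h * p_L h" by (simp add: p_L_def)
    qed simp
    also have "\<dots> = p_T k h * p_L h" by (simp add: p_T_def mult.assoc)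
    finally have i: "?i < p_T k h * p_L h" .
    have q4: "4 * p_T k h * p_L h \<le> p_q k h" using p_q(2)[of k h] by (simp add: p_Y_def)
    have L1: "1 \<le> p_L h" by (simp add: p_L_def)
    have TL: "p_L h \<le> p_T k h * p_L h" using p_T_pos[of k h] by simp
    have card: "card {r. r < p_q k h \<and> goodr z x y r} \<le> 2 * p_L h"
    proof (rule pcp_sound[OF p_q(1) _ L1])
      show "p_T k h * p_L h < p_q k h" using q4 TL L1 by linarith
      show "aa 0 x (KK z) ?i = 1" "aa 1 y (KK z) ?i = 1" by (rule one)+
      show "?i < p_T k h * p_L h" by (rule i)
    qed (simp_all add: aa_def)
    have "card (setA z x \<inter> setB z y) * 2 ^ p_R k h = (card {r. r < p_q k h \<and> goodr z x y r} * 2) ^ p_R k h"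
      by (simp add: card_setAB power_mult_distrib)
    also have "\<dots> \<le> p_q k h ^ p_R k h"
    proof (rule power_mono)
      show "card {r. r < p_q k h \<and> goodr z x y r} * 2 \<le> p_q k h" using card q4 TL by linarith
    qed simp
    finally have "real (card (setA z x \<inter> setB z y) * 2 ^ p_R k h) \<le> real (p_q k h ^ p_R k h)"
      by (simp only: of_nat_le_iff)
    then show ?thesis by (simp add: field_simps)
  qed
  then show ?thesis unfolding soundness_case_def by auto
qed

end

section \<open>Asymptotics of the parameters\<close>

abbreviation lh :: "nat \<Rightarrow> real" where "lh h \<equiv> log 2 (4 * real h + 4)"

lemma real_div_bounds: "real (x div y) \<le> real x / real y" "real x / real y \<le> real (x div y) + 1"
  using real_of_int_div4[of "int x" "int y"] real_of_int_div3[of "int x" "int y"]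
  by (simp_all add: zdiv_int[symmetric] algebra_simps)

text \<open>Encloses the integer \<open>p_lb\<close> between real logarithms, so that limits can be
  computed for explicit real functions.\<close>

lemma p_lb_bounds: "lh h \<le> real (p_lb h)" "real (p_lb h) \<le> lh h + 1" "2 ^ p_lb h \<le> 8 * h + 8" "2 \<le> lh h"
proof -
  obtain j where j: "p_lb h = Suc j" using p_lb_pos[of h] by (cases "p_lb h") auto
  have b: "2 ^ j \<le> 4 * h + 4" "4 * h + 4 < 2 ^ p_lb h"
    using floorlog_bounds[of "4 * h + 4" 2] j by (simp_all add: p_lb_def[symmetric])
  show "2 ^ p_lb h \<le> 8 * h + 8" using b(1) j by simp
  have "real (2 ^ j) \<le> real (4 * h + 4)" using b(1) by (simp only: of_nat_le_iff)
  then have r1: "2 ^ j \<le> 4 * real h + 4" by simp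
  have "real (4 * h + 4) < real (2 ^ p_lb h)" using b(2) by (simp only: of_nat_less_iff)
  then have r2: "4 * real h + 4 \<le> 2 ^ p_lb h" by simp
  have "real j = log 2 (2 ^ j)" by simp
  also have "\<dots> \<le> lh h" using r1 by (subst log_le_cancel_iff) auto
  finally show "real (p_lb h) \<le> lh h + 1" using j by simp
  have "lh h \<le> log 2 (2 ^ p_lb h)" using r2 by (subst log_le_cancel_iff) auto
  then show "lh h \<le> real (p_lb h)" by simp
  have "log 2 4 \<le> lh h" by (subst log_le_cancel_iff) auto
  moreover have "log 2 (4::real) = 2" using log_pow_cancel[of "2::real" 2] by simp
  ultimately show "2 \<le> lh h" by simp
qed

lemma p_T_eq: "\<exists>c\<ge>1. \<forall>h. p_T k h = c * p_lb h ^ (4 * k + 2)"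
proof (intro exI[of _ "2 * (k + 1) * (4 * (k + 1)) ^ (2 * k)"] conjI allI)
  show "1 \<le> 2 * (k + 1) * (4 * (k + 1)) ^ (2 * k)" by (simp add: Suc_le_eq)
  fix h
  have "p_W h ^ (2 * k) = p_lb h ^ (4 * k)" "p_lb h ^ (4 * k + 2) = p_lb h ^ (4 * k) * p_W h"
    by (simp_all add: p_W_def power2_eq_square[symmetric] power_mult[symmetric] power_add)
  then show "p_T k h = 2 * (k + 1) * (4 * (k + 1)) ^ (2 * k) * p_lb h ^ (4 * k + 2)"
    unfolding p_T_def p_X_def power_mult_distrib by (simp only: mult.assoc)
qed

lemma p_L_le: "p_L h \<le> 2 ^ p_lb h"
proof -
  have "2 ^ p_lb h div p_W h \<le> 2 ^ p_lb h div 2"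
    using p_lb_pos[of h] mult_le_mono[of 2 "p_lb h" 1 "p_lb h"] by (intro div_le_mono2) (auto simp: p_W_def)
  moreover have "(2::nat) ^ 1 \<le> 2 ^ p_lb h" using p_lb_pos[of h] by (intro power_increasing) auto
  moreover have "x div 2 + 1 \<le> x" if "2 \<le> x" for x :: nat using that by presburger
  ultimately show ?thesis unfolding p_L_def using le_trans by fastforce
qed

text \<open>\<open>T\<close> is a power of \<open>lb < 2 ^ lb\<close>, \<open>L\<close> is at most
  \<open>2 ^ lb\<close>, and \<open>prime_between\<close> costs only a square. So \<open>q\<close>
  is polynomial in \<open>2 ^ lb\<close>, and its bit length is linear in \<open>lb\<close>.\<close>

lemma p_lam_le: "\<exists>c. \<forall>h. p_lam k h \<le> c * p_lb h"
proof -
  obtain c where c: "1 \<le> c" "\<And>h. p_T k h = c * p_lb h ^ (4 * k + 2)" using p_T_eq[of k] by auto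
  have "p_lam k h \<le> (17 * (16 * c ^ 2) + (8 * k + 6)) * p_lb h" for h
  proof -
    let ?b = "2 ^ p_lb h :: nat" and ?c = "17 * (16 * c ^ 2)"
    have "p_lb h ^ (4 * k + 2) \<le> ?b ^ (4 * k + 2)" using less_exp[of "p_lb h"] by (intro power_mono) auto
    then have "p_Y k h \<le> 4 * (c * ?b ^ (4 * k + 2)) * ?b"
      unfolding p_Y_def c(2) using p_L_le[of h] by (intro mult_le_mono) auto
    also have "\<dots> = 4 * c * ?b ^ (4 * k + 3)"
    proof -
      have e: "4 * k + 3 = Suc (4 * k + 2)" by simp
      show ?thesis unfolding e power_Suc2 by (simp only: mult.assoc)
    qed
    finally have "p_Y k h ^ 2 \<le> (4 * c * ?b ^ (4 * k + 3)) ^ 2" by (rule power_mono) simp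
    also have "\<dots> = 16 * c ^ 2 * ?b ^ (8 * k + 6)"
      by (simp add: power_mult_distrib power_mult[symmetric] algebra_simps)
    finally have "17 * p_Y k h ^ 2 \<le> ?c * ?b ^ (8 * k + 6)" by simp
    moreover have "p_Y k h \<le> p_Y k h ^ 2" by (simp add: power2_nat_le_imp_le power2_eq_square)
    ultimately have "p_q k h \<le> ?c * ?b ^ (8 * k + 6)" using p_q(3)[of k h] by linarith
    also have "\<dots> < 2 ^ ?c * ?b ^ (8 * k + 6)" by (rule mult_strict_right_mono[OF less_exp]) simp
    also have "\<dots> = 2 ^ (?c + (8 * k + 6) * p_lb h)" unfolding power_add[of 2 ?c] power_mult[symmetric] mult.commute[of "p_lb h"] ..
    finally have "p_lam k h \<le> ?c + (8 * k + 6) * p_lb h" unfolding p_lam_def by (intro floorlog_leI) auto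
    also have "\<dots> \<le> ?c * p_lb h + (8 * k + 6) * p_lb h" using p_lb_pos[of h] by simp
    finally show ?thesis by (simp only: distrib_right)
  qed
  then show ?thesis by blast
qed

lemma p_R_bounds:
  "real h / (lh h + 1) ^ (4 * k + 6) \<le> real (p_R k h)"
  "real (p_R k h) \<le> real h / real (p_lb h) ^ (4 * k + 6) + 1"
  "p_R k h \<le> h + 1" "1 \<le> p_R k h"
proof -
  have lb: "0 < p_lb h ^ (4 * k + 6)" using p_lb_pos[of h] by simp
  show "p_R k h \<le> h + 1" "1 \<le> p_R k h" by (simp_all add: p_R_def)
  show "real (p_R k h) \<le> real h / real (p_lb h) ^ (4 * k + 6) + 1"
    using real_div_bounds(1)[of h "p_lb h ^ (4 * k + 6)"] by (simp add: p_R_def)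
  have "real h / (lh h + 1) ^ (4 * k + 6) \<le> real h / real (p_lb h) ^ (4 * k + 6)"
    using p_lb_bounds[of h] p_lb_pos[of h] by (intro divide_left_mono power_mono mult_pos_pos zero_less_power) auto
  also have "\<dots> \<le> real (p_R k h)"
    using real_div_bounds(2)[of h "p_lb h ^ (4 * k + 6)"] by (simp add: p_R_def)
  finally show "real h / (lh h + 1) ^ (4 * k + 6) \<le> real (p_R k h)" .
qed

lemma p_m_small: "(\<lambda>h. real (p_m k h) / real h) \<longlonglongrightarrow> 0"
proof -
  obtain c where c: "1 \<le> c" "\<And>h. p_T k h = c * p_lb h ^ (4 * k + 2)" using p_T_eq[of k] by auto
  obtain d where d: "\<And>h. p_lam k h \<le> d * p_lb h" using p_lam_le[of k] by auto
  define C where "C = real (d * (2 * c))"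
  have bound: "real (p_m k h) / real h \<le> C * (1 / lh h ^ 3 + (lh h + 1) ^ (4 * k + 3) / real h)" if h: "1 \<le> h" for h
  proof -
    let ?l = "real (p_lb h)"
    have l: "0 < ?l" using p_lb_pos[of h] by simp
    have "p_T k h + 1 \<le> 2 * c * p_lb h ^ (4 * k + 2)" using p_T_pos[of k h] c(2)[of h] by simp
    then have "p_lam k h * (p_T k h + 1) \<le> d * p_lb h * (2 * c * p_lb h ^ (4 * k + 2))"
      using d[of h] by (intro mult_le_mono)
    also have "\<dots> = d * (2 * c) * p_lb h ^ (4 * k + 3)"
    proof -
      have e: "4 * k + 3 = Suc (4 * k + 2)" by simp
      show ?thesis unfolding e power_Suc by (simp only: mult_ac)
    qed
    finally have "real (p_lam k h * (p_T k h + 1)) \<le> real (d * (2 * c) * p_lb h ^ (4 * k + 3))"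
      by (simp only: of_nat_le_iff)
    then have "real (p_lam k h * (p_T k h + 1)) \<le> C * ?l ^ (4 * k + 3)" by (simp only: C_def of_nat_mult of_nat_power)
    then have "real (p_m k h) \<le> (C * ?l ^ (4 * k + 3)) * (real h / ?l ^ (4 * k + 6) + 1)"
      unfolding p_m_def mult.assoc[symmetric] of_nat_mult[of _ "p_R k h"]
      using p_R_bounds(2)[of k h] by (intro mult_mono) (auto simp: C_def)
    also have "\<dots> = C * (real h / ?l ^ 3 + ?l ^ (4 * k + 3))"
    proof -
      have e: "4 * k + 6 = 4 * k + 3 + 3" by simp
      have "?l ^ (4 * k + 6) = ?l ^ (4 * k + 3) * ?l ^ 3" unfolding e by (rule power_add)
      then show ?thesis using l by (simp add: field_simps)
    qed
    also have "\<dots> \<le> C * (real h / lh h ^ 3 + (lh h + 1) ^ (4 * k + 3))"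
      using p_lb_bounds[of h] l
      by (intro mult_left_mono add_mono divide_left_mono power_mono mult_pos_pos zero_less_power) (auto simp: C_def)
    finally show ?thesis using h by (simp add: field_simps)
  qed
  show ?thesis
  proof (rule tendsto_sandwich)
    show "\<forall>\<^sub>F h in sequentially. 0 \<le> real (p_m k h) / real h" by simp
    show "\<forall>\<^sub>F h in sequentially. real (p_m k h) / real h \<le> C * (1 / lh h ^ 3 + (lh h + 1) ^ (4 * k + 3) / real h)"
      using eventually_ge_at_top[of 1] by eventually_elim (rule bound)
    show "(\<lambda>h. C * (1 / lh h ^ 3 + (lh h + 1) ^ (4 * k + 3) / real h)) \<longlonglongrightarrow> 0" by real_asymp
  qed simp
qed

lemma p_z_small: "(\<lambda>h. real (p_z k h) / real h) \<longlonglongrightarrow> 0"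
proof -
  obtain d where d: "\<And>h. p_lam k h \<le> d * p_lb h" using p_lam_le[of k] by auto
  define C where "C = real ((k + 1) * k + 2 * d)"
  have bound: "real (p_z k h) / real h \<le> C * ((8 + 8 / real h) / lh h + (lh h + 1) / real h)" if h: "1 \<le> h" for h
  proof -
    let ?l = "real (p_lb h)" and ?b = "2 ^ p_lb h div p_W h" and ?B = "8 * real h + 8"
    have l: "0 < ?l" using p_lb_pos[of h] by simp
    have "real (2 ^ p_lb h) \<le> real (8 * h + 8)" using p_lb_bounds(3)[of h] by (simp only: of_nat_le_iff)
    then have B: "2 ^ p_lb h \<le> ?B" by simp
    have W: "real (p_W h) = ?l * ?l" by (simp add: p_W_def)
    have b: "real ?b \<le> ?B / (?l * ?l)"
      using real_div_bounds(1)[of "2 ^ p_lb h" "p_W h"] divide_right_mono[OF B, of "?l * ?l"] W by simp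
    have K: "real (p_K k h) \<le> real k * (?B / (?l * ?l))"
    proof -
      have "real (p_K k h) \<le> real k * (2 ^ p_lb h / (?l * ?l))"
        using real_div_bounds(1)[of "k * 2 ^ p_lb h" "p_W h"] W by (simp add: p_K_def)
      also have "\<dots> \<le> real k * (?B / (?l * ?l))" by (intro mult_left_mono divide_right_mono B) auto
      finally show ?thesis .
    qed
    have kap: "real (p_kap k h) \<le> real (k + 1) * ?l" using l p_lb_pos[of h] by (simp add: p_kap_def algebra_simps)
    have "real (p_z1 k h) \<le> (real (k + 1) * ?l) * (real k * (?B / (?l * ?l)))"
      unfolding p_z1_def of_nat_mult by (rule mult_mono[OF kap K]) auto
    also have "\<dots> = real ((k + 1) * k) * (?B / ?l)"
    proof -
      have gen: "(a * ?l) * (b * (x / (?l * ?l))) = a * b * (x / ?l)" for a b x using l by (simp add: field_simps)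
      show ?thesis unfolding gen of_nat_mult ..
    qed
    \<comment> \<open>The summand \<open>?l\<close> is added to match the second kind of advice,
      where the \<open>+ 1\<close> in \<open>p_L\<close> produces it.\<close>
    also have "\<dots> \<le> real ((k + 1) * k) * (?B / ?l + ?l)" by (rule mult_left_mono) auto
    finally have z1: "real (p_z1 k h) \<le> real ((k + 1) * k) * (?B / ?l + ?l)" .
    have lam: "real (p_lam k h) \<le> real d * ?l"
      using d[of h] unfolding of_nat_mult[symmetric] by (simp only: of_nat_le_iff)
    have L: "real (2 * p_L h) \<le> 2 * (?B / (?l * ?l) + 1)" 
    proof -
      have "real (2 * p_L h) = 2 * (real ?b + 1)" by (simp add: p_L_def)
      also have "\<dots> \<le> 2 * (?B / (?l * ?l) + 1)" by (intro mult_left_mono add_right_mono b) simp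
      finally show ?thesis .
    qed
    have "real (p_lam k h * (2 * p_L h)) \<le> (real d * ?l) * (2 * (?B / (?l * ?l) + 1))"
      unfolding of_nat_mult[of "p_lam k h"] by (rule mult_mono[OF lam L]) auto
    also have "\<dots> = real (2 * d) * (?B / ?l + ?l)" using l by (simp add: field_simps)
    finally have "real (p_z k h) \<le> C * (?B / ?l + ?l)"
      using z1 unfolding p_z_def C_def of_nat_add distrib_right by linarith
    also have "\<dots> \<le> C * (?B / lh h + (lh h + 1))"
      using p_lb_bounds[of h] l by (intro mult_left_mono add_mono divide_left_mono mult_pos_pos) (auto simp: C_def)
    finally have "real (p_z k h) / real h \<le> C * (?B / lh h + (lh h + 1)) / real h" by (rule divide_right_mono) simp
    also have "\<dots> = C * ((8 + 8 / real h) / lh h + (lh h + 1) / real h)"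
      using h p_lb_bounds(4)[of h] by (simp add: field_simps)
    finally show ?thesis .
  qed
  show ?thesis
  proof (rule tendsto_sandwich)
    show "\<forall>\<^sub>F h in sequentially. 0 \<le> real (p_z k h) / real h" by simp
    show "\<forall>\<^sub>F h in sequentially. real (p_z k h) / real h \<le> C * ((8 + 8 / real h) / lh h + (lh h + 1) / real h)"
      using eventually_ge_at_top[of 1] by eventually_elim (rule bound)
    show "(\<lambda>h. C * ((8 + 8 / real h) / lh h + (lh h + 1) / real h)) \<longlonglongrightarrow> 0" by real_asymp
  qed simp
qed

text \<open>Only \<open>N = 2 ^ h\<close> occurs as a query size, but universe size and exponents
  have to be defined for all \<open>N\<close>; rounding the logarithm down extends them.\<close>

definition log_floor :: "nat \<Rightarrow> nat" where "log_floor N = floorlog 2 N - 1"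

lemma log_floor_bounds:
  assumes "N \<ge> 2"
  shows "1 \<le> log_floor N" "real (log_floor N) \<le> log 2 (real N)" "log 2 (real N) \<le> real (log_floor N) + 1"
proof -
  have fl: "2 \<le> floorlog 2 N" using assms by (intro floorlog_geI) auto
  then have j: "floorlog 2 N = Suc (log_floor N)" by (simp add: log_floor_def)
  show "1 \<le> log_floor N" using fl by (simp add: log_floor_def)
  have b: "2 ^ log_floor N \<le> N" "N < 2 ^ Suc (log_floor N)"
    using floorlog_bounds[of N 2] assms j by simp_all
  have "real (2 ^ log_floor N) \<le> real N" using b(1) by (simp only: of_nat_le_iff)
  then have "log 2 (2 ^ log_floor N) \<le> log 2 (real N)" by (intro log_mono) auto
  then show "real (log_floor N) \<le> log 2 (real N)" by simp
  have "real N \<le> real (2 ^ Suc (log_floor N))" using b(2) by (simp only: of_nat_le_iff less_imp_le)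
  then have "log 2 (real N) \<le> log 2 (2 ^ Suc (log_floor N))" using assms by (intro log_mono) auto
  then show "log 2 (real N) \<le> real (log_floor N) + 1" by (subst (asm) log_pow_cancel) auto
qed

lemma log_floor_power: "log_floor (2 ^ h) = h"
  using floorlog_power[of 1 2 h] by (simp add: log_floor_def floorlog_def)

lemma log_floor_at_top: "filterlim log_floor at_top at_top"
proof (rule filterlim_at_top_mono)
  show "filterlim (\<lambda>N::nat. nat \<lfloor>log 2 (real N) - 1\<rfloor>) at_top at_top" by real_asymp
  show "\<forall>\<^sub>F N in at_top. nat \<lfloor>log 2 (real N) - 1\<rfloor> \<le> log_floor N"
    using eventually_ge_at_top[of 2]
  proof eventually_elim
    case (elim N)
    then show ?case using log_floor_bounds(3)[OF elim] by linarith
  qed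
qed

definition univ :: "nat \<Rightarrow> nat \<Rightarrow> nat" where "univ k N = 2 ^ p_m k (log_floor N)"

definition univ_exp :: "nat \<Rightarrow> nat \<Rightarrow> real" where "univ_exp k N = real (p_m k (log_floor N)) / log 2 (real N)"

text \<open>Obtained by solving \<open>log 2 N powr (1 - gap_exp k N) = R\<close>, so that for
  \<open>N = 2 ^ h\<close> with \<open>h \<ge> 2\<close> the gap is exactly
  \<open>2 ^ R\<close>.\<close>

definition gap_exp :: "nat \<Rightarrow> nat \<Rightarrow> real" where
  "gap_exp k N = 1 - ln (real (p_R k (log_floor N))) / ln (log 2 (real N))"

lemma univ_exp: "N \<ge> 2 \<Longrightarrow> real (univ k N) = real N powr univ_exp k N"
proof -
  assume N: "N \<ge> 2"
  then have "0 < log 2 (real N)" by simp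
  then have "real N powr univ_exp k N = 2 powr (log 2 (real N) * (real (p_m k (log_floor N)) / log 2 (real N)))"
    using N unfolding univ_exp_def powr_powr[symmetric] by simp
  also have "\<dots> = 2 powr real (p_m k (log_floor N))" using \<open>0 < log 2 (real N)\<close> by simp
  also have "\<dots> = real (univ k N)" by (simp add: univ_def powr_realpow)
  finally show ?thesis by simp
qed

lemma univ_exp_small: "univ_exp k \<in> o(\<lambda>_. 1)"
proof (rule smalloI_tendsto)
  have "univ_exp k \<longlonglongrightarrow> 0"
  proof (rule tendsto_sandwich)
    show "\<forall>\<^sub>F N in sequentially. 0 \<le> univ_exp k N"
      using eventually_ge_at_top[of 2] by eventually_elim (simp add: univ_exp_def)
    show "\<forall>\<^sub>F N in sequentially. univ_exp k N \<le> real (p_m k (log_floor N)) / real (log_floor N)"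
      using eventually_ge_at_top[of 2]
    proof eventually_elim
      case (elim N)
      show ?case unfolding univ_exp_def using log_floor_bounds[OF elim]
        by (intro divide_left_mono mult_pos_pos) auto
    qed
    show "(\<lambda>N. real (p_m k (log_floor N)) / real (log_floor N)) \<longlonglongrightarrow> 0"
      by (rule filterlim_compose[OF p_m_small log_floor_at_top])
  qed simp
  then show "((\<lambda>x. univ_exp k x / 1) \<longlongrightarrow> 0) at_top" by simp
qed simp

text \<open>\<open>R\<close> lies between \<open>h\<close> divided by a polylogarithm and
  \<open>h + 1\<close>. Hence \<open>ln R\<close> differs from \<open>ln h\<close> by
  \<open>O(ln (ln h))\<close>, and the quotient of logarithms tends to 1.\<close>

lemma gap_exp_small: "gap_exp k \<in> o(\<lambda>_. 1)"
proof (rule smalloI_tendsto)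
  let ?f = "\<lambda>N. ln (real (p_R k (log_floor N))) / ln (log 2 (real N))"
  let ?lo = "\<lambda>h::nat. (ln (real h) - (4 * real k + 6) * ln (lh h + 1)) / ln (real h + 1)"
  let ?hi = "\<lambda>h::nat. ln (real h + 1) / ln (real h)"
  have ev: "\<forall>\<^sub>F N in sequentially. 2 \<le> N \<and> 2 \<le> log_floor N"
    using eventually_ge_at_top[of "2::nat"] eventually_compose_filterlim[OF eventually_ge_at_top[of "2::nat"] log_floor_at_top]
    by eventually_elim simp
  have bounds: "?lo (log_floor N) \<le> ?f N \<and> ?f N \<le> ?hi (log_floor N)" if N: "2 \<le> N" "2 \<le> log_floor N" for N
  proof -
    let ?h = "log_floor N"
    have R: "0 < real (p_R k ?h)" "0 \<le> ln (real (p_R k ?h))" using p_R_bounds(4)[of k ?h] by auto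
    have lN: "ln (real ?h) \<le> ln (log 2 (real N))" "ln (log 2 (real N)) \<le> ln (real ?h + 1)"
      "0 < ln (real ?h)" using log_floor_bounds[OF N(1)] N(2) by auto
    have lN': "0 < ln (log 2 (real N))" "0 < ln (real ?h + 1)" using lN by linarith+
    have lh: "0 < lh ?h + 1" using p_lb_bounds(4)[of ?h] by simp
    have "ln (real ?h) - (4 * real k + 6) * ln (lh ?h + 1) = ln (real ?h / (lh ?h + 1) ^ (4 * k + 6))"
      using N(2) lh by (simp add: ln_div ln_realpow)
    also have "\<dots> \<le> ln (real (p_R k ?h))"
    proof (rule ln_mono)
      show "real ?h / (lh ?h + 1) ^ (4 * k + 6) \<le> real (p_R k ?h)" by (rule p_R_bounds(1))
    qed (use N(2) lh R in auto)
    finally have "?lo ?h \<le> ln (real (p_R k ?h)) / ln (real ?h + 1)" by (rule divide_right_mono) simp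
    also have "\<dots> \<le> ?f N" 
      by (rule divide_left_mono[OF lN(2) R(2) mult_pos_pos[OF lN'(2,1)]])
    finally have lo: "?lo ?h \<le> ?f N" .
    have "real (p_R k ?h) \<le> real ?h + 1" using p_R_bounds(3)[of k ?h] by linarith
    then have "ln (real (p_R k ?h)) \<le> ln (real ?h + 1)" using R by (subst ln_le_cancel_iff) auto
    then have "?f N \<le> ?hi ?h" using lN R by (intro frac_le) auto
    then show ?thesis using lo by blast
  qed
  have "?f \<longlonglongrightarrow> 1"
  proof (rule tendsto_sandwich)
    show "\<forall>\<^sub>F N in sequentially. ?lo (log_floor N) \<le> ?f N" using ev by eventually_elim (use bounds in blast)
    show "\<forall>\<^sub>F N in sequentially. ?f N \<le> ?hi (log_floor N)" using ev by eventually_elim (use bounds in blast)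
    have "?lo \<longlonglongrightarrow> 1" by real_asymp
    then show "(\<lambda>N. ?lo (log_floor N)) \<longlonglongrightarrow> 1" by (rule filterlim_compose[OF _ log_floor_at_top])
    have "?hi \<longlonglongrightarrow> 1" by real_asymp
    then show "(\<lambda>N. ?hi (log_floor N)) \<longlonglongrightarrow> 1" by (rule filterlim_compose[OF _ log_floor_at_top])
  qed
  from tendsto_diff[OF tendsto_const[of 1] this] have "gap_exp k \<longlonglongrightarrow> 0" by (simp add: gap_exp_def[abs_def])
  then show "((\<lambda>x. gap_exp k x / 1) \<longlongrightarrow> 0) at_top" by simp
qed simp

text \<open>For \<open>h = 1\<close> the exponent is 1 because \<open>ln (log 2 2) = 0\<close> and division by zero gives zero.\<close>

lemma gap_le:
  assumes "1 \<le> h"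
  shows "2 powr (log 2 (real (2 ^ h)) powr (1 - gap_exp k (2 ^ h))) \<le> 2 ^ p_R k h"
proof -
  have l: "log 2 (real (2 ^ h)) = real h" by simp
  have e: "1 - gap_exp k (2 ^ h) = ln (real (p_R k h)) / ln (real h)"
    unfolding gap_exp_def log_floor_power l by simp
  have R: "0 < real (p_R k h)" using p_R_bounds(4)[of k h] by simp
  have "real h powr (ln (real (p_R k h)) / ln (real h)) \<le> real (p_R k h)"
  proof (cases "h = 1")
    case True
    then show ?thesis using p_R_bounds(4)[of k h] by simp
  next
    case False
    then have "0 < ln (real h)" using assms by simp
    then show ?thesis using R assms by (simp add: powr_def)
  qed
  then have "2 powr (real h powr (ln (real (p_R k h)) / ln (real h))) \<le> 2 powr real (p_R k h)"
    by (rule powr_mono) simp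
  then show ?thesis unfolding l e by (simp add: powr_realpow)
qed

section \<open>The lower bound\<close>

text \<open>\<open>2 ^ lb\<close> is linear in the argument, so for a fixed exponent
  \<open>c\<close> its power is polynomial. With \<open>c = k\<close> this covers the number of
  codes.\<close>

lemma poly_bdd_exp_lb: "poly_bdd (\<lambda>v. 2 ^ (p_lb (v div 2) * c))"
proof (rule poly_bddI)
  fix v :: nat assume v: "1 \<le> v"
  have "(2::nat) ^ (p_lb (v div 2) * c) = (2 ^ p_lb (v div 2)) ^ c" by (rule power_mult)
  also have "\<dots> \<le> (12 * v) ^ c"
  proof (rule power_mono)
    have "8 * (v div 2) + 8 \<le> 12 * v" using v by presburger
    then show "2 ^ p_lb (v div 2) \<le> 12 * v" using p_lb_bounds(3)[of "v div 2"] by linarith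
  qed simp
  also have "\<dots> = 12 ^ c * v ^ c" by (rule power_mult_distrib)
  finally show "2 ^ (p_lb (v div 2) * c) \<le> 12 ^ c * v ^ c" .
qed

lemma poly_bdd_p_S: "poly_bdd (\<lambda>v. p_S k (v div 2))"
proof -
  have div2: "poly_bdd (\<lambda>v. v div 2)" by (rule poly_bdd_mono[OF poly_bdd_id]) simp
  have b: "poly_bdd (\<lambda>v. 2 ^ p_lb (v div 2))" using poly_bdd_exp_lb[of 1] by simp
  have lb: "poly_bdd (\<lambda>v. p_lb (v div 2))" by (rule poly_bdd_mono[OF b]) (rule less_imp_le[OF less_exp])
  have W: "poly_bdd (\<lambda>v. p_W (v div 2))" unfolding p_W_def by (rule poly_bdd_mult[OF lb lb])
  have X: "poly_bdd (\<lambda>v. p_X k (v div 2))" unfolding p_X_def by (rule poly_bdd_mult[OF poly_bdd_const W])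
  have T: "poly_bdd (\<lambda>v. p_T k (v div 2))"
    unfolding p_T_def by (rule poly_bdd_mult[OF poly_bdd_mult[OF poly_bdd_const poly_bdd_power[OF X]] W])
  have L: "poly_bdd (\<lambda>v. p_L (v div 2))" by (rule poly_bdd_mono[OF b p_L_le])
  have L2: "poly_bdd (\<lambda>v. 2 * p_L (v div 2))" by (rule poly_bdd_mult[OF poly_bdd_const L])
  have Y: "poly_bdd (\<lambda>v. p_Y k (v div 2))"
    unfolding p_Y_def by (rule poly_bdd_mult[OF poly_bdd_mult[OF poly_bdd_const T] L])
  have Y2: "poly_bdd (\<lambda>v. 16 * p_Y k (v div 2) ^ 2)" by (rule poly_bdd_mult[OF poly_bdd_const poly_bdd_power[OF Y]])
  obtain d where d: "\<And>h. p_lam k h \<le> d * p_lb h" using p_lam_le[of k] by auto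
  have lam: "poly_bdd (\<lambda>v. p_lam k (v div 2))"
    by (rule poly_bdd_mono[OF poly_bdd_mult[OF poly_bdd_const[of d] lb] d])
  have R: "poly_bdd (\<lambda>v. p_R k (v div 2))"
    by (rule poly_bdd_mono[OF poly_bdd_add[OF div2 poly_bdd_const[of 1]] p_R_bounds(3)])
  have m: "poly_bdd (\<lambda>v. p_m k (v div 2))" unfolding p_m_def
    by (rule poly_bdd_mult[OF lam poly_bdd_mult[OF poly_bdd_add[OF T poly_bdd_const] R]])
  have K: "poly_bdd (\<lambda>v. p_K k (v div 2))"
    by (rule poly_bdd_mono[OF poly_bdd_mult[OF poly_bdd_const[of k] b]]) (simp add: p_K_def div_le_dividend)
  have kap: "poly_bdd (\<lambda>v. p_kap k (v div 2))"
    unfolding p_kap_def by (rule poly_bdd_add[OF poly_bdd_mult[OF lb poly_bdd_const] poly_bdd_const])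
  have z: "poly_bdd (\<lambda>v. p_z k (v div 2))"
    unfolding p_z_def p_z1_def by (rule poly_bdd_add[OF poly_bdd_mult[OF kap K] poly_bdd_mult[OF lam L2]])
  have E: "poly_bdd (\<lambda>v. (k + 1) * (k + 1) * 2 ^ (p_lb (v div 2) * k))"
    by (rule poly_bdd_mult[OF poly_bdd_const poly_bdd_exp_lb])
  have h4: "poly_bdd (\<lambda>v. 4 * (v div 2) + 4)" by (rule poly_bdd_add[OF poly_bdd_mult[OF poly_bdd_const div2] poly_bdd_const])
  show ?thesis
    unfolding p_S_def
    by (intro poly_bdd_add poly_bdd_exp_lb E poly_bdd_const poly_bdd_mult[OF lb poly_bdd_const] b h4 T L2 R Y Y2
        lam m z K kap poly_bdd_power[OF X] poly_bdd_power[OF lb] lb)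
qed

text \<open>The constant factor is absorbed by \<open>C \<le> 2 ^ C \<le> (n + 2) ^ C\<close>, so
  that a pure power remains, the form that \<open>setup_code\<close> computes.\<close>

lemma p_S_le: "\<exists>c\<ge>1. \<forall>n. p_S k (n div 2 + 1) \<le> (n + 2) ^ c"
proof -
  obtain C where C: "\<And>v. 1 \<le> v \<Longrightarrow> p_S k (v div 2) \<le> C * v ^ C" using poly_bdd_p_S[of k] by (auto simp: poly_bdd_def)
  have "p_S k (n div 2 + 1) \<le> (n + 2) ^ (2 * C + 1)" for n
  proof -
    \<comment> \<open>Taken at \<open>v = n + 2\<close>, for which
      \<open>v div 2 = n div 2 + 1\<close>.\<close>
    have "p_S k (n div 2 + 1) \<le> C * (n + 2) ^ C" using C[of "n + 2"] by simp
    also have "\<dots> \<le> (n + 2) ^ (C + 1) * (n + 2) ^ C"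
    proof (rule mult_right_mono)
      have "C \<le> 2 ^ C" by (rule less_imp_le[OF less_exp])
      also have "\<dots> \<le> (n + 2) ^ C" by (rule power_mono) auto
      also have "\<dots> \<le> (n + 2) ^ (C + 1)" by (rule power_increasing) auto
      finally show "C \<le> (n + 2) ^ (C + 1)" .
    qed simp
    also have "\<dots> = (n + 2) ^ (2 * C + 1)" by (simp only: power_add[symmetric]) (simp add: mult_2)
    finally show ?thesis .
  qed
  then show ?thesis by (intro exI[of _ "2 * C + 1"]) auto
qed

definition query_bound :: "nat \<Rightarrow> (nat \<Rightarrow> real) \<Rightarrow> (nat \<Rightarrow> nat) \<Rightarrow> nat \<Rightarrow> nat \<Rightarrow> nat" where
  "query_bound k T F c n = (let h = n div 2 + 1 in
     F ((n + 2) ^ c) * ((2 ^ p_z k h + 1) * (2 + 2 * 2 ^ h * 2 ^ p_m k h + nat \<lfloor>T (2 ^ h)\<rfloor> + 1)))"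

text \<open>All advice strings are tried and one accepted query suffices. A satisfiable formula has
  a string leading to the completeness case; for an unsatisfiable one every string leads to the
  soundness case, where each query is rejected.\<close>

lemma solves_by_queries:
  assumes k: "1 \<le> k"
    and P: "distinguishes P (univ k) (\<lambda>N. 2 powr (log 2 (real N) powr (1 - gap_exp k N))) T"
  shows "\<exists>Q F c. poly_bdd F \<and> solves_kSAT Q k (\<lambda>n. real (query_bound k T F c n))"
proof -
  obtain c where c: "1 \<le> c" "\<And>n. p_S k (n div 2 + 1) \<le> (n + 2) ^ c" using p_S_le[of k] by auto
  let ?eI = "eadd (Num 2) (emul (emul (Num 2) (Pow2 c_h)) (Pow2 (c_m k)))"
  from query_reduction[OF c(1), where P = P and eZ = "Pow2 (c_z k)" and eI = ?eI and e = "f_word k"]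
  obtain Q F where F: "poly_bdd F" and Q: "\<forall>xs S Z I t ys. S = (input_word xs 0 + 2) ^ c \<longrightarrow> length xs \<le> S + 1 \<longrightarrow>
      (\<forall>x\<in>set xs. x < 2 ^ S) \<longrightarrow> Z = eval S (input_word xs) (Pow2 (c_z k)) [] \<longrightarrow> I = eval S (input_word xs) ?eI [] \<longrightarrow>
      (\<forall>z<Z. ys z = map (\<lambda>i. eval S (input_word xs) (f_word k) [z, i]) [0..<I] \<and>
        (\<exists>i. halted P (config_after P (ys z) i) \<and> (\<Sum>l<i. step_cost P (config_after P (ys z) l)) \<le> t)) \<longrightarrow>
      (\<exists>i. halted Q (config_after Q xs i) \<and> (\<Sum>l<i. step_cost Q (config_after Q xs l)) \<le> F S * ((Z + 1) * (I + t + 1)) \<and>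
        (reg (config_after Q xs i) 0 \<noteq> 0 \<longleftrightarrow> (\<exists>z<Z. accepts P (ys z))))"
    by (elim exE conjE) (rule that)
  note Q = Q[THEN spec, THEN spec, THEN spec, THEN spec, THEN spec, THEN spec,
      THEN mp, THEN mp, THEN mp, THEN mp, THEN mp, THEN mp]
  have "solves_kSAT Q k (\<lambda>n. real (query_bound k T F c n))"
    unfolding solves_kSAT_def
  proof (intro allI impI)
    fix n \<phi> assume kcnf: "is_kcnf k n \<phi>"
    define h where "h = n div 2 + 1"
    define xs where "xs = enc_cnf n \<phi>"
    define S where "S = (n + 2) ^ c"
    have xs0: "input_word xs 0 = n" by (simp add: xs_def enc_cnf_def)
    interpret formula k h S "input_word xs" n \<phi>
    proof
      show "1 \<le> k" by (rule k)
      show "input_word xs 0 div 2 + 1 = h" unfolding xs0 h_def ..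
      show "p_S k h \<le> S" unfolding h_def S_def by (rule c(2))
      show "is_kcnf k n \<phi>" by (rule kcnf)
      show "h = n div 2 + 1" by (rule h_def)
      show "input_word xs = input_word (enc_cnf n \<phi>)" by (simp only: xs_def)
    qed
    let ?N = "2 ^ h :: nat" and ?M = "2 ^ p_m k h :: nat"
    let ?A = "\<lambda>z. map (setA z) [0..<?N]" and ?B = "\<lambda>z. map (setB z) [0..<?N]"
    let ?ys = "\<lambda>z. enc_instance ?N ?M (?A z) (?B z)" and ?t = "nat \<lfloor>T ?N\<rfloor>"
    let ?g = "2 powr (log 2 (real ?N) powr (1 - gap_exp k ?N))"
    have N2: "2 \<le> ?N" using power_increasing[of 1 h "2::nat"] by (simp add: h_def)
    have M: "univ k ?N = ?M" by (simp add: univ_def log_floor_power)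
    have D: "halts_within P (?ys z) (T ?N)" "completeness_case (?A z) (?B z) \<Longrightarrow> accepts P (?ys z)"
        "soundness_case ?g (p_q k h ^ p_R k h) (?A z) (?B z) \<Longrightarrow> rejects P (?ys z)" for z
      using P[unfolded distinguishes_def, rule_format, OF N2, unfolded M, OF is_inst[of z]] by blast+
    have halts: "\<exists>i. halted P (config_after P (?ys z) i) \<and> (\<Sum>l<i. step_cost P (config_after P (?ys z) l)) \<le> ?t" for z
    proof -
      obtain i where i: "halted P (config_after P (?ys z) i)" "real (\<Sum>l<i. step_cost P (config_after P (?ys z) l)) \<le> T ?N"
        using D(1)[of z] unfolding halts_within_def by blast
      have "(\<Sum>l<i. step_cost P (config_after P (?ys z) l)) \<le> ?t" using i(2) by (rule le_nat_floor)
      then show ?thesis using i(1) by blast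
    qed
    have Z: "2 ^ p_z k h = ev (Pow2 (c_z k)) []" using S_ge(13) by simp
    have I: "2 + 2 * ?N * ?M = ev ?eI []" using S_ge(6,12) by simp
    have "\<exists>i. halted Q (config_after Q xs i) \<and>
        (\<Sum>l<i. step_cost Q (config_after Q xs l)) \<le> F S * ((2 ^ p_z k h + 1) * (2 + 2 * ?N * ?M + ?t + 1)) \<and>
        (reg (config_after Q xs i) 0 \<noteq> 0 \<longleftrightarrow> (\<exists>z<2 ^ p_z k h. accepts P (?ys z)))"
    proof (rule Q[OF _ _ _ Z I])
      show "S = (input_word xs 0 + 2) ^ c" unfolding xs0 S_def ..
      show "length xs \<le> S + 1" using length_enc by (simp add: xs_def)
      show "\<forall>x\<in>set xs. x < 2 ^ S" using words by (simp only: xs_def)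
      show "\<forall>z<2 ^ p_z k h. ?ys z = map (\<lambda>i. ev (f_word k) [z, i]) [0..<2 + 2 * ?N * ?M] \<and>
          (\<exists>i. halted P (config_after P (?ys z) i) \<and> (\<Sum>l<i. step_cost P (config_after P (?ys z) l)) \<le> ?t)"
        using instance_word[symmetric] halts by blast
    qed
    moreover have "F S * ((2 ^ p_z k h + 1) * (2 + 2 * ?N * ?M + ?t + 1)) = query_bound k T F c n"
      by (simp only: query_bound_def Let_def h_def S_def)
    ultimately obtain i where i: "halted Q (config_after Q xs i)"
        "(\<Sum>l<i. step_cost Q (config_after Q xs l)) \<le> query_bound k T F c n"
        "reg (config_after Q xs i) 0 \<noteq> 0 \<longleftrightarrow> (\<exists>z<2 ^ p_z k h. accepts P (?ys z))" by auto
    have "halts_within Q xs (real (query_bound k T F c n))"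
      unfolding halts_within_def using i(1,2) of_nat_le_iff by blast
    moreover have "accepts Q xs" if sat: "satisfiable \<phi>"
    proof -
      obtain z where "z < 2 ^ p_z k h" "completeness_case (?A z) (?B z)" using completeness[OF sat] by blast
      then have "reg (config_after Q xs i) 0 \<noteq> 0" using i(3) D(2) by blast
      then show ?thesis using i(1) unfolding accepts_def by blast
    qed
    moreover have "rejects Q xs" if unsat: "\<not> satisfiable \<phi>"
    proof -
      have "\<not> accepts P (?ys z)" for z
      proof -
        \<comment> \<open>The advertised gap is at most \<open>2 ^ R\<close>, so the bound obtained
          with \<open>2 ^ R\<close> implies the required one.\<close>
        have g: "0 < ?g" "?g \<le> 2 ^ p_R k h" using gap_le[of h k] by (simp_all add: h_def)
        have "soundness_case ?g (p_q k h ^ p_R k h) (?A z) (?B z)"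
          unfolding soundness_case_def
        proof (intro ballI)
          fix a b assume "a \<in> set (?A z)" "b \<in> set (?B z)"
          then have "real (card (a \<inter> b)) \<le> real (p_q k h ^ p_R k h) / 2 ^ p_R k h"
            using soundness[OF unsat, of z] unfolding soundness_case_def by blast
          also have "\<dots> \<le> real (p_q k h ^ p_R k h) / ?g" using g by (intro divide_left_mono mult_pos_pos) auto
          finally show "real (card (a \<inter> b)) \<le> real (p_q k h ^ p_R k h) / ?g" .
        qed
        then have "rejects P (?ys z)" by (rule D(3))
        moreover obtain j where "halted P (config_after P (?ys z) j)" using halts[of z] by blast
        ultimately show ?thesis using accepts_iff_halted by blast
      qed
      then have "reg (config_after Q xs i) 0 = 0" using i(3) by blast
      then show ?thesis using i(1) unfolding rejects_def by blast
    qed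
    ultimately show "halts_within Q (enc_cnf n \<phi>) (real (query_bound k T F c n)) \<and>
        (satisfiable \<phi> \<longrightarrow> accepts Q (enc_cnf n \<phi>)) \<and> (\<not> satisfiable \<phi> \<longrightarrow> rejects Q (enc_cnf n \<phi>))"
      unfolding xs_def by blast
  qed
  then show ?thesis using F by blast
qed

text \<open>With \<open>h\<close> about \<open>n / 2\<close> a query takes time
  \<open>2 powr (n - \<epsilon> * n / 2)\<close>. Advice, universe size and polynomial overhead
  together add \<open>2 * e * n = \<epsilon> * n / 8\<close> to the exponent, up to constants. A
  saving of \<open>3 * \<epsilon> * n / 8\<close> remains, more than the quarter that is
  claimed.\<close>

lemma query_bound_bigo:
  assumes T: "T \<in> O(\<lambda>N. real N powr (2 - \<epsilon>))" and \<epsilon>: "0 < \<epsilon>" "\<epsilon> \<le> 1" and F: "poly_bdd F"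
  shows "(\<lambda>n. real (query_bound k T F c n)) \<in> O(\<lambda>n. 2 powr ((1 - \<epsilon> / 4) * real n))"
proof -
  obtain C where C: "0 < C" "\<forall>\<^sub>F N in sequentially. norm (T N) \<le> C * norm (real N powr (2 - \<epsilon>))"
    using T by (elim landau_o.bigE)
  obtain D where D: "\<And>S. 1 \<le> S \<Longrightarrow> F S \<le> D * S ^ D" using F by (auto simp: poly_bdd_def)
  define e where "e = \<epsilon> / 16"
  have e: "0 < e" using \<epsilon> by (simp add: e_def)
  define half where "half n = n div 2 + 1" for n :: nat
  have half_top: "filterlim half at_top at_top"
  proof (rule filterlim_at_top_mono)
    show "filterlim (\<lambda>n::nat. nat \<lfloor>real n / 2 - 1\<rfloor>) at_top at_top" by real_asymp
    have "nat \<lfloor>real n / 2 - 1\<rfloor> \<le> half n" for n unfolding half_def by linarith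
    then show "\<forall>\<^sub>F n in at_top. nat \<lfloor>real n / 2 - 1\<rfloor> \<le> half n" by simp
  qed
  have "filterlim (\<lambda>n::nat. 2 ^ n :: nat) at_top at_top"
    by (rule filterlim_at_top_mono[OF filterlim_ident]) (simp add: less_imp_le[OF less_exp])
  then have pow_top: "filterlim (\<lambda>n. 2 ^ half n :: nat) at_top at_top" by (rule filterlim_compose[OF _ half_top])
  have evT: "\<forall>\<^sub>F n in at_top. norm (T (2 ^ half n)) \<le> C * norm (real (2 ^ half n) powr (2 - \<epsilon>))"
    by (rule eventually_compose_filterlim[OF C(2) pow_top])
  have "\<forall>\<^sub>F h in at_top. real (p_m k h) / real h < e" "\<forall>\<^sub>F h in at_top. real (p_z k h) / real h < e"
    using order_tendstoD(2)[OF p_m_small e] order_tendstoD(2)[OF p_z_small e] by auto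
  then have "\<forall>\<^sub>F h in at_top. real (p_m k h) / real h < e \<and> real (p_z k h) / real h < e"
    by (rule eventually_conj)
  then have evm: "\<forall>\<^sub>F n in at_top. real (p_m k (half n)) / real (half n) < e \<and> real (p_z k (half n)) / real (half n) < e"
    by (rule eventually_compose_filterlim[OF _ half_top])
  have evp: "\<forall>\<^sub>F n::nat in at_top. (real n + 2) ^ (c * D) \<le> 2 powr (e * real n)" using e by real_asymp
  have bound: "real (query_bound k T F c n) \<le> (16 * real D * (5 + C)) * 2 powr ((1 - \<epsilon> / 4) * real n)"
    if ev: "norm (T (2 ^ half n)) \<le> C * norm (real (2 ^ half n) powr (2 - \<epsilon>))"
      "real (p_m k (half n)) / real (half n) < e \<and> real (p_z k (half n)) / real (half n) < e"
      "(real n + 2) ^ (c * D) \<le> 2 powr (e * real n)" for n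
  proof -
    let ?h = "real (half n)" and ?m = "real (p_m k (half n))" and ?z = "real (p_z k (half n))"
    have h: "1 \<le> ?h" "?h \<le> real n / 2 + 1" unfolding half_def by (simp, linarith)
    have m: "?m \<le> e * ?h" "?z \<le> e * ?h" using ev(2) h(1) by (simp_all add: field_simps)
    have S1: "1 \<le> (n + 2) ^ c" by simp
    have "F ((n + 2) ^ c) \<le> D * (n + 2) ^ (c * D)" using D[OF S1] by (simp only: power_mult)
    then have "real (F ((n + 2) ^ c)) \<le> real (D * (n + 2) ^ (c * D))" by (simp only: of_nat_le_iff)
    also have "\<dots> = real D * (real n + 2) ^ (c * D)" by (simp add: add.commute)
    also have "\<dots> \<le> real D * 2 powr (e * real n)" using ev(3) by (intro mult_left_mono) auto
    finally have f: "real (F ((n + 2) ^ c)) \<le> real D * 2 powr (e * real n)" .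
    have z: "real (2 ^ p_z k (half n) + 1) \<le> 2 * 2 powr ?z"
      using one_le_power[of "2::real" "p_z k (half n)"] by (simp add: powr_realpow)
    have "real (nat \<lfloor>T (2 ^ half n)\<rfloor>) \<le> norm (T (2 ^ half n))" by (simp, linarith)
    also have "\<dots> \<le> C * norm (real (2 ^ half n) powr (2 - \<epsilon>))" by (rule ev(1))
    also have "real (2 ^ half n) = 2 powr ?h" by (simp add: powr_realpow)
    also have "C * norm ((2 powr ?h) powr (2 - \<epsilon>)) = C * 2 powr (?h * (2 - \<epsilon>))" by (simp add: powr_powr)
    also have "\<dots> \<le> C * 2 powr (?h * (2 - \<epsilon>) + ?m)" using C(1) by (intro mult_left_mono powr_mono) auto
    finally have t: "real (nat \<lfloor>T (2 ^ half n)\<rfloor>) \<le> C * 2 powr (?h * (2 - \<epsilon>) + ?m)" .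
    \<comment> \<open>Writing an instance takes time about \<open>2 powr (h + m)\<close>; with
      \<open>\<epsilon> \<le> 1\<close> this is covered by the bound for running the
      algorithm.\<close>
    have "?h * 1 \<le> ?h * (2 - \<epsilon>)" using \<epsilon> h(1) by (intro mult_left_mono) auto
    then have "2 powr (?h + ?m) \<le> 2 powr (?h * (2 - \<epsilon>) + ?m)" by (intro powr_mono) auto
    then have hm: "2 ^ half n * 2 ^ p_m k (half n) \<le> 2 powr (?h * (2 - \<epsilon>) + ?m)"
      by (simp add: powr_add powr_realpow)
    have "2 powr 0 \<le> 2 powr (?h * (2 - \<epsilon>) + ?m)" using \<epsilon> h(1) by (intro powr_mono add_nonneg_nonneg mult_nonneg_nonneg) auto
    then have one: "1 \<le> 2 powr (?h * (2 - \<epsilon>) + ?m)" by simp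
    have "real (2 + 2 * 2 ^ half n * 2 ^ p_m k (half n) + nat \<lfloor>T (2 ^ half n)\<rfloor> + 1) =
        3 + 2 * (2 ^ half n * 2 ^ p_m k (half n)) + real (nat \<lfloor>T (2 ^ half n)\<rfloor>)" by simp
    also have "\<dots> \<le> 3 * 2 powr (?h * (2 - \<epsilon>) + ?m) + 2 * 2 powr (?h * (2 - \<epsilon>) + ?m) + C * 2 powr (?h * (2 - \<epsilon>) + ?m)"
      using t hm one by linarith
    also have "\<dots> = (5 + C) * 2 powr (?h * (2 - \<epsilon>) + ?m)" by (simp add: algebra_simps)
    finally have i: "real (2 + 2 * 2 ^ half n * 2 ^ p_m k (half n) + nat \<lfloor>T (2 ^ half n)\<rfloor> + 1) \<le>
        (5 + C) * 2 powr (?h * (2 - \<epsilon>) + ?m)" .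
    have "real (query_bound k T F c n) \<le> (real D * 2 powr (e * real n)) * ((2 * 2 powr ?z) * ((5 + C) * 2 powr (?h * (2 - \<epsilon>) + ?m)))"
      unfolding query_bound_def Let_def half_def[symmetric] of_nat_mult[of "F _"] of_nat_mult[of "2 ^ p_z k (half n) + 1"]
      by (intro mult_mono f z i) (use C(1) in auto)
    also have "\<dots> = (2 * real D * (5 + C)) * 2 powr (e * real n + ?z + (?h * (2 - \<epsilon>) + ?m))"
      by (simp add: powr_add)
    \<comment> \<open>The 3 covers the constant part of the exponent, which stems from
      \<open>h \<le> n / 2 + 1\<close>.\<close>
    also have "\<dots> \<le> (2 * real D * (5 + C)) * 2 powr (3 + (1 - \<epsilon> / 4) * real n)"
    proof (intro mult_left_mono powr_mono)
      have "?h * (2 - \<epsilon> + 2 * e) \<le> (real n / 2 + 1) * (2 - \<epsilon> + 2 * e)"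
        using h(2) \<epsilon> e by (intro mult_right_mono) auto
      moreover have "(real n / 2 + 1) * (2 - \<epsilon> + 2 * e) = real n - (7 / 16) * (\<epsilon> * real n) + 2 - (7 / 8) * \<epsilon>"
        by (simp add: e_def field_simps)
      moreover have "?h * (2 - \<epsilon> + 2 * e) = ?h * (2 - \<epsilon>) + 2 * (e * ?h)" by (simp add: algebra_simps)
      moreover have "e * real n = (1 / 16) * (\<epsilon> * real n)" "(1 - \<epsilon> / 4) * real n = real n - (1 / 4) * (\<epsilon> * real n)"
        by (simp_all add: e_def algebra_simps)
      moreover have "0 \<le> \<epsilon> * real n" using \<epsilon> by simp
      ultimately show "e * real n + ?z + (?h * (2 - \<epsilon>) + ?m) \<le> 3 + (1 - \<epsilon> / 4) * real n"
        using m \<epsilon> by linarith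
    qed (use C(1) in auto)
    also have "\<dots> = (16 * real D * (5 + C)) * 2 powr ((1 - \<epsilon> / 4) * real n)"
    proof -
      have "(2::real) powr 3 = 8" by simp
      then show ?thesis unfolding powr_add by simp
    qed
    finally show ?thesis .
  qed
  show ?thesis
  proof (rule bigoI)
    show "\<forall>\<^sub>F n in at_top. norm (real (query_bound k T F c n)) \<le> (16 * real D * (5 + C)) * norm (2 powr ((1 - \<epsilon> / 4) * real n))"
      using evT evm evp
    proof eventually_elim
      case (elim n)
      then show ?case using bound[of n] by simp
    qed
  qed
qed

theorem theorem2:
  fixes \<epsilon> :: real
  assumes "SETH" and "\<epsilon> > 0"
  shows "\<exists>(m :: nat \<Rightarrow> nat) (\<delta> :: nat \<Rightarrow> real) (\<eta> :: nat \<Rightarrow> real).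
           \<delta> \<in> o(\<lambda>_. 1) \<and> \<eta> \<in> o(\<lambda>_. 1) \<and>
           (\<forall>N\<ge>2. real (m N) = real N powr \<delta> N) \<and>
           \<not> (\<exists>P T. T \<in> O(\<lambda>N. real N powr (2 - \<epsilon>)) \<and>
                distinguishes P m (\<lambda>N. 2 powr (log 2 (real N) powr (1 - \<eta> N))) T)"
proof -
  \<comment> \<open>A faster algorithm also meets the weaker time bound, and with the cap at 1 the
    time bound is never below the order of \<open>N\<close>, so that it covers the factor
    \<open>N\<close> in the cost of writing an instance.\<close>
  define \<epsilon>' where "\<epsilon>' = min \<epsilon> 1"
  have \<epsilon>': "0 < \<epsilon>'" "\<epsilon>' \<le> 1" "\<epsilon>' \<le> \<epsilon>" using assms(2) by (auto simp: \<epsilon>'_def)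
  \<comment> \<open>SETH is applied to the saving that survives the reduction. The resulting
    \<open>k\<close> fixes the universe size and both error exponents before any algorithm is
    considered.\<close>
  obtain k where k: "3 \<le> k" "\<not> (\<exists>P T. T \<in> O(\<lambda>n. 2 powr ((1 - \<epsilon>' / 4) * real n)) \<and> solves_kSAT P k T)"
    using assms(1)[unfolded SETH_def, rule_format, of "\<epsilon>' / 4"] \<epsilon>'(1) by auto
  have False if P: "T \<in> O(\<lambda>N. real N powr (2 - \<epsilon>))"
    "distinguishes P (univ k) (\<lambda>N. 2 powr (log 2 (real N) powr (1 - gap_exp k N))) T" for P T
  proof -
    have "(\<lambda>N. real N powr (2 - \<epsilon>)) \<in> O(\<lambda>N. real N powr (2 - \<epsilon>'))"
    proof (rule bigoI[where c = 1])
      show "\<forall>\<^sub>F N in sequentially. norm (real N powr (2 - \<epsilon>)) \<le> 1 * norm (real N powr (2 - \<epsilon>'))"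
        using eventually_ge_at_top[of 1]
      proof eventually_elim
        case (elim N)
        have "real N powr (2 - \<epsilon>) \<le> real N powr (2 - \<epsilon>')" using elim \<epsilon>'(3) by (intro powr_mono) auto
        then show ?case by simp
      qed
    qed
    with P(1) have T: "T \<in> O(\<lambda>N. real N powr (2 - \<epsilon>'))" by (rule landau_o.big_trans)
    have "1 \<le> k" using k(1) by simp
    from solves_by_queries[OF this P(2)] obtain Q F c where "poly_bdd F" "solves_kSAT Q k (\<lambda>n. real (query_bound k T F c n))"
      by blast
    then show False using k(2) query_bound_bigo[OF T \<epsilon>'(1,2)] by blast
  qed
  then show ?thesis
    using univ_exp_small[of k] gap_exp_small[of k] univ_exp[of _ k]
    by (intro exI[of _ "univ k"] exI[of _ "univ_exp k"] exI[of _ "gap_exp k"]) blast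
qed

end
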